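(* Suppose $1<p<\infty$. The triangular truncation $\mathcal{T}\colon S^p\to S^p$ and the discrete noncommutative Hilbert transform $\mathcal{H}\colon S^p\to S^p$ are $\mathrm{CB}$-strongly non decomposable.
   Context: $S^p$ is the Schatten space of operators on $\ell^2=\ell^2_{\mathbb{N}}$, i.e. $L^p(B(\ell^2),\mathrm{Tr})$, with its natural operator space structure (complex interpolation); its elements are viewed as matrices $[a_{ij}]$. The maps are the completely bounded Schur multipliers $\mathcal{T}([a_{ij}])=[\delta_{i\le j}a_{ij}]$ and $\mathcal{H}([a_{ij}])=[-\mathrm{i}\,\delta_{i<j}a_{ij}+\mathrm{i}\,\delta_{i>j}a_{ij}]$, where $\mathrm{i}^2=-1$ and $\delta_{i\le j}$ equals $1$ if $i\le j$ and $0$ otherwise (similarly $\delta_{i<j},\delta_{i>j}$). For a von Neumann algebra $M$ with faithful normal semifinite trace $\tau$, $S^p_n(L^p(M)) = L^p(M_n(M),\mathrm{Tr}\otimes\tau)$ with its usual positive cone. A map between such spaces is completely positive if all its amplifications by $\mathrm{Id}_{M_m}$, $m\ge1$, are positive. Put $T^\circ(x)=T(x^* )^*$. A linear map $T\colon L^p(M)\to L^p(M)$ is decomposable if there are linear maps $v_1,v_2$ on $L^p(M)$ such that $\begin{bmatrix} a&b\\ c&d\end{bmatrix}\mapsto \begin{bmatrix} v_1(a)&T(b)\\ T^\circ(c)&v_2(d)\end{bmatrix}$ is completely positive on $S^p_2(L^p(M))$; $\mathrm{Dec}(L^p(M))$ is the space of decomposable operators. A completely bounded operator $T$ on $L^p(M)$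 is $\mathrm{CB}$-strongly non decomposable if $T$ does not belong to the closure of $\mathrm{Dec}(L^p(M))$ with respect to the completely bounded norm. *)

theory Defs
  imports "HOL-Analysis.Analysis"
begin

text \<open>
  Operators on \<open>\<ell>\<^sup>2(A)\<close> are represented by their matrices in the canonical basis. The index set \<open>A\<close> is
  a subset of a type, and the matrix vanishes outside \<open>A \<times> A\<close>; thus \<open>\<ell>\<^sup>2\<^sub>n \<otimes> \<ell>\<^sup>2(A)\<close> is
  \<open>\<ell>\<^sup>2({..<n} \<times> A)\<close>, and a matrix over \<open>{..<n} \<times> A\<close> is an \<open>n \<times> n\<close> matrix of matrices over \<open>A\<close>.
\<close>

type_synonym 'i cmat = "'i \<Rightarrow> 'i \<Rightarrow> complex"

definition supported_on :: "'i set \<Rightarrow> 'i cmat \<Rightarrow> bool" where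
  "supported_on A x \<longleftrightarrow> (\<forall>i j. x i j \<noteq> 0 \<longrightarrow> i \<in> A \<and> j \<in> A)"

definition ell2 :: "('i \<Rightarrow> complex) set" where
  "ell2 = {\<xi>. (\<lambda>i. (cmod (\<xi> i))\<^sup>2) summable_on UNIV}"

definition ell2_inner :: "('i \<Rightarrow> complex) \<Rightarrow> ('i \<Rightarrow> complex) \<Rightarrow> complex" where
  "ell2_inner \<xi> \<eta> = (\<Sum>\<^sub>\<infinity>i. \<xi> i * cnj (\<eta> i))"

definition ell2_norm :: "('i \<Rightarrow> complex) \<Rightarrow> real" where
  "ell2_norm \<xi> = sqrt (\<Sum>\<^sub>\<infinity>i. (cmod (\<xi> i))\<^sup>2)"

definition mat_vec :: "'i cmat \<Rightarrow> ('i \<Rightarrow> complex) \<Rightarrow> 'i \<Rightarrow> complex" where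
  "mat_vec x \<xi> = (\<lambda>i. \<Sum>\<^sub>\<infinity>j. x i j * \<xi> j)"

definition adj :: "'i cmat \<Rightarrow> 'i cmat" where
  "adj x = (\<lambda>i j. cnj (x j i))"

definition bounded_ops :: "'i set \<Rightarrow> 'i cmat set" where
  "bounded_ops A = {x. supported_on A x \<and>
     (\<exists>C. \<forall>\<xi>\<in>ell2. (\<forall>i. (\<lambda>j. x i j * \<xi> j) summable_on UNIV) \<and>
        mat_vec x \<xi> \<in> ell2 \<and> ell2_norm (mat_vec x \<xi>) \<le> C * ell2_norm \<xi>)}"

definition op_norm :: "'i cmat \<Rightarrow> real" where
  "op_norm x = (SUP \<xi>\<in>{\<xi>\<in>ell2. ell2_norm \<xi> \<le> 1}. ell2_norm (mat_vec x \<xi>))"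

definition positive_op :: "'i cmat \<Rightarrow> bool" where
  "positive_op x \<longleftrightarrow> (\<forall>\<xi>\<in>ell2. ell2_inner (mat_vec x \<xi>) \<xi> \<in> \<real>\<^sub>\<ge>\<^sub>0)"


section \<open>Schatten spaces\<close>

text \<open>
  \<open>x = \<Sum>\<^sub>k s\<^sub>k \<langle>\<cdot>, v\<^sub>k\<rangle> u\<^sub>k\<close> with \<open>s\<^sub>k \<ge> 0\<close>; the vectors belonging to nonzero \<open>s\<^sub>k\<close> form orthonormal
  systems. Then \<open>|x|\<^sup>p = \<Sum>\<^sub>k s\<^sub>k\<^sup>p \<langle>\<cdot>, v\<^sub>k\<rangle> v\<^sub>k\<close> and \<open>Tr |x|\<^sup>p = \<Sum>\<^sub>k s\<^sub>k\<^sup>p\<close>.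
\<close>

definition singular_decomp ::
    "'i cmat \<Rightarrow> (nat \<Rightarrow> real) \<Rightarrow> (nat \<Rightarrow> 'i \<Rightarrow> complex) \<Rightarrow> (nat \<Rightarrow> 'i \<Rightarrow> complex) \<Rightarrow> bool" where
  "singular_decomp x s u v \<longleftrightarrow>
     (\<forall>k. 0 \<le> s k \<and> u k \<in> ell2 \<and> v k \<in> ell2) \<and>
     (\<forall>k l. s k \<noteq> 0 \<longrightarrow> s l \<noteq> 0 \<longrightarrow>
        ell2_inner (u k) (u l) = (if k = l then 1 else 0) \<and>
        ell2_inner (v k) (v l) = (if k = l then 1 else 0)) \<and>
     (\<forall>i j. ((\<lambda>k. complex_of_real (s k) * u k i * cnj (v k j)) has_sum x i j) UNIV)"

text \<open>\<open>S\<^sup>p(\<ell>\<^sup>2(A))\<close> for \<open>1 \<le> p < \<infinity>\<close>.\<close>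

definition schatten :: "real \<Rightarrow> 'i set \<Rightarrow> 'i cmat set" where
  "schatten p A = {x. supported_on A x \<and>
     (\<exists>s u v. singular_decomp x s u v \<and> (\<lambda>k. s k powr p) summable_on UNIV)}"

text \<open>\<open>S\<^sup>\<infinity>(\<ell>\<^sup>2(A))\<close>, the compact operators.\<close>

definition compact_ops :: "'i set \<Rightarrow> 'i cmat set" where
  "compact_ops A = {x. supported_on A x \<and> (\<exists>s u v. singular_decomp x s u v \<and> s \<longlonglongrightarrow> 0)}"


section \<open>Amplifications\<close>

definition block :: "(nat \<times> 'i) cmat \<Rightarrow> nat \<Rightarrow> nat \<Rightarrow> 'i cmat" where
  "block X a b = (\<lambda>i j. X (a, i) (b, j))"

text \<open>\<open>Id\<^bsub>M\<^sub>n\<^esub> \<otimes> T\<close>, for every \<open>n\<close> at once: blocks outside \<open>{..<n}\<close> are zero and stay so when \<open>T\<close> is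
  linear.\<close>

definition amplify :: "('i cmat \<Rightarrow> 'i cmat) \<Rightarrow> (nat \<times> 'i) cmat \<Rightarrow> (nat \<times> 'i) cmat" where
  "amplify T X = (\<lambda>(a, i) (b, j). T (block X a b) i j)"

text \<open>Maps on \<open>S\<^sup>p(\<ell>\<^sup>2(A))\<close> are total functions on matrices; only their values on \<open>schatten p A\<close>
  matter.\<close>

definition linear_on_schatten :: "real \<Rightarrow> 'i set \<Rightarrow> ('i cmat \<Rightarrow> 'i cmat) \<Rightarrow> bool" where
  "linear_on_schatten p A T \<longleftrightarrow>
     (\<forall>x\<in>schatten p A. T x \<in> schatten p A) \<and>
     (\<forall>x\<in>schatten p A. \<forall>y\<in>schatten p A.
        T (\<lambda>i j. x i j + y i j) = (\<lambda>i j. T x i j + T y i j)) \<and>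
     (\<forall>c. \<forall>x\<in>schatten p A. T (\<lambda>i j. c * x i j) = (\<lambda>i j. c * T x i j))"


section \<open>The natural operator space structure\<close>

text \<open>
  The norm of \<open>M\<^sub>n(S\<^sup>1)\<close>: \<open>x\<close> is identified with the map \<open>B(\<ell>\<^sup>2(A)) \<rightarrow> M\<^sub>n\<close>,
  \<open>y \<mapsto> [\<Sum>\<^sub>k\<^sub>,\<^sub>l x\<^sub>a\<^sub>b\<^sub>,\<^sub>k\<^sub>l y\<^sub>k\<^sub>l]\<^sub>a\<^sub>b\<close>, and has the completely bounded norm of this map. Here \<open>S\<^sup>1\<close> is the
  predual of \<open>B(\<ell>\<^sup>2)\<close> through the parallel bracket \<open>\<Sum> x\<^sub>k\<^sub>l y\<^sub>k\<^sub>l = Tr(x y\<^sup>t)\<close>, i.e. the predual of the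
  opposite algebra through \<open>Tr(x y)\<close>. This is the convention under which interpolation with \<open>S\<^sup>\<infinity>\<close>
  gives \<open>S\<^sup>p\<^sub>n(S\<^sup>p) = S\<^sup>p(\<ell>\<^sup>2\<^sub>n \<otimes> \<ell>\<^sup>2)\<close>. The double series converges as an iterated one only.
\<close>

definition S1_pairing :: "(nat \<times> 'i) cmat \<Rightarrow> (nat \<times> 'i) cmat \<Rightarrow> (nat \<times> nat) cmat" where
  "S1_pairing x Y = (\<lambda>(r, a) (s, b). \<Sum>\<^sub>\<infinity>k. \<Sum>\<^sub>\<infinity>l. x (a, k) (b, l) * Y (r, k) (s, l))"

definition S1_matrix_norm :: "'i set \<Rightarrow> (nat \<times> 'i) cmat \<Rightarrow> real" where
  "S1_matrix_norm A x =
     Sup {op_norm (S1_pairing x Y) | m Y. Y \<in> bounded_ops ({..<m} \<times> A) \<and> op_norm Y \<le> 1}"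

definition strip :: "complex set" where
  "strip = {z. 0 \<le> Re z \<and> Re z \<le> 1}"

text \<open>
  Calderon's space of functions on the strip for the couple \<open>(M\<^sub>n(S\<^sup>\<infinity>), M\<^sub>n(S\<^sup>1))\<close>. The norm of
  \<open>M\<^sub>n(S\<^sup>\<infinity>)\<close> is the operator norm on \<open>\<ell>\<^sup>2\<^sub>n \<otimes> \<ell>\<^sup>2(A)\<close>. For fixed \<open>n\<close>, \<open>M\<^sub>n(S\<^sup>1)\<close> embeds continuously
  into \<open>M\<^sub>n(S\<^sup>\<infinity>)\<close>, although not contractively; so the sum space of the couple is \<open>M\<^sub>n(S\<^sup>\<infinity>)\<close> with an
  equivalent norm, and boundedness, continuity and holomorphy in the sum space can be expressed with
  \<open>op_norm\<close>.
\<close>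

definition interp_functions :: "'i set \<Rightarrow> nat \<Rightarrow> (complex \<Rightarrow> (nat \<times> 'i) cmat) set" where
  "interp_functions A n = {F.
     (\<forall>z\<in>strip. F z \<in> compact_ops ({..<n} \<times> A)) \<and>
     (\<exists>C. \<forall>z\<in>strip. op_norm (F z) \<le> C) \<and>
     (\<forall>z\<in>strip. ((\<lambda>w. op_norm (F w - F z)) \<longlongrightarrow> 0) (at z within strip)) \<and>
     (\<forall>z\<in>interior strip. \<exists>D\<in>compact_ops ({..<n} \<times> A).
        ((\<lambda>w. op_norm (\<lambda>i j. (F w i j - F z i j) / (w - z) - D i j)) \<longlongrightarrow> 0) (at z)) \<and>
     (\<forall>t::real. F (Complex 1 t) \<in> schatten 1 ({..<n} \<times> A)) \<and>
     (\<exists>C. \<forall>t. S1_matrix_norm A (F (Complex 1 t)) \<le> C) \<and>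
     (\<forall>t. ((\<lambda>s. S1_matrix_norm A (F (Complex 1 s) - F (Complex 1 t))) \<longlongrightarrow> 0) (at t))}"

text \<open>The norm of \<open>M\<^sub>n(S\<^sup>p) = (M\<^sub>n(S\<^sup>\<infinity>), M\<^sub>n(S\<^sup>1))\<^sub>\<theta>\<close>, \<open>\<theta> = 1/p\<close>, for \<open>1 < p < \<infinity>\<close>.\<close>

definition Sp_matrix_norm :: "real \<Rightarrow> 'i set \<Rightarrow> nat \<Rightarrow> (nat \<times> 'i) cmat \<Rightarrow> real" where
  "Sp_matrix_norm p A n x =
     Inf {max (SUP t. op_norm (F (Complex 0 t))) (SUP t. S1_matrix_norm A (F (Complex 1 t))) | F.
          F \<in> interp_functions A n \<and> F (complex_of_real (1 / p)) = x}"

definition cb_norm :: "real \<Rightarrow> ('i cmat \<Rightarrow> 'i cmat) \<Rightarrow> ennreal" where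
  "cb_norm p T =
     (SUP n. SUP x\<in>{x \<in> schatten p ({..<n} \<times> UNIV). Sp_matrix_norm p UNIV n x \<le> 1}.
        ennreal (Sp_matrix_norm p UNIV n (amplify T x)))"

definition completely_bounded :: "real \<Rightarrow> ('i cmat \<Rightarrow> 'i cmat) \<Rightarrow> bool" where
  "completely_bounded p T \<longleftrightarrow> linear_on_schatten p UNIV T \<and> cb_norm p T < \<infinity>"


section \<open>Decomposable maps\<close>

definition completely_positive :: "real \<Rightarrow> 'i set \<Rightarrow> ('i cmat \<Rightarrow> 'i cmat) \<Rightarrow> bool" where
  "completely_positive p A \<Phi> \<longleftrightarrow> linear_on_schatten p A \<Phi> \<and>
     (\<forall>m\<ge>1. \<forall>X\<in>schatten p ({..<m} \<times> A). positive_op X \<longrightarrow> positive_op (amplify \<Phi> X))"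

definition circ :: "('i cmat \<Rightarrow> 'i cmat) \<Rightarrow> 'i cmat \<Rightarrow> 'i cmat" where
  "circ T x = adj (T (adj x))"

definition two_by_two_map ::
    "('i cmat \<Rightarrow> 'i cmat) \<Rightarrow> ('i cmat \<Rightarrow> 'i cmat) \<Rightarrow> ('i cmat \<Rightarrow> 'i cmat) \<Rightarrow> ('i cmat \<Rightarrow> 'i cmat) \<Rightarrow>
     (nat \<times> 'i) cmat \<Rightarrow> (nat \<times> 'i) cmat" where
  "two_by_two_map \<Phi>00 \<Phi>01 \<Phi>10 \<Phi>11 X = (\<lambda>(a, i) (b, j).
     if a = 0 \<and> b = 0 then \<Phi>00 (block X 0 0) i j
     else if a = 0 \<and> b = 1 then \<Phi>01 (block X 0 1) i j
     else if a = 1 \<and> b = 0 then \<Phi>10 (block X 1 0) i j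
     else if a = 1 \<and> b = 1 then \<Phi>11 (block X 1 1) i j
     else 0)"

definition decomposable :: "real \<Rightarrow> ('i cmat \<Rightarrow> 'i cmat) \<Rightarrow> bool" where
  "decomposable p T \<longleftrightarrow> linear_on_schatten p UNIV T \<and>
     (\<exists>v1 v2. linear_on_schatten p UNIV v1 \<and> linear_on_schatten p UNIV v2 \<and>
        completely_positive p ({..<2} \<times> UNIV) (two_by_two_map v1 T (circ T) v2))"

definition in_cb_closure_of_Dec :: "real \<Rightarrow> ('i cmat \<Rightarrow> 'i cmat) \<Rightarrow> bool" where
  "in_cb_closure_of_Dec p T \<longleftrightarrow>
     (\<forall>\<epsilon>>0. \<exists>R. decomposable p R \<and> cb_norm p (\<lambda>x. T x - R x) < ennreal \<epsilon>)"

definition CB_strongly_non_decomposable :: "real \<Rightarrow> ('i cmat \<Rightarrow> 'i cmat) \<Rightarrow> bool" where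
  "CB_strongly_non_decomposable p T \<longleftrightarrow>
     completely_bounded p T \<and> \<not> in_cb_closure_of_Dec p T"


section \<open>The two Schur multipliers\<close>

definition triangular_truncation :: "nat cmat \<Rightarrow> nat cmat" where
  "triangular_truncation a = (\<lambda>i j. if i \<le> j then a i j else 0)"

definition discrete_Hilbert_transform :: "nat cmat \<Rightarrow> nat cmat" where
  "discrete_Hilbert_transform a =
     (\<lambda>i j. if i < j then - \<i> * a i j else if i > j then \<i> * a i j else 0)"

end

theory Submission
  imports Defs "HOL-Complex_Analysis.Conformal_Mappings"
begin

text \<open>
  Write \<open>\<theta> = 1/p\<close>. Both maps are Schur multipliers with symbol \<open>\<alpha> \<delta>\<^bsub>i\<le>j\<^esub> + \<beta> \<delta>\<^bsub>i<j\<^esub> + \<gamma>\<close> and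
  \<open>\<alpha> + \<beta> \<noteq> 0\<close>, so the symbol takes two different values above and below the diagonal. They are treated
  together (\<open>gmul\<close>).

  Complete boundedness rests on Pisier's formula: an element \<open>y\<close> of \<open>M\<^sub>n(S\<^sup>p)\<close> has norm at most \<open>c\<close> iff
  \<open>(a \<otimes> 1) y (b \<otimes> 1)\<close> has norm at most \<open>c\<close> in \<open>S\<^sup>p(\<ell>\<^sup>2\<^sub>n \<otimes> \<ell>\<^sup>2)\<close> for all \<open>a\<close>, \<open>b\<close> in the unit ball of
  \<open>S\<^sup>2\<^sup>p\<^sub>n\<close> (\<open>Sp_matrix_norm_mbound\<close>, \<open>Sp_matrix_norm_le\<close>). Truncation along the second coordinate of
  \<open>{..<n} \<times> \<nat>\<close> commutes with \<open>a \<otimes> 1\<close>, so the formula reduces the matter to the boundedness of graded triangular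
  truncations on \<open>S\<^sup>p\<close> with a constant independent of the grading (\<open>triangular_truncation_bounded\<close>). That is
  Cotlar's doubling argument, duality and interpolation.

  The necessity half of the formula is the three lines theorem (\<open>interpolation_lower\<close>). For the sufficiency
  (\<open>interpolation_upper\<close>), maximise \<open>Re Tr (a y b w) + \<delta> Re Tr a + \<delta> Re Tr b\<close> over a finite corner. A maximiser
  can be taken with \<open>a\<close>, \<open>b\<close> positive; they are invertible thanks to the \<open>\<delta>\<close> terms, and the first order condition
  says that \<open>G(\<zeta>) = a\<^sup>-\<^sup>p\<^sup>\<zeta> u |a y b|\<^sup>p\<^sup>\<zeta> b\<^sup>-\<^sup>p\<^sup>\<zeta>\<close>, normalised, is bounded by \<open>c + \<epsilon>\<close> on both edges of the strip.
  Here the derivative of the \<open>S\<^sup>2\<^sup>p\<close> norm is controlled by the inequality of \<open>stretch_norm\<close>. The infinite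
  dimensional case follows by adding a series of small analytic families of finite matrices.

  Non decomposability: if \<open>R\<close> is decomposable with completing maps \<open>v\<^sub>1\<close>, \<open>v\<^sub>2\<close>, then the coefficients
  \<open>R(e\<^sub>i\<^sub>j)\<^sub>i\<^sub>j\<close> form an off-diagonal block of a positive kernel with diagonal blocks \<open>v\<^sub>1(e\<^sub>i\<^sub>j)\<^sub>i\<^sub>j\<close> and
  \<open>v\<^sub>2(e\<^sub>i\<^sub>j)\<^sub>i\<^sub>j\<close> (\<open>decomposable_diagonal_bound\<close>), whose diagonals are bounded because positive maps on \<open>S\<^sup>p\<close>
  are bounded (\<open>two_by_two_diag_bounded\<close>). Thus \<open>R(e\<^sub>i\<^sub>j)\<^sub>i\<^sub>j = \<langle>\<eta>\<^sub>j, \<xi>\<^sub>i\<rangle>\<close> for bounded sequences of vectors.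
  A weak limit argument forbids that such a kernel is uniformly within \<open>\<epsilon>\<close> of a symbol with values \<open>\<gamma>\<^sub>1\<close>
  above and \<open>\<gamma>\<^sub>2\<close> below the diagonal when \<open>2\<epsilon> < |\<gamma>\<^sub>1 - \<gamma>\<^sub>2|\<close> (\<open>order_property_bound\<close>), whereas the completely bounded
  distance dominates the distance of the coefficients (\<open>cb_norm_entry\<close>).
\<close>

section \<open>Finite matrices and the unit balls of the Schatten norms\<close>

definition sq :: "'i set => ('i => complex) => real" where
 "sq J \<xi> = (\<Sum>i\<in>J. (cmod (\<xi> i))\<^sup>2)"

definition ip :: "'i set => ('i => complex) => ('i => complex) => complex" where
 "ip J \<xi> \<eta> = (\<Sum>i\<in>J. \<xi> i * cnj (\<eta> i))"

definition mv :: "'i set => 'i cmat => ('i => complex) => 'i => complex" where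
 "mv J x \<xi> = (%i. \<Sum>j\<in>J. x i j * \<xi> j)"

definition mm :: "'i set => 'i cmat => 'i cmat => 'i cmat" where
 "mm J x y = (%i j. \<Sum>k\<in>J. x i k * y k j)"

definition tr :: "'i set => 'i cmat => 'i cmat => complex" where
 "tr J x w = (\<Sum>i\<in>J. \<Sum>j\<in>J. x i j * w j i)"

lemma sq_nonneg [simp]: "0 \<le> sq J \<xi>"
 by (auto simp: sq_def intro: sum_nonneg)

lemma sq_cong: "(\<And>i. i \<in> J ==> \<xi> i = \<eta> i) ==> sq J \<xi> = sq J \<eta>"
 by (auto simp: sq_def intro: sum.cong)

lemma ip_cong: "(\<And>i. i \<in> J ==> \<xi> i = \<xi>' i) ==> (\<And>i. i \<in> J ==> \<eta> i = \<eta>' i) ==> ip J \<xi> \<eta> = ip J \<xi>' \<eta>'"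
 by (auto simp: ip_def intro: sum.cong)

lemma ip_self: "ip J \<xi> \<xi> = of_real (sq J \<xi>)"
 by (simp add: ip_def sq_def flip: complex_norm_square)

lemma ip_commute: "ip J \<xi> \<eta> = cnj (ip J \<eta> \<xi>)"
 by (simp add: ip_def mult.commute)

lemma ip_sum_right: "ip J \<xi> (%i. \<Sum>k\<in>K. c k * e k i) = (\<Sum>k\<in>K. cnj (c k) * ip J \<xi> (e k))"
proof -
 have "ip J \<xi> (%i. \<Sum>k\<in>K. c k * e k i) = (\<Sum>i\<in>J. \<Sum>k\<in>K. cnj (c k) * (\<xi> i * cnj (e k i)))"
  by (simp add: ip_def sum_distrib_left mult_ac)
 also have "... = (\<Sum>k\<in>K. \<Sum>i\<in>J. cnj (c k) * (\<xi> i * cnj (e k i)))"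
  by (rule sum.swap)
 finally show ?thesis by (simp add: ip_def sum_distrib_left)
qed

lemma ip_sum_left: "ip J (%i. \<Sum>k\<in>K. c k * e k i) \<xi> = (\<Sum>k\<in>K. c k * ip J (e k) \<xi>)"
proof -
 have "ip J (%i. \<Sum>k\<in>K. c k * e k i) \<xi> = cnj (ip J \<xi> (%i. \<Sum>k\<in>K. c k * e k i))"
  by (rule ip_commute)
 also have "... = (\<Sum>k\<in>K. c k * cnj (ip J \<xi> (e k)))"
  by (simp add: ip_sum_right)
 also have "... = (\<Sum>k\<in>K. c k * ip J (e k) \<xi>)"
  by (intro sum.cong refl, subst ip_commute, simp)
 finally show ?thesis .
qed

lemma ip_mult_left: "ip J (%i. c * \<xi> i) \<eta> = c * ip J \<xi> \<eta>"
 by (simp add: ip_def sum_distrib_left mult_ac)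

lemma ip_mult_right: "ip J \<xi> (%i. c * \<eta> i) = cnj c * ip J \<xi> \<eta>"
 by (simp add: ip_def sum_distrib_left mult_ac)

lemma sq_mult: "sq J (%i. c * \<xi> i) = (cmod c)\<^sup>2 * sq J \<xi>"
 by (simp add: sq_def sum_distrib_left norm_mult power_mult_distrib)

lemma sum_norm_cs:
 fixes a b :: "'a => complex"
 shows "(cmod (\<Sum>i\<in>I. a i * b i))\<^sup>2 \<le> (\<Sum>i\<in>I. (cmod (a i))\<^sup>2) * (\<Sum>i\<in>I. (cmod (b i))\<^sup>2)"
proof -
 have "cmod (\<Sum>i\<in>I. a i * b i) \<le> (\<Sum>i\<in>I. cmod (a i) * cmod (b i))"
  using norm_sum[of "%i. a i * b i" I] by (simp add: norm_mult)
 hence "(cmod (\<Sum>i\<in>I. a i * b i))\<^sup>2 \<le> (\<Sum>i\<in>I. cmod (a i) * cmod (b i))\<^sup>2"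
  by (intro power_mono) auto
 also have "... \<le> (\<Sum>i\<in>I. (cmod (a i))\<^sup>2) * (\<Sum>i\<in>I. (cmod (b i))\<^sup>2)"
  by (rule Cauchy_Schwarz_ineq_sum)
 finally show ?thesis .
qed

lemma ip_cs: "(cmod (ip J \<xi> \<eta>))\<^sup>2 \<le> sq J \<xi> * sq J \<eta>"
 using sum_norm_cs[of \<xi> "%i. cnj (\<eta> i)" J] by (simp add: ip_def sq_def)

subsection \<open>Bessel systems\<close>

definition bessel :: "'i set => 'k set => ('k => 'i => complex) => bool" where
 "bessel J K e \<longleftrightarrow> (\<forall>\<xi>. (\<Sum>k\<in>K. (cmod (ip J \<xi> (e k)))\<^sup>2) \<le> sq J \<xi>)"

lemma square_le_mult_imp_le:
 fixes a b :: real
 assumes "a\<^sup>2 \<le> b * a" "0 \<le> a" "0 \<le> b" shows "a \<le> b"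
 using assms unfolding power2_eq_square by (cases "a = 0") (auto simp: mult_le_cancel_right)

lemma bessel_iff_synthesis:
 "bessel J K e \<longleftrightarrow> (\<forall>c. sq J (%i. \<Sum>k\<in>K. c k * e k i) \<le> (\<Sum>k\<in>K. (cmod (c k))\<^sup>2))"
proof
 assume B: "bessel J K e"
 show "\<forall>c. sq J (%i. \<Sum>k\<in>K. c k * e k i) \<le> (\<Sum>k\<in>K. (cmod (c k))\<^sup>2)"
 proof
  fix c
  define \<xi> where "\<xi> = (%i. \<Sum>k\<in>K. c k * e k i)"
  have "sq J \<xi> = cmod (\<Sum>k\<in>K. cnj (c k) * ip J \<xi> (e k))"
   using ip_self[of J \<xi>] ip_sum_right[of J \<xi> c e K] unfolding \<xi>_def[symmetric]
   by (metis norm_of_real abs_of_nonneg sq_nonneg)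
  hence "(sq J \<xi>)\<^sup>2 \<le> (\<Sum>k\<in>K. (cmod (c k))\<^sup>2) * (\<Sum>k\<in>K. (cmod (ip J \<xi> (e k)))\<^sup>2)"
   using sum_norm_cs[of "%k. cnj (c k)" "%k. ip J \<xi> (e k)" K] by simp
  also have "... \<le> (\<Sum>k\<in>K. (cmod (c k))\<^sup>2) * sq J \<xi>"
   using B by (intro mult_left_mono) (auto simp: bessel_def intro: sum_nonneg)
  finally show "sq J \<xi> \<le> (\<Sum>k\<in>K. (cmod (c k))\<^sup>2)"
   by (rule square_le_mult_imp_le) (auto intro: sum_nonneg)
 qed
next
 assume D: "\<forall>c. sq J (%i. \<Sum>k\<in>K. c k * e k i) \<le> (\<Sum>k\<in>K. (cmod (c k))\<^sup>2)"
 show "bessel J K e" unfolding bessel_def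
 proof
  fix \<xi>
  define S where "S = (\<Sum>k\<in>K. (cmod (ip J \<xi> (e k)))\<^sup>2)"
  have S0: "0 \<le> S" unfolding S_def by (auto intro: sum_nonneg)
  have "of_real S = ip J \<xi> (%i. \<Sum>k\<in>K. ip J \<xi> (e k) * e k i)"
   unfolding ip_sum_right S_def by (simp add: mult.commute flip: complex_norm_square)
  hence "S = cmod (ip J \<xi> (%i. \<Sum>k\<in>K. ip J \<xi> (e k) * e k i))"
   using S0 by (metis norm_of_real abs_of_nonneg)
  hence "S\<^sup>2 \<le> sq J \<xi> * sq J (%i. \<Sum>k\<in>K. ip J \<xi> (e k) * e k i)"
   using ip_cs by metis
  also have "... \<le> sq J \<xi> * S"
   using D unfolding S_def by (intro mult_left_mono) auto
  finally show "S \<le> sq J \<xi>" by (rule square_le_mult_imp_le) (use S0 in auto)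
 qed
qed

lemma bessel_synthesis:
 "bessel J K e ==> sq J (%i. \<Sum>k\<in>K. c k * e k i) \<le> (\<Sum>k\<in>K. (cmod (c k))\<^sup>2)"
 by (simp add: bessel_iff_synthesis)

lemma bessel_sq_le:
 assumes "bessel J K e" "finite K" "k \<in> K" shows "sq J (e k) \<le> 1"
proof -
 have "(sq J (e k))\<^sup>2 = (cmod (ip J (e k) (e k)))\<^sup>2" by (simp add: ip_self)
 also have "... \<le> (\<Sum>l\<in>K. (cmod (ip J (e k) (e l)))\<^sup>2)"
  using assms by (intro member_le_sum) auto
 also have "... \<le> sq J (e k)" using assms by (simp add: bessel_def)
 finally have "(sq J (e k))\<^sup>2 \<le> 1 * sq J (e k)" by simp
 thus ?thesis by (rule square_le_mult_imp_le) auto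
qed

lemma bessel_scale:
 assumes "bessel J K e" "\<And>k. k \<in> K ==> cmod (c k) \<le> 1"
 shows "bessel J K (%k i. c k * e k i)"
 unfolding bessel_def
proof
 fix \<xi>
 have "(\<Sum>k\<in>K. (cmod (ip J \<xi> (%i. c k * e k i)))\<^sup>2) \<le> (\<Sum>k\<in>K. (cmod (ip J \<xi> (e k)))\<^sup>2)"
 proof (rule sum_mono)
  fix k assume "k \<in> K"
  hence "cmod (c k) * cmod (ip J \<xi> (e k)) \<le> 1 * cmod (ip J \<xi> (e k))"
   using assms by (intro mult_right_mono) auto
  thus "(cmod (ip J \<xi> (%i. c k * e k i)))\<^sup>2 \<le> (cmod (ip J \<xi> (e k)))\<^sup>2"
   unfolding ip_mult_right by (intro power_mono) (auto simp: norm_mult)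
 qed
 also have "... \<le> sq J \<xi>" using assms by (auto simp: bessel_def)
 finally show "(\<Sum>k\<in>K. (cmod (ip J \<xi> (%i. c k * e k i)))\<^sup>2) \<le> sq J \<xi>" .
qed

lemma orthonormal_sq_synthesis:
 assumes "\<And>k l. k \<in> K ==> l \<in> K ==> ip J (e k) (e l) = (if k = l then 1 else 0)" "finite K"
 shows "sq J (%i. \<Sum>k\<in>K. c k * e k i) = (\<Sum>k\<in>K. (cmod (c k))\<^sup>2)"
proof -
 have "ip J (e k) (%i. \<Sum>l\<in>K. c l * e l i) = cnj (c k)" if "k \<in> K" for k
 proof -
  have "(\<Sum>l\<in>K. cnj (c l) * ip J (e k) (e l)) = (\<Sum>l\<in>K. if k = l then cnj (c l) else 0)"
   using assms(1)[OF that] by (intro sum.cong) auto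
  thus ?thesis using that assms by (simp add: ip_sum_right)
 qed
 hence "ip J (%i. \<Sum>k\<in>K. c k * e k i) (%i. \<Sum>k\<in>K. c k * e k i) = (\<Sum>k\<in>K. c k * cnj (c k))"
  by (simp add: ip_sum_left)
 also have "... = of_real (\<Sum>k\<in>K. (cmod (c k))\<^sup>2)" by (simp flip: complex_norm_square)
 finally show ?thesis by (metis ip_self of_real_eq_iff)
qed

lemma orthonormal_bessel:
 assumes "\<And>k l. k \<in> K ==> l \<in> K ==> ip J (e k) (e l) = (if k = l then 1 else 0)" "finite K"
 shows "bessel J K e"
 using orthonormal_sq_synthesis[OF assms] by (simp add: bessel_iff_synthesis)

lemma bessel_singleton: "sq J \<eta> \<le> 1 ==> bessel J {k} (%_. \<eta>)"
proof -
 assume 1: "sq J \<eta> \<le> 1"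
 have "(cmod (ip J \<xi> \<eta>))\<^sup>2 \<le> sq J \<xi>" for \<xi>
  using order_trans[OF ip_cs[of J \<xi> \<eta>] mult_left_le[OF 1 sq_nonneg]] .
 thus ?thesis by (simp add: bessel_def)
qed

subsection \<open>Contractions\<close>

definition contr :: "'i set => 'i cmat => bool" where
 "contr J w \<longleftrightarrow> (\<forall>\<xi>. sq J (mv J w \<xi>) \<le> sq J \<xi>)"

lemma mv_sum: "mv J w (%i. \<Sum>k\<in>K. c k * e k i) = (%i. \<Sum>k\<in>K. c k * mv J w (e k) i)"
proof
 fix i
 have "mv J w (%i. \<Sum>k\<in>K. c k * e k i) i = (\<Sum>j\<in>J. \<Sum>k\<in>K. c k * (w i j * e k j))"
  by (simp add: mv_def sum_distrib_left mult_ac)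
 also have "... = (\<Sum>k\<in>K. \<Sum>j\<in>J. c k * (w i j * e k j))" by (rule sum.swap)
 finally show "mv J w (%i. \<Sum>k\<in>K. c k * e k i) i = (\<Sum>k\<in>K. c k * mv J w (e k) i)"
  by (simp add: mv_def sum_distrib_left)
qed

lemma ip_mv: "ip J (mv J w \<xi>) \<eta> = ip J \<xi> (mv J (adj w) \<eta>)"
proof -
 have "ip J (mv J w \<xi>) \<eta> = (\<Sum>i\<in>J. \<Sum>j\<in>J. w i j * \<xi> j * cnj (\<eta> i))"
  by (simp add: ip_def mv_def sum_distrib_right)
 also have "... = (\<Sum>j\<in>J. \<Sum>i\<in>J. w i j * \<xi> j * cnj (\<eta> i))" by (rule sum.swap)
 finally show ?thesis by (simp add: ip_def mv_def adj_def sum_distrib_left mult_ac)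
qed

lemma adj_adj [simp]: "adj (adj x) = x" by (simp add: adj_def)

lemma contr_ip:
 assumes "contr J w" shows "(cmod (ip J (mv J w \<xi>) \<eta>))\<^sup>2 \<le> sq J \<xi> * sq J \<eta>"
proof -
 have "(cmod (ip J (mv J w \<xi>) \<eta>))\<^sup>2 \<le> sq J (mv J w \<xi>) * sq J \<eta>" by (rule ip_cs)
 also have "... \<le> sq J \<xi> * sq J \<eta>" using assms by (intro mult_right_mono) (auto simp: contr_def)
 finally show ?thesis .
qed

lemma contr_adj: assumes "contr J w" shows "contr J (adj w)"
 unfolding contr_def
proof
 fix \<eta>
 let ?h = "mv J (adj w) \<eta>"
 have "of_real (sq J ?h) = ip J (mv J w ?h) \<eta>" by (simp add: ip_mv ip_self)
 hence "(sq J ?h)\<^sup>2 = (cmod (ip J (mv J w ?h) \<eta>))\<^sup>2" by (metis norm_of_real power2_abs)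
 also have "... \<le> sq J \<eta> * sq J ?h" using contr_ip[OF assms, of ?h \<eta>] by (simp add: mult.commute)
 finally show "sq J ?h \<le> sq J \<eta>"
  by (rule square_le_mult_imp_le) auto
qed

lemma bessel_contr:
 assumes "contr J w" "bessel J K e" shows "bessel J K (%k. mv J w (e k))"
 unfolding bessel_iff_synthesis
proof
 fix c
 have "sq J (%i. \<Sum>k\<in>K. c k * mv J w (e k) i) = sq J (mv J w (%i. \<Sum>k\<in>K. c k * e k i))"
  by (simp add: mv_sum)
 also have "... \<le> sq J (%i. \<Sum>k\<in>K. c k * e k i)" using assms by (simp add: contr_def)
 also have "... \<le> (\<Sum>k\<in>K. (cmod (c k))\<^sup>2)" using assms by (simp add: bessel_synthesis)
 finally show "sq J (%i. \<Sum>k\<in>K. c k * mv J w (e k) i) \<le> (\<Sum>k\<in>K. (cmod (c k))\<^sup>2)" .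
qed

lemma mv_mm: "mv J (mm J x y) \<xi> = mv J x (mv J y \<xi>)"
proof
 fix i
 have "mv J (mm J x y) \<xi> i = (\<Sum>j\<in>J. \<Sum>k\<in>J. x i k * y k j * \<xi> j)"
  by (simp add: mv_def mm_def sum_distrib_right)
 also have "... = (\<Sum>k\<in>J. \<Sum>j\<in>J. x i k * y k j * \<xi> j)" by (rule sum.swap)
 finally show "mv J (mm J x y) \<xi> i = mv J x (mv J y \<xi>) i"
  by (simp add: mv_def sum_distrib_left mult_ac)
qed

lemma tr_commute: "tr J x w = tr J w x"
 unfolding tr_def by (subst sum.swap) (simp add: mult.commute)

lemma tr_mm_assoc: "tr J (mm J x y) w = tr J x (mm J y w)"
proof -
 have "tr J (mm J x y) w = (\<Sum>i\<in>J. \<Sum>j\<in>J. \<Sum>k\<in>J. x i k * y k j * w j i)"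
  by (simp add: tr_def mm_def sum_distrib_right)
 also have "... = (\<Sum>i\<in>J. \<Sum>k\<in>J. \<Sum>j\<in>J. x i k * y k j * w j i)"
  by (intro sum.cong refl sum.swap)
 finally show ?thesis by (simp add: tr_def mm_def sum_distrib_left mult_ac)
qed

lemma mm_assoc: "mm J (mm J x y) z = mm J x (mm J y z)"
proof (intro ext)
 fix i j
 have "mm J (mm J x y) z i j = (\<Sum>k\<in>J. \<Sum>l\<in>J. x i l * y l k * z k j)"
  by (simp add: mm_def sum_distrib_right)
 also have "... = (\<Sum>l\<in>J. \<Sum>k\<in>J. x i l * y l k * z k j)" by (rule sum.swap)
 finally show "mm J (mm J x y) z i j = mm J x (mm J y z) i j"
  by (simp add: mm_def sum_distrib_left mult_ac)
qed

lemma adj_mm: "adj (mm J x y) = mm J (adj y) (adj x)"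
 by (auto simp: adj_def mm_def fun_eq_iff mult.commute)

lemma tr_adj: "tr J (adj x) (adj w) = cnj (tr J x w)"
proof -
 have "tr J (adj x) (adj w) = (\<Sum>i\<in>J. \<Sum>j\<in>J. cnj (x j i * w i j))"
  by (simp add: tr_def adj_def)
 also have "... = (\<Sum>j\<in>J. \<Sum>i\<in>J. cnj (x j i * w i j))" by (rule sum.swap)
 finally show ?thesis by (simp add: tr_def)
qed

lemma tr_cong:
 "(\<And>i j. i \<in> J ==> j \<in> J ==> x i j = x' i j) ==> (\<And>i j. i \<in> J ==> j \<in> J ==> w i j = w' i j) ==>
  tr J x w = tr J x' w'"
 by (auto simp: tr_def intro!: sum.cong)

lemma tr_dyads:
 "tr J x (%i j. \<Sum>k\<in>K. c k * e k i * cnj (f k j)) = (\<Sum>k\<in>K. c k * ip J (mv J x (e k)) (f k))"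
proof -
 have "tr J x (%i j. \<Sum>k\<in>K. c k * e k i * cnj (f k j))
   = (\<Sum>i\<in>J. \<Sum>j\<in>J. \<Sum>k\<in>K. c k * (x i j * e k j * cnj (f k i)))"
  by (simp add: tr_def sum_distrib_left mult_ac)
 also have "... = (\<Sum>i\<in>J. \<Sum>k\<in>K. \<Sum>j\<in>J. c k * (x i j * e k j * cnj (f k i)))"
  by (intro sum.cong refl sum.swap)
 also have "... = (\<Sum>k\<in>K. \<Sum>i\<in>J. \<Sum>j\<in>J. c k * (x i j * e k j * cnj (f k i)))"
  by (rule sum.swap)
 also have "... = (\<Sum>k\<in>K. c k * ip J (mv J x (e k)) (f k))"
  by (simp add: ip_def mv_def sum_distrib_left sum_distrib_right)
 finally show ?thesis .
qed

lemma mv_dyads: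
 "mv J (%i j. \<Sum>k\<in>K. c k * e k i * cnj (f k j)) \<xi> = (%i. \<Sum>k\<in>K. (c k * ip J \<xi> (f k)) * e k i)"
proof
 fix i
 have "mv J (%i j. \<Sum>k\<in>K. c k * e k i * cnj (f k j)) \<xi> i = (\<Sum>j\<in>J. \<Sum>k\<in>K. c k * e k i * cnj (f k j) * \<xi> j)"
  by (simp add: mv_def sum_distrib_right)
 also have "... = (\<Sum>k\<in>K. \<Sum>j\<in>J. c k * e k i * cnj (f k j) * \<xi> j)" by (rule sum.swap)
 finally show "mv J (%i j. \<Sum>k\<in>K. c k * e k i * cnj (f k j)) \<xi> i = (\<Sum>k\<in>K. (c k * ip J \<xi> (f k)) * e k i)"
  by (simp add: ip_def sum_distrib_left sum_distrib_right mult_ac)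
qed

subsection \<open>Schatten balls\<close>

text \<open>The unit ball of \<open>S\<^sup>1\<^sup>/\<^sup>\<theta>\<close> on \<open>\<ell>\<^sup>2(J)\<close> as a set of sums \<open>\<Sum> \<rho>\<^sub>k\<^sup>\<theta> e\<^sub>k f\<^sub>k\<^sup>*\<close>. The vectors form Bessel systems instead of
 orthonormal ones: such sums are stable under contractions, restriction and truncation to corners, and
 replacing \<open>\<theta>\<close> by \<open>z\<close> in the exponent gives an analytic family.\<close>

definition dyadic :: "'i set => real => 'i cmat => nat set => (nat => real) =>
  (nat => 'i => complex) => (nat => 'i => complex) => bool" where
 "dyadic J \<theta> x K \<rho> e f \<longleftrightarrow> finite K \<and> (\<forall>k\<in>K. 0 < \<rho> k) \<and> sum \<rho> K \<le> 1 \<and>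
   bessel J K e \<and> bessel J K f \<and>
   (\<forall>i\<in>J. \<forall>j\<in>J. x i j = (\<Sum>k\<in>K. complex_of_real (\<rho> k powr \<theta>) * e k i * cnj (f k j)))"

definition sball :: "'i set => real => 'i cmat => bool" where
 "sball J \<theta> x \<longleftrightarrow> (\<exists>K \<rho> e f. dyadic J \<theta> x K \<rho> e f)"

text \<open>\<open>c\<close> bounds the \<open>S\<^sup>1\<^sup>/\<^sup>\<theta>\<close> norm of \<open>x\<close> on \<open>\<ell>\<^sup>2(J)\<close>, by trace duality with the exponent \<open>1 - \<theta>\<close>. In this form the triangle
 inequality and limits are immediate.\<close>

definition sb :: "'i set => real => 'i cmat => real => bool" where
 "sb J \<theta> x c \<longleftrightarrow> (\<forall>w. sball J (1 - \<theta>) w \<longrightarrow> cmod (tr J x w) \<le> c)"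

lemma sballI:
 fixes K :: "nat set"
 assumes "finite K" "\<And>k. k \<in> K ==> 0 < \<rho> k" "sum \<rho> K \<le> 1" "bessel J K e" "bessel J K f"
  "\<And>i j. i \<in> J ==> j \<in> J ==> x i j = (\<Sum>k\<in>K. complex_of_real (\<rho> k powr \<theta>) * e k i * cnj (f k j))"
 shows "sball J \<theta> x"
 unfolding sball_def dyadic_def
 by (rule exI[of _ K], rule exI[of _ \<rho>], rule exI[of _ e], rule exI[of _ f]) (simp add: assms)

lemma dyadicD:
 assumes "dyadic J \<theta> x K \<rho> e f"
 shows "finite K" "\<And>k. k \<in> K ==> 0 < \<rho> k" "sum \<rho> K \<le> 1" "bessel J K e" "bessel J K f"
  "\<And>i j. i \<in> J ==> j \<in> J ==> x i j = (\<Sum>k\<in>K. complex_of_real (\<rho> k powr \<theta>) * e k i * cnj (f k j))"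
 using assms unfolding dyadic_def by simp_all

lemma sb_cong: "(\<And>i j. i \<in> J ==> j \<in> J ==> x i j = y i j) ==> sb J \<theta> x c = sb J \<theta> y c"
proof -
 assume *: "\<And>i j. i \<in> J ==> j \<in> J ==> x i j = y i j"
 have "tr J x w = tr J y w" for w by (rule tr_cong) (simp_all add: *)
 thus ?thesis by (simp add: sb_def)
qed

text \<open>\<open>x = \<Sum> z\<^sub>k e\<^sub>k f\<^sub>k\<^sup>*\<close> with complex coefficients of modulus at most \<open>\<rho>\<^sub>k\<^sup>\<theta>\<close>: excess phases and
 contraction factors are absorbed into \<open>e\<close>.\<close>

lemma sball_coeffI:
 fixes K :: "nat set"
 assumes "finite K" "\<And>k. k \<in> K ==> 0 < \<rho> k" "sum \<rho> K \<le> 1" "bessel J K e" "bessel J K f"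
  "\<And>k. k \<in> K ==> cmod (c k) \<le> \<rho> k powr \<theta>"
  "\<And>i j. i \<in> J ==> j \<in> J ==> x i j = (\<Sum>k\<in>K. c k * e k i * cnj (f k j))"
 shows "sball J \<theta> x"
proof (rule sballI)
 show "bessel J K (%k i. (c k / complex_of_real (\<rho> k powr \<theta>)) * e k i)"
  using assms by (intro bessel_scale) (auto simp: norm_divide divide_le_eq)
 show "x i j = (\<Sum>k\<in>K. complex_of_real (\<rho> k powr \<theta>) * (c k / complex_of_real (\<rho> k powr \<theta>) * e k i) * cnj (f k j))"
  if "i \<in> J" "j \<in> J" for i j
  unfolding assms(7)[OF that] using assms(2) by (intro sum.cong) fastforce+
qed (use assms in auto)

lemma sball_mono:
 assumes "sball J \<theta> x" "\<theta>' \<le> \<theta>" shows "sball J \<theta>' x"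
proof -
 obtain K \<rho> e f where "dyadic J \<theta> x K \<rho> e f"
  using assms(1) unfolding sball_def by blast
 note * = dyadicD[OF this]
 have le1: "\<rho> k \<le> 1" if "k \<in> K" for k
  using member_le_sum[of k K \<rho>] that * by (force intro: less_imp_le)
 have "\<rho> k powr \<theta> \<le> \<rho> k powr \<theta>'" if "k \<in> K" for k
  using that le1[OF that] *(2)[OF that] assms(2) by (intro powr_mono') auto
 thus ?thesis
  by (intro sball_coeffI[OF *(1-5), where c = "%k. complex_of_real (\<rho> k powr \<theta>)"]) (use * in auto)
qed

lemma sball_adj: assumes "sball J \<theta> x" shows "sball J \<theta> (adj x)"
proof -
 obtain K \<rho> e f where "dyadic J \<theta> x K \<rho> e f"
  using assms(1) unfolding sball_def by blast
 note * = dyadicD[OF this]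
 show ?thesis
  by (rule sballI[OF *(1-3) *(5) *(4)]) (auto simp: adj_def *(6) mult_ac)
qed

lemma sball_mm_left:
 assumes "contr J a" "sball J \<theta> x" shows "sball J \<theta> (mm J a x)"
proof -
 obtain K \<rho> e f where "dyadic J \<theta> x K \<rho> e f"
  using assms(2) unfolding sball_def by blast
 note * = dyadicD[OF this]
 show ?thesis
 proof (rule sballI[OF *(1-3) bessel_contr[OF assms(1) *(4)] *(5)])
  fix i j assume ij: "i \<in> J" "j \<in> J"
  have "mm J a x i j = (\<Sum>l\<in>J. \<Sum>k\<in>K. complex_of_real (\<rho> k powr \<theta>) * (a i l * e k l) * cnj (f k j))"
   using ij by (simp add: mm_def *(6) sum_distrib_left mult_ac)
  also have "... = (\<Sum>k\<in>K. \<Sum>l\<in>J. complex_of_real (\<rho> k powr \<theta>) * (a i l * e k l) * cnj (f k j))"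
   by (rule sum.swap)
  also have "... = (\<Sum>k\<in>K. complex_of_real (\<rho> k powr \<theta>) * mv J a (e k) i * cnj (f k j))"
   by (simp add: mv_def sum_distrib_left sum_distrib_right)
  finally show "mm J a x i j = (\<Sum>k\<in>K. complex_of_real (\<rho> k powr \<theta>) * mv J a (e k) i * cnj (f k j))" .
 qed
qed

lemma sball_mm_right:
 assumes "contr J a" "sball J \<theta> x" shows "sball J \<theta> (mm J x a)"
 using sball_adj[OF sball_mm_left[OF contr_adj[OF assms(1)] sball_adj[OF assms(2)]]]
 by (simp add: adj_mm)

lemma sball_0_contr: assumes "sball J 0 x" shows "contr J x"
 unfolding contr_def
proof
 fix \<xi>
 obtain K \<rho> e f where "dyadic J 0 x K \<rho> e f"
  using assms(1) unfolding sball_def by blast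
 note * = dyadicD[OF this]
 have x: "x i j = (\<Sum>k\<in>K. 1 * e k i * cnj (f k j))" if "i \<in> J" "j \<in> J" for i j
  unfolding *(6)[OF that] using *(2) by (intro sum.cong refl) fastforce
 have "sq J (mv J x \<xi>) = sq J (mv J (%i j. \<Sum>k\<in>K. 1 * e k i * cnj (f k j)) \<xi>)"
  using x by (intro sq_cong) (auto simp: mv_def)
 also have "... = sq J (%i. \<Sum>k\<in>K. ip J \<xi> (f k) * e k i)"
  unfolding mv_dyads by simp
 also have "... \<le> (\<Sum>k\<in>K. (cmod (ip J \<xi> (f k)))\<^sup>2)" by (rule bessel_synthesis[OF *(4)])
 also have "... \<le> sq J \<xi>" using *(5) by (simp add: bessel_def)
 finally show "sq J (mv J x \<xi>) \<le> sq J \<xi>" .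
qed

lemma sball_contr: "sball J \<theta> x ==> 0 \<le> \<theta> ==> contr J x"
 using sball_0_contr sball_mono by blast

lemma young_theta:
 assumes "0 \<le> \<theta>" "\<theta> \<le> 1" "0 < a" "0 < b"
 shows "a powr \<theta> * b powr (1 - \<theta>) \<le> \<theta> * a + (1 - \<theta>) * (b::real)"
 using Youngs_inequality_0[of \<theta> "1-\<theta>" a b] assms by simp

text \<open>Hoelder's inequality for the trace: Young's inequality for the coefficients and the Bessel inequality for the vectors.\<close>

lemma sball_pair:
 assumes "0 \<le> \<theta>" "\<theta> \<le> 1" "sball J \<theta> x" "sball J (1 - \<theta>) w"
 shows "cmod (tr J x w) \<le> 1"
proof -
 obtain K \<rho> e f where "dyadic J \<theta> x K \<rho> e f"
  using assms(3) unfolding sball_def by blast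
 note k = dyadicD[OF this]
 obtain L \<sigma> g h where "dyadic J (1-\<theta>) w L \<sigma> g h"
  using assms(4) unfolding sball_def by blast
 note l = dyadicD[OF this]
 define A where "A = (%k l. (cmod (ip J (h l) (e k)))\<^sup>2)"
 define B where "B = (%k l. (cmod (ip J (g l) (f k)))\<^sup>2)"
 have sw: "cmod (ip J \<xi> \<eta>) = cmod (ip J \<eta> \<xi>)" for \<xi> \<eta>
  by (subst ip_commute) (rule complex_mod_cnj)
 have A1: "(\<Sum>k\<in>K. A k l) \<le> 1" if "l \<in> L" for l
  using k(4) bessel_sq_le[OF l(5) l(1) that] unfolding A_def bessel_def by (meson order_trans)
 have B1: "(\<Sum>k\<in>K. B k l) \<le> 1" if "l \<in> L" for l
  using k(5) bessel_sq_le[OF l(4) l(1) that] unfolding B_def bessel_def by (meson order_trans)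
 have A2: "(\<Sum>l\<in>L. A k l) \<le> 1" if "k \<in> K" for k
  using l(5) bessel_sq_le[OF k(4) k(1) that] unfolding A_def bessel_def sw[of "h _"] by (meson order_trans)
 have B2: "(\<Sum>l\<in>L. B k l) \<le> 1" if "k \<in> K" for k
  using l(4) bessel_sq_le[OF k(5) k(1) that] unfolding B_def bessel_def sw[of "g _"] by (meson order_trans)
 have "tr J x w = tr J x (%i j. \<Sum>k\<in>L. complex_of_real (\<sigma> k powr (1-\<theta>)) * g k i * cnj (h k j))"
  using l(6) by (intro tr_cong) auto
 also have "... = (\<Sum>l\<in>L. complex_of_real (\<sigma> l powr (1-\<theta>)) * ip J (mv J x (g l)) (h l))"
  by (rule tr_dyads)
 also have "... = (\<Sum>l\<in>L. complex_of_real (\<sigma> l powr (1-\<theta>)) *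
    ip J (mv J (%i j. \<Sum>k\<in>K. complex_of_real (\<rho> k powr \<theta>) * e k i * cnj (f k j)) (g l)) (h l))"
  using k(6) by (intro sum.cong refl arg_cong2[where f = "(*)"] ip_cong) (auto simp: mv_def)
 also have "... = (\<Sum>l\<in>L. \<Sum>k\<in>K. complex_of_real (\<rho> k powr \<theta> * \<sigma> l powr (1-\<theta>)) *
    (ip J (g l) (f k) * ip J (e k) (h l)))"
  unfolding mv_dyads ip_sum_left by (simp add: sum_distrib_left mult_ac)
 finally have eq: "tr J x w = (\<Sum>l\<in>L. \<Sum>k\<in>K. complex_of_real (\<rho> k powr \<theta> * \<sigma> l powr (1-\<theta>)) *
    (ip J (g l) (f k) * ip J (e k) (h l)))" .
 have "cmod (tr J x w) \<le> (\<Sum>l\<in>L. \<Sum>k\<in>K. cmod (complex_of_real (\<rho> k powr \<theta> * \<sigma> l powr (1-\<theta>)) *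
    (ip J (g l) (f k) * ip J (e k) (h l))))"
  unfolding eq by (rule order_trans[OF norm_sum sum_mono]) (rule norm_sum)
 also have "... \<le> (\<Sum>l\<in>L. \<Sum>k\<in>K. (\<theta> * \<rho> k + (1-\<theta>) * \<sigma> l) * ((A k l + B k l) / 2))"
 proof (intro sum_mono)
  fix l q assume lq: "l \<in> L" "q \<in> K"
  have "cmod (ip J (g l) (f q)) * cmod (ip J (h l) (e q)) \<le> (A q l + B q l) / 2"
   using sum_squares_bound[of "cmod (ip J (g l) (f q))" "cmod (ip J (h l) (e q))"]
   unfolding A_def B_def by simp
  moreover have "\<rho> q powr \<theta> * \<sigma> l powr (1-\<theta>) \<le> \<theta> * \<rho> q + (1-\<theta>) * \<sigma> l"
   using young_theta assms k l lq by auto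
  ultimately have "(\<rho> q powr \<theta> * \<sigma> l powr (1-\<theta>)) * (cmod (ip J (g l) (f q)) * cmod (ip J (h l) (e q)))
    \<le> (\<theta> * \<rho> q + (1-\<theta>) * \<sigma> l) * ((A q l + B q l) / 2)"
   using assms k(2)[OF lq(2)] l(2)[OF lq(1)]
   by (intro mult_mono) (auto intro!: add_nonneg_nonneg mult_nonneg_nonneg simp: less_imp_le)
  thus "cmod (complex_of_real (\<rho> q powr \<theta> * \<sigma> l powr (1-\<theta>)) * (ip J (g l) (f q) * ip J (e q) (h l)))
    \<le> (\<theta> * \<rho> q + (1-\<theta>) * \<sigma> l) * ((A q l + B q l) / 2)"
   by (simp add: norm_mult sw[of "h l"] mult_ac)
 qed
 also have "... = (\<Sum>l\<in>L. \<Sum>k\<in>K. \<theta> * (\<rho> k * ((A k l + B k l) / 2))) + (\<Sum>l\<in>L. \<Sum>k\<in>K. (1-\<theta>) * (\<sigma> l * ((A k l + B k l) / 2)))"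
  by (simp only: distrib_right sum.distrib mult.assoc)
 also have "(\<Sum>l\<in>L. \<Sum>k\<in>K. \<theta> * (\<rho> k * ((A k l + B k l) / 2))) = \<theta> * (\<Sum>k\<in>K. \<rho> k * (((\<Sum>l\<in>L. A k l) + (\<Sum>l\<in>L. B k l)) / 2))"
  by (subst sum.swap) (simp add: sum.distrib flip: sum_distrib_left sum_divide_distrib)
 also have "(\<Sum>l\<in>L. \<Sum>k\<in>K. (1-\<theta>) * (\<sigma> l * ((A k l + B k l) / 2))) = (1-\<theta>) * (\<Sum>l\<in>L. \<sigma> l * (((\<Sum>k\<in>K. A k l) + (\<Sum>k\<in>K. B k l)) / 2))"
  by (simp add: sum.distrib flip: sum_distrib_left sum_divide_distrib)
 also have "\<theta> * (\<Sum>k\<in>K. \<rho> k * (((\<Sum>l\<in>L. A k l) + (\<Sum>l\<in>L. B k l)) / 2)) \<le> \<theta> * (\<Sum>k\<in>K. \<rho> k * 1)"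
  using A2 B2 k(2) assms by (intro mult_left_mono sum_mono) (fastforce simp: less_imp_le)+
 also have "(1-\<theta>) * (\<Sum>l\<in>L. \<sigma> l * (((\<Sum>k\<in>K. A k l) + (\<Sum>k\<in>K. B k l)) / 2)) \<le> (1-\<theta>) * (\<Sum>l\<in>L. \<sigma> l * 1)"
  using A1 B1 l(2) assms by (intro mult_left_mono sum_mono) (fastforce simp: less_imp_le)+
 also have "\<theta> * (\<Sum>k\<in>K. \<rho> k * 1) + (1-\<theta>) * (\<Sum>l\<in>L. \<sigma> l * 1) \<le> \<theta> * 1 + (1-\<theta>) * 1"
  using k(3) l(3) assms by (intro add_mono mult_left_mono) auto
 finally show ?thesis by simp
qed

lemma sball_sb: "0 \<le> \<theta> ==> \<theta> \<le> 1 ==> sball J \<theta> x ==> sb J \<theta> x 1"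
 using sball_pair by (auto simp: sb_def)

definition hs :: "'i set => 'i cmat => real" where
 "hs J x = (\<Sum>i\<in>J. \<Sum>j\<in>J. (cmod (x i j))\<^sup>2)"

lemma sball_half_hs: assumes "sball J (1/2) x" shows "hs J x \<le> 1"
proof -
 obtain K \<rho> e f where "dyadic J (1/2) x K \<rho> e f"
  using assms(1) unfolding sball_def by blast
 note * = dyadicD[OF this]
 have "hs J x = (\<Sum>j\<in>J. sq J (%i. x i j))"
  unfolding hs_def sq_def by (rule sum.swap)
 also have "... = (\<Sum>j\<in>J. sq J (%i. \<Sum>k\<in>K. (complex_of_real (\<rho> k powr (1/2)) * cnj (f k j)) * e k i))"
  using *(6) by (intro sum.cong refl sq_cong) (auto simp: mult_ac)
 also have "... \<le> (\<Sum>j\<in>J. \<Sum>k\<in>K. (cmod (complex_of_real (\<rho> k powr (1/2)) * cnj (f k j)))\<^sup>2)"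
  by (intro sum_mono bessel_synthesis *(4))
 also have "... = (\<Sum>j\<in>J. \<Sum>k\<in>K. \<rho> k * (cmod (f k j))\<^sup>2)"
  using *(2) by (intro sum.cong refl) (auto simp: norm_mult power_mult_distrib powr_half_sqrt less_imp_le)
 also have "... = (\<Sum>k\<in>K. \<rho> k * sq J (f k))"
  by (subst sum.swap) (simp add: sq_def sum_distrib_left)
 also have "... \<le> (\<Sum>k\<in>K. \<rho> k * 1)"
  using *(2) bessel_sq_le[OF *(5) *(1)] by (intro sum_mono mult_left_mono) (auto simp: less_imp_le)
 finally show ?thesis using *(3) by simp
qed

lemma tr_hs: "(cmod (tr J x w))\<^sup>2 \<le> hs J x * hs J w"
proof -
 have "(cmod (tr J x w))\<^sup>2 = (cmod (\<Sum>(i,j)\<in>J\<times>J. x i j * w j i))\<^sup>2"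
  by (simp add: tr_def sum.cartesian_product)
 also have "... = (cmod (\<Sum>z\<in>J\<times>J. x (fst z) (snd z) * w (snd z) (fst z)))\<^sup>2"
  by (simp add: case_prod_beta)
 also have "... \<le> (\<Sum>z\<in>J\<times>J. (cmod (x (fst z) (snd z)))\<^sup>2) * (\<Sum>z\<in>J\<times>J. (cmod (w (snd z) (fst z)))\<^sup>2)"
  by (rule sum_norm_cs)
 also have "... = hs J x * (\<Sum>i\<in>J. \<Sum>j\<in>J. (cmod (w j i))\<^sup>2)"
  by (simp add: hs_def sum.cartesian_product case_prod_beta)
 also have "(\<Sum>i\<in>J. \<Sum>j\<in>J. (cmod (w j i))\<^sup>2) = hs J w"
  unfolding hs_def by (rule sum.swap)
 finally show ?thesis .
qed

lemma hs_nonneg [simp]: "0 \<le> hs J x" by (auto simp: hs_def intro!: sum_nonneg)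

lemma hs_sb: assumes "hs J x \<le> c\<^sup>2" "0 \<le> c" shows "sb J (1/2) x c"
 unfolding sb_def
proof (intro allI impI)
 fix w assume "sball J (1 - 1/2) w"
 hence "hs J w \<le> 1" using sball_half_hs by simp
 hence "hs J x * hs J w \<le> hs J x" by (simp add: mult_left_le)
 hence "(cmod (tr J x w))\<^sup>2 \<le> c\<^sup>2" using tr_hs[of J x w] assms by linarith
 thus "cmod (tr J x w) \<le> c" using assms power2_le_imp_le by blast
qed

subsection \<open>Norm bounds by duality\<close>

lemma tr_add_left: "tr J (%i j. x i j + y i j) w = tr J x w + tr J y w"
 by (simp add: tr_def distrib_right sum.distrib)

lemma tr_diff_left: "tr J (%i j. x i j - y i j) w = tr J x w - tr J y w"
 by (simp add: tr_def left_diff_distrib sum_subtractf)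

lemma tr_mult_left: "tr J (%i j. c * x i j) w = c * tr J x w"
 by (simp add: tr_def sum_distrib_left mult_ac)

lemma sb_add: "sb J \<theta> x c ==> sb J \<theta> y d ==> sb J \<theta> (%i j. x i j + y i j) (c + d)"
 unfolding sb_def tr_add_left by (meson add_mono norm_triangle_le)

lemma sb_diff: "sb J \<theta> x c ==> sb J \<theta> y d ==> sb J \<theta> (%i j. x i j - y i j) (c + d)"
 unfolding sb_def tr_diff_left by (meson add_mono norm_triangle_le_diff)

lemma sb_mult: "sb J \<theta> x c ==> sb J \<theta> (%i j. d * x i j) (cmod d * c)"
 unfolding sb_def tr_mult_left by (auto simp: norm_mult intro: mult_left_mono)

lemma sball_0 [simp]: "sball J \<theta> (%i j. 0)"
 by (rule sballI[where K = "{}"]) (auto simp: bessel_def)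

lemma sb_nonneg: assumes "sb J \<theta> x c" shows "0 \<le> c"
proof -
 have "cmod (tr J x (%i j. 0)) \<le> c" using assms sball_0 unfolding sb_def by blast
 thus ?thesis by (simp add: tr_def)
qed

lemma sb_mono_const: "sb J \<theta> x c ==> c \<le> d ==> sb J \<theta> x d"
 by (auto simp: sb_def intro: order_trans)

lemma sb_adj: assumes "sb J \<theta> x c" shows "sb J \<theta> (adj x) c"
 unfolding sb_def
proof (intro allI impI)
 fix w assume "sball J (1 - \<theta>) w"
 hence "cmod (tr J x (adj w)) \<le> c" using assms sball_adj unfolding sb_def by blast
 thus "cmod (tr J (adj x) w) \<le> c"
  using tr_adj[of J x "adj w"] by (metis adj_adj complex_mod_cnj)
qed

lemma sb_mm_left: assumes "contr J a" "sb J \<theta> x c" shows "sb J \<theta> (mm J a x) c"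
 unfolding sb_def
proof (intro allI impI)
 fix w assume "sball J (1 - \<theta>) w"
 hence "sball J (1 - \<theta>) (mm J w a)" using assms sball_mm_right by blast
 hence "cmod (tr J x (mm J w a)) \<le> c" using assms unfolding sb_def by blast
 thus "cmod (tr J (mm J a x) w) \<le> c"
  by (metis tr_commute tr_mm_assoc)
qed

lemma sb_mm_right: assumes "contr J a" "sb J \<theta> x c" shows "sb J \<theta> (mm J x a) c"
 using sb_adj[OF sb_mm_left[OF contr_adj[OF assms(1)] sb_adj[OF assms(2)]]]
 by (simp add: adj_mm)

lemma sb_decreasing: assumes "sb J \<theta> x c" "\<theta>' \<le> \<theta>" shows "sb J \<theta>' x c"
 using assms sball_mono unfolding sb_def by (metis diff_left_mono)

lemma sb_0_formI:
 assumes "\<And>\<xi> \<eta>. sq J \<xi> \<le> 1 ==> sq J \<eta> \<le> 1 ==> cmod (ip J (mv J x \<xi>) \<eta>) \<le> c" "0 \<le> c"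
 shows "sb J 0 x c"
 unfolding sb_def
proof (intro allI impI)
 fix w assume "sball J (1 - 0) w"
 then obtain K \<rho> e f where "dyadic J 1 w K \<rho> e f" unfolding sball_def by auto
 note * = dyadicD[OF this]
 have "tr J x w = tr J x (%i j. \<Sum>k\<in>K. complex_of_real (\<rho> k powr 1) * e k i * cnj (f k j))"
  using *(6) by (intro tr_cong) auto
 hence "tr J x w = (\<Sum>k\<in>K. complex_of_real (\<rho> k powr 1) * ip J (mv J x (e k)) (f k))"
  by (simp add: tr_dyads)
 hence "cmod (tr J x w) \<le> (\<Sum>k\<in>K. \<rho> k * cmod (ip J (mv J x (e k)) (f k)))"
  using *(2) norm_sum[of "%k. complex_of_real (\<rho> k powr 1) * ip J (mv J x (e k)) (f k)" K]
  by (simp add: norm_mult less_imp_le)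
 also have "... \<le> (\<Sum>k\<in>K. \<rho> k * c)"
  using bessel_sq_le[OF *(4) *(1)] bessel_sq_le[OF *(5) *(1)] *(2)
  by (intro sum_mono mult_left_mono assms(1)) (auto simp: less_imp_le)
 also have "... = sum \<rho> K * c" by (simp add: sum_distrib_right)
 also have "... \<le> c"
  using *(3) assms(2) mult_right_mono[of "sum \<rho> K" 1 c] by simp
 finally show "cmod (tr J x w) \<le> c" .
qed

lemma sb_0I:
 assumes "\<And>\<xi>. sq J (mv J x \<xi>) \<le> c\<^sup>2 * sq J \<xi>" "0 \<le> c" shows "sb J 0 x c"
proof (rule sb_0_formI[OF _ assms(2)])
 fix \<xi> \<eta> assume 1: "sq J \<xi> \<le> 1" and 2: "sq J \<eta> \<le> 1"
 have "(cmod (ip J (mv J x \<xi>) \<eta>))\<^sup>2 \<le> sq J (mv J x \<xi>) * sq J \<eta>" by (rule ip_cs)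
 also have "... \<le> (c\<^sup>2 * 1) * 1"
  using 2 order_trans[OF assms(1)[of \<xi>] mult_left_mono[OF 1 zero_le_power2]] by (intro mult_mono) simp_all
 finally show "cmod (ip J (mv J x \<xi>) \<eta>) \<le> c" using assms(2) power2_le_imp_le by simp
qed

lemma contr_sb: "contr J x ==> sb J 0 x 1"
 by (rule sb_0I) (auto simp: contr_def)

text \<open>Testing against the rank one matrix \<open>\<xi> \<eta>\<^sup>*\<close>, which lies in every ball.\<close>

lemma sball_rank_one:
 assumes "sq J \<xi> \<le> 1" "sq J \<eta> \<le> 1" shows "sball J \<theta> (%i j. \<xi> i * cnj (\<eta> j))"
 by (rule sballI[where K = "{0}" and \<rho> = "%_. 1" and e = "%_. \<xi>" and f = "%_. \<eta>"])
  (simp_all add: assms bessel_singleton)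

lemma tr_rank_one: "tr J x (%i j. \<xi> i * cnj (\<eta> j)) = ip J (mv J x \<xi>) \<eta>"
 using tr_dyads[where J = J and x = x and K = "{0::nat}" and c = "%_. 1" and e = "%_. \<xi>" and f = "%_. \<eta>"] by simp

lemma sb_ip_le:
 assumes "sb J \<theta> x c" "sq J \<xi> \<le> 1" "sq J \<eta> \<le> 1"
 shows "cmod (ip J (mv J x \<xi>) \<eta>) \<le> c"
 using assms sball_rank_one[OF assms(2,3), of "1 - \<theta>"] unfolding sb_def
 by (metis tr_rank_one)

lemma sb_ip:
 assumes "sb J \<theta> x c"
 shows "cmod (ip J (mv J x \<xi>) \<eta>) \<le> c * sqrt (sq J \<xi>) * sqrt (sq J \<eta>)"
proof -
 have c: "0 \<le> c" using sb_nonneg[OF assms] .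
 have z: "ip J (mv J x \<xi>) \<eta> = 0" if "sq J \<xi> = 0 \<or> sq J \<eta> = 0"
 proof -
  have "(cmod (ip J (mv J x \<xi>) \<eta>))\<^sup>2 \<le> sq J (mv J x \<xi>) * sq J \<eta>" by (rule ip_cs)
  moreover have "(cmod (ip J \<xi> (mv J (adj x) \<eta>)))\<^sup>2 \<le> sq J \<xi> * sq J (mv J (adj x) \<eta>)" by (rule ip_cs)
  ultimately show ?thesis using that by (auto simp: ip_mv)
 qed
 show ?thesis
 proof (cases "sq J \<xi> = 0 \<or> sq J \<eta> = 0")
  case True thus ?thesis using z c by simp
 next
  case False
  define r where "r = sqrt (sq J \<xi>)" define t where "t = sqrt (sq J \<eta>)"
  have r: "r > 0" "r\<^sup>2 = sq J \<xi>" and t: "t > 0" "t\<^sup>2 = sq J \<eta>"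
   using False sq_nonneg[of J \<xi>] sq_nonneg[of J \<eta>] unfolding r_def t_def by (auto simp: less_le)
  have 1: "sq J (%i. complex_of_real (1/r) * \<xi> i) \<le> 1"
   unfolding sq_mult using r by (simp add: norm_divide power_divide)
  have 2: "sq J (%i. complex_of_real (1/t) * \<eta> i) \<le> 1"
   unfolding sq_mult using t by (simp add: norm_divide power_divide)
  have 3: "mv J x (%i. complex_of_real (1/r) * \<xi> i) = (%i. complex_of_real (1/r) * mv J x \<xi> i)"
   by (simp add: mv_def sum_distrib_left mult_ac)
  have "cmod (ip J (mv J x (%i. complex_of_real (1/r) * \<xi> i)) (%i. complex_of_real (1/t) * \<eta> i)) \<le> c"
   by (rule sb_ip_le[OF assms 1 2])
  hence "1/r * (1/t) * cmod (ip J (mv J x \<xi>) \<eta>) \<le> c"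
   unfolding 3 ip_mult_left ip_mult_right using r t by (simp add: norm_mult norm_divide)
  thus ?thesis unfolding r_def[symmetric] t_def[symmetric] using r t by (simp add: field_simps)
 qed
qed

lemma sb_contr: assumes "sb J \<theta> x 1" shows "contr J x"
 unfolding contr_def
proof
 fix \<xi>
 have "(sq J (mv J x \<xi>)) = cmod (ip J (mv J x \<xi>) (mv J x \<xi>))" by (simp add: ip_self)
 also have "... \<le> sqrt (sq J \<xi>) * sqrt (sq J (mv J x \<xi>))" using sb_ip[OF assms] by (metis mult_1)
 finally have "(sqrt (sq J (mv J x \<xi>)))\<^sup>2 \<le> sqrt (sq J \<xi>) * sqrt (sq J (mv J x \<xi>))" by simp
 hence "sqrt (sq J (mv J x \<xi>)) \<le> sqrt (sq J \<xi>)" by (rule square_le_mult_imp_le) auto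
 thus "sq J (mv J x \<xi>) \<le> sq J \<xi>" by simp
qed

section \<open>Square summable vectors and bounded matrices\<close>

definition rs :: "'i set => ('i => complex) => 'i => complex" where
 "rs J \<xi> = (%i. if i \<in> J then \<xi> i else 0)"

lemma sq_rs: "finite M ==> sq M (rs J \<xi>) = sq (M \<inter> J) \<xi>"
proof -
 assume M: "finite M"
 have "sq M (rs J \<xi>) = (\<Sum>i\<in>M. if i \<in> J then (cmod (\<xi> i))\<^sup>2 else 0)"
  unfolding sq_def rs_def by (intro sum.cong) auto
 thus ?thesis using M by (simp add: sum.inter_restrict sq_def)
qed

lemma sq_mono: "finite M ==> J \<subseteq> M ==> sq J \<xi> \<le> sq M \<xi>"
 unfolding sq_def by (intro sum_mono2) auto

lemma ell2_norm_nonneg [simp]: "0 \<le> ell2_norm \<xi>"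
 by (simp add: ell2_norm_def infsum_nonneg)

lemma ell2_norm_sq: "(ell2_norm \<xi>)\<^sup>2 = (\<Sum>\<^sub>\<infinity>i. (cmod (\<xi> i))\<^sup>2)"
 by (simp add: ell2_norm_def infsum_nonneg)

lemma sq_le_ell2: "\<xi> \<in> ell2 ==> finite J ==> sq J \<xi> \<le> (ell2_norm \<xi>)\<^sup>2"
 unfolding ell2_norm_sq sq_def ell2_def by (intro finite_sum_le_infsum) auto

lemma ell2_boundI:
 assumes "\<And>J. finite J ==> sq J \<xi> \<le> C\<^sup>2" "0 \<le> C"
 shows "\<xi> \<in> ell2" "ell2_norm \<xi> \<le> C"
proof -
 have s: "(%i. (cmod (\<xi> i))\<^sup>2) summable_on UNIV"
  by (rule nonneg_bounded_partial_sums_imp_summable_on[where C = "C\<^sup>2"])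
    (use assms in \<open>auto simp: sq_def intro!: eventually_finite_subsets_at_top_weakI\<close>)
 thus "\<xi> \<in> ell2" by (simp add: ell2_def)
 have "(ell2_norm \<xi>)\<^sup>2 \<le> C\<^sup>2"
  unfolding ell2_norm_sq using s by (rule infsum_le_finite_sums) (use assms in \<open>auto simp: sq_def\<close>)
 thus "ell2_norm \<xi> \<le> C" using assms(2) power2_le_imp_le by blast
qed

lemma ell2_prod_summable:
 assumes "\<xi> \<in> ell2" "\<eta> \<in> ell2" shows "(%i. \<xi> i * \<eta> i) summable_on UNIV"
proof -
 have "(%i. norm (\<xi> i * \<xi> i)) summable_on UNIV" "(%i. norm (\<eta> i * \<eta> i)) summable_on UNIV"
  using assms by (simp_all add: ell2_def norm_mult power2_eq_square)
 hence "(%i. norm (\<xi> i * \<eta> i)) summable_on UNIV" by (rule abs_summable_product)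
 thus ?thesis by (rule abs_summable_summable)
qed

lemma ell2_cnj: "\<xi> \<in> ell2 ==> (%i. cnj (\<xi> i)) \<in> ell2" by (simp add: ell2_def)

lemma ell2_inner_summable:
 "\<xi> \<in> ell2 ==> \<eta> \<in> ell2 ==> (%i. \<xi> i * cnj (\<eta> i)) summable_on UNIV"
 by (rule ell2_prod_summable[OF _ ell2_cnj])

lemma ell2_mult: "\<xi> \<in> ell2 ==> (%i. c * \<xi> i) \<in> ell2"
 unfolding ell2_def by (simp add: norm_mult power_mult_distrib summable_on_cmult_right)

lemma sq_add_le: "sq J (%i. \<xi> i + \<eta> i) \<le> 2 * sq J \<xi> + 2 * sq J \<eta>"
proof -
 have "(cmod (\<xi> i + \<eta> i))\<^sup>2 \<le> 2 * (cmod (\<xi> i))\<^sup>2 + 2 * (cmod (\<eta> i))\<^sup>2" for i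
 proof -
  have "(cmod (\<xi> i + \<eta> i))\<^sup>2 \<le> (cmod (\<xi> i) + cmod (\<eta> i))\<^sup>2"
   by (intro power_mono norm_triangle_ineq) auto
  also have "... \<le> 2 * (cmod (\<xi> i))\<^sup>2 + 2 * (cmod (\<eta> i))\<^sup>2"
   using sum_squares_bound[of "cmod (\<xi> i)" "cmod (\<eta> i)"] by (simp add: power2_sum)
  finally show ?thesis .
 qed
 thus ?thesis unfolding sq_def sum_distrib_left sum.distrib[symmetric] by (intro sum_mono)
qed

lemma ell2_add: assumes "\<xi> \<in> ell2" "\<eta> \<in> ell2" shows "(%i. \<xi> i + \<eta> i) \<in> ell2"
proof (rule ell2_boundI(1))
 fix J :: "'a set" assume J: "finite J"
 have "2 * sq J \<xi> + 2 * sq J \<eta> \<le> 2 * (ell2_norm \<xi>)\<^sup>2 + 2 * (ell2_norm \<eta>)\<^sup>2"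
  using sq_le_ell2[OF assms(1) J] sq_le_ell2[OF assms(2) J] by simp
 thus "sq J (%i. \<xi> i + \<eta> i) \<le> (sqrt (2 * (ell2_norm \<xi>)\<^sup>2 + 2 * (ell2_norm \<eta>)\<^sup>2))\<^sup>2"
  using sq_add_le[of J \<xi> \<eta>] by simp
qed simp

lemma ell2_diff: assumes "\<xi> \<in> ell2" "\<eta> \<in> ell2" shows "(%i. \<xi> i - \<eta> i) \<in> ell2"
 using ell2_add[OF assms(1) ell2_mult[OF assms(2), of "-1"]] by simp

lemma ell2_zero [simp]: "(%i. 0) \<in> ell2" by (simp add: ell2_def)

lemma ell2_sum: "(\<And>k. k \<in> K ==> e k \<in> ell2) ==> (%i. \<Sum>k\<in>K. c k * e k i) \<in> ell2"
 by (induction K rule: infinite_finite_induct) (auto intro!: ell2_add ell2_mult)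

lemma ell2_finite_support:
 assumes "finite J" "\<And>i. i \<notin> J ==> \<xi> i = 0" shows "\<xi> \<in> ell2" "(ell2_norm \<xi>)\<^sup>2 = sq J \<xi>"
proof -
 have 0: "((%i. (cmod (\<xi> i))\<^sup>2) has_sum sq J \<xi>) UNIV"
  unfolding sq_def by (rule has_sum_finite_neutralI[where B = J]) (use assms in auto)
 thus "\<xi> \<in> ell2" "(ell2_norm \<xi>)\<^sup>2 = sq J \<xi>"
  unfolding ell2_def ell2_norm_sq using has_sum_imp_summable infsumI by auto
qed

lemma rs_ell2: "finite J ==> rs J \<xi> \<in> ell2"
 by (rule ell2_finite_support) (auto simp: rs_def)

lemma ell2_inner_self: "\<xi> \<in> ell2 ==> ell2_inner \<xi> \<xi> = of_real ((ell2_norm \<xi>)\<^sup>2)"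
proof -
 assume "\<xi> \<in> ell2"
 hence "((%i. (cmod (\<xi> i))\<^sup>2) has_sum (ell2_norm \<xi>)\<^sup>2) UNIV"
  by (simp add: ell2_norm_sq ell2_def)
 hence "((%i. complex_of_real ((cmod (\<xi> i))\<^sup>2)) has_sum of_real ((ell2_norm \<xi>)\<^sup>2)) UNIV"
  by (rule has_sum_of_real)
 thus ?thesis unfolding ell2_inner_def complex_norm_square by (rule infsumI)
qed

lemma ell2_inner_tendsto:
 "\<xi> \<in> ell2 ==> \<eta> \<in> ell2 ==> ((%J. ip J \<xi> \<eta>) \<longlongrightarrow> ell2_inner \<xi> \<eta>) (finite_subsets_at_top UNIV)"
 unfolding ip_def ell2_inner_def by (rule infsum_tendsto) (rule ell2_inner_summable)

lemma ell2_inner_cs: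
 assumes "\<xi> \<in> ell2" "\<eta> \<in> ell2" shows "cmod (ell2_inner \<xi> \<eta>) \<le> ell2_norm \<xi> * ell2_norm \<eta>"
proof (rule tendsto_upperbound[OF tendsto_norm[OF ell2_inner_tendsto[OF assms]]])
 show "\<forall>\<^sub>F J in finite_subsets_at_top UNIV. cmod (ip J \<xi> \<eta>) \<le> ell2_norm \<xi> * ell2_norm \<eta>"
 proof (rule eventually_finite_subsets_at_top_weakI)
  fix J :: "'a set" assume J: "finite J"
  have "(cmod (ip J \<xi> \<eta>))\<^sup>2 \<le> sq J \<xi> * sq J \<eta>" by (rule ip_cs)
  also have "... \<le> (ell2_norm \<xi>)\<^sup>2 * (ell2_norm \<eta>)\<^sup>2"
   using assms J by (intro mult_mono sq_le_ell2) auto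
  finally have "(cmod (ip J \<xi> \<eta>))\<^sup>2 \<le> (ell2_norm \<xi> * ell2_norm \<eta>)\<^sup>2" by (simp add: power_mult_distrib)
  thus "cmod (ip J \<xi> \<eta>) \<le> ell2_norm \<xi> * ell2_norm \<eta>" by (rule power2_le_imp_le) auto
 qed
qed (rule finite_subsets_at_top_neq_bot)

lemma ell2_inner_add_left:
 "\<xi> \<in> ell2 ==> \<xi>' \<in> ell2 ==> \<eta> \<in> ell2 ==> ell2_inner (%i. \<xi> i + \<xi>' i) \<eta> = ell2_inner \<xi> \<eta> + ell2_inner \<xi>' \<eta>"
 unfolding ell2_inner_def distrib_right by (rule infsum_add) (auto intro: ell2_inner_summable)

lemma ell2_inner_mult_left: "ell2_inner (%i. c * \<xi> i) \<eta> = c * ell2_inner \<xi> \<eta>"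
 unfolding ell2_inner_def mult.assoc by (rule infsum_cmult_right')

lemma ell2_inner_commute: "ell2_inner \<xi> \<eta> = cnj (ell2_inner \<eta> \<xi>)"
 unfolding ell2_inner_def infsum_cnj[symmetric] by (simp add: mult.commute)

lemma ell2_inner_diff_left:
 assumes "\<xi> \<in> ell2" "\<xi>' \<in> ell2" "\<eta> \<in> ell2"
 shows "ell2_inner (%i. \<xi> i - \<xi>' i) \<eta> = ell2_inner \<xi> \<eta> - ell2_inner \<xi>' \<eta>"
 using ell2_inner_add_left[OF assms(1) ell2_mult[OF assms(2), of "-1"] assms(3)]
  ell2_inner_mult_left[of "-1" \<xi>' \<eta>] by simp

lemma ell2_inner_mult_right: "ell2_inner \<xi> (%i. c * \<eta> i) = cnj c * ell2_inner \<xi> \<eta>"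
 by (subst (1 2) ell2_inner_commute) (simp add: ell2_inner_mult_left)

lemma ell2_inner_diff_right:
 assumes "\<xi> \<in> ell2" "\<eta>' \<in> ell2" "\<eta> \<in> ell2"
 shows "ell2_inner \<xi> (%i. \<eta> i - \<eta>' i) = ell2_inner \<xi> \<eta> - ell2_inner \<xi> \<eta>'"
 by (subst (1 2 3) ell2_inner_commute) (simp add: ell2_inner_diff_left assms)

lemma ell2_inner_sum_right:
 assumes "\<xi> \<in> ell2" "\<And>k. k \<in> K ==> e k \<in> ell2"
 shows "ell2_inner \<xi> (%i. \<Sum>k\<in>K. c k * e k i) = (\<Sum>k\<in>K. cnj (c k) * ell2_inner \<xi> (e k))"
 using assms(2)
proof (induction K rule: infinite_finite_induct)
 case (insert k K)
 have "ell2_inner \<xi> (%i. \<Sum>k\<in>insert k K. c k * e k i)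
   = cnj (ell2_inner (%i. c k * e k i + (\<Sum>k\<in>K. c k * e k i)) \<xi>)"
  using insert.hyps by (subst ell2_inner_commute) simp
 also have "... = cnj (ell2_inner (%i. c k * e k i) \<xi>) + cnj (ell2_inner (%i. (\<Sum>k\<in>K. c k * e k i)) \<xi>)"
  using insert.prems assms(1) by (subst ell2_inner_add_left) (auto intro!: ell2_mult ell2_sum)
 also have "... = ell2_inner \<xi> (%i. c k * e k i) + ell2_inner \<xi> (%i. (\<Sum>k\<in>K. c k * e k i))"
  by (simp flip: ell2_inner_commute)
 finally show ?case using insert by (simp add: ell2_inner_mult_right)
qed (simp_all add: ell2_inner_def)

lemma ell2_inner_rs_right:
 assumes "finite J" shows "ell2_inner \<xi> (rs J \<eta>) = ip J \<xi> \<eta>"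
 unfolding ell2_inner_def ip_def
 by (rule infsumI, rule has_sum_finite_neutralI[where B = J]) (use assms in \<open>auto simp: rs_def\<close>)

lemma ell2_inner_rs_left:
 assumes "finite J" shows "ell2_inner (rs J \<xi>) \<eta> = ip J \<xi> \<eta>"
 by (subst ell2_inner_commute) (simp add: ell2_inner_rs_right[OF assms] flip: ip_commute)

lemma ell2_norm_zero_iff:
 assumes "\<xi> \<in> ell2" "ell2_norm \<xi> \<le> 0" shows "\<xi> i = 0"
 using sq_le_ell2[OF assms(1), of "{i}"] assms(2) ell2_norm_nonneg[of \<xi>] by (simp add: sq_def)

lemma ell2_norm_cutoff:
 assumes "\<xi> \<in> ell2"
 shows "((%J. ell2_norm (%i. \<xi> i - rs J \<xi> i)) \<longlongrightarrow> 0) (finite_subsets_at_top UNIV)"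
proof -
 have eq: "(ell2_norm \<xi>)\<^sup>2 - sq J \<xi> = (ell2_norm (%i. \<xi> i - rs J \<xi> i))\<^sup>2" if J: "finite J" for J
 proof -
  have r: "((%i. (cmod (rs J \<xi> i))\<^sup>2) has_sum sq J \<xi>) UNIV"
   unfolding sq_def by (rule has_sum_finite_neutralI[where B = J]) (use J in \<open>auto simp: rs_def\<close>)
  have "((%i. (cmod (\<xi> i))\<^sup>2) has_sum (ell2_norm \<xi>)\<^sup>2) UNIV"
   using assms by (simp add: ell2_norm_sq ell2_def)
  from has_sum_add[OF this has_sum_uminusI[OF r]]
  have "((%i. (cmod (\<xi> i))\<^sup>2 - (cmod (rs J \<xi> i))\<^sup>2) has_sum ((ell2_norm \<xi>)\<^sup>2 - sq J \<xi>)) UNIV" by simp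
  also have "(%i. (cmod (\<xi> i))\<^sup>2 - (cmod (rs J \<xi> i))\<^sup>2) = (%i. (cmod (\<xi> i - rs J \<xi> i))\<^sup>2)"
   by (auto simp: rs_def)
  finally show ?thesis unfolding ell2_norm_sq[of "%i. \<xi> i - rs J \<xi> i"] by (simp add: infsumI)
 qed
 have "((%J. sq J \<xi>) \<longlongrightarrow> (ell2_norm \<xi>)\<^sup>2) (finite_subsets_at_top UNIV)"
  unfolding sq_def ell2_norm_sq using assms by (intro infsum_tendsto) (simp add: ell2_def)
 hence "((%J. sqrt ((ell2_norm \<xi>)\<^sup>2 - sq J \<xi>)) \<longlongrightarrow> sqrt ((ell2_norm \<xi>)\<^sup>2 - (ell2_norm \<xi>)\<^sup>2)) (finite_subsets_at_top UNIV)"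
  by (intro tendsto_intros)
 moreover have "\<forall>\<^sub>F J in finite_subsets_at_top UNIV. sqrt ((ell2_norm \<xi>)\<^sup>2 - sq J \<xi>) = ell2_norm (%i. \<xi> i - rs J \<xi> i)"
  by (rule eventually_finite_subsets_at_top_weakI) (simp add: eq)
 ultimately show ?thesis using tendsto_cong by fastforce
qed

subsection \<open>Schatten norm bounds on infinite matrices\<close>

text \<open>The norm of \<open>S\<^sup>1\<^sup>/\<^sup>\<theta>\<close> on infinite matrices, tested on finite corners.\<close>

definition sbf :: "real => 'i cmat => real => bool" where
 "sbf \<theta> x c \<longleftrightarrow> (\<forall>J. finite J \<longrightarrow> sb J \<theta> x c)"

definition trunc :: "'i set => 'i cmat => 'i cmat" where
 "trunc J x = (%i j. if i \<in> J \<and> j \<in> J then x i j else 0)"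

text \<open>Norm limits of finite matrices: the elements of \<open>S\<^sup>1\<^sup>/\<^sup>\<theta>\<close> for \<open>\<theta> > 0\<close> and the compact operators for \<open>\<theta> = 0\<close>.\<close>

definition sapp :: "real => 'i cmat => bool" where
 "sapp \<theta> x \<longleftrightarrow> (\<forall>\<epsilon>>0. \<exists>J. finite J \<and> sbf \<theta> (%i j. x i j - trunc J x i j) \<epsilon>)"

lemma sbf_nonneg: "sbf \<theta> x c ==> 0 \<le> c" unfolding sbf_def using sb_nonneg[of "{}" \<theta> x c] by simp

lemma sbf_add: "sbf \<theta> x c ==> sbf \<theta> y d ==> sbf \<theta> (%i j. x i j + y i j) (c + d)"
 unfolding sbf_def by (auto intro: sb_add)

lemma sbf_diff: "sbf \<theta> x c ==> sbf \<theta> y d ==> sbf \<theta> (%i j. x i j - y i j) (c + d)"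
 unfolding sbf_def by (auto intro: sb_diff)

lemma sbf_mult: "sbf \<theta> x c ==> sbf \<theta> (%i j. d * x i j) (cmod d * c)"
 unfolding sbf_def by (auto intro: sb_mult)

lemma sbf_mono: "sbf \<theta> x c ==> c \<le> d ==> sbf \<theta> x d"
 unfolding sbf_def by (auto intro: sb_mono_const)

lemma sbf_adj: "sbf \<theta> x c ==> sbf \<theta> (adj x) c"
 unfolding sbf_def by (auto intro: sb_adj)

lemma sbf_decreasing: "sbf \<theta> x c ==> \<theta>' \<le> \<theta> ==> sbf \<theta>' x c"
 unfolding sbf_def by (auto intro: sb_decreasing)

lemma bessel_rs:
 assumes "finite M" "bessel M K e" shows "bessel M K (%k. rs J (e k))"
 unfolding bessel_iff_synthesis
proof
 fix c
 have "(%i. \<Sum>k\<in>K. c k * rs J (e k) i) = rs J (%i. \<Sum>k\<in>K. c k * e k i)"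
  by (auto simp: rs_def fun_eq_iff)
 hence "sq M (%i. \<Sum>k\<in>K. c k * rs J (e k) i) = sq (M \<inter> J) (%i. \<Sum>k\<in>K. c k * e k i)"
  using assms by (simp add: sq_rs)
 also have "... \<le> sq M (%i. \<Sum>k\<in>K. c k * e k i)" using assms by (intro sq_mono) auto
 also have "... \<le> (\<Sum>k\<in>K. (cmod (c k))\<^sup>2)" using assms by (simp add: bessel_synthesis)
 finally show "sq M (%i. \<Sum>k\<in>K. c k * rs J (e k) i) \<le> (\<Sum>k\<in>K. (cmod (c k))\<^sup>2)" .
qed

lemma sball_trunc:
 assumes "finite M" "sball M \<theta> x" shows "sball M \<theta> (trunc J x)"
proof -
 obtain K \<rho> e f where "dyadic M \<theta> x K \<rho> e f"
  using assms(2) unfolding sball_def by blast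
 note * = dyadicD[OF this]
 show ?thesis
  by (rule sballI[OF *(1-3) bessel_rs[where J = J, OF assms(1) *(4)] bessel_rs[where J = J, OF assms(1) *(5)]])
    (auto simp: trunc_def rs_def *(6))
qed

lemma sbf_trunc: assumes "sbf \<theta> x c" shows "sbf \<theta> (trunc J x) c"
 unfolding sbf_def sb_def
proof (intro allI impI)
 fix M :: "'a set" and w assume M: "finite M" "sball M (1 - \<theta>) w"
 have "tr M (trunc J x) w = tr M x (trunc J w)"
  unfolding tr_def trunc_def by (intro sum.cong refl) auto
 thus "cmod (tr M (trunc J x) w) \<le> c"
  using assms M sball_trunc[OF M] unfolding sbf_def sb_def by metis
qed

lemma contr_entry:
 assumes "contr J w" "finite J" "i \<in> J" "j \<in> J" shows "cmod (w i j) \<le> 1"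
proof -
 define \<delta> where "\<delta> = (%k. if k = j then 1 else (0::complex))"
 have 1: "mv J w \<delta> i = w i j"
 proof -
  have "(\<Sum>k\<in>J. w i k * \<delta> k) = (\<Sum>k\<in>J. if k = j then w i j else 0)"
   unfolding \<delta>_def by (intro sum.cong) auto
  thus ?thesis using assms by (simp add: mv_def)
 qed
 have "sq J \<delta> = (\<Sum>k\<in>J. if k = j then 1 else 0)"
  unfolding sq_def \<delta>_def by (intro sum.cong) auto
 hence 2: "sq J \<delta> = 1" using assms by simp
 have "(cmod (mv J w \<delta> i))\<^sup>2 \<le> sq J (mv J w \<delta>)"
  unfolding sq_def using assms by (intro member_le_sum) auto
 also have "... \<le> 1" using assms(1) 2 unfolding contr_def by metis
 finally show ?thesis using 1 by (simp add: power_le_one_iff)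
qed

lemma sbf_trunc_finite:
 assumes "finite J" "\<theta> \<le> 1" shows "sbf \<theta> (trunc J x) (\<Sum>i\<in>J. \<Sum>j\<in>J. cmod (x i j))"
 unfolding sbf_def sb_def
proof (intro allI impI)
 fix M :: "'a set" and w assume M: "finite M" "sball M (1 - \<theta>) w"
 have c: "contr M w" using M assms by (intro sball_contr) auto
 have "cmod (tr M (trunc J x) w) \<le> (\<Sum>i\<in>M. \<Sum>j\<in>M. cmod (trunc J x i j * w j i))"
  unfolding tr_def by (rule order_trans[OF norm_sum sum_mono]) (rule norm_sum)
 also have "... \<le> (\<Sum>i\<in>M. \<Sum>j\<in>M. cmod (trunc J x i j))"
  using contr_entry[OF c M(1)] by (intro sum_mono) (simp add: norm_mult mult_left_le)
 also have "... = (\<Sum>(i,j)\<in>M\<times>M. cmod (trunc J x i j))" by (simp add: sum.cartesian_product)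
 also have "... = (\<Sum>(i,j)\<in>(M\<inter>J)\<times>(M\<inter>J). cmod (x i j))"
  using M by (intro sum.mono_neutral_cong_right) (auto simp: trunc_def split: if_splits)
 also have "... \<le> (\<Sum>(i,j)\<in>J\<times>J. cmod (x i j))"
  using assms by (intro sum_mono2) auto
 finally show "cmod (tr M (trunc J x) w) \<le> (\<Sum>i\<in>J. \<Sum>j\<in>J. cmod (x i j))"
  by (simp add: sum.cartesian_product)
qed

lemma sapp_sbf: assumes "sapp \<theta> x" "\<theta> \<le> 1" obtains C where "sbf \<theta> x C"
proof -
 obtain J where J: "finite J" "sbf \<theta> (%i j. x i j - trunc J x i j) 1"
  using assms(1) unfolding sapp_def by (meson zero_less_one)
 from sbf_add[OF J(2) sbf_trunc_finite[OF J(1) assms(2), of x]] show ?thesis by (intro that) auto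
qed

lemma sapp_superset:
 assumes "sbf \<theta> (%i j. x i j - trunc J x i j) \<epsilon>" "J \<subseteq> J'"
 shows "sbf \<theta> (%i j. x i j - trunc J' x i j) (2 * \<epsilon>)"
proof -
 let ?y = "%i j. x i j - trunc J x i j"
 have "(%i j. ?y i j - trunc J' ?y i j) = (%i j. x i j - trunc J' x i j)"
  using assms(2) by (auto simp: trunc_def fun_eq_iff)
 thus ?thesis using sbf_diff[OF assms(1) sbf_trunc[OF assms(1), of J']] by simp
qed

lemma sapp_add: assumes "sapp \<theta> x" "sapp \<theta> y" shows "sapp \<theta> (%i j. x i j + y i j)"
 unfolding sapp_def
proof (intro allI impI)
 fix \<epsilon> :: real assume e: "\<epsilon> > 0"
 obtain J1 where J1: "finite J1" "sbf \<theta> (%i j. x i j - trunc J1 x i j) (\<epsilon>/4)"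
  using assms(1) e unfolding sapp_def by (meson divide_pos_pos zero_less_numeral)
 obtain J2 where J2: "finite J2" "sbf \<theta> (%i j. y i j - trunc J2 y i j) (\<epsilon>/4)"
  using assms(2) e unfolding sapp_def by (meson divide_pos_pos zero_less_numeral)
 have "sbf \<theta> (%i j. (x i j - trunc (J1 \<union> J2) x i j) + (y i j - trunc (J1 \<union> J2) y i j)) (2*(\<epsilon>/4) + 2*(\<epsilon>/4))"
  by (intro sbf_add sapp_superset[OF J1(2)] sapp_superset[OF J2(2)]) auto
 also have "(%i j. (x i j - trunc (J1 \<union> J2) x i j) + (y i j - trunc (J1 \<union> J2) y i j))
   = (%i j. (x i j + y i j) - trunc (J1 \<union> J2) (%i j. x i j + y i j) i j)"
  by (auto simp: trunc_def fun_eq_iff)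
 finally show "\<exists>J. finite J \<and> sbf \<theta> (%i j. x i j + y i j - trunc J (%i j. x i j + y i j) i j) \<epsilon>"
  using J1(1) J2(1) by (intro exI[of _ "J1 \<union> J2"]) auto
qed

lemma sapp_mult: assumes "sapp \<theta> x" shows "sapp \<theta> (%i j. c * x i j)"
 unfolding sapp_def
proof (intro allI impI)
 fix \<epsilon> :: real assume e: "\<epsilon> > 0"
 hence "\<epsilon> / (cmod c + 1) > 0" by (simp add: add_nonneg_pos)
 then obtain J where J: "finite J" "sbf \<theta> (%i j. x i j - trunc J x i j) (\<epsilon> / (cmod c + 1))"
  using assms unfolding sapp_def by meson
 have "cmod c * (\<epsilon> / (cmod c + 1)) \<le> \<epsilon>"
  using mult_left_mono[of "cmod c / (cmod c + 1)" 1 \<epsilon>] e by (simp add: divide_le_eq_1 add_nonneg_pos mult.commute)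
 from sbf_mono[OF sbf_mult[OF J(2)] this]
 have "sbf \<theta> (%i j. c * (x i j - trunc J x i j)) \<epsilon>" .
 also have "(%i j. c * (x i j - trunc J x i j)) = (%i j. c * x i j - trunc J (%i j. c * x i j) i j)"
  by (auto simp: trunc_def fun_eq_iff algebra_simps)
 finally show "\<exists>J. finite J \<and> sbf \<theta> (%i j. c * x i j - trunc J (%i j. c * x i j) i j) \<epsilon>"
  using J(1) by blast
qed

lemma sapp_diff: "sapp \<theta> x ==> sapp \<theta> y ==> sapp \<theta> (%i j. x i j - y i j)"
 using sapp_add[OF _ sapp_mult[of \<theta> y "-1"], of x] by simp

lemma sapp_limit:
 assumes "\<And>\<epsilon>. \<epsilon> > 0 ==> \<exists>y. sapp \<theta> y \<and> sbf \<theta> (%i j. x i j - y i j) \<epsilon>"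
 shows "sapp \<theta> x"
 unfolding sapp_def
proof (intro allI impI)
 fix \<epsilon> :: real assume e: "\<epsilon> > 0"
 obtain y where y: "sapp \<theta> y" "sbf \<theta> (%i j. x i j - y i j) (\<epsilon>/3)" using assms[of "\<epsilon>/3"] e by auto
 obtain J where J: "finite J" "sbf \<theta> (%i j. y i j - trunc J y i j) (\<epsilon>/3)"
  using y(1) e unfolding sapp_def by (meson divide_pos_pos zero_less_numeral)
 have "sbf \<theta> (%i j. ((x i j - y i j) - trunc J (%i j. x i j - y i j) i j) + (y i j - trunc J y i j)) ((\<epsilon>/3 + \<epsilon>/3) + \<epsilon>/3)"
  by (intro sbf_add sbf_diff sbf_trunc y J)
 also have "(%i j. ((x i j - y i j) - trunc J (%i j. x i j - y i j) i j) + (y i j - trunc J y i j))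
   = (%i j. x i j - trunc J x i j)"
  by (auto simp: trunc_def fun_eq_iff)
 finally show "\<exists>J. finite J \<and> sbf \<theta> (%i j. x i j - trunc J x i j) \<epsilon>"
  using J(1) by auto
qed

lemma sapp_finite: assumes "finite J" "\<And>i j. x i j \<noteq> 0 ==> i \<in> J \<and> j \<in> J" shows "sapp \<theta> x"
proof -
 have z: "sbf \<theta> (%i j. 0) 0" by (simp add: sbf_def sb_def tr_def)
 have eq: "(%i j. x i j - trunc J x i j) = (%i j. 0)"
  using assms(2) by (auto simp: trunc_def fun_eq_iff)
 have "sbf \<theta> (%i j. x i j - trunc J x i j) \<epsilon>" if "\<epsilon> > 0" for \<epsilon>
  unfolding eq by (rule sbf_mono[OF z]) (use that in simp)
 thus ?thesis using assms(1) unfolding sapp_def by blast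
qed

lemma sapp_trunc: "finite J ==> sapp \<theta> (trunc J x)"
 by (rule sapp_finite[of J]) (auto simp: trunc_def split: if_splits)

lemma sbf_rank_one:
 assumes "u \<in> ell2" "v \<in> ell2" "0 \<le> \<theta>" "\<theta> \<le> 1"
 shows "sbf \<theta> (%i j. u i * cnj (v j)) (ell2_norm u * ell2_norm v)"
 unfolding sbf_def sb_def
proof (intro allI impI)
 fix J :: "'a set" and w assume J: "finite J" "sball J (1 - \<theta>) w"
 have "contr J w" using sball_contr[OF J(2)] assms(4) by simp
 have "(cmod (tr J (%i j. u i * cnj (v j)) w))\<^sup>2 = (cmod (ip J (mv J w u) v))\<^sup>2"
  by (subst tr_commute) (simp add: tr_rank_one)
 also have "... \<le> sq J u * sq J v" by (rule contr_ip) fact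
 also have "... \<le> (ell2_norm u)\<^sup>2 * (ell2_norm v)\<^sup>2"
  using assms J by (intro mult_mono sq_le_ell2) auto
 finally have "(cmod (tr J (%i j. u i * cnj (v j)) w))\<^sup>2 \<le> (ell2_norm u * ell2_norm v)\<^sup>2" by (simp add: power_mult_distrib)
 thus "cmod (tr J (%i j. u i * cnj (v j)) w) \<le> ell2_norm u * ell2_norm v" by (rule power2_le_imp_le) auto
qed

lemma ell2_norm_rs_le: "\<xi> \<in> ell2 ==> finite J ==> ell2_norm (rs J \<xi>) \<le> ell2_norm \<xi>"
proof -
 assume a: "\<xi> \<in> ell2" "finite J"
 have "(ell2_norm (rs J \<xi>))\<^sup>2 = sq J (rs J \<xi>)"
  by (rule ell2_finite_support(2)) (auto simp: rs_def a)
 also have "... = sq J \<xi>" using a by (simp add: sq_rs)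
 also have "... \<le> (ell2_norm \<xi>)\<^sup>2" using a by (rule sq_le_ell2)
 finally show ?thesis by (rule power2_le_imp_le) auto
qed

lemma sapp_rank_one:
 assumes "u \<in> ell2" "v \<in> ell2" "0 \<le> \<theta>" "\<theta> \<le> 1"
 shows "sapp \<theta> (%i j. u i * cnj (v j))"
 unfolding sapp_def
proof (intro allI impI)
 fix \<epsilon> :: real assume e: "\<epsilon> > 0"
 let ?d = "%J u i. u i - rs J u i"
 have "((%J. ell2_norm (?d J u) * ell2_norm v + ell2_norm u * ell2_norm (?d J v)) \<longlongrightarrow>
   0 * ell2_norm v + ell2_norm u * 0) (finite_subsets_at_top UNIV)"
  by (intro tendsto_intros ell2_norm_cutoff assms)
 hence "\<forall>\<^sub>F J in finite_subsets_at_top UNIV. ell2_norm (?d J u) * ell2_norm v + ell2_norm u * ell2_norm (?d J v) < \<epsilon>"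
  using e by (intro order_tendstoD) auto
 then obtain J where J: "finite J" "ell2_norm (?d J u) * ell2_norm v + ell2_norm u * ell2_norm (?d J v) < \<epsilon>"
  unfolding eventually_finite_subsets_at_top by blast
 have 1: "sbf \<theta> (%i j. ?d J u i * cnj (v j) + rs J u i * cnj (?d J v j))
   (ell2_norm (?d J u) * ell2_norm v + ell2_norm (rs J u) * ell2_norm (?d J v))"
  using J(1) assms by (intro sbf_add sbf_rank_one ell2_diff rs_ell2) auto
 have 2: "(%i j. ?d J u i * cnj (v j) + rs J u i * cnj (?d J v j))
   = (%i j. u i * cnj (v j) - trunc J (%i j. u i * cnj (v j)) i j)"
  by (auto simp: rs_def trunc_def fun_eq_iff algebra_simps)
 have 3: "ell2_norm (?d J u) * ell2_norm v + ell2_norm (rs J u) * ell2_norm (?d J v) \<le> \<epsilon>"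
  using J(2) mult_right_mono[OF ell2_norm_rs_le[OF assms(1) J(1)] ell2_norm_nonneg[of "?d J v"]] by linarith
 show "\<exists>J. finite J \<and> sbf \<theta> (%i j. u i * cnj (v j) - trunc J (%i j. u i * cnj (v j)) i j) \<epsilon>"
  using J(1) sbf_mono[OF 1 3] unfolding 2 by blast
qed

subsection \<open>The operator of a bounded matrix\<close>

lemma sb_0_mv:
 assumes "sb J \<theta> x c" shows "sq J (mv J x \<xi>) \<le> c\<^sup>2 * sq J \<xi>"
proof -
 have c: "0 \<le> c" by (rule sb_nonneg[OF assms])
 have "(sq J (mv J x \<xi>)) = cmod (ip J (mv J x \<xi>) (mv J x \<xi>))" by (simp add: ip_self)
 also have "... \<le> c * sqrt (sq J \<xi>) * sqrt (sq J (mv J x \<xi>))" using sb_ip[OF assms] by metis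
 finally have "(sqrt (sq J (mv J x \<xi>)))\<^sup>2 \<le> (c * sqrt (sq J \<xi>)) * sqrt (sq J (mv J x \<xi>))" by simp
 hence "sqrt (sq J (mv J x \<xi>)) \<le> c * sqrt (sq J \<xi>)" by (rule square_le_mult_imp_le) (use c in auto)
 hence "(sqrt (sq J (mv J x \<xi>)))\<^sup>2 \<le> (c * sqrt (sq J \<xi>))\<^sup>2" by (intro power_mono) auto
 thus ?thesis by (simp add: power_mult_distrib)
qed

lemma sb_entry:
 assumes "sb J \<theta> x c" "finite J" "i \<in> J" "j \<in> J" shows "cmod (x i j) \<le> c"
proof -
 have c: "0 \<le> c" by (rule sb_nonneg[OF assms(1)])
 have "sq J (mv J x (rs {j} (%_. 1))) \<le> c\<^sup>2 * sq J (rs {j} (%_. 1))" by (rule sb_0_mv[OF assms(1)])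
 moreover have "mv J x (rs {j} (%_. 1)) = (%i. x i j)"
  using assms unfolding mv_def rs_def by (auto simp: fun_eq_iff if_distrib cong: if_cong)
 moreover have "sq J (rs {j} (%_. 1)) = 1" using assms by (simp add: sq_rs) (simp add: sq_def)
 moreover have "(cmod (x i j))\<^sup>2 \<le> sq J (%i. x i j)"
  unfolding sq_def using assms by (intro member_le_sum) auto
 ultimately have "(cmod (x i j))\<^sup>2 \<le> c\<^sup>2" by simp
 thus ?thesis using c power2_le_imp_le by blast
qed

lemma sbf_entry: "sbf \<theta> x c ==> cmod (x i j) \<le> c"
 unfolding sbf_def using sb_entry[of "{i,j}" \<theta> x c i j] by simp

lemma sbf_partial:
 assumes "sbf \<theta> x c" "finite J" "finite L" shows "sq J (mv L x \<xi>) \<le> c\<^sup>2 * sq L \<xi>"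
proof -
 have M: "finite (J \<union> L)" using assms by simp
 have eq: "mv (J \<union> L) x (rs L \<xi>) = mv L x \<xi>"
 proof
  fix i
  have "mv (J \<union> L) x (rs L \<xi>) i = (\<Sum>j\<in>J \<union> L. if j \<in> L then x i j * \<xi> j else 0)"
   unfolding mv_def rs_def by (intro sum.cong) auto
  also have "... = mv L x \<xi> i" using M by (subst sum.inter_restrict[symmetric]) (auto simp: mv_def Int_absorb1)
  finally show "mv (J \<union> L) x (rs L \<xi>) i = mv L x \<xi> i" .
 qed
 have "sq J (mv L x \<xi>) \<le> sq (J \<union> L) (mv (J \<union> L) x (rs L \<xi>))"
  unfolding eq using M by (intro sq_mono) auto
 also have "... \<le> c\<^sup>2 * sq (J \<union> L) (rs L \<xi>)"
  using assms(1) M unfolding sbf_def by (intro sb_0_mv) blast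
 also have "... = c\<^sup>2 * sq L \<xi>" using M by (simp add: sq_rs Int_absorb1)
 finally show ?thesis .
qed

lemma sbf_col:
 assumes "sbf \<theta> x c" shows "(%i. x i j) \<in> ell2"
proof (rule ell2_boundI(1))
 show "0 \<le> c" by (rule sbf_nonneg[OF assms])
 fix J :: "'a set" assume "finite J"
 from sbf_partial[OF assms this, of "{j}" "%_. 1"]
 show "sq J (%i. x i j) \<le> c\<^sup>2" by (simp add: mv_def) (simp add: sq_def)
qed

lemma sbf_row: assumes "sbf \<theta> x c" shows "(%j. x i j) \<in> ell2"
 using ell2_cnj[OF sbf_col[OF sbf_adj[OF assms], of i]] by (simp add: adj_def)

lemma mat_vec_summable: "sbf \<theta> x c ==> \<xi> \<in> ell2 ==> (%j. x i j * \<xi> j) summable_on UNIV"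
 by (rule ell2_prod_summable[OF sbf_row])

lemma mat_vec_bounded:
 assumes "sbf \<theta> x c" "\<xi> \<in> ell2"
 shows "mat_vec x \<xi> \<in> ell2" "ell2_norm (mat_vec x \<xi>) \<le> c * ell2_norm \<xi>"
proof -
 have c: "0 \<le> c" by (rule sbf_nonneg[OF assms(1)])
 have "sq J (mat_vec x \<xi>) \<le> (c * ell2_norm \<xi>)\<^sup>2" if J: "finite J" for J
 proof (rule tendsto_upperbound)
  show "((%L. sq J (mv L x \<xi>)) \<longlongrightarrow> sq J (mat_vec x \<xi>)) (finite_subsets_at_top UNIV)"
   unfolding sq_def mv_def mat_vec_def
   by (intro tendsto_intros infsum_tendsto mat_vec_summable[OF assms])
  show "\<forall>\<^sub>F L in finite_subsets_at_top UNIV. sq J (mv L x \<xi>) \<le> (c * ell2_norm \<xi>)\<^sup>2"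
  proof (rule eventually_finite_subsets_at_top_weakI)
   fix L :: "'a set" assume L: "finite L"
   have "sq J (mv L x \<xi>) \<le> c\<^sup>2 * sq L \<xi>" by (rule sbf_partial[OF assms(1) J L])
   also have "... \<le> c\<^sup>2 * (ell2_norm \<xi>)\<^sup>2" using assms L by (intro mult_left_mono sq_le_ell2) auto
   finally show "sq J (mv L x \<xi>) \<le> (c * ell2_norm \<xi>)\<^sup>2" by (simp add: power_mult_distrib)
  qed
 qed (rule finite_subsets_at_top_neq_bot)
 from ell2_boundI[OF this] c
 show "mat_vec x \<xi> \<in> ell2" "ell2_norm (mat_vec x \<xi>) \<le> c * ell2_norm \<xi>" by auto
qed

lemma mat_vec_add:
 assumes "sbf \<theta> x c" "\<xi> \<in> ell2" "\<eta> \<in> ell2"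
 shows "mat_vec x (%i. \<xi> i + \<eta> i) = (%i. mat_vec x \<xi> i + mat_vec x \<eta> i)"
 unfolding mat_vec_def distrib_left
 by (intro ext infsum_add mat_vec_summable[OF assms(1)] assms)

lemma mat_vec_mult: "mat_vec x (%i. c * \<xi> i) = (%i. c * mat_vec x \<xi> i)"
 unfolding mat_vec_def by (simp add: mult.left_commute infsum_cmult_right')

lemma mat_vec_diff:
 assumes "sbf \<theta> x c" "\<xi> \<in> ell2" "\<eta> \<in> ell2"
 shows "mat_vec x (%i. \<xi> i - \<eta> i) = (%i. mat_vec x \<xi> i - mat_vec x \<eta> i)"
 using mat_vec_add[OF assms(1,2) ell2_mult[OF assms(3), of "-1"]] mat_vec_mult[of x "-1" \<eta>] by simp

lemma mat_vec_diff_mat: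
 assumes "sbf \<theta> x c" "sbf \<theta>' y d" "\<xi> \<in> ell2"
 shows "mat_vec (%i j. x i j - y i j) \<xi> = (%i. mat_vec x \<xi> i - mat_vec y \<xi> i)"
proof
 fix i
 have "(\<Sum>\<^sub>\<infinity>j. x i j * \<xi> j + (-1) * (y i j * \<xi> j)) = (\<Sum>\<^sub>\<infinity>j. x i j * \<xi> j) + (\<Sum>\<^sub>\<infinity>j. (-1) * (y i j * \<xi> j))"
  by (intro infsum_add summable_on_cmult_right mat_vec_summable[OF assms(1)] mat_vec_summable[OF assms(2)] assms)
 thus "mat_vec (%i j. x i j - y i j) \<xi> i = mat_vec x \<xi> i - mat_vec y \<xi> i"
  unfolding mat_vec_def infsum_cmult_right' by (simp add: left_diff_distrib)
qed

lemma mat_vec_rank_one: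
 "mat_vec (%i j. u i * cnj (v j)) \<xi> = (%i. ell2_inner \<xi> v * u i)"
proof
 fix i
 have "mat_vec (%i j. u i * cnj (v j)) \<xi> i = (\<Sum>\<^sub>\<infinity>j. u i * (\<xi> j * cnj (v j)))"
  unfolding mat_vec_def by (simp add: mult_ac)
 also have "... = u i * ell2_inner \<xi> v" unfolding ell2_inner_def by (rule infsum_cmult_right')
 finally show "mat_vec (%i j. u i * cnj (v j)) \<xi> i = ell2_inner \<xi> v * u i" by simp
qed

lemma mat_vec_rs: "finite J ==> mat_vec x (rs J \<xi>) = mv J x \<xi>"
 unfolding mat_vec_def mv_def
 by (intro ext infsumI, rule has_sum_finite_neutralI[where B = J]) (auto simp: rs_def)

lemma mat_vec_form:
 assumes "sbf \<theta> x c" "\<xi> \<in> ell2" "\<eta> \<in> ell2"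
 shows "cmod (ell2_inner (mat_vec x \<xi>) \<eta>) \<le> c * ell2_norm \<xi> * ell2_norm \<eta>"
proof -
 have "cmod (ell2_inner (mat_vec x \<xi>) \<eta>) \<le> ell2_norm (mat_vec x \<xi>) * ell2_norm \<eta>"
  by (intro ell2_inner_cs mat_vec_bounded[OF assms(1)] assms)
 also have "... \<le> c * ell2_norm \<xi> * ell2_norm \<eta>"
  by (intro mult_right_mono mat_vec_bounded[OF assms(1)] assms) auto
 finally show ?thesis .
qed

lemma mat_vec_form_tendsto:
 assumes x: "sbf \<theta> x c" and xi: "\<xi> \<in> ell2" and eta: "\<eta> \<in> ell2"
 shows "((%J. ip J (mv J x \<xi>) \<eta>) \<longlongrightarrow> ell2_inner (mat_vec x \<xi>) \<eta>) (finite_subsets_at_top UNIV)"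
proof -
 let ?d = "%J u i. u i - rs J u i"
 have c: "0 \<le> c" by (rule sbf_nonneg[OF x])
 have b: "cmod (ip J (mv J x \<xi>) \<eta> - ell2_inner (mat_vec x \<xi>) \<eta>)
  \<le> c * ell2_norm (?d J \<xi>) * ell2_norm \<eta> + c * ell2_norm \<xi> * ell2_norm (?d J \<eta>)" if J: "finite J" for J
 proof -
  note r = rs_ell2[OF J]
  have "ell2_inner (mat_vec x \<xi>) \<eta> - ip J (mv J x \<xi>) \<eta>
   = (ell2_inner (mat_vec x \<xi>) \<eta> - ell2_inner (mat_vec x (rs J \<xi>)) \<eta>)
    + (ell2_inner (mat_vec x (rs J \<xi>)) \<eta> - ell2_inner (mat_vec x (rs J \<xi>)) (rs J \<eta>))"
   using J by (simp add: ell2_inner_rs_right mat_vec_rs)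
  also have "... = ell2_inner (mat_vec x (?d J \<xi>)) \<eta> + ell2_inner (mat_vec x (rs J \<xi>)) (?d J \<eta>)"
   by (simp add: mat_vec_diff[OF x xi r] ell2_inner_diff_left ell2_inner_diff_right
     mat_vec_bounded[OF x] xi eta r)
  finally have "cmod (ell2_inner (mat_vec x \<xi>) \<eta> - ip J (mv J x \<xi>) \<eta>)
    \<le> cmod (ell2_inner (mat_vec x (?d J \<xi>)) \<eta>) + cmod (ell2_inner (mat_vec x (rs J \<xi>)) (?d J \<eta>))"
   by (metis norm_triangle_ineq)
  also have "... \<le> c * ell2_norm (?d J \<xi>) * ell2_norm \<eta> + c * ell2_norm (rs J \<xi>) * ell2_norm (?d J \<eta>)"
   by (intro add_mono mat_vec_form[OF x] ell2_diff xi eta r)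
  also have "... \<le> c * ell2_norm (?d J \<xi>) * ell2_norm \<eta> + c * ell2_norm \<xi> * ell2_norm (?d J \<eta>)"
   using ell2_norm_rs_le[OF xi J] c by (intro add_mono mult_right_mono mult_left_mono) auto
  finally show ?thesis by (simp add: norm_minus_commute)
 qed
 have "((%J. c * ell2_norm (?d J \<xi>) * ell2_norm \<eta> + c * ell2_norm \<xi> * ell2_norm (?d J \<eta>)) \<longlongrightarrow>
   c * 0 * ell2_norm \<eta> + c * ell2_norm \<xi> * 0) (finite_subsets_at_top UNIV)"
  by (intro tendsto_intros ell2_norm_cutoff xi eta)
 hence 0: "((%J. c * ell2_norm (?d J \<xi>) * ell2_norm \<eta> + c * ell2_norm \<xi> * ell2_norm (?d J \<eta>)) \<longlongrightarrow> 0)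
   (finite_subsets_at_top UNIV)" by simp
 have "((%J. ip J (mv J x \<xi>) \<eta> - ell2_inner (mat_vec x \<xi>) \<eta>) \<longlongrightarrow> 0) (finite_subsets_at_top UNIV)"
  by (rule Lim_null_comparison[OF _ 0]) (intro eventually_finite_subsets_at_top_weakI b)
 thus ?thesis by (simp add: LIM_zero_iff)
qed

lemma mat_vec_adj:
 assumes x: "sbf \<theta> x c" and xi: "\<xi> \<in> ell2" and eta: "\<eta> \<in> ell2"
 shows "ell2_inner (mat_vec x \<xi>) \<eta> = ell2_inner \<xi> (mat_vec (adj x) \<eta>)"
proof -
 have "((%J. cnj (ip J (mv J (adj x) \<eta>) \<xi>)) \<longlongrightarrow> cnj (ell2_inner (mat_vec (adj x) \<eta>) \<xi>)) (finite_subsets_at_top UNIV)"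
  by (intro tendsto_intros mat_vec_form_tendsto[OF sbf_adj[OF x]] xi eta)
 moreover have "cnj (ip J (mv J (adj x) \<eta>) \<xi>) = ip J (mv J x \<xi>) \<eta>" for J
  unfolding ip_mv[of J x \<xi> \<eta>] by (rule ip_commute[symmetric])
 ultimately have "((%J. ip J (mv J x \<xi>) \<eta>) \<longlongrightarrow> cnj (ell2_inner (mat_vec (adj x) \<eta>) \<xi>)) (finite_subsets_at_top UNIV)"
  by simp
 from tendsto_unique[OF finite_subsets_at_top_neq_bot mat_vec_form_tendsto[OF x xi eta] this]
 show ?thesis using ell2_inner_commute by metis
qed

section \<open>Singular value decomposition of compact matrices\<close>

definition ub :: "('i => complex) set" where
 "ub = {\<xi>. \<forall>J. finite J \<longrightarrow> sq J \<xi> \<le> 1}"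

lemma ub_iff: "\<xi> \<in> ub \<longleftrightarrow> \<xi> \<in> ell2 \<and> ell2_norm \<xi> \<le> 1"
proof
 assume "\<xi> \<in> ub"
 hence "sq J \<xi> \<le> 1\<^sup>2" if "finite J" for J using that by (simp add: ub_def)
 from ell2_boundI[OF this] show "\<xi> \<in> ell2 \<and> ell2_norm \<xi> \<le> 1" by simp
next
 assume a: "\<xi> \<in> ell2 \<and> ell2_norm \<xi> \<le> 1"
 hence "(ell2_norm \<xi>)\<^sup>2 \<le> 1" by (simp add: power_le_one)
 thus "\<xi> \<in> ub" unfolding ub_def using sq_le_ell2[of \<xi>] a by fastforce
qed

lemma continuous_on_coord: "continuous_on UNIV (%\<xi>::'i => complex. \<xi> i)"
 by (rule continuous_on_product_coordinates)

lemma compact_ub: "compact (ub :: ('i => complex) set)"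
proof -
 have "compactin (product_topology (%i::'i. euclidean) UNIV) (PiE UNIV (%i. cball (0::complex) 1))"
  by (simp add: compactin_PiE)
 hence 1: "compact (PiE UNIV (%i::'i. cball (0::complex) 1))"
  by (simp add: euclidean_product_topology)
 have "closed {\<xi>::'i => complex. sq J \<xi> \<le> 1}" for J
  unfolding sq_def by (intro closed_Collect_le continuous_intros continuous_on_coord)
 hence "closed (\<Inter>J\<in>{J. finite J}. {\<xi>::'i => complex. sq J \<xi> \<le> 1})" by auto
 moreover have "ub = (\<Inter>J\<in>{J. finite J}. {\<xi>::'i => complex. sq J \<xi> \<le> 1})"
  by (auto simp: ub_def)
 ultimately have 2: "closed (ub :: ('i => complex) set)" by simp
 have "\<xi> \<in> PiE UNIV (%i. cball 0 1)" if "\<xi> \<in> ub" for \<xi> :: "'i => complex"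
 proof -
  have "sq {i} \<xi> \<le> 1" for i using that by (simp add: ub_def)
  thus ?thesis by (auto simp: sq_def power_le_one_iff abs_square_le_1)
 qed
 hence "ub = PiE UNIV (%i. cball 0 1) \<inter> (ub :: ('i => complex) set)" by auto
 thus ?thesis using compact_Int_closed[OF 1 2] by simp
qed

lemma mat_vec_trunc:
 assumes "finite J" shows "mat_vec (trunc J x) \<xi> = rs J (mv J x \<xi>)"
proof
 fix i
 show "mat_vec (trunc J x) \<xi> i = rs J (mv J x \<xi>) i"
 proof (cases "i \<in> J")
  case True
  thus ?thesis unfolding mat_vec_def rs_def mv_def trunc_def using assms
   by (simp, intro infsumI has_sum_finite_neutralI[where B = J]) auto
 qed (simp add: mat_vec_def rs_def trunc_def)
qed

lemma form_trunc_close: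
 assumes "sbf \<theta> x C" "finite J" "sbf \<theta>' (%i j. x i j - trunc J x i j) \<epsilon>" "\<xi> \<in> ub" "\<eta> \<in> ub"
 shows "cmod (ell2_inner (mat_vec x \<xi>) \<eta> - ip J (mv J x \<xi>) \<eta>) \<le> \<epsilon>"
proof -
 have xi: "\<xi> \<in> ell2" "ell2_norm \<xi> \<le> 1" and eta: "\<eta> \<in> ell2" "ell2_norm \<eta> \<le> 1"
  using assms(4,5) by (auto simp: ub_iff)
 have e: "0 \<le> \<epsilon>" by (rule sbf_nonneg[OF assms(3)])
 have t: "sbf \<theta> (trunc J x) C" by (rule sbf_trunc[OF assms(1)])
 have "ell2_inner (mat_vec (%i j. x i j - trunc J x i j) \<xi>) \<eta>
   = ell2_inner (mat_vec x \<xi>) \<eta> - ell2_inner (mat_vec (trunc J x) \<xi>) \<eta>"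
  unfolding mat_vec_diff_mat[OF assms(1) t xi(1)]
  by (intro ell2_inner_diff_left mat_vec_bounded[OF assms(1)] mat_vec_bounded[OF t] xi eta)
 also have "ell2_inner (mat_vec (trunc J x) \<xi>) \<eta> = ip J (mv J x \<xi>) \<eta>"
  using assms(2) by (simp add: mat_vec_trunc ell2_inner_rs_left)
 finally have "cmod (ell2_inner (mat_vec x \<xi>) \<eta> - ip J (mv J x \<xi>) \<eta>) \<le> \<epsilon> * ell2_norm \<xi> * ell2_norm \<eta>"
  using mat_vec_form[OF assms(3) xi(1) eta(1)] by simp
 also have "\<epsilon> * ell2_norm \<xi> * ell2_norm \<eta> \<le> \<epsilon> * 1 * 1"
  using xi eta e by (intro mult_mono) auto
 finally show ?thesis by simp
qed

lemma continuous_on_form: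
 assumes "sapp 0 x"
 shows "continuous_on (ub \<times> ub) (%(\<xi>, \<eta>). Re (ell2_inner (mat_vec x \<xi>) \<eta>))"
proof -
 obtain C where C: "sbf 0 x C" using sapp_sbf[OF assms] by auto
 have "\<exists>J. finite J \<and> sbf 0 (%i j. x i j - trunc J x i j) (1 / real (Suc n))" for n
  using assms unfolding sapp_def by simp
 then obtain J where J: "\<And>n. finite (J n)" "\<And>n. sbf 0 (%i j. x i j - trunc (J n) x i j) (1 / real (Suc n))"
  by metis
 define f where "f = (%n z. Re (ip (J n) (mv (J n) x (fst z)) (snd z)))"
 define l where "l = (%z. Re (ell2_inner (mat_vec x (fst z)) (snd z)))"
 have cont: "continuous_on (ub \<times> ub) (f n)" for n
  unfolding f_def ip_def mv_def
  by (intro continuous_intros continuous_on_compose2[OF continuous_on_coord] subset_UNIV)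
 have b: "dist (f n z) (l z) \<le> 1 / real (Suc n)" if "z \<in> ub \<times> ub" for n z
 proof -
  have "cmod (ell2_inner (mat_vec x (fst z)) (snd z) - ip (J n) (mv (J n) x (fst z)) (snd z)) \<le> 1 / real (Suc n)"
   using that by (intro form_trunc_close[OF C J]) auto
  moreover have "\<bar>l z - f n z\<bar> \<le> cmod (ell2_inner (mat_vec x (fst z)) (snd z) - ip (J n) (mv (J n) x (fst z)) (snd z))"
   unfolding f_def l_def using abs_Re_le_cmod by (metis minus_complex.simps(1))
  ultimately show ?thesis by (simp add: dist_real_def abs_minus_commute)
 qed
 have "uniform_limit (ub \<times> ub) f l sequentially"
 proof (rule uniform_limitI)
  fix e :: real assume e: "e > 0"
  then obtain N where N: "1 / real (Suc N) < e" using nat_approx_posE by blast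
  have "\<forall>z\<in>ub \<times> ub. dist (f n z) (l z) < e" if "n \<ge> N" for n
  proof
   fix z :: "('a => complex) \<times> ('a => complex)" assume "z \<in> ub \<times> ub"
   hence "dist (f n z) (l z) \<le> 1 / real (Suc n)" by (rule b)
   also have "... \<le> 1 / real (Suc N)" using that by (intro divide_left_mono) auto
   finally show "dist (f n z) (l z) < e" using N by simp
  qed
  thus "\<forall>\<^sub>F n in sequentially. \<forall>z\<in>ub \<times> ub. dist (f n z) (l z) < e"
   unfolding eventually_sequentially by blast
 qed
 hence "continuous_on (ub \<times> ub) l"
  by (rule uniform_limit_theorem[rotated]) (auto simp: cont)
 thus ?thesis by (simp add: l_def case_prod_beta)
qed

lemma ell2_norm_mult: "ell2_norm (%i. c * \<xi> i) = cmod c * ell2_norm \<xi>"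
 unfolding ell2_norm_def by (simp add: norm_mult power_mult_distrib infsum_cmult_right' real_sqrt_mult)

lemma ell2_norm_diff_sq:
 assumes "\<xi> \<in> ell2" "\<eta> \<in> ell2"
 shows "(ell2_norm (%i. \<xi> i - \<eta> i))\<^sup>2 = (ell2_norm \<xi>)\<^sup>2 - 2 * Re (ell2_inner \<xi> \<eta>) + (ell2_norm \<eta>)\<^sup>2"
proof -
 have d: "(%i. \<xi> i - \<eta> i) \<in> ell2" by (rule ell2_diff[OF assms])
 have "complex_of_real ((ell2_norm (%i. \<xi> i - \<eta> i))\<^sup>2) = ell2_inner (%i. \<xi> i - \<eta> i) (%i. \<xi> i - \<eta> i)"
  by (rule ell2_inner_self[OF d, symmetric])
 also have "... = ell2_inner \<xi> \<xi> - ell2_inner \<xi> \<eta> - (ell2_inner \<eta> \<xi> - ell2_inner \<eta> \<eta>)"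
  by (simp add: ell2_inner_diff_left ell2_inner_diff_right assms d)
 also have "... = of_real ((ell2_norm \<xi>)\<^sup>2) - ell2_inner \<xi> \<eta> - (cnj (ell2_inner \<xi> \<eta>) - of_real ((ell2_norm \<eta>)\<^sup>2))"
  by (simp only: ell2_inner_self assms ell2_inner_commute[of \<eta> \<xi>])
 finally have "Re (complex_of_real ((ell2_norm (%i. \<xi> i - \<eta> i))\<^sup>2)) =
  Re (of_real ((ell2_norm \<xi>)\<^sup>2) - ell2_inner \<xi> \<eta> - (cnj (ell2_inner \<xi> \<eta>) - of_real ((ell2_norm \<eta>)\<^sup>2)))" by (rule arg_cong)
 thus ?thesis by (simp only: Re_complex_of_real minus_complex.simps cnj.simps)
qed

definition top_sv :: "'i cmat => real => ('i => complex) => ('i => complex) => bool" where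
 "top_sv x s u v \<longleftrightarrow> 0 \<le> s \<and> u \<in> ell2 \<and> v \<in> ell2 \<and> (s \<noteq> 0 \<longrightarrow> ell2_norm u = 1 \<and> ell2_norm v = 1) \<and>
   mat_vec x v = (%i. of_real s * u i) \<and> mat_vec (adj x) u = (%i. of_real s * v i) \<and> sbf 0 x s"

lemma maximizer_eq:
 assumes "sbf 0 x s" "u \<in> ub" "v \<in> ub" "Re (ell2_inner (mat_vec x v) u) = s"
 shows "mat_vec x v = (%i. of_real s * u i)"
proof
 fix i
 have s: "0 \<le> s" by (rule sbf_nonneg[OF assms(1)])
 have u: "u \<in> ell2" "ell2_norm u \<le> 1" and v: "v \<in> ell2" "ell2_norm v \<le> 1"
  using assms(2,3) by (auto simp: ub_iff)
 let ?h = "mat_vec x v"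
 have h: "?h \<in> ell2" "ell2_norm ?h \<le> s * ell2_norm v" using mat_vec_bounded[OF assms(1) v(1)] by auto
 have su: "(%i. of_real s * u i) \<in> ell2" by (rule ell2_mult[OF u(1)])
 have "ell2_norm ?h \<le> s" using h(2) mult_left_mono[OF v(2) s] by simp
 hence 1: "(ell2_norm ?h)\<^sup>2 \<le> s\<^sup>2" by (intro power_mono) auto
 have "ell2_norm (%i. of_real s * u i) \<le> s"
  unfolding ell2_norm_mult using u(2) s mult_left_mono[OF u(2) s] by simp
 hence 2: "(ell2_norm (%i. of_real s * u i))\<^sup>2 \<le> s\<^sup>2" by (intro power_mono) auto
 have 3: "Re (ell2_inner ?h (%i. of_real s * u i)) = s * s"
  unfolding ell2_inner_mult_right using assms(4) by simp
 have "(ell2_norm (%i. ?h i - of_real s * u i))\<^sup>2 \<le> 0"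
  unfolding ell2_norm_diff_sq[OF h(1) su] 3 using 1 2 by (simp add: power2_eq_square)
 hence "ell2_norm (%i. ?h i - of_real s * u i) \<le> 0" by simp
 from ell2_norm_zero_iff[OF ell2_diff[OF h(1) su] this, of i]
 show "?h i = of_real s * u i" by simp
qed

lemma rs_ub: "finite J ==> sq J \<xi> \<le> 1 ==> rs J \<xi> \<in> ub"
proof -
 assume J: "finite J" and s: "sq J \<xi> \<le> 1"
 have "(ell2_norm (rs J \<xi>))\<^sup>2 = sq J (rs J \<xi>)"
  by (rule ell2_finite_support(2)) (auto simp: rs_def J)
 hence "(ell2_norm (rs J \<xi>))\<^sup>2 \<le> 1\<^sup>2" using s J by (simp add: sq_rs)
 hence "ell2_norm (rs J \<xi>) \<le> 1" by (rule power2_le_imp_le) simp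
 thus ?thesis using rs_ell2[OF J] by (simp add: ub_iff)
qed

lemma top_sv_exists: assumes "sapp 0 x" shows "\<exists>s u v. top_sv x s u v"
proof -
 obtain C where C: "sbf 0 x C" using sapp_sbf[OF assms] by auto
 have z: "(%i. 0) \<in> ub" by (simp add: ub_def sq_def)
 have "\<exists>z\<in>ub \<times> ub. \<forall>z'\<in>ub \<times> ub. (%(\<xi>, \<eta>). Re (ell2_inner (mat_vec x \<xi>) \<eta>)) z' \<le> (%(\<xi>, \<eta>). Re (ell2_inner (mat_vec x \<xi>) \<eta>)) z"
  by (rule continuous_attains_sup[OF compact_Times[OF compact_ub compact_ub] _ continuous_on_form[OF assms]])
    (use z in auto)
 then obtain v u where vu: "v \<in> ub" "u \<in> ub"
  and mx: "\<And>\<xi> \<eta>. \<xi> \<in> ub ==> \<eta> \<in> ub ==> Re (ell2_inner (mat_vec x \<xi>) \<eta>) \<le> Re (ell2_inner (mat_vec x v) u)"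
  by auto
 define s where "s = Re (ell2_inner (mat_vec x v) u)"
 have s0: "0 \<le> s" using mx[OF z z] by (simp add: s_def ell2_inner_def)
 have u: "u \<in> ell2" "ell2_norm u \<le> 1" and v: "v \<in> ell2" "ell2_norm v \<le> 1"
  using vu by (auto simp: ub_iff)
 have bd: "cmod (ell2_inner (mat_vec x \<xi>) \<eta>) \<le> s" if "\<xi> \<in> ub" "\<eta> \<in> ub" for \<xi> \<eta>
 proof (cases "ell2_inner (mat_vec x \<xi>) \<eta> = 0")
  case False
  define t where "t = ell2_inner (mat_vec x \<xi>) \<eta>"
  define c where "c = cnj t / of_real (cmod t)"
  have c1: "cmod c = 1" using False by (simp add: c_def t_def norm_divide)
  have "(%i. c * \<xi> i) \<in> ub" using that(1) c1 by (simp add: ub_iff ell2_mult ell2_norm_mult)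
  from mx[OF this that(2)] have "Re (c * t) \<le> s"
   by (simp add: mat_vec_mult ell2_inner_mult_left s_def t_def)
  also have "c * t = of_real (cmod t)"
   using False complex_norm_square[of t] by (simp add: c_def t_def mult.commute power2_eq_square field_simps)
  finally show ?thesis by (simp add: t_def)
 qed (use s0 in simp)
 have sx: "sbf 0 x s"
  unfolding sbf_def
 proof (intro allI impI)
  fix J :: "'a set" assume J: "finite J"
  show "sb J 0 x s"
  proof (rule sb_0_formI[OF _ s0])
   fix \<xi> \<eta> assume "sq J \<xi> \<le> 1" "sq J \<eta> \<le> 1"
   hence "cmod (ell2_inner (mat_vec x (rs J \<xi>)) (rs J \<eta>)) \<le> s" using J by (intro bd rs_ub)
   thus "cmod (ip J (mv J x \<xi>) \<eta>) \<le> s" using J by (simp add: mat_vec_rs ell2_inner_rs_right)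
  qed
 qed
 have e1: "mat_vec x v = (%i. of_real s * u i)"
  by (rule maximizer_eq[OF sx vu(2) vu(1)]) (simp add: s_def)
 have "Re (ell2_inner (mat_vec (adj x) u) v) = s"
  using mat_vec_adj[OF sx v(1) u(1)] ell2_inner_commute[of v "mat_vec (adj x) u"] by (simp add: s_def)
 hence e2: "mat_vec (adj x) u = (%i. of_real s * v i)"
  by (intro maximizer_eq[OF sbf_adj[OF sx] vu(1) vu(2)])
 have "ell2_norm u = 1 \<and> ell2_norm v = 1" if "s \<noteq> 0"
 proof -
  have sp: "s > 0" using that s0 by simp
  have "s \<le> cmod (ell2_inner (mat_vec x v) u)" unfolding s_def by (rule complex_Re_le_cmod)
  also have "... \<le> s * ell2_norm v * ell2_norm u" by (rule mat_vec_form[OF sx v(1) u(1)])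
  finally have "s * 1 \<le> s * (ell2_norm v * ell2_norm u)" by (simp add: mult.assoc)
  hence p: "1 \<le> ell2_norm v * ell2_norm u" using sp by (simp only: mult_le_cancel_left_pos)
  have "ell2_norm v * ell2_norm u \<le> ell2_norm v * 1" "ell2_norm v * ell2_norm u \<le> 1 * ell2_norm u"
   using u v by (intro mult_left_mono mult_right_mono; simp)+
  thus ?thesis using p u v by linarith
 qed
 hence "top_sv x s u v" unfolding top_sv_def using s0 u v e1 e2 sx by blast
 thus ?thesis by blast
qed

lemma orthonormal_ell2_bessel:
 assumes "finite F" "\<And>k. k \<in> F ==> e k \<in> ell2"
  "\<And>k l. k \<in> F ==> l \<in> F ==> ell2_inner (e k) (e l) = (if k = l then 1 else 0)" "finite J"
 shows "bessel J F e"
 unfolding bessel_iff_synthesis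
proof
 fix c
 let ?w = "%i. \<Sum>k\<in>F. c k * e k i"
 have w: "?w \<in> ell2" using assms(2) by (rule ell2_sum)
 have 1: "ell2_inner ?w (e k) = c k" if "k \<in> F" for k
 proof -
  have "ell2_inner (e k) ?w = (\<Sum>l\<in>F. cnj (c l) * ell2_inner (e k) (e l))"
   by (rule ell2_inner_sum_right) (use assms(2) that in auto)
  also have "... = (\<Sum>l\<in>F. if k = l then cnj (c l) else 0)"
   using assms(3)[OF that] by (intro sum.cong) auto
  also have "... = cnj (c k)" using that assms(1) by simp
  finally show ?thesis using ell2_inner_commute[of ?w "e k"] by simp
 qed
 have "complex_of_real ((ell2_norm ?w)\<^sup>2) = ell2_inner ?w ?w" by (rule ell2_inner_self[OF w, symmetric])
 also have "... = (\<Sum>k\<in>F. cnj (c k) * ell2_inner ?w (e k))"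
  by (rule ell2_inner_sum_right) (use assms(2) w in auto)
 also have "... = (\<Sum>k\<in>F. complex_of_real ((cmod (c k))\<^sup>2))"
  using 1 by (intro sum.cong refl) (simp add: complex_norm_square mult.commute del: of_real_power)
 also have "... = complex_of_real (\<Sum>k\<in>F. (cmod (c k))\<^sup>2)" by simp
 finally have "(ell2_norm ?w)\<^sup>2 = (\<Sum>k\<in>F. (cmod (c k))\<^sup>2)" by (simp only: of_real_eq_iff)
 thus "sq J ?w \<le> (\<Sum>k\<in>F. (cmod (c k))\<^sup>2)" using sq_le_ell2[OF w assms(4)] by simp
qed

lemma bessel_coord:
 assumes "bessel {i} F e" shows "(\<Sum>k\<in>F. (cmod (e k i))\<^sup>2) \<le> 1"
proof -
 have "(\<Sum>k\<in>F. (cmod (ip {i} (%_. 1) (e k)))\<^sup>2) \<le> sq {i} (%_. 1)"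
  using assms unfolding bessel_def by blast
 thus ?thesis by (simp add: ip_def sq_def)
qed

lemma sum_prod_bessel_le:
 assumes "bessel {i} F e" "bessel {j} F f"
 shows "(\<Sum>k\<in>F. cmod (e k i) * cmod (f k j)) \<le> 1"
proof -
 have "(\<Sum>k\<in>F. cmod (e k i) * cmod (f k j)) \<le> (\<Sum>k\<in>F. ((cmod (e k i))\<^sup>2 + (cmod (f k j))\<^sup>2) / 2)"
 proof (rule sum_mono)
  fix k
  show "cmod (e k i) * cmod (f k j) \<le> ((cmod (e k i))\<^sup>2 + (cmod (f k j))\<^sup>2) / 2"
   using sum_squares_bound[of "cmod (e k i)" "cmod (f k j)"] by simp
 qed
 also have "... = ((\<Sum>k\<in>F. (cmod (e k i))\<^sup>2) + (\<Sum>k\<in>F. (cmod (f k j))\<^sup>2)) / 2"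
  by (simp add: sum.distrib flip: sum_divide_distrib)
 also have "... \<le> 1" using bessel_coord[OF assms(1)] bessel_coord[OF assms(2)] by simp
 finally show ?thesis .
qed

definition defl :: "'i cmat => real => ('i => complex) => ('i => complex) => 'i cmat" where
 "defl x s u v = (%i j. x i j - of_real s * (u i * cnj (v j)))"

lemma adj_defl: "adj (defl x s u v) = defl (adj x) s v u"
 by (auto simp: adj_def defl_def fun_eq_iff mult_ac)

lemma mat_vec_defl:
 assumes "sbf \<theta> x C" "u \<in> ell2" "v \<in> ell2" "\<xi> \<in> ell2"
 shows "mat_vec (defl x s u v) \<xi> = (%i. mat_vec x \<xi> i - of_real s * ell2_inner \<xi> v * u i)"
proof -
 have r: "sbf 0 (%i j. of_real s * (u i * cnj (v j))) (cmod (of_real s) * (ell2_norm u * ell2_norm v))"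
  by (intro sbf_mult sbf_rank_one assms) auto
 have "mat_vec (%i j. (of_real s * u i) * cnj (v j)) \<xi> = (%i. ell2_inner \<xi> v * (of_real s * u i))"
  by (rule mat_vec_rank_one)
 thus ?thesis unfolding defl_def mat_vec_diff_mat[OF assms(1) r assms(4)] by (simp add: mult_ac)
qed

text \<open>The bilinear form of a norm limit of finite matrices is continuous on the unit balls in the topology of pointwise
 convergence, which makes them compact by Tychonoff's theorem. So it attains its supremum, and maximisers can be split off one after
 the other.\<close>

lemma compact_svd:
 assumes sx: "sapp 0 x"
 obtains s u v where "singular_decomp x s u v" "s \<longlonglongrightarrow> 0"
  "\<And>k. mat_vec x (v k) = (%i. of_real (s k) * u k i)"
  "\<And>k. mat_vec (adj x) (u k) = (%i. of_real (s k) * v k i)"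
proof -
 have "\<exists>f. \<forall>x::'a cmat. sapp 0 x \<longrightarrow> top_sv x (fst (f x)) (fst (snd (f x))) (snd (snd (f x)))"
 proof (rule choice, rule allI)
  fix x :: "'a cmat"
  show "\<exists>z. sapp 0 x \<longrightarrow> top_sv x (fst z) (fst (snd z)) (snd (snd z))"
  proof (cases "sapp 0 x")
   case True
   then obtain s u v where "top_sv x s u v" using top_sv_exists by blast
   thus ?thesis by (intro exI[of _ "(s,u,v)"]) simp
  qed simp
 qed
 then obtain f where f: "\<And>x::'a cmat. sapp 0 x ==> top_sv x (fst (f x)) (fst (snd (f x))) (snd (snd (f x)))"
  by blast
 define X where "X = rec_nat x (%_ y. defl y (fst (f y)) (fst (snd (f y))) (snd (snd (f y))))"
 define s where "s = (%k. fst (f (X k)))"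
 define u where "u = (%k. fst (snd (f (X k))))"
 define v where "v = (%k. snd (snd (f (X k))))"
 have X0: "X 0 = x" by (simp add: X_def)
 have XS: "X (Suc k) = defl (X k) (s k) (u k) (v k)" for k by (simp add: X_def s_def u_def v_def)
 have "sapp 0 (X k) \<and> top_sv (X k) (s k) (u k) (v k)" for k
 proof (induction k)
  case 0
  show ?case using f[OF sx] sx by (simp add: X0 s_def u_def v_def)
 next
  case (Suc k)
  hence "u k \<in> ell2" "v k \<in> ell2" by (auto simp: top_sv_def)
  hence "sapp 0 (X (Suc k))" unfolding XS defl_def using Suc
   by (intro sapp_diff sapp_mult sapp_rank_one) auto
  thus ?case using f by (simp add: s_def u_def v_def)
 qed
 hence top: "top_sv (X k) (s k) (u k) (v k)" for k by blast
 have s0: "0 \<le> s k" and ue: "u k \<in> ell2" and ve: "v k \<in> ell2"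
  and n1: "s k \<noteq> 0 ==> ell2_norm (u k) = 1 \<and> ell2_norm (v k) = 1"
  and xv: "mat_vec (X k) (v k) = (%i. of_real (s k) * u k i)"
  and xu: "mat_vec (adj (X k)) (u k) = (%i. of_real (s k) * v k i)"
  and sbX: "sbf 0 (X k) (s k)" for k
  using top[of k] unfolding top_sv_def by blast+
 have mS: "mat_vec (X (Suc k)) \<xi> = (%i. mat_vec (X k) \<xi> i - of_real (s k) * ell2_inner \<xi> (v k) * u k i)"
  if "\<xi> \<in> ell2" for \<xi> k unfolding XS by (rule mat_vec_defl[OF sbX ue ve that])
 have mS': "mat_vec (adj (X (Suc k))) \<xi> = (%i. mat_vec (adj (X k)) \<xi> i - of_real (s k) * ell2_inner \<xi> (u k) * v k i)"
  if "\<xi> \<in> ell2" for \<xi> k unfolding XS adj_defl by (rule mat_vec_defl[OF sbf_adj[OF sbX] ve ue that])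
 have self: "ell2_inner (u k) (u k) = 1" "ell2_inner (v k) (v k) = 1" if "s k \<noteq> 0" for k
  using n1[OF that] by (simp_all add: ell2_inner_self ue ve)
 have sv: "of_real (s k) * ell2_inner \<xi> (v k) = ell2_inner (mat_vec (X k) \<xi>) (u k)" if "\<xi> \<in> ell2" for \<xi> k
  unfolding mat_vec_adj[OF sbX that ue] xu ell2_inner_mult_right by simp
 have su: "of_real (s k) * ell2_inner \<xi> (u k) = ell2_inner (mat_vec (adj (X k)) \<xi>) (v k)" if "\<xi> \<in> ell2" for \<xi> k
  unfolding mat_vec_adj[OF sbf_adj[OF sbX] that ve] adj_adj xv ell2_inner_mult_right by simp
 have zi: "ell2_inner (%i. 0) \<xi> = 0" for \<xi> :: "'a => complex" by (simp add: ell2_inner_def)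
 have kill: "j < k ==> s j \<noteq> 0 ==> mat_vec (X k) (v j) = (%i. 0) \<and> mat_vec (adj (X k)) (u j) = (%i. 0)" for j k
 proof (induction k)
  case (Suc k)
  show ?case
  proof (cases "j = k")
   case True
   thus ?thesis unfolding mS[OF ve] mS'[OF ue] using self[of k] Suc.prems by (simp add: xv xu)
  next
   case False
   hence h: "mat_vec (X k) (v j) = (%i. 0)" "mat_vec (adj (X k)) (u j) = (%i. 0)" using Suc by auto
   show ?thesis unfolding mS[OF ve] mS'[OF ue] sv[OF ve] su[OF ue] h zi by simp
  qed
 qed simp
 have orth1: "ell2_inner (v j) (v k) = 0 \<and> ell2_inner (u j) (u k) = 0" if "j < k" "s j \<noteq> 0" "s k \<noteq> 0" for j k
  using sv[OF ve, of k j] su[OF ue, of k j] kill[OF that(1,2)] that(3) by (simp add: zi)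
 have orth: "ell2_inner (u k) (u l) = (if k = l then 1 else 0) \<and> ell2_inner (v k) (v l) = (if k = l then 1 else 0)"
  if "s k \<noteq> 0" "s l \<noteq> 0" for k l
 proof (cases k l rule: linorder_cases)
  case less thus ?thesis using orth1[OF less that] by simp
 next
  case equal thus ?thesis using self[OF that(1)] by simp
 next
  case greater
  thus ?thesis using orth1[OF greater that(2,1)] ell2_inner_commute[of "u k" "u l"] ell2_inner_commute[of "v k" "v l"]
   by simp
 qed
 have same: "j \<le> k ==> s k \<noteq> 0 ==> mat_vec (X j) (v k) = mat_vec x (v k) \<and> mat_vec (adj (X j)) (u k) = mat_vec (adj x) (u k)" for j k
 proof (induction j)
  case (Suc j)
  have "s j = 0 \<or> (ell2_inner (v k) (v j) = 0 \<and> ell2_inner (u k) (u j) = 0)"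
   using orth[of k j] Suc.prems by (cases "s j = 0") auto
  thus ?case unfolding mS[OF ve] mS'[OF ue] using Suc by (elim disjE conjE) simp_all
 qed (simp add: X0)
 have bes: "bessel J F u \<and> bessel J F v" if "finite J" "finite F" "\<And>k. k \<in> F ==> s k \<noteq> 0" for J F
  using orthonormal_ell2_bessel[of F u J] orthonormal_ell2_bessel[of F v J] that orth ue ve by auto
 obtain C where C: "sbf 0 x C" using sapp_sbf[OF sx] by auto
 have C0: "0 \<le> C" by (rule sbf_nonneg[OF C])
 have xvk: "mat_vec x (v k) = (%i. of_real (s k) * u k i)" "mat_vec (adj x) (u k) = (%i. of_real (s k) * v k i)"
  if "s k \<noteq> 0" for k
  using same[of k k] that xv[of k] xu[of k] by simp_all
 have form: "ell2_inner (mat_vec x (v k)) (u k) = of_real (s k)" if "s k \<noteq> 0" for k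
  unfolding xvk(1)[OF that] ell2_inner_mult_left using self[OF that] by simp
 have fin: "finite {k. s k \<ge> \<epsilon>}" if e: "\<epsilon> > 0" for \<epsilon>
 proof -
  obtain J where J: "finite J" "sbf 0 (%i j. x i j - trunc J x i j) (\<epsilon>/2)"
   using sx e unfolding sapp_def by (meson half_gt_zero)
  define B where "B = (\<Sum>i\<in>J. \<Sum>j\<in>J. cmod (x i j))"
  have "real (card F) \<le> B / (\<epsilon>/2)" if F: "F \<subseteq> {k. s k \<ge> \<epsilon>}" "finite F" for F
  proof -
   have nz: "s k \<noteq> 0" if "k \<in> F" for k using that F e by auto
   have b: "bessel {i} F u" "bessel {i} F v" for i using bes[of "{i}" F] nz F by auto
   have "\<epsilon>/2 \<le> (\<Sum>i\<in>J. \<Sum>j\<in>J. cmod (x i j) * (cmod (u k i) * cmod (v k j)))" if k: "k \<in> F" for k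
   proof -
    have ubk: "u k \<in> ub" "v k \<in> ub" using n1[OF nz[OF k]] ue ve by (auto simp: ub_iff)
    have "cmod (ell2_inner (mat_vec x (v k)) (u k) - ip J (mv J x (v k)) (u k)) \<le> \<epsilon>/2"
     by (rule form_trunc_close[OF C J ubk(2,1)])
    hence "s k - cmod (ip J (mv J x (v k)) (u k)) \<le> \<epsilon>/2"
     using norm_triangle_ineq2[of "complex_of_real (s k)" "ip J (mv J x (v k)) (u k)"] s0[of k]
     by (simp add: form[OF nz[OF k]])
    hence "\<epsilon>/2 \<le> cmod (ip J (mv J x (v k)) (u k))" using k F by auto
    also have "ip J (mv J x (v k)) (u k) = (\<Sum>i\<in>J. \<Sum>j\<in>J. x i j * v k j * cnj (u k i))"
     by (simp add: ip_def mv_def sum_distrib_right)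
    also have "cmod ... \<le> (\<Sum>i\<in>J. \<Sum>j\<in>J. cmod (x i j * v k j * cnj (u k i)))"
     by (rule order_trans[OF norm_sum sum_mono]) (rule norm_sum)
    finally show ?thesis by (simp add: norm_mult mult_ac)
   qed
   hence "(\<Sum>k\<in>F. \<epsilon>/2) \<le> (\<Sum>k\<in>F. \<Sum>i\<in>J. \<Sum>j\<in>J. cmod (x i j) * (cmod (u k i) * cmod (v k j)))"
    by (rule sum_mono)
   also have "... = (\<Sum>i\<in>J. \<Sum>k\<in>F. \<Sum>j\<in>J. cmod (x i j) * (cmod (u k i) * cmod (v k j)))"
    by (rule sum.swap)
   also have "... = (\<Sum>i\<in>J. \<Sum>j\<in>J. \<Sum>k\<in>F. cmod (x i j) * (cmod (u k i) * cmod (v k j)))"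
    by (intro sum.cong refl sum.swap)
   also have "... = (\<Sum>i\<in>J. \<Sum>j\<in>J. cmod (x i j) * (\<Sum>k\<in>F. cmod (u k i) * cmod (v k j)))"
    by (simp add: sum_distrib_left)
   also have "... \<le> B"
    unfolding B_def using sum_prod_bessel_le[OF b(1) b(2)] by (intro sum_mono mult_left_le) auto
   finally show ?thesis using e by (simp add: field_simps)
  qed
  hence "card F \<le> nat \<lceil>B / (\<epsilon>/2)\<rceil>" if "F \<subseteq> {k. s k \<ge> \<epsilon>}" "finite F" for F
   using that real_nat_ceiling_ge[of "B / (\<epsilon>/2)"] by (meson of_nat_le_iff order_trans)
  thus ?thesis using finite_if_finite_subsets_card_bdd[of "{k. s k \<ge> \<epsilon>}" "nat \<lceil>B / (\<epsilon>/2)\<rceil>"] by simp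
 qed
 have lim: "s \<longlonglongrightarrow> 0"
 proof (rule LIMSEQ_I)
  fix e :: real assume "e > 0"
  from fin[OF this] have "\<exists>N. \<forall>k\<in>{k. s k \<ge> e}. k < N" by (simp only: finite_nat_set_iff_bounded)
  then obtain N where N: "\<And>k. k \<in> {k. s k \<ge> e} ==> k < N" by blast
  show "\<exists>no. \<forall>n\<ge>no. norm (s n - 0) < e"
  proof (intro exI[of _ N] allI impI)
   fix n assume "n \<ge> N"
   hence "\<not> s n \<ge> e" using N[of n] by auto
   thus "norm (s n - 0) < e" using s0[of n] by simp
  qed
 qed
 have sC: "s k \<le> C" for k
 proof (cases "s k = 0")
  case False
  have "s k = cmod (ell2_inner (mat_vec x (v k)) (u k))" using form[OF False] s0[of k] by simp
  also have "... \<le> C * ell2_norm (v k) * ell2_norm (u k)" by (rule mat_vec_form[OF C ve ue])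
  finally show ?thesis using n1[OF False] by simp
 qed (use C0 in simp)
 have psum: "X n i j = x i j - (\<Sum>k<n. of_real (s k) * u k i * cnj (v k j))" for n i j
  by (induction n) (simp_all add: X0 XS defl_def algebra_simps)
 have hs: "((%k. complex_of_real (s k) * u k i * cnj (v k j)) has_sum x i j) UNIV" for i j
 proof (rule norm_summable_imp_has_sum)
  show "summable (%k. norm (complex_of_real (s k) * u k i * cnj (v k j)))"
  proof (rule summableI_nonneg_bounded[where x = C])
   fix n
   let ?F = "{k\<in>{..<n}. s k \<noteq> 0}"
   have b: "bessel {i} ?F u" "bessel {j} ?F v"
    by (rule bes[THEN conjunct1], simp_all) (rule bes[THEN conjunct2], simp_all)
   have "(\<Sum>k<n. norm (complex_of_real (s k) * u k i * cnj (v k j))) = (\<Sum>k\<in>?F. s k * (cmod (u k i) * cmod (v k j)))"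
    using s0 by (intro sum.mono_neutral_cong_right) (auto simp: norm_mult)
   also have "... \<le> (\<Sum>k\<in>?F. C * (cmod (u k i) * cmod (v k j)))"
    using sC by (intro sum_mono mult_right_mono) auto
   also have "... = C * (\<Sum>k\<in>?F. cmod (u k i) * cmod (v k j))" by (simp add: sum_distrib_left)
   also have "... \<le> C" using sum_prod_bessel_le[OF b] C0 by (rule mult_left_le)
   finally show "(\<Sum>k<n. norm (complex_of_real (s k) * u k i * cnj (v k j))) \<le> C" .
  qed simp
  have "(%n. X n i j) \<longlonglongrightarrow> 0"
   by (rule Lim_null_comparison[OF _ lim]) (use sbf_entry[OF sbX] in simp)
  from tendsto_diff[OF tendsto_const[of "x i j"] this]
  show "(%k. complex_of_real (s k) * u k i * cnj (v k j)) sums x i j"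
   unfolding psum sums_def by simp
 qed
 define u' where "u' = (%k. if s k = 0 then (%i. 0) else u k)"
 define v' where "v' = (%k. if s k = 0 then (%i. 0) else v k)"
 have mz: "mat_vec y (%i. 0) = (%i. 0)" for y :: "'a cmat" by (simp add: mat_vec_def)
 have "(%k. complex_of_real (s k) * u' k i * cnj (v' k j)) = (%k. complex_of_real (s k) * u k i * cnj (v k j))" for i j
  by (auto simp: u'_def v'_def fun_eq_iff)
 hence "\<forall>i j. ((%k. complex_of_real (s k) * u' k i * cnj (v' k j)) has_sum x i j) UNIV"
  using hs by presburger
 moreover have "\<forall>k. 0 \<le> s k \<and> u' k \<in> ell2 \<and> v' k \<in> ell2"
  using s0 ue ve by (auto simp: u'_def v'_def)
 moreover have "\<forall>k l. s k \<noteq> 0 \<longrightarrow> s l \<noteq> 0 \<longrightarrow> ell2_inner (u' k) (u' l) = (if k = l then 1 else 0) \<and>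
    ell2_inner (v' k) (v' l) = (if k = l then 1 else 0)"
  using orth by (simp add: u'_def v'_def)
 ultimately have "singular_decomp x s u' v'"
  unfolding singular_decomp_def by blast
 moreover have "mat_vec x (v' k) = (%i. of_real (s k) * u' k i)" "mat_vec (adj x) (u' k) = (%i. of_real (s k) * v' k i)" for k
  using xvk[of k] by (auto simp: u'_def v'_def mz)
 ultimately show thesis using that[of s u' v'] lim by blast
qed

subsection \<open>Finite matrices\<close>

lemma finite_svd:
 assumes J: "finite J"
 obtains K :: "nat set" and s u v where "finite K" "\<And>k. k \<in> K ==> 0 < s k"
  "\<And>k l. k \<in> K ==> l \<in> K ==> ip J (u k) (u l) = (if k = l then 1 else 0)"
  "\<And>k l. k \<in> K ==> l \<in> K ==> ip J (v k) (v l) = (if k = l then 1 else 0)"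
  "\<And>i j. i \<in> J ==> j \<in> J ==> x i j = (\<Sum>k\<in>K. of_real (s k) * u k i * cnj (v k j))"
proof -
 obtain s u v where sv: "singular_decomp (trunc J x) s u v"
  "\<And>k. mat_vec (trunc J x) (v k) = (%i. of_real (s k) * u k i)"
  "\<And>k. mat_vec (adj (trunc J x)) (u k) = (%i. of_real (s k) * v k i)"
  by (rule compact_svd[OF sapp_trunc[OF J, of 0 x]]) (rule that)
 define K where "K = {k. s k \<noteq> 0}"
 have s0: "0 \<le> s k" and ue: "u k \<in> ell2" and ve: "v k \<in> ell2" for k using sv(1) by (auto simp: singular_decomp_def)
 have at: "adj (trunc J x) = trunc J (adj x)" by (auto simp: adj_def trunc_def fun_eq_iff)
 have us: "u k i = 0" if "k \<in> K" "i \<notin> J" for k i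
  using fun_cong[OF sv(2)[of k], of i] that J by (simp add: mat_vec_trunc rs_def K_def)
 have vs: "v k i = 0" if "k \<in> K" "i \<notin> J" for k i
  using fun_cong[OF sv(3)[of k], of i] that J by (simp add: at mat_vec_trunc rs_def K_def)
 have uJ: "rs J (u k) = u k" and vJ: "rs J (v k) = v k" if "k \<in> K" for k
  using us vs that by (auto simp: rs_def fun_eq_iff)
 have ou: "ip J (u k) (u l) = (if k = l then 1 else 0)" and ov: "ip J (v k) (v l) = (if k = l then 1 else 0)"
  if "k \<in> K" "l \<in> K" for k l
  using sv(1) that ell2_inner_rs_right[OF J, of "u k" "u l"] ell2_inner_rs_right[OF J, of "v k" "v l"]
  by (simp_all add: uJ vJ singular_decomp_def K_def)
 have ouE: "ell2_inner (u k) (u l) = (if k = l then 1 else 0)" if "k \<in> K" "l \<in> K" for k l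
  using sv(1) that by (simp add: singular_decomp_def K_def)
 have "card F \<le> card J" if F: "F \<subseteq> K" "finite F" for F
 proof -
  have b: "bessel {i} F u" for i
  proof (rule orthonormal_ell2_bessel[OF F(2) ue])
   show "ell2_inner (u k) (u l) = (if k = l then 1 else 0)" if "k \<in> F" "l \<in> F" for k l
    by (rule ouE[OF subsetD[OF F(1) that(1)] subsetD[OF F(1) that(2)]])
  qed simp
  have one: "sq J (u k) = 1" if "k \<in> F" for k
   using ou[of k k] ip_self[of J "u k"] that F(1) by (metis of_real_eq_1_iff subsetD)
  have "real (card F) = (\<Sum>k\<in>F. sq J (u k))" using one by simp
  also have "... = (\<Sum>i\<in>J. \<Sum>k\<in>F. (cmod (u k i))\<^sup>2)" unfolding sq_def by (rule sum.swap)
  also have "... \<le> (\<Sum>i\<in>J. 1)" by (intro sum_mono bessel_coord b)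
  finally show ?thesis by simp
 qed
 hence fK: "finite K" using finite_if_finite_subsets_card_bdd by blast
 have "x i j = (\<Sum>k\<in>K. of_real (s k) * u k i * cnj (v k j))" if "i \<in> J" "j \<in> J" for i j
 proof -
  have "((%k. complex_of_real (s k) * u k i * cnj (v k j)) has_sum trunc J x i j) UNIV"
   using sv(1) by (simp add: singular_decomp_def)
  moreover have "((%k. complex_of_real (s k) * u k i * cnj (v k j)) has_sum (\<Sum>k\<in>K. of_real (s k) * u k i * cnj (v k j))) UNIV"
   by (rule has_sum_finite_neutralI[where B = K]) (use fK in \<open>auto simp: K_def\<close>)
  ultimately show ?thesis using that has_sum_unique by (fastforce simp: trunc_def)
 qed
 moreover have "0 < s k" if "k \<in> K" for k using s0[of k] that by (simp add: K_def)
 ultimately show thesis using that[of K s u v] fK ou ov by blast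
qed

text \<open>The normal form: a matrix of \<open>S\<^sup>p\<close> norm at most \<open>c\<close>, \<open>\<theta> = 1/p\<close>, is \<open>\<kappa> \<Sum> \<rho>\<^sub>k\<^sup>\<theta> u\<^sub>k v\<^sub>k\<^sup>*\<close> with \<open>\<kappa> \<le> c\<close>,
 \<open>\<Sum> \<rho>\<^sub>k = 1\<close> and orthonormal \<open>u\<close>, \<open>v\<close>.\<close>

lemma schatten_normal_form:
 assumes J: "finite J" and x: "sb J \<theta> x c" and th: "0 < \<theta>"
 obtains K \<rho> u v \<kappa> where "finite K" "\<And>k. k \<in> K ==> 0 < (\<rho> :: nat => real) k" "K \<noteq> {} ==> sum \<rho> K = 1" "sum \<rho> K \<le> 1"
  "\<And>k l. k \<in> K ==> l \<in> K ==> ip J (u k) (u l) = (if k = l then 1 else 0)"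
  "\<And>k l. k \<in> K ==> l \<in> K ==> ip J (v k) (v l) = (if k = l then 1 else 0)"
  "0 \<le> \<kappa>" "\<kappa> \<le> c" "K = {} ==> \<kappa> = 0" "K \<noteq> {} ==> 0 < \<kappa>"
  "\<And>i j. i \<in> J ==> j \<in> J ==> x i j = of_real \<kappa> * (\<Sum>k\<in>K. of_real (\<rho> k powr \<theta>) * u k i * cnj (v k j))"
proof -
 obtain K :: "nat set" and s u v where K: "finite K" and s: "\<And>k. k \<in> K ==> 0 < s k"
  and ou: "\<And>k l. k \<in> K ==> l \<in> K ==> ip J (u k) (u l) = (if k = l then 1 else 0)"
  and ov: "\<And>k l. k \<in> K ==> l \<in> K ==> ip J (v k) (v l) = (if k = l then 1 else 0)"
  and xs: "\<And>i j. i \<in> J ==> j \<in> J ==> x i j = (\<Sum>k\<in>K. of_real (s k) * u k i * cnj (v k j))"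
  by (rule finite_svd[OF J, of x]) (rule that)
 show thesis
 proof (cases "K = {}")
  case True
  show thesis by (rule that[of "{}" "%_. 1" u v 0]) (use True xs sb_nonneg[OF x] in auto)
 next
  case False
  define S where "S = (\<Sum>k\<in>K. s k powr (1/\<theta>))"
  have sp: "0 < s k powr (1/\<theta>)" if "k \<in> K" for k using s[OF that] by simp
  have S: "S > 0" unfolding S_def using K False sp by (rule sum_pos)
  define \<rho> where "\<rho> = (%k. s k powr (1/\<theta>) / S)"
  define \<kappa> where "\<kappa> = S powr \<theta>"
  have r: "\<And>k. k \<in> K ==> 0 < \<rho> k" unfolding \<rho>_def using sp S by (intro divide_pos_pos)
  have r1: "sum \<rho> K = 1" unfolding \<rho>_def using S by (simp add: S_def flip: sum_divide_distrib)
  have k0: "\<kappa> > 0" using S by (simp add: \<kappa>_def)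
  have sk: "\<kappa> * \<rho> k powr \<theta> = s k" if "k \<in> K" for k
   using s[OF that] S th by (simp add: \<kappa>_def \<rho>_def powr_divide powr_powr)
  have x': "x i j = of_real \<kappa> * (\<Sum>k\<in>K. of_real (\<rho> k powr \<theta>) * u k i * cnj (v k j))" if "i \<in> J" "j \<in> J" for i j
  proof -
   have "of_real \<kappa> * (\<Sum>k\<in>K. of_real (\<rho> k powr \<theta>) * u k i * cnj (v k j))
     = (\<Sum>k\<in>K. complex_of_real (\<kappa> * \<rho> k powr \<theta>) * u k i * cnj (v k j))"
    by (simp add: sum_distrib_left mult_ac)
   also have "... = (\<Sum>k\<in>K. of_real (s k) * u k i * cnj (v k j))"
    using sk by (intro sum.cong refl) simp
   finally show ?thesis using xs[OF that] by simp
  qed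
  have bu: "bessel J K u" and bv: "bessel J K v"
   using orthonormal_bessel[of K J u] orthonormal_bessel[of K J v] ou ov K by auto
  have mvk: "ip J (mv J x (v k)) (u k) = of_real (s k)" if k: "k \<in> K" for k
  proof -
   have "ip J (mv J x (v k)) (u k) = ip J (mv J (%i j. \<Sum>k\<in>K. of_real (s k) * u k i * cnj (v k j)) (v k)) (u k)"
    using xs by (intro ip_cong) (auto simp: mv_def)
   also have "... = (\<Sum>l\<in>K. (of_real (s l) * ip J (v k) (v l)) * ip J (u l) (u k))"
    unfolding mv_dyads ip_sum_left by simp
   also have "... = (\<Sum>l\<in>K. if k = l then of_real (s l) else 0)"
    using ou ov k by (intro sum.cong refl) auto
   finally show ?thesis using K k by simp
  qed
  define w where "w = (%i j. \<Sum>k\<in>K. complex_of_real (\<rho> k powr (1-\<theta>)) * v k i * cnj (u k j))"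
  have "sball J (1 - \<theta>) w"
   by (rule sballI[OF K r _ bv bu]) (auto simp: r1 w_def)
  hence "cmod (tr J x w) \<le> c" using x by (simp add: sb_def)
  moreover have "tr J x w = (\<Sum>k\<in>K. complex_of_real (\<rho> k powr (1-\<theta>)) * of_real (s k))"
   unfolding w_def tr_dyads using mvk by (intro sum.cong) auto
  moreover have "... = (\<Sum>k\<in>K. of_real (\<kappa> * \<rho> k))"
  proof (intro sum.cong refl)
   fix k assume k: "k \<in> K"
   have "\<rho> k powr (1-\<theta>) * s k = \<rho> k powr (1-\<theta>) * (\<kappa> * \<rho> k powr \<theta>)" by (simp add: sk[OF k])
   also have "... = \<kappa> * (\<rho> k powr (1-\<theta>) * \<rho> k powr \<theta>)" by simp
   also have "... = \<kappa> * \<rho> k" using r[OF k] by (simp flip: powr_add)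
   finally show "complex_of_real (\<rho> k powr (1-\<theta>)) * of_real (s k) = of_real (\<kappa> * \<rho> k)"
    by (metis of_real_mult)
  qed
  moreover have "... = of_real \<kappa>" using r1 by (simp flip: sum_distrib_left of_real_sum)
  ultimately have "cmod (complex_of_real \<kappa>) \<le> c" by simp
  hence "\<kappa> \<le> c" using k0 by simp
  thus thesis using that[of K \<rho> u v \<kappa>] K r r1 ou ov k0 x' False by (simp add: less_imp_le)
 qed
qed

text \<open>For \<open>\<theta> > 0\<close> the dual description is attained: the singular values of \<open>x\<close> supply the test matrix.\<close>

lemma sb_sball:
 assumes "finite J" "sb J \<theta> x c" "0 < \<theta>"
 obtains \<kappa> x' where "0 \<le> \<kappa>" "\<kappa> \<le> c" "sball J \<theta> x'" "\<And>i j. i \<in> J ==> j \<in> J ==> x i j = of_real \<kappa> * x' i j"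
proof -
 obtain K \<rho> u v \<kappa> where *: "finite K" "\<And>k. k \<in> K ==> 0 < (\<rho> :: nat => real) k" "K \<noteq> {} ==> sum \<rho> K = 1" "sum \<rho> K \<le> 1"
  "\<And>k l. k \<in> K ==> l \<in> K ==> ip J (u k) (u l) = (if k = l then 1 else 0)"
  "\<And>k l. k \<in> K ==> l \<in> K ==> ip J (v k) (v l) = (if k = l then 1 else 0)"
  "0 \<le> \<kappa>" "\<kappa> \<le> c" "K = {} ==> \<kappa> = 0" "K \<noteq> {} ==> 0 < \<kappa>"
  "\<And>i j. i \<in> J ==> j \<in> J ==> x i j = of_real \<kappa> * (\<Sum>k\<in>K. of_real (\<rho> k powr \<theta>) * u k i * cnj (v k j))"
  by (rule schatten_normal_form[OF assms]) (rule that)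
 show thesis
 proof (rule that[OF *(7,8)])
  show "sball J \<theta> (%i j. \<Sum>k\<in>K. of_real (\<rho> k powr \<theta>) * u k i * cnj (v k j))"
   by (rule sballI[OF *(1,2,4) orthonormal_bessel[OF *(5,1)] orthonormal_bessel[OF *(6,1)]]) auto
 qed (rule *(11))
qed

section \<open>Three lines and analytic families\<close>

lemma half_in_strip: "1/2 \<in> strip"
proof -
 have e: "(1/2::complex) = complex_of_real (1/2)" by simp
 show ?thesis unfolding strip_def mem_Collect_eq e Re_complex_of_real by simp
qed

text \<open>The factor \<open>exp (\<delta> (z\<^sup>2 - 1))\<close> enforces decay at infinity, so that the maximum principle applies to rectangles.\<close>

lemma three_lines_pos:
 assumes cont: "continuous_on strip f" and hol: "f holomorphic_on interior strip"
  and bd: "\<And>z. z \<in> strip ==> cmod (f z) \<le> B"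
  and M: "0 < M" "\<And>z. Re z = 0 \<or> Re z = 1 ==> cmod (f z) \<le> M"
  and z0: "z0 \<in> strip"
 shows "cmod (f z0) \<le> M"
proof -
 have B0: "0 \<le> B" using bd[OF z0] norm_ge_zero order_trans by blast
 have main: "cmod (f z0) * exp (\<delta> * Re (z0\<^sup>2 - 1)) \<le> M" if d: "\<delta> > 0" for \<delta>
 proof -
  define R where "R = \<bar>Im z0\<bar> + 1 + B / (\<delta> * M)"
  have R: "R \<ge> 1" "R \<ge> \<bar>Im z0\<bar>" "R \<ge> B / (\<delta> * M)"
   using d M B0 by (auto simp: R_def add_nonneg_nonneg)
  have RR: "B / (\<delta> * M) \<le> R\<^sup>2"
   using R self_le_power[of R 2] by simp
  have BR: "B * exp (- \<delta> * R\<^sup>2) \<le> M"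
  proof -
   have "B \<le> M * (\<delta> * R\<^sup>2)" using RR d M by (simp add: divide_le_eq mult_ac)
   also have "... \<le> M * exp (\<delta> * R\<^sup>2)"
    using M(1) exp_ge_add_one_self[of "\<delta> * R\<^sup>2"] by (intro mult_left_mono) linarith+
   finally have "B \<le> M * exp (\<delta> * R\<^sup>2)" .
   hence "B * exp (- \<delta> * R\<^sup>2) \<le> M * exp (\<delta> * R\<^sup>2) * exp (- \<delta> * R\<^sup>2)" by (intro mult_right_mono) auto
   thus ?thesis by (simp add: mult.assoc flip: exp_add)
  qed
  define S where "S = cbox (Complex 0 (-R)) (Complex 1 R)"
  define g where "g = (%z. f z * exp (of_real \<delta> * (z\<^sup>2 - 1)))"
  have Ss: "S \<subseteq> strip" by (auto simp: S_def strip_def in_cbox_complex_iff)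
  have ng: "cmod (g z) = cmod (f z) * exp (\<delta> * ((Re z)\<^sup>2 - (Im z)\<^sup>2 - 1))" for z
   by (simp add: g_def norm_mult power2_eq_square)
  have "cmod (g z0) \<le> M"
  proof (rule maximum_modulus_frontier[of g S])
   show "g holomorphic_on interior S"
    unfolding g_def using hol interior_mono[OF Ss]
    by (intro holomorphic_intros) (auto intro: holomorphic_on_subset)
   show "continuous_on (closure S) g"
    unfolding g_def using continuous_on_subset[OF cont Ss] by (auto intro!: continuous_intros simp: S_def)
   show "bounded S" by (simp add: S_def)
   show "z0 \<in> S" using z0 R by (auto simp: S_def strip_def in_cbox_complex_iff)
   fix z assume "z \<in> frontier S"
   hence zS: "z \<in> S" and zi: "z \<notin> box (Complex 0 (-R)) (Complex 1 R)"
    by (auto simp: S_def frontier_def)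
   have x: "0 \<le> Re z" "Re z \<le> 1" using zS by (auto simp: S_def in_cbox_complex_iff)
   have x2: "(Re z)\<^sup>2 \<le> 1" using x by (simp add: power_le_one)
   from zS zi consider "Re z = 0 \<or> Re z = 1" | "\<bar>Im z\<bar> = R"
    by (auto simp: S_def in_cbox_complex_iff in_box_complex_iff)
   thus "cmod (g z) \<le> M"
   proof cases
    case 1
    have "(Re z)\<^sup>2 - (Im z)\<^sup>2 - 1 \<le> 0" using x2 zero_le_power2[of "Im z"] by linarith
    hence "\<delta> * ((Re z)\<^sup>2 - (Im z)\<^sup>2 - 1) \<le> 0" using d by (intro mult_nonneg_nonpos) auto
    hence "exp (\<delta> * ((Re z)\<^sup>2 - (Im z)\<^sup>2 - 1)) \<le> 1" by simp
    hence "cmod (g z) \<le> cmod (f z) * 1" unfolding ng by (intro mult_left_mono) auto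
    thus ?thesis using M(2)[OF 1] by simp
   next
    case 2
    have "(Im z)\<^sup>2 = R\<^sup>2" using 2 by (metis power2_abs)
    hence "exp (\<delta> * ((Re z)\<^sup>2 - (Im z)\<^sup>2 - 1)) \<le> exp (- \<delta> * R\<^sup>2)"
     using d x2 by (simp add: algebra_simps mult_left_le)
    hence "cmod (g z) \<le> B * exp (- \<delta> * R\<^sup>2)"
     unfolding ng using bd[of z] Ss zS B0 by (intro mult_mono) auto
    thus ?thesis using BR by simp
   qed
  qed
  thus ?thesis unfolding ng by (simp add: power2_eq_square)
 qed
 have "((%\<delta>. cmod (f z0) * exp (\<delta> * Re (z0\<^sup>2 - 1))) \<longlongrightarrow> cmod (f z0) * exp (0 * Re (z0\<^sup>2 - 1))) (at_right 0)"
  by (intro tendsto_intros)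
 moreover have "\<forall>\<^sub>F \<delta> in at_right 0. cmod (f z0) * exp (\<delta> * Re (z0\<^sup>2 - 1)) \<le> M"
  using eventually_at_right_less[of "0::real"] by eventually_elim (rule main)
 ultimately have "cmod (f z0) * exp (0 * Re (z0\<^sup>2 - 1)) \<le> M"
  by (rule tendsto_upperbound) (rule trivial_limit_at_right_real)
 thus ?thesis by simp
qed

lemma three_lines:
 assumes "continuous_on strip f" "f holomorphic_on interior strip"
  "\<And>z. z \<in> strip ==> cmod (f z) \<le> B" "\<And>z. Re z = 0 \<or> Re z = 1 ==> cmod (f z) \<le> M" "z \<in> strip"
 shows "cmod (f z) \<le> M"
proof (rule field_le_epsilon)
 fix e :: real assume e: "0 < e"
 have "0 \<le> M" using order_trans[OF norm_ge_zero assms(4)[of 0]] by simp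
 thus "cmod (f z) \<le> M + e"
  using e order_trans[OF assms(4)] by (intro three_lines_pos[OF assms(1-3) _ _ assms(5)]) auto
qed

text \<open>The entries of analytic families of finite matrices; a bound on the strip suffices for the three lines theorem.\<close>

definition ebs :: "(complex => complex) => bool" where
 "ebs f \<longleftrightarrow> f holomorphic_on UNIV \<and> (\<exists>B. \<forall>z\<in>strip. cmod (f z) \<le> B)"

lemma ebs_const: "ebs (%z. c)" unfolding ebs_def by auto

lemma ebs_add: assumes "ebs f" "ebs g" shows "ebs (%z. f z + g z)"
proof -
 obtain B C where "\<forall>z\<in>strip. cmod (f z) \<le> B" "\<forall>z\<in>strip. cmod (g z) \<le> C" using assms by (auto simp: ebs_def)
 hence "\<forall>z\<in>strip. cmod (f z + g z) \<le> B + C" by (meson add_mono norm_triangle_le)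
 thus ?thesis using assms unfolding ebs_def by (blast intro: holomorphic_on_add)
qed

lemma ebs_mult: assumes "ebs f" "ebs g" shows "ebs (%z. f z * g z)"
proof -
 obtain B C where BC: "\<forall>z\<in>strip. cmod (f z) \<le> B" "\<forall>z\<in>strip. cmod (g z) \<le> C" using assms by (auto simp: ebs_def)
 have "cmod (f z * g z) \<le> \<bar>B\<bar> * \<bar>C\<bar>" if "z \<in> strip" for z
  unfolding norm_mult using BC that by (intro mult_mono) (auto intro: order_trans)
 thus ?thesis using assms unfolding ebs_def by (blast intro: holomorphic_on_mult)
qed

lemma ebs_sum: "(\<And>k. k \<in> K ==> ebs (f k)) ==> ebs (%z. \<Sum>k\<in>K. f k z)"
 by (induction K rule: infinite_finite_induct) (auto intro: ebs_const ebs_add)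

lemma norm_of_real_powr: "0 < r ==> cmod (complex_of_real r powr z) = r powr Re z"
 by (simp add: norm_powr_real_powr)

lemma of_real_powr: "0 < r ==> complex_of_real r powr complex_of_real t = complex_of_real (r powr t)"
 by (simp add: powr_of_real)

lemma ebs_powr:
 assumes "0 < r" shows "ebs (%z. complex_of_real r powr (of_real a + of_real b * z))"
proof -
 have "(%z. complex_of_real r powr (of_real a + of_real b * z)) holomorphic_on UNIV"
  using assms by (intro holomorphic_intros) auto
 moreover have "cmod (complex_of_real r powr (of_real a + of_real b * z)) \<le> r powr a + r powr (a + b)" if "z \<in> strip" for z
 proof -
  have t: "0 \<le> Re z" "Re z \<le> 1" using that by (auto simp: strip_def)
  have "r powr (a + b * Re z) = (r powr (a + b)) powr (Re z) * (r powr a) powr (1 - Re z)"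
   using assms by (simp add: powr_powr algebra_simps flip: powr_add)
  also have "... \<le> Re z * r powr (a + b) + (1 - Re z) * r powr a"
   using assms t by (intro young_theta) auto
  also have "... \<le> 1 * r powr (a + b) + 1 * r powr a"
   using t by (intro add_mono mult_right_mono) auto
  finally show ?thesis using assms by (simp add: norm_of_real_powr)
 qed
 ultimately show ?thesis unfolding ebs_def by blast
qed

lemma ebs_comp:
 assumes "ebs f" "0 \<le> a" "a \<le> 1" "0 \<le> a + b" "a + b \<le> 1"
 shows "ebs (%z. f (of_real a + of_real b * z))"
proof -
 obtain B where B: "\<forall>z\<in>strip. cmod (f z) \<le> B" using assms by (auto simp: ebs_def)
 have "of_real a + of_real b * z \<in> strip" if "z \<in> strip" for z
 proof -
  have t: "0 \<le> Re z" "Re z \<le> 1" using that by (auto simp: strip_def)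
  have "a + b * Re z = (1 - Re z) * a + Re z * (a + b)" by (simp add: algebra_simps)
  moreover have "0 \<le> (1 - Re z) * a" "0 \<le> Re z * (a + b)" using t assms by simp_all
  moreover have "(1 - Re z) * a + Re z * (a + b) \<le> (1 - Re z) * 1 + Re z * 1"
   using t assms by (intro add_mono mult_left_mono) auto
  ultimately show ?thesis by (simp add: strip_def)
 qed
 moreover have "(%z. f (of_real a + of_real b * z)) holomorphic_on UNIV"
 proof -
  have "(%z. complex_of_real a + complex_of_real b * z) holomorphic_on UNIV" by (intro holomorphic_intros)
  from holomorphic_on_compose_gen[OF this, of f UNIV] show ?thesis
   using assms(1) unfolding ebs_def o_def by simp
 qed
 ultimately show ?thesis using B unfolding ebs_def by blast
qed

lemma ebs_three_lines:
 assumes "ebs f" "\<And>z. Re z = 0 \<or> Re z = 1 ==> cmod (f z) \<le> M" "z \<in> strip"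
 shows "cmod (f z) \<le> M"
proof -
 obtain B where B: "\<And>z. z \<in> strip ==> cmod (f z) \<le> B" using assms(1) unfolding ebs_def by blast
 have h: "f holomorphic_on UNIV" using assms(1) by (simp add: ebs_def)
 show ?thesis
  using assms(2,3) B
  by (intro three_lines[of f B M z] holomorphic_on_imp_continuous_on[OF holomorphic_on_subset[OF h]]
    holomorphic_on_subset[OF h]) auto
qed

lemma sball_family:
 assumes "sball J \<theta> x"
 obtains X where "\<And>i j. i \<in> J ==> j \<in> J ==> X (complex_of_real \<theta>) i j = x i j"
  "\<And>z. sball J (Re z) (X z)" "\<And>i j. ebs (%z. X z i j)"
proof -
 obtain K \<rho> e f where "dyadic J \<theta> x K \<rho> e f"
  using assms unfolding sball_def by blast
 note * = dyadicD[OF this]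
 define X where "X = (%z i j. \<Sum>k\<in>K. complex_of_real (\<rho> k) powr z * e k i * cnj (f k j))"
 have "X (complex_of_real \<theta>) i j = x i j" if "i \<in> J" "j \<in> J" for i j
  unfolding X_def *(6)[OF that] using *(2) by (intro sum.cong refl) (simp add: of_real_powr)
 moreover have "sball J (Re z) (X z)" for z
  by (rule sball_coeffI[OF *(1-5)]) (auto simp: X_def norm_of_real_powr *(2))
 moreover have "ebs (%z. X z i j)" for i j
 proof -
  have "ebs (%z. complex_of_real (\<rho> k) powr z)" if "k \<in> K" for k
   using ebs_powr[OF *(2)[OF that], of 0 1] by simp
  thus ?thesis unfolding X_def by (intro ebs_sum ebs_mult ebs_const)
 qed
 ultimately show thesis by (rule that)
qed

lemma ebs_mm: "(\<And>i j. ebs (%z. X z i j)) ==> (\<And>i j. ebs (%z. Y z i j)) ==> ebs (%z. mm J (X z) (Y z) i j)"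
 unfolding mm_def by (intro ebs_sum ebs_mult)

lemma ebs_tr: "(\<And>i j. ebs (%z. X z i j)) ==> (\<And>i j. ebs (%z. Y z i j)) ==> ebs (%z. tr J (X z) (Y z))"
 unfolding tr_def by (intro ebs_sum ebs_mult)

lemma mm_cong:
 "(\<And>i j. i \<in> J ==> j \<in> J ==> x i j = x' i j) ==> (\<And>i j. i \<in> J ==> j \<in> J ==> y i j = y' i j) ==>
  i \<in> J ==> j \<in> J ==> mm J x y i j = mm J x' y' i j"
 by (auto simp: mm_def intro!: sum.cong)

text \<open>Hoelder's inequality: interpolation between \<open>\<parallel>ab\<parallel>\<^sub>\<theta> \<le> \<parallel>a\<parallel>\<^sub>\<infinity> \<parallel>b\<parallel>\<^sub>\<theta>\<close> and \<open>\<parallel>ab\<parallel>\<^sub>\<theta> \<le> \<parallel>a\<parallel>\<^sub>\<theta> \<parallel>b\<parallel>\<^sub>\<infinity>\<close>.\<close>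

lemma sball_mm_half:
 assumes th: "0 \<le> \<theta>" "\<theta> \<le> 1" and a: "sball J (\<theta>/2) a" and b: "sball J (\<theta>/2) b"
 shows "sb J \<theta> (mm J a b) 1"
 unfolding sb_def
proof (intro allI impI)
 fix w assume w: "sball J (1 - \<theta>) w"
 obtain A where A: "\<And>i j. i \<in> J ==> j \<in> J ==> A (complex_of_real (\<theta>/2)) i j = a i j"
  "\<And>z. sball J (Re z) (A z)" "\<And>i j. ebs (%z. A z i j)" by (rule sball_family[OF a]) (rule that)
 obtain B where B: "\<And>i j. i \<in> J ==> j \<in> J ==> B (complex_of_real (\<theta>/2)) i j = b i j"
  "\<And>z. sball J (Re z) (B z)" "\<And>i j. ebs (%z. B z i j)" by (rule sball_family[OF b]) (rule that)
 define A' where "A' = (%z. A (of_real 0 + of_real \<theta> * z))"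
 define B' where "B' = (%z. B (of_real \<theta> + of_real (-\<theta>) * z))"
 define f where "f = (%z. tr J (mm J (A' z) (B' z)) w)"
 have "ebs f" unfolding f_def A'_def B'_def using th A(3) B(3)
  by (intro ebs_tr ebs_mm ebs_const ebs_comp) auto
 moreover have "cmod (f z) \<le> 1" if "Re z = 0 \<or> Re z = 1" for z
 proof -
  have ra: "sball J (\<theta> * Re z) (A' z)" using A(2)[of "of_real 0 + of_real \<theta> * z"] by (simp add: A'_def)
  have rb: "sball J (\<theta> * (1 - Re z)) (B' z)"
   using B(2)[of "of_real \<theta> + of_real (-\<theta>) * z"] by (simp add: B'_def algebra_simps)
  have "sball J \<theta> (mm J (A' z) (B' z))"
   using that
  proof
   assume "Re z = 0"
   thus ?thesis using ra rb by (intro sball_mm_left[OF sball_0_contr]) auto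
  next
   assume "Re z = 1"
   thus ?thesis using ra rb by (intro sball_mm_right[OF sball_0_contr]) auto
  qed
  thus ?thesis unfolding f_def by (rule sball_pair[OF th _ w])
 qed
 ultimately have "cmod (f (1/2)) \<le> 1" by (rule ebs_three_lines) (auto intro: half_in_strip)
 moreover have "f (1/2) = tr J (mm J a b) w"
 proof -
  have e: "of_real 0 + of_real \<theta> * (1/2) = complex_of_real (\<theta>/2)" "of_real \<theta> + of_real (-\<theta>) * (1/2) = complex_of_real (\<theta>/2)"
   by simp_all
  show ?thesis unfolding f_def A'_def B'_def e by (intro tr_cong mm_cong A B refl)
 qed
 ultimately show "cmod (tr J (mm J a b) w) \<le> 1" by simp
qed

section \<open>Boundedness of triangular truncation on Schatten classes\<close>

definition trunc_rel :: "(nat => nat => bool) => ('i => nat) => 'i cmat => 'i cmat" where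
 "trunc_rel R \<phi> x = (%i j. if R (\<phi> i) (\<phi> j) then x i j else 0)"

text \<open>The truncation is graded by \<open>\<phi>\<close>, so that one bound covers both \<open>\<ell>\<^sup>2\<close> and its amplifications.\<close>

definition tri_bound :: "'i set => ('i => nat) => real => real => bool" where
 "tri_bound J \<phi> \<theta> C \<longleftrightarrow> (\<forall>R\<in>{(\<le>), (<)}. \<forall>x c. sb J \<theta> x c \<longrightarrow> sb J \<theta> (trunc_rel R \<phi> x) (C * c))"

lemma tri_boundD: "tri_bound J \<phi> \<theta> C ==> R \<in> {(\<le>), (<)} ==> sb J \<theta> x c ==> sb J \<theta> (trunc_rel R \<phi> x) (C * c)"
 unfolding tri_bound_def by blast

lemma tri_bound_half: assumes J: "finite J" shows "tri_bound J \<phi> (1/2) 1"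
 unfolding tri_bound_def
proof (intro ballI allI impI)
 fix R x c assume x: "sb J (1/2) x c"
 obtain \<kappa> x' where k: "0 \<le> \<kappa>" "\<kappa> \<le> c" "sball J (1/2) x'" "\<And>i j. i \<in> J ==> j \<in> J ==> x i j = of_real \<kappa> * x' i j"
  by (rule sb_sball[OF J x]) (auto intro: that)
 have "hs J x = \<kappa>\<^sup>2 * hs J x'"
  unfolding hs_def sum_distrib_left using k(4) by (intro sum.cong refl) (simp add: norm_mult power_mult_distrib)
 also have "... \<le> c\<^sup>2 * 1" using k sball_half_hs[OF k(3)] by (intro mult_mono power_mono) auto
 finally have "hs J x \<le> c\<^sup>2" by simp
 moreover have "hs J (trunc_rel R \<phi> x) \<le> hs J x"
  unfolding hs_def trunc_rel_def by (intro sum_mono) auto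
 ultimately show "sb J (1/2) (trunc_rel R \<phi> x) (1 * c)"
  using k by (intro hs_sb) auto
qed

lemma sb_exists: assumes "finite J" "\<theta> \<le> 1" shows "\<exists>c. sb J \<theta> x c"
proof -
 have "sb J \<theta> (trunc J x) (\<Sum>i\<in>J. \<Sum>j\<in>J. cmod (x i j))"
  using sbf_trunc_finite[OF assms, of x] assms(1) unfolding sbf_def by blast
 thus ?thesis using sb_cong[of J "trunc J x" x \<theta>] by (auto simp: trunc_def)
qed

text \<open>Cotlar's argument. Let \<open>u\<close> be the truncation of \<open>x\<close> and \<open>l = x - u\<close>. Then \<open>u l\<^sup>*\<close> is strictly upper
 triangular, so \<open>u u\<^sup>* = u x\<^sup>* - u l\<^sup>*\<close> and \<open>u x\<^sup>*\<close> have the same lower triangle; as \<open>u u\<^sup>*\<close> is self-adjoint, it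
 is a sum of two truncations of \<open>u x\<^sup>*\<close>. Hence \<open>\<parallel>u\<parallel>\<^sup>2\<^sub>2\<^sub>p = \<parallel>u u\<^sup>*\<parallel>\<^sub>p \<le> 2C \<parallel>u x\<^sup>*\<parallel>\<^sub>p \<le> 2C \<parallel>u\<parallel>\<^sub>2\<^sub>p \<parallel>x\<parallel>\<^sub>2\<^sub>p\<close>.\<close>

lemma cotlar_identity:
 fixes x :: "'i cmat" and \<phi> :: "'i => nat" and J :: "'i set"
 assumes R: "R \<in> {(\<le>), (<)}"
 defines "u \<equiv> trunc_rel R \<phi> x"
 defines "q \<equiv> mm J u (adj x)"
 shows "mm J u (adj u) i j = adj (trunc_rel (\<le>) \<phi> (adj q)) i j + trunc_rel (<) \<phi> (adj q) i j"
proof -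
 have low: "mm J u (adj u) i j = q i j" if "\<phi> j \<le> \<phi> i" for i j
  unfolding q_def mm_def
 proof (rule sum.cong[OF refl])
  fix k
  show "u i k * adj u k j = u i k * adj x k j"
   using that R by (auto simp: u_def trunc_rel_def adj_def)
 qed
 have sym: "mm J u (adj u) i j = cnj (mm J u (adj u) j i)" for i j
  by (simp add: mm_def adj_def mult.commute)
 show ?thesis
 proof (cases "\<phi> j \<le> \<phi> i")
  case True
  thus ?thesis using low[OF True] by (simp add: trunc_rel_def adj_def)
 next
  case False
  thus ?thesis using low[of i j] sym[of i j] by (simp add: trunc_rel_def adj_def)
 qed
qed

lemma tri_bound_double:
 assumes J: "finite J" and th: "0 < \<theta>" "\<theta> \<le> 1" and T: "tri_bound J \<phi> \<theta> C"
 shows "tri_bound J \<phi> (\<theta>/2) (2 * C)"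
 unfolding tri_bound_def
proof (intro ballI allI impI)
 fix R x c assume R: "R \<in> {(\<le>) :: nat => nat => bool, (<)}" and x: "sb J (\<theta>/2) x c"
 define u where "u = trunc_rel R \<phi> x"
 obtain c0 where c0: "sb J (\<theta>/2) u c0" using sb_exists[OF J, of "\<theta>/2" u] th by auto
 have th2: "0 < \<theta>/2" using th by simp
 obtain K \<rho> g h \<kappa> where K: "finite K" "\<And>k. k \<in> K ==> 0 < (\<rho> :: nat => real) k" "K \<noteq> {} ==> sum \<rho> K = 1" "sum \<rho> K \<le> 1"
  "\<And>k l. k \<in> K ==> l \<in> K ==> ip J (g k) (g l) = (if k = l then 1 else 0)"
  "\<And>k l. k \<in> K ==> l \<in> K ==> ip J (h k) (h l) = (if k = l then 1 else 0)"
  "0 \<le> \<kappa>" "\<kappa> \<le> c0" "K = {} ==> \<kappa> = 0" "K \<noteq> {} ==> 0 < \<kappa>"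
  "\<And>i j. i \<in> J ==> j \<in> J ==> u i j = of_real \<kappa> * (\<Sum>k\<in>K. of_real (\<rho> k powr (\<theta>/2)) * g k i * cnj (h k j))"
  by (rule schatten_normal_form[OF J c0 th2]) (rule that)
 define u0 where "u0 = (%i j. \<Sum>k\<in>K. complex_of_real (\<rho> k powr (\<theta>/2)) * g k i * cnj (h k j))"
 have bg: "bessel J K g" and bh: "bessel J K h" using orthonormal_bessel[OF K(5,1)] orthonormal_bessel[OF K(6,1)] by auto
 have u0: "sball J (\<theta>/2) u0" by (rule sballI[OF K(1,2,4) bg bh]) (auto simp: u0_def)
 have uu0: "u i j = of_real \<kappa> * u0 i j" if "i \<in> J" "j \<in> J" for i j using K(11)[OF that] by (simp add: u0_def)
 obtain \<kappa>' x0 where k': "0 \<le> \<kappa>'" "\<kappa>' \<le> c" "sball J (\<theta>/2) x0" "\<And>i j. i \<in> J ==> j \<in> J ==> x i j = of_real \<kappa>' * x0 i j"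
  by (rule sb_sball[OF J x th2]) (rule that)
 define q where "q = mm J u (adj x)"
 have "sb J \<theta> (%i j. complex_of_real (\<kappa> * \<kappa>') * mm J u0 (adj x0) i j) (cmod (of_real (\<kappa> * \<kappa>')) * 1)"
  using th u0 sball_adj[OF k'(3)] by (intro sb_mult sball_mm_half) auto
 moreover have "complex_of_real (\<kappa> * \<kappa>') * mm J u0 (adj x0) i j = q i j" if "i \<in> J" "j \<in> J" for i j
  using that unfolding q_def mm_def sum_distrib_left
  by (intro sum.cong refl) (simp add: uu0 k'(4) adj_def mult_ac)
 ultimately have "sb J \<theta> q (cmod (of_real (\<kappa> * \<kappa>')) * 1)"
  using sb_cong[of J "%i j. complex_of_real (\<kappa> * \<kappa>') * mm J u0 (adj x0) i j" q] by simp
 hence q: "sb J \<theta> (adj q) (\<kappa> * \<kappa>')" using K(7) k'(1) by (auto intro: sb_adj simp: norm_mult)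
 define W where "W = (%i j. \<Sum>k\<in>K. complex_of_real (\<rho> k powr (1-\<theta>)) * g k i * cnj (g k j))"
 have W: "sball J (1-\<theta>) W" by (rule sballI[OF K(1,2,4) bg bg]) (auto simp: W_def)
 have "sb J \<theta> (%i j. adj (trunc_rel (\<le>) \<phi> (adj q)) i j + trunc_rel (<) \<phi> (adj q) i j) (C * (\<kappa> * \<kappa>') + C * (\<kappa> * \<kappa>'))"
  by (intro sb_add sb_adj tri_boundD[OF T _ q]) auto
 also have "(%i j. adj (trunc_rel (\<le>) \<phi> (adj q)) i j + trunc_rel (<) \<phi> (adj q) i j) = mm J u (adj u)"
  unfolding q_def u_def by (intro ext cotlar_identity[OF R, symmetric])
 finally have 1: "cmod (tr J (mm J u (adj u)) W) \<le> C * (\<kappa> * \<kappa>') + C * (\<kappa> * \<kappa>')"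
  using W by (simp add: sb_def)
 have mvu: "mv J (adj u) (g k) i = of_real (\<kappa> * \<rho> k powr (\<theta>/2)) * h k i" if k: "k \<in> K" and i: "i \<in> J" for k i
 proof -
  have "mv J (adj u) (g k) i = (\<Sum>j\<in>J. cnj (of_real \<kappa> * u0 j i) * g k j)"
   unfolding mv_def adj_def using uu0 i by (intro sum.cong refl) simp
  also have "... = of_real \<kappa> * mv J (%i j. \<Sum>k\<in>K. complex_of_real (\<rho> k powr (\<theta>/2)) * h k i * cnj (g k j)) (g k) i"
   by (simp add: mv_def u0_def sum_distrib_left mult_ac)
  also have "... = of_real \<kappa> * (\<Sum>l\<in>K. (complex_of_real (\<rho> l powr (\<theta>/2)) * ip J (g k) (g l)) * h l i)"
   by (simp add: mv_dyads)
  also have "(\<Sum>l\<in>K. (complex_of_real (\<rho> l powr (\<theta>/2)) * ip J (g k) (g l)) * h l i)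
    = (\<Sum>l\<in>K. if k = l then complex_of_real (\<rho> l powr (\<theta>/2)) * h l i else 0)"
   using K(5)[OF k] by (intro sum.cong refl) auto
  finally show ?thesis using K(1) k by simp
 qed
 have "ip J (mv J (mm J u (adj u)) (g k)) (g k) = of_real (\<kappa>\<^sup>2 * \<rho> k powr \<theta>)" if k: "k \<in> K" for k
 proof -
  have "ip J (mv J (mm J u (adj u)) (g k)) (g k) = ip J (mv J (adj u) (g k)) (mv J (adj u) (g k))"
   by (simp add: mv_mm ip_mv[of J u])
  also have "... = ip J (%i. of_real (\<kappa> * \<rho> k powr (\<theta>/2)) * h k i) (%i. of_real (\<kappa> * \<rho> k powr (\<theta>/2)) * h k i)"
   using mvu[OF k] by (intro ip_cong) auto
  also have "... = of_real ((\<kappa> * \<rho> k powr (\<theta>/2)) * (\<kappa> * \<rho> k powr (\<theta>/2)))"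
   using K(6)[OF k k] by (simp add: ip_mult_left ip_mult_right)
  also have "(\<kappa> * \<rho> k powr (\<theta>/2)) * (\<kappa> * \<rho> k powr (\<theta>/2)) = \<kappa>\<^sup>2 * (\<rho> k powr (\<theta>/2) * \<rho> k powr (\<theta>/2))"
   by (simp add: power2_eq_square)
  also have "\<rho> k powr (\<theta>/2) * \<rho> k powr (\<theta>/2) = \<rho> k powr \<theta>" by (simp flip: powr_add)
  finally show ?thesis .
 qed
 hence "tr J (mm J u (adj u)) W = (\<Sum>k\<in>K. complex_of_real (\<rho> k powr (1-\<theta>)) * of_real (\<kappa>\<^sup>2 * \<rho> k powr \<theta>))"
  unfolding W_def tr_dyads by (intro sum.cong refl) simp
 also have "... = (\<Sum>k\<in>K. of_real (\<kappa>\<^sup>2 * \<rho> k))"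
 proof (intro sum.cong refl)
  fix k assume k: "k \<in> K"
  have "\<rho> k powr (1-\<theta>) * (\<kappa>\<^sup>2 * \<rho> k powr \<theta>) = \<kappa>\<^sup>2 * (\<rho> k powr (1-\<theta>) * \<rho> k powr \<theta>)" by simp
  also have "... = \<kappa>\<^sup>2 * \<rho> k" using K(2)[OF k] by (simp flip: powr_add)
  finally show "complex_of_real (\<rho> k powr (1-\<theta>)) * of_real (\<kappa>\<^sup>2 * \<rho> k powr \<theta>) = of_real (\<kappa>\<^sup>2 * \<rho> k)"
   by (metis of_real_mult)
 qed
 also have "... = complex_of_real (\<kappa>\<^sup>2 * sum \<rho> K)" by (simp add: sum_distrib_left)
 also have "\<kappa>\<^sup>2 * sum \<rho> K = \<kappa>\<^sup>2" using K(3,9) by (cases "K = {}") auto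
 finally have "\<kappa>\<^sup>2 \<le> C * (\<kappa> * \<kappa>') + C * (\<kappa> * \<kappa>')" using 1 by (simp add: norm_power)
 hence k2: "\<kappa>\<^sup>2 \<le> (2 * C * \<kappa>') * \<kappa>" by (simp add: algebra_simps)
 have "\<kappa> \<le> 2 * C * c"
 proof (cases "\<kappa> = 0")
  case True
  have "sb J \<theta> (trunc_rel (\<le>) \<phi> (%i j. 0)) (C * c)"
   using sb_nonneg[OF x] by (intro tri_boundD[OF T]) (auto simp: sb_def tr_def)
  from sb_nonneg[OF this] show ?thesis using True by simp
 next
  case False
  hence kp: "\<kappa> > 0" using K(7) by simp
  hence "\<kappa> \<le> 2 * C * \<kappa>'" using k2 by (simp add: power2_eq_square)
  moreover have "0 \<le> C"
  proof (rule ccontr)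
   assume "\<not> 0 \<le> C"
   hence "2 * C * \<kappa>' \<le> 0" using k'(1) by (simp add: mult_nonpos_nonneg)
   thus False using \<open>\<kappa> \<le> 2 * C * \<kappa>'\<close> kp by simp
  qed
  ultimately show ?thesis using k'(2) mult_left_mono[of \<kappa>' c "2 * C"] by linarith
 qed
 moreover have "sb J (\<theta>/2) (%i j. of_real \<kappa> * u0 i j) (cmod (of_real \<kappa>) * 1)"
  using th by (intro sb_mult sball_sb u0) auto
 ultimately have "sb J (\<theta>/2) (%i j. of_real \<kappa> * u0 i j) (2 * C * c)"
  using K(7) by (auto elim: sb_mono_const)
 thus "sb J (\<theta>/2) (trunc_rel R \<phi> x) (2 * C * c)"
  using sb_cong[of J u "%i j. of_real \<kappa> * u0 i j" "\<theta>/2"] uu0 by (simp add: u_def)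
qed

lemma tri_bound_powers: assumes "finite J" shows "tri_bound J \<phi> (1 / 2 ^ Suc n) (2 ^ n)"
proof (induction n)
 case 0
 show ?case using tri_bound_half[OF assms] by simp
next
 case (Suc n)
 have "(1/2::real) ^ Suc n \<le> 1" by (rule power_le_one) auto
 hence "1 / 2 ^ Suc n \<le> (1::real)" by (simp add: power_one_over)
 from tri_bound_double[OF assms _ this Suc] show ?case by (simp add: field_simps)
qed

lemma tr_trunc_rel: "tr J (trunc_rel R \<phi> x) w = tr J x (adj (trunc_rel R \<phi> (adj w)))"
 unfolding tr_def trunc_rel_def adj_def by (intro sum.cong refl) auto

lemma tri_bound_interpolate:
 assumes J: "finite J" and T: "tri_bound J \<phi> \<theta>\<^sub>0 C"
  and t0: "0 < \<theta>\<^sub>0" "\<theta>\<^sub>0 < 1/2" and th: "\<theta>\<^sub>0 \<le> \<theta>" "\<theta> \<le> 1 - \<theta>\<^sub>0"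
 shows "tri_bound J \<phi> \<theta> C"
 unfolding tri_bound_def
proof (intro ballI allI impI)
 fix R x c assume R: "R \<in> {(\<le>) :: nat => nat => bool, (<)}" and x: "sb J \<theta> x c"
 have thp: "0 < \<theta>" "\<theta> < 1" using t0 th by auto
 obtain \<kappa> x0 where k: "0 \<le> \<kappa>" "\<kappa> \<le> c" "sball J \<theta> x0" "\<And>i j. i \<in> J ==> j \<in> J ==> x i j = of_real \<kappa> * x0 i j"
  by (rule sb_sball[OF J x thp(1)]) (rule that)
 obtain X where X: "\<And>i j. i \<in> J ==> j \<in> J ==> X (complex_of_real \<theta>) i j = x0 i j"
  "\<And>z. sball J (Re z) (X z)" "\<And>i j. ebs (%z. X z i j)" by (rule sball_family[OF k(3)]) (rule that)
 show "sb J \<theta> (trunc_rel R \<phi> x) (C * c)"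
  unfolding sb_def
 proof (intro allI impI)
  fix w assume w: "sball J (1 - \<theta>) w"
  obtain W where W: "\<And>i j. i \<in> J ==> j \<in> J ==> W (complex_of_real (1-\<theta>)) i j = w i j"
   "\<And>z. sball J (Re z) (W z)" "\<And>i j. ebs (%z. W z i j)" by (rule sball_family[OF w]) (rule that)
  define X' where "X' = (%z. X (of_real \<theta>\<^sub>0 + of_real (1 - 2*\<theta>\<^sub>0) * z))"
  define W' where "W' = (%z. W (of_real (1 - \<theta>\<^sub>0) + of_real (-(1 - 2*\<theta>\<^sub>0)) * z))"
  define f where "f = (%z. tr J (trunc_rel R \<phi> (X' z)) (W' z))"
  have eX: "ebs (%z. trunc_rel R \<phi> (X' z) i j)" for i j
  proof (cases "R (\<phi> i) (\<phi> j)")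
   case True
   have "ebs (%z. X (of_real \<theta>\<^sub>0 + of_real (1 - 2*\<theta>\<^sub>0) * z) i j)" using t0 by (intro ebs_comp X(3)) auto
   thus ?thesis using True by (simp add: trunc_rel_def X'_def)
  qed (simp add: trunc_rel_def ebs_const)
  have "ebs f" unfolding f_def W'_def using t0 W(3)
   by (intro ebs_tr eX ebs_comp) auto
  moreover have "cmod (f z) \<le> C" if z: "Re z = 0 \<or> Re z = 1" for z
  proof -
   have rX: "sball J (\<theta>\<^sub>0 + (1 - 2*\<theta>\<^sub>0) * Re z) (X' z)" using X(2)[of "of_real \<theta>\<^sub>0 + of_real (1 - 2*\<theta>\<^sub>0) * z"] by (simp add: X'_def)
   have rW: "sball J (1 - \<theta>\<^sub>0 - (1 - 2*\<theta>\<^sub>0) * Re z) (W' z)"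
    using W(2)[of "of_real (1 - \<theta>\<^sub>0) + of_real (-(1 - 2*\<theta>\<^sub>0)) * z"] by (simp add: W'_def algebra_simps)
   from z show ?thesis
   proof
    assume z: "Re z = 0"
    have "sb J \<theta>\<^sub>0 (X' z) 1" using rX z t0 by (intro sball_sb) auto
    hence "sb J \<theta>\<^sub>0 (trunc_rel R \<phi> (X' z)) (C * 1)" by (rule tri_boundD[OF T R])
    thus ?thesis using rW z by (simp add: f_def sb_def)
   next
    assume z: "Re z = 1"
    have "sball J \<theta>\<^sub>0 (W' z)" using rW z by simp
    hence "sb J \<theta>\<^sub>0 (adj (W' z)) 1" using t0 by (intro sb_adj sball_sb) auto
    hence "sb J \<theta>\<^sub>0 (adj (trunc_rel R \<phi> (adj (W' z)))) (C * 1)" by (rule sb_adj[OF tri_boundD[OF T R]])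
    moreover have "sball J (1 - \<theta>\<^sub>0) (X' z)" using rX z by simp
    ultimately show ?thesis unfolding f_def tr_trunc_rel by (subst tr_commute) (simp add: sb_def)
   qed
  qed
  moreover define z0 where "z0 = complex_of_real ((\<theta> - \<theta>\<^sub>0) / (1 - 2*\<theta>\<^sub>0))"
  moreover have "z0 \<in> strip" using t0 th by (simp add: z0_def strip_def divide_le_eq_1)
  ultimately have "cmod (f z0) \<le> C" using ebs_three_lines by blast
  moreover have "f z0 = tr J (trunc_rel R \<phi> x0) w"
  proof -
   have m: "complex_of_real (1 - 2*\<theta>\<^sub>0) * z0 = of_real (\<theta> - \<theta>\<^sub>0)"
    unfolding z0_def of_real_mult[symmetric] of_real_eq_iff using t0 by simp
   have e: "of_real \<theta>\<^sub>0 + of_real (1 - 2*\<theta>\<^sub>0) * z0 = complex_of_real \<theta>" unfolding m by simp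
   have e': "of_real (1 - \<theta>\<^sub>0) + of_real (-(1 - 2*\<theta>\<^sub>0)) * z0 = complex_of_real (1 - \<theta>)"
    unfolding of_real_minus minus_mult_left[symmetric] m by simp
   show ?thesis unfolding f_def X'_def W'_def e e' trunc_rel_def by (rule tr_cong) (simp_all only: X(1) W(1))
  qed
  ultimately have b: "cmod (tr J (trunc_rel R \<phi> x0) w) \<le> C" by simp
  have "tr J (trunc_rel R \<phi> x) w = tr J (%i j. of_real \<kappa> * trunc_rel R \<phi> x0 i j) w"
   by (intro tr_cong) (auto simp: trunc_rel_def k(4))
  hence "cmod (tr J (trunc_rel R \<phi> x) w) = \<kappa> * cmod (tr J (trunc_rel R \<phi> x0) w)"
   using k(1) by (simp add: tr_mult_left norm_mult)
  also have "... \<le> c * C" using b k by (intro mult_mono) auto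
  finally show "cmod (tr J (trunc_rel R \<phi> x) w) \<le> C * c" by (simp add: mult.commute)
 qed
qed

text \<open>On \<open>S\<^sup>2\<close> truncation is a projection. Halving \<open>\<theta>\<close> reaches exponents near \<open>0\<close>, duality
 those near \<open>1\<close>, and interpolation everything in between.\<close>

theorem triangular_truncation_bounded:
 assumes "0 < \<theta>" "\<theta> < 1"
 shows "\<exists>C. \<forall>(J :: 'i set) \<phi>. finite J \<longrightarrow> tri_bound J \<phi> \<theta> C"
proof -
 obtain n where n: "(1/2) ^ n < min \<theta> (1 - \<theta>)"
  using real_arch_pow_inv[of "min \<theta> (1-\<theta>)" "1/2"] assms by auto
 define \<theta>\<^sub>0 :: real where "\<theta>\<^sub>0 = 1 / 2 ^ Suc (Suc n)"
 have e: "\<theta>\<^sub>0 = (1/2)^n / 4" by (simp add: \<theta>\<^sub>0_def power_one_over)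
 have p: "0 < (1/2::real)^n" "(1/2::real)^n \<le> 1" by (simp_all add: power_le_one)
 have t0: "0 < \<theta>\<^sub>0" "\<theta>\<^sub>0 < 1/2" "\<theta>\<^sub>0 \<le> \<theta>" "\<theta> \<le> 1 - \<theta>\<^sub>0" using n p unfolding e min_less_iff_conj by linarith+
 have "tri_bound J \<phi> \<theta> (2 ^ Suc n)" if J: "finite J" for J :: "'i set" and \<phi>
  using tri_bound_powers[OF J, of \<phi> "Suc n"] by (intro tri_bound_interpolate[OF J _ t0]) (simp add: \<theta>\<^sub>0_def)
 thus ?thesis by blast
qed

section \<open>Amplification and the interpolation inequality\<close>

text \<open>\<open>a \<otimes> 1\<close>\<close>

definition amp :: "nat cmat => (nat \<times> 'k) cmat" where
 "amp a = (%p q. if snd p = snd q then a (fst p) (fst q) else 0)"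

lemma sq_prod: "sq (I \<times> L) \<xi> = (\<Sum>l\<in>L. sq I (%i. \<xi> (i, l)))"
 unfolding sq_def by (subst sum.swap) (simp add: sum.cartesian_product)

lemma mv_amp:
 assumes "finite L" "l \<in> L" shows "mv (I \<times> L) (amp a) \<xi> (i, l) = mv I a (%j. \<xi> (j, l)) i"
proof -
 have "mv (I \<times> L) (amp a) \<xi> (i, l) = (\<Sum>j\<in>I. \<Sum>l'\<in>L. if l' = l then a i j * \<xi> (j, l) else 0)"
  unfolding mv_def by (subst sum.cartesian_product, intro sum.cong refl) (auto simp: amp_def)
 also have "... = (\<Sum>j\<in>I. a i j * \<xi> (j, l))" using assms by simp
 finally show ?thesis by (simp add: mv_def)
qed

lemma contr_amp: assumes "finite L" "contr I a" shows "contr (I \<times> L) (amp a)"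
 unfolding contr_def
proof
 fix \<xi> :: "nat \<times> 'a => complex"
 have "sq (I \<times> L) (mv (I \<times> L) (amp a) \<xi>) = (\<Sum>l\<in>L. sq I (mv I a (%j. \<xi> (j, l))))"
  unfolding sq_prod using assms by (intro sum.cong refl) (simp add: mv_amp)
 also have "... \<le> (\<Sum>l\<in>L. sq I (%j. \<xi> (j, l)))"
  using assms(2) unfolding contr_def by (intro sum_mono) blast
 finally show "sq (I \<times> L) (mv (I \<times> L) (amp a) \<xi>) \<le> sq (I \<times> L) \<xi>" by (simp add: sq_prod)
qed

lemma adj_amp: "adj (amp a) = amp (adj a)"
 by (auto simp: adj_def amp_def fun_eq_iff)

lemma mm_amp:
 assumes "finite L" "p \<in> I \<times> L" "q \<in> I \<times> L"
 shows "mm (I \<times> L) (amp a) (amp b) p q = amp (mm I a b) p q"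
proof -
 obtain i k where p: "p = (i, k)" "k \<in> L" using assms by (cases p) auto
 obtain j l where q: "q = (j, l)" "l \<in> L" using assms by (cases q) auto
 have "mm (I \<times> L) (amp a) (amp b) p q = (\<Sum>i'\<in>I. \<Sum>k'\<in>L. if k' = k then (if k = l then a i i' * b i' j else 0) else 0)"
  unfolding mm_def p q by (subst sum.cartesian_product, intro sum.cong refl) (auto simp: amp_def)
 also have "... = (\<Sum>i'\<in>I. if k = l then a i i' * b i' j else 0)" using assms(1) p by simp
 finally show ?thesis by (simp add: amp_def mm_def p q)
qed

text \<open>The norm of \<open>M\<^sub>n(S\<^sup>1)\<close> on finite matrices: \<open>|Tr ((A \<otimes> 1) x (B \<otimes> 1) W)| \<le> c\<close> for Hilbert-Schmidt contractions
 \<open>A\<close>, \<open>B\<close> and contractions \<open>W\<close>.\<close>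

definition s1b :: "nat set => 'k set => (nat \<times> 'k) cmat => real => bool" where
 "s1b I L x c \<longleftrightarrow> (\<forall>A B W. hs I A \<le> 1 \<longrightarrow> hs I B \<le> 1 \<longrightarrow> contr (I \<times> L) W \<longrightarrow>
   cmod (tr (I \<times> L) (mm (I \<times> L) (amp A) (mm (I \<times> L) x (amp B))) W) \<le> c)"

text \<open>What membership in \<open>interp_functions\<close> gives for single matrix entries.\<close>

definition sok :: "(complex => complex) => bool" where
 "sok f \<longleftrightarrow> continuous_on strip f \<and> f holomorphic_on interior strip \<and> (\<exists>B. \<forall>z\<in>strip. cmod (f z) \<le> B)"

lemma ebs_sok: "ebs f ==> sok f"
 unfolding ebs_def sok_def using holomorphic_on_subset holomorphic_on_imp_continuous_on subset_UNIV by metis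

lemma sok_add: assumes "sok f" "sok g" shows "sok (%z. f z + g z)"
proof -
 obtain B C where "\<forall>z\<in>strip. cmod (f z) \<le> B" "\<forall>z\<in>strip. cmod (g z) \<le> C" using assms by (auto simp: sok_def)
 hence "\<forall>z\<in>strip. cmod (f z + g z) \<le> B + C" by (meson add_mono norm_triangle_le)
 thus ?thesis using assms unfolding sok_def by (blast intro: holomorphic_on_add continuous_on_add)
qed

lemma sok_mult: assumes "sok f" "sok g" shows "sok (%z. f z * g z)"
proof -
 obtain B C where BC: "\<forall>z\<in>strip. cmod (f z) \<le> B" "\<forall>z\<in>strip. cmod (g z) \<le> C" using assms by (auto simp: sok_def)
 have "cmod (f z * g z) \<le> \<bar>B\<bar> * \<bar>C\<bar>" if "z \<in> strip" for z
  unfolding norm_mult using BC that by (intro mult_mono) (auto intro: order_trans)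
 thus ?thesis using assms unfolding sok_def by (blast intro: holomorphic_on_mult continuous_on_mult)
qed

lemma sok_sum: "(\<And>k. k \<in> K ==> sok (f k)) ==> sok (%z. \<Sum>k\<in>K. f k z)"
 by (induction K rule: infinite_finite_induct) (auto intro: ebs_sok ebs_const sok_add)

lemma sok_mm: "(\<And>i j. sok (%z. X z i j)) ==> (\<And>i j. sok (%z. Y z i j)) ==> sok (%z. mm J (X z) (Y z) i j)"
 unfolding mm_def by (intro sok_sum sok_mult)

lemma sok_tr: "(\<And>i j. sok (%z. X z i j)) ==> (\<And>i j. sok (%z. Y z i j)) ==> sok (%z. tr J (X z) (Y z))"
 unfolding tr_def by (intro sok_sum sok_mult)

lemma sok_three_lines:
 assumes "sok f" "\<And>z. Re z = 0 \<or> Re z = 1 ==> cmod (f z) \<le> M" "z \<in> strip"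
 shows "cmod (f z) \<le> M"
proof -
 obtain B where B: "\<And>z. z \<in> strip ==> cmod (f z) \<le> B" using assms(1) unfolding sok_def by blast
 show ?thesis using assms(1) B by (intro three_lines[of f B M z] assms(2,3)) (auto simp: sok_def)
qed

lemma ebs_amp: "(\<And>i j. ebs (%z. A z i j)) ==> ebs (%z. amp (A z) p q)"
 unfolding amp_def by (cases "snd p = snd q") (auto intro: ebs_const)

lemma of_real_in_strip: "0 \<le> t ==> t \<le> 1 ==> complex_of_real t \<in> strip"
 by (simp add: strip_def)

text \<open>Multiplying by the \<open>S\<^sup>2\<^sup>p\<close> balls of \<open>M\<^sub>n\<close> maps the interpolation space of the couple
 \<open>(M\<^sub>n(S\<^sup>\<infinity>), M\<^sub>n(S\<^sup>1))\<close> into \<open>S\<^sup>p\<close>.\<close>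

lemma interpolation_lower:
 assumes I: "finite I" and L: "finite L" and th: "0 < \<theta>" "\<theta> < 1"
  and F: "\<And>i j. sok (%z. F z i j)"
  and F0: "\<And>z. Re z = 0 ==> sb (I \<times> L) 0 (F z) c"
  and F1: "\<And>z. Re z = 1 ==> s1b I L (F z) c"
  and a: "sball I (\<theta>/2) a" and b: "sball I (\<theta>/2) b"
 shows "sb (I \<times> L) \<theta> (mm (I \<times> L) (amp a) (mm (I \<times> L) (F (of_real \<theta>)) (amp b))) c"
 unfolding sb_def
proof (intro allI impI)
 let ?J = "I \<times> L"
 fix w assume w: "sball ?J (1 - \<theta>) w"
 obtain A where A: "\<And>i j. i \<in> I ==> j \<in> I ==> A (complex_of_real (\<theta>/2)) i j = a i j"
  "\<And>z. sball I (Re z) (A z)" "\<And>i j. ebs (%z. A z i j)" by (rule sball_family[OF a]) (rule that)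
 obtain B where B: "\<And>i j. i \<in> I ==> j \<in> I ==> B (complex_of_real (\<theta>/2)) i j = b i j"
  "\<And>z. sball I (Re z) (B z)" "\<And>i j. ebs (%z. B z i j)" by (rule sball_family[OF b]) (rule that)
 obtain W where W: "\<And>i j. i \<in> ?J ==> j \<in> ?J ==> W (complex_of_real (1-\<theta>)) i j = w i j"
  "\<And>z. sball ?J (Re z) (W z)" "\<And>i j. ebs (%z. W z i j)" by (rule sball_family[OF w]) (rule that)
 define A' where "A' = (%z. A (of_real 0 + of_real (1/2) * z))"
 define B' where "B' = (%z. B (of_real 0 + of_real (1/2) * z))"
 define W' where "W' = (%z. W (of_real 1 + of_real (-1) * z))"
 define f where "f = (%z. tr ?J (mm ?J (amp (A' z)) (mm ?J (F z) (amp (B' z)))) (W' z))"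
 have "sok f" unfolding f_def A'_def B'_def W'_def
  by (intro sok_tr sok_mm F ebs_sok ebs_amp ebs_comp A(3) B(3) W(3)) auto
 moreover have "cmod (f z) \<le> c" if z: "Re z = 0 \<or> Re z = 1" for z
 proof -
  have rA: "sball I (Re z / 2) (A' z)" using A(2)[of "of_real 0 + of_real (1/2) * z"] by (simp add: A'_def)
  have rB: "sball I (Re z / 2) (B' z)" using B(2)[of "of_real 0 + of_real (1/2) * z"] by (simp add: B'_def)
  have rW: "sball ?J (1 - Re z) (W' z)" using W(2)[of "of_real 1 + of_real (-1) * z"] by (simp add: W'_def)
  from z show ?thesis
  proof
   assume z: "Re z = 0"
   have "sb ?J 0 (mm ?J (amp (A' z)) (mm ?J (F z) (amp (B' z)))) c"
    using rA rB z by (intro sb_mm_left sb_mm_right contr_amp L sball_0_contr F0) auto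
   thus ?thesis using rW z by (simp add: f_def sb_def)
  next
   assume z: "Re z = 1"
   have "hs I (A' z) \<le> 1" "hs I (B' z) \<le> 1" "contr ?J (W' z)"
    using rA rB rW z by (auto intro: sball_half_hs sball_0_contr)
   thus ?thesis using F1[OF z] unfolding f_def s1b_def by blast
  qed
 qed
 ultimately have "cmod (f (of_real \<theta>)) \<le> c"
  by (rule sok_three_lines) (use th in \<open>auto intro: of_real_in_strip\<close>)
 moreover have "f (of_real \<theta>) = tr ?J (mm ?J (amp a) (mm ?J (F (of_real \<theta>)) (amp b))) w"
 proof -
  have e: "of_real 0 + of_real (1/2) * complex_of_real \<theta> = complex_of_real (\<theta>/2)"
   "of_real 1 + of_real (-1) * complex_of_real \<theta> = complex_of_real (1-\<theta>)" by simp_all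
  have aA: "amp (A (complex_of_real (\<theta>/2))) p q = amp a p q" if "p \<in> ?J" "q \<in> ?J" for p q
   using that A(1) by (auto simp: amp_def)
  have bB: "amp (B (complex_of_real (\<theta>/2))) p q = amp b p q" if "p \<in> ?J" "q \<in> ?J" for p q
   using that B(1) by (auto simp: amp_def)
  show ?thesis unfolding f_def A'_def B'_def W'_def e by (intro tr_cong mm_cong aA bB W(1) refl)
 qed
 ultimately show "cmod (tr ?J (mm ?J (amp a) (mm ?J (F (of_real \<theta>)) (amp b))) w) \<le> c" by simp
qed

section \<open>Perturbation of the norm of \<open>S\<^sup>2\<^sup>p\<close>\<close>

lemma schatten_normal_form1:
 assumes J: "finite J" and x: "sb J \<theta> x 1" and th: "0 < \<theta>"
 obtains K \<rho> u v where "finite K" "\<And>k. k \<in> K ==> 0 < (\<rho> :: nat => real) k" "sum \<rho> K \<le> 1"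
  "\<And>k l. k \<in> K ==> l \<in> K ==> ip J (u k) (u l) = (if k = l then 1 else 0)"
  "\<And>k l. k \<in> K ==> l \<in> K ==> ip J (v k) (v l) = (if k = l then 1 else 0)"
  "\<And>i j. i \<in> J ==> j \<in> J ==> x i j = (\<Sum>k\<in>K. of_real (\<rho> k powr \<theta>) * u k i * cnj (v k j))"
proof -
 obtain K \<rho> u v \<kappa> where K: "finite K" "\<And>k. k \<in> K ==> 0 < (\<rho> :: nat => real) k" "K \<noteq> {} ==> sum \<rho> K = 1" "sum \<rho> K \<le> 1"
  "\<And>k l. k \<in> K ==> l \<in> K ==> ip J (u k) (u l) = (if k = l then 1 else 0)"
  "\<And>k l. k \<in> K ==> l \<in> K ==> ip J (v k) (v l) = (if k = l then 1 else 0)"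
  "0 \<le> \<kappa>" "\<kappa> \<le> 1" "K = {} ==> \<kappa> = 0" "K \<noteq> {} ==> 0 < \<kappa>"
  "\<And>i j. i \<in> J ==> j \<in> J ==> x i j = of_real \<kappa> * (\<Sum>k\<in>K. of_real (\<rho> k powr \<theta>) * u k i * cnj (v k j))"
  by (rule schatten_normal_form[OF J x th]) (rule that)
 define s where "s = \<kappa> powr (1/\<theta>)"
 have s1: "s \<le> 1" using K(7,8) th by (simp add: s_def powr_le1)
 have st: "s powr \<theta> = \<kappa>" if "K \<noteq> {}" using K(10)[OF that] th by (simp add: s_def powr_powr)
 have s0: "0 < s" if "k \<in> K" for k using K(10) that by (auto simp: s_def)
 show thesis
 proof (rule that[OF K(1) _ _ K(5,6), of "%k. s * \<rho> k"])
  show "0 < s * \<rho> k" if "k \<in> K" for k using s0[OF that] K(2)[OF that] by simp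
  have "sum (%k. s * \<rho> k) K = s * sum \<rho> K" by (simp add: sum_distrib_left)
  also have "... \<le> 1" using s1 K(2,4) s_def by (intro mult_le_one) (auto intro: sum_nonneg less_imp_le)
  finally show "(\<Sum>k\<in>K. s * \<rho> k) \<le> 1" .
  show "x i j = (\<Sum>k\<in>K. complex_of_real ((s * \<rho> k) powr \<theta>) * u k i * cnj (v k j))" if "i \<in> J" "j \<in> J" for i j
  proof (cases "K = {}")
   case False
   have "(s * \<rho> k) powr \<theta> = \<kappa> * \<rho> k powr \<theta>" if "k \<in> K" for k
    using st[OF False] s0[OF that] K(2)[OF that] by (simp add: powr_mult)
   thus ?thesis unfolding K(11)[OF that] sum_distrib_left by (intro sum.cong refl) (simp add: mult_ac)
  qed (use K(11)[OF that] in simp)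
 qed
qed

lemma sb_1_sball: assumes "finite J" "sb J \<theta> x 1" "0 < \<theta>" shows "sball J \<theta> x"
proof -
 obtain K \<rho> u v where K: "finite K" "\<And>k. k \<in> K ==> 0 < (\<rho> :: nat => real) k" "sum \<rho> K \<le> 1"
  "\<And>k l. k \<in> K ==> l \<in> K ==> ip J (u k) (u l) = (if k = l then 1 else 0)"
  "\<And>k l. k \<in> K ==> l \<in> K ==> ip J (v k) (v l) = (if k = l then 1 else 0)"
  "\<And>i j. i \<in> J ==> j \<in> J ==> x i j = (\<Sum>k\<in>K. of_real (\<rho> k powr \<theta>) * u k i * cnj (v k j))"
  by (rule schatten_normal_form1[OF assms]) (rule that)
 show ?thesis by (rule sballI[OF K(1-3) orthonormal_bessel[OF K(4,1)] orthonormal_bessel[OF K(5,1)] K(6)])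
qed

definition idm :: "'i cmat" where "idm = (%i j. if i = j then 1 else 0)"

text \<open>\<open>1 + (w - 1) c c\<^sup>*\<close>\<close>

definition stretch :: "complex => ('i => complex) => 'i cmat" where
 "stretch w c = (%i j. idm i j + (w - 1) * (c i * cnj (c j)))"

lemma mv_stretch:
 assumes "finite I" "i \<in> I" shows "mv I (stretch w c) \<xi> i = \<xi> i + (w - 1) * ip I \<xi> c * c i"
proof -
 have "mv I (stretch w c) \<xi> i = (\<Sum>j\<in>I. (if i = j then \<xi> j else 0) + (w - 1) * c i * (\<xi> j * cnj (c j)))"
  unfolding mv_def stretch_def idm_def by (intro sum.cong refl) (simp add: algebra_simps)
 also have "... = \<xi> i + (w - 1) * c i * ip I \<xi> c" using assms by (simp add: sum.distrib ip_def sum_distrib_left)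
 finally show ?thesis by simp
qed

lemma sq_stretch:
 assumes I: "finite I" and c: "sq I c = 1"
 shows "sq I (mv I (stretch w c) \<xi>) = sq I \<xi> + ((cmod w)\<^sup>2 - 1) * (cmod (ip I \<xi> c))\<^sup>2"
proof -
 define t where "t = ip I \<xi> c"
 define \<beta> where "\<beta> = (w - 1) * t"
 have "sq I (mv I (stretch w c) \<xi>) = sq I (%i. \<xi> i + \<beta> * c i)"
  using I by (intro sq_cong) (simp add: mv_stretch \<beta>_def t_def)
 also have "... = (\<Sum>i\<in>I. (cmod (\<xi> i))\<^sup>2 + 2 * Re (cnj \<beta> * (\<xi> i * cnj (c i))) + (cmod \<beta>)\<^sup>2 * (cmod (c i))\<^sup>2)"
  unfolding sq_def cmod_power2 by (intro sum.cong refl) (simp add: power2_eq_square algebra_simps)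
 also have "... = sq I \<xi> + (2 * Re (cnj \<beta> * t) + (cmod \<beta>)\<^sup>2)"
  using c by (simp add: sum.distrib sq_def t_def ip_def sum_distrib_left flip: Re_sum)
   (simp flip: sum_distrib_left)
 also have "2 * Re (cnj \<beta> * t) + (cmod \<beta>)\<^sup>2 = ((cmod w)\<^sup>2 - 1) * (cmod t)\<^sup>2"
  unfolding \<beta>_def cmod_power2 by (simp add: power2_eq_square algebra_simps)
 finally show ?thesis by (simp add: t_def)
qed

lemma hs_dyads:
 assumes K: "finite K" and o: "\<And>k l. k \<in> K ==> l \<in> K ==> ip I (v k) (v l) = (if k = l then 1 else 0)"
 shows "hs I (%i j. \<Sum>k\<in>K. a k * x k i * cnj (v k j)) = (\<Sum>k\<in>K. (cmod (a k))\<^sup>2 * sq I (x k))"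
proof -
 have "hs I (%i j. \<Sum>k\<in>K. a k * x k i * cnj (v k j)) = (\<Sum>i\<in>I. sq I (%j. \<Sum>k\<in>K. cnj (a k * x k i) * v k j))"
  unfolding hs_def sq_def
 proof (intro sum.cong refl)
  fix i j
  have "(\<Sum>k\<in>K. a k * x k i * cnj (v k j)) = cnj (\<Sum>k\<in>K. cnj (a k * x k i) * v k j)" by simp
  thus "(cmod (\<Sum>k\<in>K. a k * x k i * cnj (v k j)))\<^sup>2 = (cmod (\<Sum>k\<in>K. cnj (a k * x k i) * v k j))\<^sup>2"
   by (simp only: complex_mod_cnj)
 qed
 also have "... = (\<Sum>i\<in>I. \<Sum>k\<in>K. (cmod (cnj (a k * x k i)))\<^sup>2)"
  using orthonormal_sq_synthesis[OF o K] by simp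
 also have "... = (\<Sum>k\<in>K. \<Sum>i\<in>I. (cmod (a k))\<^sup>2 * (cmod (x k i))\<^sup>2)"
  by (subst sum.swap) (simp add: norm_mult power_mult_distrib)
 finally show ?thesis by (simp add: sq_def sum_distrib_left)
qed

text \<open>A special case of the Araki-Lieb-Thirring inequality: with \<open>p = 1/\<theta>\<close> and \<open>g = 1 + t c c\<^sup>*\<close>, the norm of
 \<open>g a\<close> in \<open>S\<^sup>2\<^sup>p\<close> is at most the \<open>p\<close>-th root of the Hilbert-Schmidt norm of \<open>g\<^sup>p a\<^sup>p\<close>. Interpolate
 \<open>g\<^sup>p\<^sup>z a\<^sup>p\<^sup>z\<close>.\<close>

lemma stretch_norm:
 assumes I: "finite I" and th: "0 < \<theta>" "\<theta> \<le> 1" and c: "sq I c = 1" and t: "0 < t"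
  and Q: "finite Q" "\<And>q. q \<in> Q ==> 0 < (\<alpha> :: nat => real) q" "sum \<alpha> Q \<le> 1"
  and o: "\<And>k l. k \<in> Q ==> l \<in> Q ==> ip I (v k) (v l) = (if k = l then 1 else 0)"
  and a: "\<And>i j. i \<in> I ==> j \<in> I ==> a i j = (\<Sum>q\<in>Q. of_real (\<alpha> q powr (\<theta>/2)) * v q i * cnj (v q j))"
 shows "sb I (\<theta>/2) (mm I (stretch (of_real (1 + t)) c) a)
  ((1 + ((1 + t) powr (2/\<theta>) - 1) * (\<Sum>q\<in>Q. \<alpha> q * (cmod (ip I (v q) c))\<^sup>2)) powr (\<theta>/2))"
 unfolding sb_def
proof (intro allI impI)
 fix w assume w: "sball I (1 - \<theta>/2) w"
 define m where "m = (\<Sum>q\<in>Q. \<alpha> q * (cmod (ip I (v q) c))\<^sup>2)"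
 define B2 where "B2 = 1 + ((1 + t) powr (2/\<theta>) - 1) * m"
 have m0: "0 \<le> m" unfolding m_def using Q(2) by (intro sum_nonneg mult_nonneg_nonneg) (auto simp: less_imp_le)
 have tp: "1 \<le> (1 + t) powr (2/\<theta>)" using t th by (intro ge_one_powr_ge_zero) auto
 have B1: "1 \<le> B2" unfolding B2_def using tp m0 by simp
 obtain W where W: "\<And>i j. i \<in> I ==> j \<in> I ==> W (complex_of_real (1-\<theta>/2)) i j = w i j"
  "\<And>z. sball I (Re z) (W z)" "\<And>i j. ebs (%z. W z i j)" by (rule sball_family[OF w]) (rule that)
 define g where "g = (%z. stretch (complex_of_real (1 + t) powr (of_real 0 + of_real (1/\<theta>) * z)) c)"
 define A where "A = (%z i j. \<Sum>q\<in>Q. complex_of_real (\<alpha> q) powr (of_real 0 + of_real (1/2) * z) * v q i * cnj (v q j))"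
 define W' where "W' = (%z. W (of_real 1 + of_real (-1/2) * z))"
 define f where "f = (%z. tr I (mm I (g z) (A z)) (W' z) * complex_of_real B2 powr (of_real 0 + of_real (-1/2) * z))"
 have eg: "ebs (%z. g z i j)" for i j
 proof -
  have "ebs (%z. idm i j + (complex_of_real (1 + t) powr (of_real 0 + of_real (1/\<theta>) * z) + (-1)) * (c i * cnj (c j)))"
   using t by (intro ebs_add ebs_mult ebs_const ebs_powr) auto
  thus ?thesis by (simp add: g_def stretch_def)
 qed
 have eA: "ebs (%z. A z i j)" for i j
  unfolding A_def by (intro ebs_sum ebs_mult ebs_const ebs_powr Q(2))
 have "ebs f" unfolding f_def W'_def using B1
  by (intro ebs_mult ebs_tr ebs_mm eg eA ebs_powr ebs_comp W(3)) auto
 moreover have "cmod (f z) \<le> 1" if z: "Re z = 0 \<or> Re z = 1" for z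
 proof -
  have rW: "sball I (1 - Re z / 2) (W' z)"
   using W(2)[of "of_real 1 + of_real (-1/2) * z"] by (simp add: W'_def)
  have nw: "cmod (complex_of_real (1 + t) powr (of_real 0 + of_real (1/\<theta>) * z)) = (1 + t) powr (Re z / \<theta>)"
   using t norm_of_real_powr[of "1+t" "of_real 0 + of_real (1/\<theta>) * z"] by simp
  have nB: "cmod (complex_of_real B2 powr (of_real 0 + of_real (-1/2) * z)) = B2 powr (- Re z / 2)"
   using B1 norm_of_real_powr[of B2 "of_real 0 + of_real (-1/2) * z"] by simp
  have na: "cmod (complex_of_real (\<alpha> q) powr (of_real 0 + of_real (1/2) * z)) = \<alpha> q powr (Re z / 2)" if "q \<in> Q" for q
   using Q(2)[OF that] norm_of_real_powr[of "\<alpha> q" "of_real 0 + of_real (1/2) * z"] by simp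
  from z show ?thesis
  proof
   assume z: "Re z = 0"
   have cg: "contr I (g z)"
    unfolding contr_def g_def sq_stretch[OF I c] nw using z t by simp
   have "sball I 0 (A z)"
   proof (rule sball_coeffI[OF Q orthonormal_bessel[OF o Q(1)] orthonormal_bessel[OF o Q(1)]])
    show "cmod (complex_of_real (\<alpha> k) powr (of_real 0 + of_real (1/2) * z)) \<le> \<alpha> k powr 0" if "k \<in> Q" for k
     unfolding na[OF that] using z by simp
    show "A z i j = (\<Sum>k\<in>Q. complex_of_real (\<alpha> k) powr (of_real 0 + of_real (1/2) * z) * v k i * cnj (v k j))" for i j
     by (simp only: A_def)
   qed
   hence "sball I 0 (mm I (g z) (A z))" by (rule sball_mm_left[OF cg])
   hence "cmod (tr I (mm I (g z) (A z)) (W' z)) \<le> 1" using rW z by (intro sball_pair[of 0]) auto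
   thus ?thesis unfolding f_def norm_mult nB using z B1 by simp
  next
   assume z: "Re z = 1"
   have "hs I (W' z) \<le> 1" using rW z by (intro sball_half_hs) simp
   moreover have "hs I (mm I (g z) (A z)) \<le> B2"
   proof -
    have "mm I (g z) (A z) = (%i j. \<Sum>q\<in>Q. (complex_of_real (\<alpha> q) powr (of_real 0 + of_real (1/2) * z)) * mv I (g z) (v q) i * cnj (v q j))"
    proof (intro ext)
     fix i j
     have "mm I (g z) (A z) i j = (\<Sum>k\<in>I. \<Sum>q\<in>Q. (complex_of_real (\<alpha> q) powr (of_real 0 + of_real (1/2) * z)) * (g z i k * v q k) * cnj (v q j))"
      by (simp add: mm_def A_def sum_distrib_left mult_ac)
     also have "... = (\<Sum>q\<in>Q. \<Sum>k\<in>I. (complex_of_real (\<alpha> q) powr (of_real 0 + of_real (1/2) * z)) * (g z i k * v q k) * cnj (v q j))"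
      by (rule sum.swap)
     finally show "mm I (g z) (A z) i j = (\<Sum>q\<in>Q. (complex_of_real (\<alpha> q) powr (of_real 0 + of_real (1/2) * z)) * mv I (g z) (v q) i * cnj (v q j))"
      by (simp add: mv_def sum_distrib_left sum_distrib_right)
    qed
    hence "hs I (mm I (g z) (A z)) = (\<Sum>q\<in>Q. (\<alpha> q powr (1/2))\<^sup>2 * sq I (mv I (g z) (v q)))"
     using hs_dyads[OF Q(1) o] na z by simp
    also have "... = (\<Sum>q\<in>Q. \<alpha> q * (1 + ((1 + t) powr (2/\<theta>) - 1) * (cmod (ip I (v q) c))\<^sup>2))"
    proof (intro sum.cong refl)
     fix q assume q: "q \<in> Q"
     have s1: "sq I (v q) = 1" using o[OF q q] ip_self[of I "v q"] by (metis of_real_eq_1_iff)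
     have e1: "(\<alpha> q powr (1/2))\<^sup>2 = \<alpha> q" using Q(2)[OF q] by (simp add: powr_half_sqrt less_imp_le)
     have e2: "((1 + t) powr (Re z / \<theta>))\<^sup>2 = (1 + t) powr (2/\<theta>)"
      using t z by (simp add: power2_eq_square flip: powr_add)
     show "(\<alpha> q powr (1/2))\<^sup>2 * sq I (mv I (g z) (v q)) = \<alpha> q * (1 + ((1 + t) powr (2/\<theta>) - 1) * (cmod (ip I (v q) c))\<^sup>2)"
      unfolding g_def sq_stretch[OF I c] nw e1 e2 s1 ..
    qed
    also have "... = sum \<alpha> Q + ((1 + t) powr (2/\<theta>) - 1) * m"
     unfolding m_def sum_distrib_left sum.distrib[symmetric] by (intro sum.cong refl) (simp add: algebra_simps)
    finally show ?thesis using Q(3) by (simp add: B2_def)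
   qed
   ultimately have "hs I (mm I (g z) (A z)) * hs I (W' z) \<le> B2 * 1" using B1 by (intro mult_mono) auto
   from order_trans[OF tr_hs this] have "(cmod (tr I (mm I (g z) (A z)) (W' z)))\<^sup>2 \<le> B2" by simp
   hence "cmod (tr I (mm I (g z) (A z)) (W' z)) \<le> sqrt B2" by (rule real_le_rsqrt)
   hence "cmod (tr I (mm I (g z) (A z)) (W' z)) * B2 powr (- Re z / 2) \<le> sqrt B2 * B2 powr (- Re z / 2)"
    by (intro mult_right_mono) auto
   also have "... = B2 powr (1/2) * B2 powr (-1/2)" using B1 z by (simp add: powr_half_sqrt)
   also have "... = 1" using B1 by (simp flip: powr_add)
   finally show ?thesis unfolding f_def norm_mult nB .
  qed
 qed
 ultimately have "cmod (f (of_real \<theta>)) \<le> 1"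
  by (rule ebs_three_lines) (use th in \<open>auto intro: of_real_in_strip\<close>)
 moreover have "f (of_real \<theta>) = tr I (mm I (stretch (of_real (1 + t)) c) a) w * of_real (B2 powr (- \<theta>/2))"
 proof -
  have e: "of_real 0 + of_real (1/2) * complex_of_real \<theta> = complex_of_real (\<theta>/2)"
   "of_real 0 + of_real (-1/2) * complex_of_real \<theta> = complex_of_real (-\<theta>/2)"
   "of_real 1 + of_real (-1/2) * complex_of_real \<theta> = complex_of_real (1-\<theta>/2)"
   "of_real 0 + of_real (1/\<theta>) * complex_of_real \<theta> = complex_of_real 1" using th by simp_all
  have pw: "complex_of_real (1 + t) powr complex_of_real 1 = of_real (1 + t)"
   using t of_real_powr[of "1+t" 1] by simp
  have pB: "complex_of_real B2 powr complex_of_real (-\<theta>/2) = of_real (B2 powr (-\<theta>/2))"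
   using B1 by (intro of_real_powr) simp
  have gA: "(\<Sum>q\<in>Q. complex_of_real (\<alpha> q) powr complex_of_real (\<theta>/2) * v q i * cnj (v q j)) = a i j" if "i \<in> I" "j \<in> I" for i j
   unfolding a[OF that] using Q(2) by (intro sum.cong refl) (simp only: of_real_powr)
  show ?thesis unfolding f_def g_def A_def W'_def e pw pB
   by (intro arg_cong2[where f = "(*)"] tr_cong mm_cong gA W(1) refl)
 qed
 ultimately have "cmod (tr I (mm I (stretch (of_real (1 + t)) c) a) w) * B2 powr (- \<theta>/2) \<le> 1"
  by (simp add: norm_mult)
 hence "cmod (tr I (mm I (stretch (of_real (1 + t)) c) a) w) * B2 powr (- \<theta>/2) * B2 powr (\<theta>/2) \<le> 1 * B2 powr (\<theta>/2)"
  by (rule mult_right_mono) simp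
 moreover have "B2 powr (- \<theta>/2) * B2 powr (\<theta>/2) = 1" using B1 by (simp flip: powr_add)
 ultimately have "cmod (tr I (mm I (stretch (of_real (1 + t)) c) a) w) \<le> B2 powr (\<theta>/2)"
  by (simp add: mult.assoc)
 thus "cmod (tr I (mm I (stretch (of_real (1 + t)) c) a) w) \<le>
  (1 + ((1 + t) powr (2/\<theta>) - 1) * (\<Sum>q\<in>Q. \<alpha> q * (cmod (ip I (v q) c))\<^sup>2)) powr (\<theta>/2)"
  by (simp add: B2_def m_def)
qed

section \<open>The extremal problem\<close>

text \<open>The regularised functional \<open>Re Tr (a y b w) + \<delta> Re Tr a + \<delta> Re Tr b\<close>.\<close>

definition phi :: "nat set => 'k set => real => (nat \<times> 'k) cmat => nat cmat => nat cmat => (nat \<times> 'k) cmat => real" where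
 "phi I L \<delta> y a b w = Re (tr (I \<times> L) (mm (I \<times> L) (amp a) (mm (I \<times> L) y (amp b))) w)
   + \<delta> * Re (\<Sum>i\<in>I. a i i) + \<delta> * Re (\<Sum>i\<in>I. b i i)"

definition maxi :: "nat set => 'k set => real => real => (nat \<times> 'k) cmat => nat cmat => nat cmat => (nat \<times> 'k) cmat => bool" where
 "maxi I L \<theta> \<delta> y a b w \<longleftrightarrow> sb I (\<theta>/2) a 1 \<and> sb I (\<theta>/2) b 1 \<and> sb (I \<times> L) (1 - \<theta>) w 1 \<and>
   (\<forall>a' b' w'. sb I (\<theta>/2) a' 1 \<longrightarrow> sb I (\<theta>/2) b' 1 \<longrightarrow> sb (I \<times> L) (1 - \<theta>) w' 1 \<longrightarrow>
    phi I L \<delta> y a' b' w' \<le> phi I L \<delta> y a b w)"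

lemma continuous_on_entry: "continuous_on UNIV (%x::'i cmat. x i j)"
 by (rule continuous_on_product_then_coordinatewise[OF continuous_on_product_coordinates])

lemma compact_sb_ball:
 assumes J: "finite J" and th: "0 \<le> \<theta>"
 shows "compact {x::'i cmat. (\<forall>i j. \<not> (i \<in> J \<and> j \<in> J) \<longrightarrow> x i j = 0) \<and> sb J \<theta> x 1}" (is "compact ?S")
proof -
 have "compactin (product_topology (%i::'i. euclidean) UNIV) (PiE UNIV (%i. cball (0::complex) 1))"
  by (simp add: compactin_PiE)
 hence "compact (PiE UNIV (%i::'i. cball (0::complex) 1))" (is "compact ?P")
  by (simp add: euclidean_product_topology)
 hence "compactin (product_topology (%i::'i. euclidean) UNIV) (PiE UNIV (%i::'i. ?P))"
  by (simp add: compactin_PiE)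
 hence 1: "compact (PiE UNIV (%i::'i. ?P))" (is "compact ?PP")
  by (simp add: euclidean_product_topology)
 have "?S = (\<Inter>w\<in>{w. sball J (1-\<theta>) w}. {x. cmod (tr J x w) \<le> 1}) \<inter> (\<Inter>p\<in>{p. \<not> (fst p \<in> J \<and> snd p \<in> J)}. {x. x (fst p) (snd p) = 0})"
  by (auto simp: sb_def)
 moreover have "closed {x::'i cmat. cmod (tr J x w) \<le> 1}" for w
  unfolding tr_def by (intro closed_Collect_le continuous_intros continuous_on_entry)
 moreover have "closed {x::'i cmat. x (fst p) (snd p) = 0}" for p
  by (intro closed_Collect_eq continuous_intros continuous_on_entry)
 ultimately have 2: "closed ?S" by (auto intro!: closed_Int)
 have "?S \<subseteq> ?PP"
 proof
  fix x assume x: "x \<in> ?S"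
  have "cmod (x i j) \<le> 1" for i j
   using x sb_entry[OF _ J, of \<theta> x 1 i j] by (cases "i \<in> J \<and> j \<in> J") auto
  thus "x \<in> ?PP" by auto
 qed
 hence "?S = ?PP \<inter> ?S" by blast
 thus ?thesis using compact_Int_closed[OF 1 2] by simp
qed

lemma phi_cong:
 assumes "\<And>i j. i \<in> I ==> j \<in> I ==> a i j = a' i j" "\<And>i j. i \<in> I ==> j \<in> I ==> b i j = b' i j"
  "\<And>p q. p \<in> I \<times> L ==> q \<in> I \<times> L ==> w p q = w' p q"
 shows "phi I L \<delta> y a b w = phi I L \<delta> y a' b' w'"
proof -
 have 1: "amp a p q = amp a' p q" "amp b p q = amp b' p q" if "p \<in> I \<times> L" "q \<in> I \<times> L" for p q
  using that assms by (auto simp: amp_def)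
 have "tr (I \<times> L) (mm (I \<times> L) (amp a) (mm (I \<times> L) y (amp b))) w = tr (I \<times> L) (mm (I \<times> L) (amp a') (mm (I \<times> L) y (amp b'))) w'"
  by (intro tr_cong mm_cong 1 assms(3) refl)
 moreover have "(\<Sum>i\<in>I. a i i) = (\<Sum>i\<in>I. a' i i)" "(\<Sum>i\<in>I. b i i) = (\<Sum>i\<in>I. b' i i)"
  using assms by (auto intro: sum.cong)
 ultimately show ?thesis by (simp add: phi_def)
qed

lemma sb_trunc_iff: "sb J \<theta> (trunc J x) c = sb J \<theta> x c"
 by (rule sb_cong) (simp add: trunc_def)

lemma ne_empty: "x \<in> S ==> S \<noteq> {}" by auto

lemma trunc_in: "i \<in> J ==> j \<in> J ==> trunc J x i j = x i j"
 by (simp add: trunc_def)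

lemma maxi_exists:
 assumes I: "finite I" and L: "finite L" and th: "0 < \<theta>" "\<theta> < 1"
 shows "\<exists>a b w. maxi I L \<theta> \<delta> y a b w"
proof -
 let ?J = "I \<times> L"
 have J: "finite ?J" using I L by simp
 let ?A = "{x::nat cmat. (\<forall>i j. \<not> (i \<in> I \<and> j \<in> I) \<longrightarrow> x i j = 0) \<and> sb I (\<theta>/2) x 1}"
 let ?W = "{x. (\<forall>i j. \<not> (i \<in> ?J \<and> j \<in> ?J) \<longrightarrow> x i j = 0) \<and> sb ?J (1-\<theta>) x 1}"
 have cA: "compact ?A" using th by (intro compact_sb_ball I) auto
 have cW: "compact ?W" using th by (intro compact_sb_ball J) auto
 have eA: "(%i j. 0) \<in> ?A" by (auto simp: sb_def tr_def)
 have eW: "(%i j. 0) \<in> ?W" by (auto simp: sb_def tr_def)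
 define f where "f = (%t. phi I L \<delta> y (fst t) (fst (snd t)) (snd (snd t)))"
 have cont: "continuous_on (?A \<times> ?A \<times> ?W) f"
 proof -
  have e: "continuous_on S (%t. g t i j)" if "continuous_on S g" for S :: "'c::topological_space set" and g :: "'c => 'd cmat" and i j
   by (rule continuous_on_compose2[OF continuous_on_entry that]) auto
  have am: "continuous_on S (%t. amp (g t) p q)" if "continuous_on S g" for S :: "'c::topological_space set" and g :: "'c => nat cmat" and p q :: "nat \<times> 'b"
   unfolding amp_def by (cases "snd p = snd q") (simp_all add: e[OF that])
  have p1: "continuous_on (?A \<times> ?A \<times> ?W) (%t. fst t)" by (intro continuous_on_fst continuous_on_id)
  have p2: "continuous_on (?A \<times> ?A \<times> ?W) (%t. fst (snd t))"
   by (intro continuous_on_fst continuous_on_snd continuous_on_id)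
  have p3: "continuous_on (?A \<times> ?A \<times> ?W) (%t. snd (snd t))" by (intro continuous_on_snd continuous_on_id)
  note cs = am[OF p1] am[OF p2] e[OF p1] e[OF p2] e[OF p3]
  show ?thesis unfolding f_def phi_def tr_def mm_def
   by (intro continuous_on_add continuous_on_mult continuous_on_sum continuous_on_const continuous_on_Re cs)
 qed
 have "\<exists>t\<in>?A \<times> ?A \<times> ?W. \<forall>t'\<in>?A \<times> ?A \<times> ?W. f t' \<le> f t"
 proof (rule continuous_attains_sup[OF _ _ cont])
  show "compact (?A \<times> ?A \<times> ?W)" by (intro compact_Times cA cW)
  have "((%i j. 0), (%i j. 0), (%i j. 0)) \<in> ?A \<times> ?A \<times> ?W"
   by (intro SigmaI eA eW)
  thus "?A \<times> ?A \<times> ?W \<noteq> {}" by (rule ne_empty)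
 qed
 then obtain t where t0: "t \<in> ?A \<times> ?A \<times> ?W \<and> (\<forall>t'\<in>?A \<times> ?A \<times> ?W. f t' \<le> f t)"
  by (elim bexE) (rule that, rule conjI)
 note t = conjunct1[OF t0] and mx = bspec[OF conjunct2[OF t0]]
 obtain a b w where tt: "t = (a, b, w)" by (rule prod_cases3)
 have abw: "a \<in> ?A" "b \<in> ?A" "w \<in> ?W"
  using t by (simp_all only: tt mem_Times_iff fst_conv snd_conv)
 have "phi I L \<delta> y a' b' w' \<le> phi I L \<delta> y a b w"
  if "sb I (\<theta>/2) a' 1" "sb I (\<theta>/2) b' 1" "sb ?J (1-\<theta>) w' 1" for a' b' w'
 proof -
  have "phi I L \<delta> y a' b' w' = phi I L \<delta> y (trunc I a') (trunc I b') (trunc ?J w')"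
   by (rule phi_cong) (rule trunc_in[symmetric]; assumption)+
  also have "... \<le> phi I L \<delta> y a b w"
  proof -
   have "trunc I a' \<in> ?A" "trunc I b' \<in> ?A" "trunc ?J w' \<in> ?W"
    using that by (simp_all only: mem_Collect_eq sb_trunc_iff) (auto simp: trunc_def)
   hence "(trunc I a', trunc I b', trunc ?J w') \<in> ?A \<times> ?A \<times> ?W"
    unfolding mem_Times_iff fst_conv snd_conv by (intro conjI)
   from mx[OF this] show ?thesis by (simp only: f_def tt fst_conv snd_conv)
  qed
  finally show ?thesis .
 qed
 thus ?thesis unfolding maxi_def using abw by blast
qed

lemma phi_adj: "phi I L \<delta> (adj y) (adj b) (adj a) (adj w) = phi I L \<delta> y a b w"
proof -
 have "mm (I \<times> L) (amp (adj b)) (mm (I \<times> L) (adj y) (amp (adj a))) = adj (mm (I \<times> L) (amp a) (mm (I \<times> L) y (amp b)))"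
  by (simp add: adj_mm adj_amp mm_assoc)
 thus ?thesis by (simp add: phi_def tr_adj) (simp add: adj_def)
qed

lemma maxi_adj: assumes "maxi I L \<theta> \<delta> y a b w" shows "maxi I L \<theta> \<delta> (adj y) (adj b) (adj a) (adj w)"
proof -
 have "phi I L \<delta> (adj y) a' b' w' \<le> phi I L \<delta> (adj y) (adj b) (adj a) (adj w)"
  if "sb I (\<theta>/2) a' 1" "sb I (\<theta>/2) b' 1" "sb (I \<times> L) (1-\<theta>) w' 1" for a' b' w'
 proof -
  have "phi I L \<delta> (adj y) a' b' w' = phi I L \<delta> y (adj b') (adj a') (adj w')"
   using phi_adj[of I L \<delta> "y" "adj a'" "adj b'" "adj w'"] by simp
  also have "... \<le> phi I L \<delta> y a b w"
   using assms that unfolding maxi_def by (simp add: sb_adj)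
  finally show ?thesis by (simp add: phi_adj)
 qed
 thus ?thesis using assms unfolding maxi_def by (simp add: sb_adj)
qed

lemma maxi_replace:
 assumes "maxi I L \<theta> \<delta> y a b w" "sb I (\<theta>/2) a' 1" "sb I (\<theta>/2) b' 1" "sb (I \<times> L) (1-\<theta>) w' 1"
  "phi I L \<delta> y a b w \<le> phi I L \<delta> y a' b' w'"
 shows "maxi I L \<theta> \<delta> y a' b' w'"
 using assms unfolding maxi_def by (meson order_trans)

text \<open>\<open>a = \<Sum> \<alpha>\<^sub>q\<^sup>\<theta>\<^sup>/\<^sup>2 v\<^sub>q v\<^sub>q\<^sup>*\<close>, a positive matrix in the unit ball of \<open>S\<^sup>2\<^sup>/\<^sup>\<theta>\<close> in spectral form.\<close>

definition posf :: "nat set => real => nat cmat => nat set => (nat => real) => (nat => nat => complex) => bool" where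
 "posf I \<theta> a Q \<alpha> v \<longleftrightarrow> finite Q \<and> (\<forall>q\<in>Q. 0 < \<alpha> q) \<and> sum \<alpha> Q \<le> 1 \<and>
   (\<forall>k\<in>Q. \<forall>l\<in>Q. ip I (v k) (v l) = (if k = l then 1 else 0)) \<and>
   (\<forall>i\<in>I. \<forall>j\<in>I. a i j = (\<Sum>q\<in>Q. of_real (\<alpha> q powr (\<theta>/2)) * v q i * cnj (v q j)))"

lemma posfD:
 assumes "posf I \<theta> a Q \<alpha> v"
 shows "finite Q" "\<And>q. q \<in> Q ==> 0 < \<alpha> q" "sum \<alpha> Q \<le> 1"
  "\<And>k l. k \<in> Q ==> l \<in> Q ==> ip I (v k) (v l) = (if k = l then 1 else 0)"
  "\<And>i j. i \<in> I ==> j \<in> I ==> a i j = (\<Sum>q\<in>Q. of_real (\<alpha> q powr (\<theta>/2)) * v q i * cnj (v q j))"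
 using assms unfolding posf_def by simp_all

lemma posf_adj: assumes "posf I \<theta> a Q \<alpha> v" shows "posf I \<theta> (adj a) Q \<alpha> v"
 using assms unfolding posf_def adj_def by (simp add: mult_ac)

lemma orthonormal_expand:
 assumes "finite Q" "\<And>k l. k \<in> Q ==> l \<in> Q ==> ip I (v k) (v l) = (if k = l then 1 else 0)" "q \<in> Q"
 shows "ip I (%i. \<Sum>k\<in>Q. c k * v k i) (v q) = c q"
proof -
 have "ip I (%i. \<Sum>k\<in>Q. c k * v k i) (v q) = (\<Sum>k\<in>Q. if k = q then c k else 0)"
  unfolding ip_sum_left using assms(2,3) by (intro sum.cong refl) auto
 thus ?thesis using assms(1,3) by simp
qed

lemma mm_dyads:
 assumes "finite Q" "\<And>k l. k \<in> Q ==> l \<in> Q ==> ip I (v k) (v l) = (if k = l then 1 else 0)"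
 shows "mm I (%i j. \<Sum>k\<in>Q. c k * u k i * cnj (v k j)) (%i j. \<Sum>k\<in>Q. d k * v k i * cnj (x k j))
   = (%i j. \<Sum>k\<in>Q. (c k * d k) * u k i * cnj (x k j))"
proof (intro ext)
 fix i j
 have "mm I (%i j. \<Sum>k\<in>Q. c k * u k i * cnj (v k j)) (%i j. \<Sum>k\<in>Q. d k * v k i * cnj (x k j)) i j
   = mv I (%i j. \<Sum>k\<in>Q. c k * u k i * cnj (v k j)) (%i. \<Sum>k\<in>Q. (d k * cnj (x k j)) * v k i) i"
  unfolding mm_def mv_def by (intro sum.cong refl) (simp add: sum_distrib_left mult_ac)
 also have "... = (\<Sum>k\<in>Q. (c k * (d k * cnj (x k j))) * u k i)"
  unfolding mv_dyads by (intro sum.cong refl) (simp add: orthonormal_expand[OF assms])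
 finally show "mm I (%i j. \<Sum>k\<in>Q. c k * u k i * cnj (v k j)) (%i j. \<Sum>k\<in>Q. d k * v k i * cnj (x k j)) i j
   = (\<Sum>k\<in>Q. (c k * d k) * u k i * cnj (x k j))" by (simp add: mult_ac)
qed

lemma trace_dyads: "(\<Sum>i\<in>I. \<Sum>k\<in>Q. c k * u k i * cnj (v k i)) = (\<Sum>k\<in>Q. c k * ip I (u k) (v k))"
 by (subst sum.swap) (simp add: ip_def sum_distrib_left mult_ac)

lemma orthonormal_sq: "ip I v v = (if True then 1 else 0) ==> sq I v = 1"
 by (metis ip_self of_real_eq_1_iff)

text \<open>Polar decomposition: in a maximal triple, \<open>a\<close> may be replaced by \<open>|a|\<close>.\<close>

lemma maxi_polar:
 assumes I: "finite I" and L: "finite L" and th: "0 < \<theta>" "\<theta> < 1" and d: "0 < \<delta>"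
  and m: "maxi I L \<theta> \<delta> y a b w"
 shows "\<exists>a1 w1 Q \<alpha> v. maxi I L \<theta> \<delta> y a1 b w1 \<and> posf I \<theta> a1 Q \<alpha> v"
proof -
 let ?J = "I \<times> L"
 have a: "sb I (\<theta>/2) a 1" and b: "sb I (\<theta>/2) b 1" and w: "sb ?J (1-\<theta>) w 1" using m by (auto simp: maxi_def)
 have th2: "0 < \<theta>/2" using th by simp
 obtain Q \<alpha> u v where K: "finite Q" "\<And>k. k \<in> Q ==> 0 < (\<alpha> :: nat => real) k" "sum \<alpha> Q \<le> 1"
  "\<And>k l. k \<in> Q ==> l \<in> Q ==> ip I (u k) (u l) = (if k = l then 1 else 0)"
  "\<And>k l. k \<in> Q ==> l \<in> Q ==> ip I (v k) (v l) = (if k = l then 1 else 0)"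
  "\<And>i j. i \<in> I ==> j \<in> I ==> a i j = (\<Sum>k\<in>Q. of_real (\<alpha> k powr (\<theta>/2)) * u k i * cnj (v k j))"
  by (rule schatten_normal_form1[OF I a th2]) (rule that)
 have bu: "bessel I Q u" and bv: "bessel I Q v" using orthonormal_bessel[OF K(4,1)] orthonormal_bessel[OF K(5,1)] by auto
 define a1 where "a1 = (%i j. \<Sum>k\<in>Q. complex_of_real (\<alpha> k powr (\<theta>/2)) * v k i * cnj (v k j))"
 define U where "U = (%i j. \<Sum>k\<in>Q. 1 * u k i * cnj (v k j))"
 have sa1: "sball I (\<theta>/2) a1" by (rule sballI[OF K(1-3) bv bv]) (auto simp: a1_def)
 have "sball I 0 U"
 proof (rule sball_coeffI[OF K(1-3) bu bv, where c = "%_. 1"])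
  show "cmod 1 \<le> \<alpha> k powr 0" if "k \<in> Q" for k using K(2)[OF that] by simp
  show "U i j = (\<Sum>k\<in>Q. 1 * u k i * cnj (v k j))" for i j by (simp add: U_def)
 qed
 hence cU: "contr I U" by (rule sball_0_contr)
 define w1 where "w1 = mm ?J w (amp U)"
 have w1: "sb ?J (1-\<theta>) w1 1" unfolding w1_def by (intro sb_mm_right contr_amp L cU w)
 have Ua: "mm I U a1 i j = a i j" if "i \<in> I" "j \<in> I" for i j
  unfolding U_def a1_def K(6)[OF that]
  using fun_cong[OF fun_cong[OF mm_dyads[OF K(1,5), where c = "%_. 1" and u = u and x = v
   and d = "%k. complex_of_real (\<alpha> k powr (\<theta>/2))"]]] by simp
 have "tr ?J (mm ?J (amp a1) (mm ?J y (amp b))) w1 = tr ?J (mm ?J (amp a) (mm ?J y (amp b))) w"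
 proof -
  have "tr ?J (mm ?J (amp a1) (mm ?J y (amp b))) w1 = tr ?J w (mm ?J (mm ?J (amp U) (amp a1)) (mm ?J y (amp b)))"
   unfolding w1_def by (subst tr_commute) (simp add: tr_mm_assoc mm_assoc)
  also have "... = tr ?J w (mm ?J (amp a) (mm ?J y (amp b)))"
  proof (intro tr_cong mm_cong refl)
   fix p q assume pq: "p \<in> ?J" "q \<in> ?J"
   show "mm ?J (amp U) (amp a1) p q = amp a p q"
    unfolding mm_amp[OF L pq] using pq Ua by (auto simp: amp_def)
  qed
  finally show ?thesis by (subst tr_commute)
 qed
 moreover have "Re (\<Sum>i\<in>I. a i i) \<le> Re (\<Sum>i\<in>I. a1 i i)"
 proof -
  have "(\<Sum>i\<in>I. a i i) = (\<Sum>k\<in>Q. of_real (\<alpha> k powr (\<theta>/2)) * ip I (u k) (v k))"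
   using K(6) by (simp flip: trace_dyads)
  hence "Re (\<Sum>i\<in>I. a i i) = (\<Sum>k\<in>Q. \<alpha> k powr (\<theta>/2) * Re (ip I (u k) (v k)))" by simp
  also have "... \<le> (\<Sum>k\<in>Q. \<alpha> k powr (\<theta>/2) * 1)"
  proof (intro sum_mono mult_left_mono)
   fix k assume k: "k \<in> Q"
   have "sq I (u k) = 1" "sq I (v k) = 1" using K(4)[OF k k] K(5)[OF k k] orthonormal_sq by auto
   hence "(cmod (ip I (u k) (v k)))\<^sup>2 \<le> 1" using ip_cs[of I "u k" "v k"] by simp
   hence "cmod (ip I (u k) (v k)) \<le> 1" by (simp add: power_le_one_iff)
   thus "Re (ip I (u k) (v k)) \<le> 1" using complex_Re_le_cmod order_trans by blast
  qed simp
  also have "... = Re (\<Sum>k\<in>Q. of_real (\<alpha> k powr (\<theta>/2)) * ip I (v k) (v k))" using K(5) by simp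
  also have "... = Re (\<Sum>i\<in>I. a1 i i)" unfolding a1_def trace_dyads ..
  finally show ?thesis .
 qed
 ultimately have "phi I L \<delta> y a b w \<le> phi I L \<delta> y a1 b w1" using d by (simp add: phi_def)
 hence "maxi I L \<theta> \<delta> y a1 b w1" using th
  by (intro maxi_replace[OF m _ b w1] sball_sb sa1) auto
 moreover have "posf I \<theta> a1 Q \<alpha> v" unfolding posf_def a1_def using K(1-3) K(5) by auto
 ultimately show ?thesis by blast
qed

text \<open>A critical point: a maximal triple with \<open>a \<ge> 0\<close>, together with the singular value decomposition
 \<open>\<kappa> \<Sum> \<sigma>\<^sub>k\<^sup>\<theta> g\<^sub>k h\<^sub>k\<^sup>*\<close> of \<open>a y b\<close>, and \<open>w\<close> the functional norming it.\<close>

definition crit :: "nat set => 'k set => real => real => (nat \<times> 'k) cmat => nat cmat => nat cmat => (nat \<times> 'k) cmat =>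
  nat set => (nat => real) => real => (nat => nat \<times> 'k => complex) => (nat => nat \<times> 'k => complex) => bool" where
 "crit I L \<theta> \<delta> y a b w K \<sigma> \<kappa> g h \<longleftrightarrow> maxi I L \<theta> \<delta> y a b w \<and>
   finite K \<and> (\<forall>k\<in>K. 0 < \<sigma> k) \<and> sum \<sigma> K \<le> 1 \<and> \<kappa> * sum \<sigma> K = \<kappa> \<and> (K \<noteq> {} \<longrightarrow> 0 < \<kappa>) \<and> 0 \<le> \<kappa> \<and>
   (\<forall>k\<in>K. \<forall>l\<in>K. ip (I \<times> L) (g k) (g l) = (if k = l then 1 else 0)) \<and>
   (\<forall>k\<in>K. \<forall>l\<in>K. ip (I \<times> L) (h k) (h l) = (if k = l then 1 else 0)) \<and>
   (\<forall>p\<in>I \<times> L. \<forall>q\<in>I \<times> L. mm (I \<times> L) (amp a) (mm (I \<times> L) y (amp b)) p q =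
    of_real \<kappa> * (\<Sum>k\<in>K. of_real (\<sigma> k powr \<theta>) * g k p * cnj (h k q))) \<and>
   w = (%p q. \<Sum>k\<in>K. of_real (\<sigma> k powr (1-\<theta>)) * h k p * cnj (g k q))"

lemma critD:
 assumes "crit I L \<theta> \<delta> y a b w K \<sigma> \<kappa> g h"
 shows "maxi I L \<theta> \<delta> y a b w" "finite K" "\<And>k. k \<in> K ==> 0 < \<sigma> k" "sum \<sigma> K \<le> 1" "\<kappa> * sum \<sigma> K = \<kappa>" "K \<noteq> {} ==> 0 < \<kappa>" "0 \<le> \<kappa>"
   "\<And>k l. k \<in> K ==> l \<in> K ==> ip (I \<times> L) (g k) (g l) = (if k = l then 1 else 0)"
   "\<And>k l. k \<in> K ==> l \<in> K ==> ip (I \<times> L) (h k) (h l) = (if k = l then 1 else 0)"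
   "\<And>p q. p \<in> I \<times> L ==> q \<in> I \<times> L ==> mm (I \<times> L) (amp a) (mm (I \<times> L) y (amp b)) p q =
    of_real \<kappa> * (\<Sum>k\<in>K. of_real (\<sigma> k powr \<theta>) * g k p * cnj (h k q))"
   "w = (%p q. \<Sum>k\<in>K. of_real (\<sigma> k powr (1-\<theta>)) * h k p * cnj (g k q))"
 using assms unfolding crit_def by blast+

lemma crit_adj:
 assumes "crit I L \<theta> \<delta> y a b w K \<sigma> \<kappa> g h"
 shows "crit I L \<theta> \<delta> (adj y) (adj b) (adj a) (adj w) K \<sigma> \<kappa> h g"
proof -
 note c = critD[OF assms]
 have "mm (I \<times> L) (amp (adj b)) (mm (I \<times> L) (adj y) (amp (adj a))) = adj (mm (I \<times> L) (amp a) (mm (I \<times> L) y (amp b)))"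
  by (simp add: adj_mm adj_amp mm_assoc)
 hence "\<forall>p\<in>I \<times> L. \<forall>q\<in>I \<times> L. mm (I \<times> L) (amp (adj b)) (mm (I \<times> L) (adj y) (amp (adj a))) p q =
    of_real \<kappa> * (\<Sum>k\<in>K. of_real (\<sigma> k powr \<theta>) * h k p * cnj (g k q))"
  using c(10) by (simp add: adj_def mult_ac)
 moreover have "adj w = (%p q. \<Sum>k\<in>K. of_real (\<sigma> k powr (1-\<theta>)) * g k p * cnj (h k q))"
  unfolding c(11) by (simp add: adj_def mult_ac)
 ultimately show ?thesis unfolding crit_def using c(2-9) maxi_adj[OF c(1)] by simp
qed

lemma crit_form:
 assumes "crit I L \<theta> \<delta> y a b w K \<sigma> \<kappa> g h"
 shows "tr (I \<times> L) (mm (I \<times> L) x (mm (I \<times> L) (amp a) (mm (I \<times> L) y (amp b)))) w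
   = (\<Sum>k\<in>K. of_real (\<kappa> * \<sigma> k) * ip (I \<times> L) (mv (I \<times> L) x (g k)) (g k))"
  and "k \<in> K ==> p \<in> I \<times> L ==> mv (I \<times> L) (mm (I \<times> L) (amp a) (mm (I \<times> L) y (amp b))) (h k) p = of_real (\<kappa> * \<sigma> k powr \<theta>) * g k p"
proof -
 let ?J = "I \<times> L"
 let ?z = "mm ?J (amp a) (mm ?J y (amp b))"
 note c = critD[OF assms]
 show zh: "mv ?J ?z (h k) p = of_real (\<kappa> * \<sigma> k powr \<theta>) * g k p" if k: "k \<in> K" and p: "p \<in> ?J" for k p
 proof -
  have "mv ?J ?z (h k) p = of_real \<kappa> * mv ?J (%p q. \<Sum>k\<in>K. of_real (\<sigma> k powr \<theta>) * g k p * cnj (h k q)) (h k) p"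
   unfolding mv_def sum_distrib_left[of "of_real \<kappa>"] using p by (intro sum.cong refl) (simp add: c(10) mult_ac)
  also have "... = of_real \<kappa> * (\<Sum>l\<in>K. if k = l then of_real (\<sigma> l powr \<theta>) * g l p else 0)"
   unfolding mv_dyads using c(9)[OF k] by (intro arg_cong2[where f = "(*)"] refl sum.cong) auto
  finally show ?thesis using k c(2) by simp
 qed
 have "tr ?J (mm ?J x ?z) w = (\<Sum>k\<in>K. of_real (\<sigma> k powr (1-\<theta>)) * ip ?J (mv ?J x (mv ?J ?z (h k))) (g k))"
  unfolding c(11) tr_dyads mv_mm ..
 also have "... = (\<Sum>k\<in>K. of_real (\<kappa> * \<sigma> k) * ip ?J (mv ?J x (g k)) (g k))"
 proof (intro sum.cong refl)
  fix k assume k: "k \<in> K"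
  have "mv ?J x (mv ?J ?z (h k)) = (%p. of_real (\<kappa> * \<sigma> k powr \<theta>) * mv ?J x (g k) p)"
  proof
   fix p
   have "mv ?J x (mv ?J ?z (h k)) p = (\<Sum>q\<in>?J. x p q * (of_real (\<kappa> * \<sigma> k powr \<theta>) * g k q))"
    unfolding mv_def[of ?J x] using zh[OF k] by (intro sum.cong refl) simp
   thus "mv ?J x (mv ?J ?z (h k)) p = of_real (\<kappa> * \<sigma> k powr \<theta>) * mv ?J x (g k) p"
    by (simp add: mv_def sum_distrib_left mult_ac)
  qed
  moreover have "\<sigma> k powr (1-\<theta>) * (\<kappa> * \<sigma> k powr \<theta>) = \<kappa> * \<sigma> k"
   using c(3)[OF k] powr_add[of "\<sigma> k" "1-\<theta>" \<theta>] by (simp add: mult_ac)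
  ultimately show "of_real (\<sigma> k powr (1-\<theta>)) * ip ?J (mv ?J x (mv ?J ?z (h k))) (g k) = of_real (\<kappa> * \<sigma> k) * ip ?J (mv ?J x (g k)) (g k)"
   by (simp only: ip_mult_left mult.assoc[symmetric] of_real_mult[symmetric])
 qed
 finally show "tr ?J (mm ?J x ?z) w = (\<Sum>k\<in>K. of_real (\<kappa> * \<sigma> k) * ip ?J (mv ?J x (g k)) (g k))" .
qed

lemma mv_idm: "finite J ==> i \<in> J ==> mv J idm \<xi> i = \<xi> i"
proof -
 assume "finite J" "i \<in> J"
 moreover have "(\<Sum>j\<in>J. idm i j * \<xi> j) = (\<Sum>j\<in>J. if i = j then \<xi> j else 0)"
  by (intro sum.cong refl) (simp add: idm_def)
 ultimately show ?thesis by (simp add: mv_def)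
qed

lemma mm_idm: "finite J ==> i \<in> J ==> mm J idm x i j = x i j"
 using mv_idm[of J i "%k. x k j"] by (simp add: mv_def mm_def)

lemma crit_value:
 assumes "crit I L \<theta> \<delta> y a b w K \<sigma> \<kappa> g h" "finite I" "finite L"
 shows "tr (I \<times> L) (mm (I \<times> L) (amp a) (mm (I \<times> L) y (amp b))) w = of_real \<kappa>"
proof -
 let ?J = "I \<times> L"
 let ?z = "mm ?J (amp a) (mm ?J y (amp b))"
 note c = critD[OF assms(1)]
 have J: "finite ?J" using assms by simp
 have "tr ?J ?z w = tr ?J (mm ?J idm ?z) w" using J by (intro tr_cong) (simp_all add: mm_idm)
 also have "... = (\<Sum>k\<in>K. of_real (\<kappa> * \<sigma> k) * ip ?J (mv ?J idm (g k)) (g k))" by (rule crit_form[OF assms(1)])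
 also have "... = (\<Sum>k\<in>K. of_real (\<kappa> * \<sigma> k))"
 proof (intro sum.cong refl)
  fix k assume k: "k \<in> K"
  have "ip ?J (mv ?J idm (g k)) (g k) = ip ?J (g k) (g k)" using J by (intro ip_cong) (simp_all add: mv_idm)
  thus "of_real (\<kappa> * \<sigma> k) * ip ?J (mv ?J idm (g k)) (g k) = of_real (\<kappa> * \<sigma> k)" using c(8)[OF k k] by simp
 qed
 also have "... = of_real (\<kappa> * sum \<sigma> K)" by (simp add: sum_distrib_left)
 finally show ?thesis using c(5) by simp
qed

lemma crit_exists:
 assumes I: "finite I" and L: "finite L" and th: "0 < \<theta>" "\<theta> < 1" and m: "maxi I L \<theta> \<delta> y a b w"
 shows "\<exists>w' K \<sigma> \<kappa> g h. crit I L \<theta> \<delta> y a b w' K \<sigma> \<kappa> g h"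
proof -
 let ?J = "I \<times> L"
 let ?z = "mm ?J (amp a) (mm ?J y (amp b))"
 have J: "finite ?J" using I L by simp
 obtain c0 where c0: "sb ?J \<theta> ?z c0" using sb_exists[OF J, of \<theta>] th by auto
 obtain K \<sigma> g h \<kappa> where K: "finite K" "\<And>k. k \<in> K ==> 0 < (\<sigma> :: nat => real) k" "K \<noteq> {} ==> sum \<sigma> K = 1" "sum \<sigma> K \<le> 1"
  "\<And>k l. k \<in> K ==> l \<in> K ==> ip ?J (g k) (g l) = (if k = l then 1 else 0)"
  "\<And>k l. k \<in> K ==> l \<in> K ==> ip ?J (h k) (h l) = (if k = l then 1 else 0)"
  "0 \<le> \<kappa>" "\<kappa> \<le> c0" "K = {} ==> \<kappa> = 0" "K \<noteq> {} ==> 0 < \<kappa>"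
  "\<And>i j. i \<in> ?J ==> j \<in> ?J ==> ?z i j = of_real \<kappa> * (\<Sum>k\<in>K. of_real (\<sigma> k powr \<theta>) * g k i * cnj (h k j))"
  by (rule schatten_normal_form[OF J c0 th(1)]) (rule that)
 have bg: "bessel ?J K g" and bh: "bessel ?J K h" using orthonormal_bessel[OF K(5,1)] orthonormal_bessel[OF K(6,1)] by auto
 define w' where "w' = (%p q. \<Sum>k\<in>K. complex_of_real (\<sigma> k powr (1-\<theta>)) * h k p * cnj (g k q))"
 define z0 where "z0 = (%p q. \<Sum>k\<in>K. complex_of_real (\<sigma> k powr \<theta>) * g k p * cnj (h k q))"
 have w': "sball ?J (1-\<theta>) w'" by (rule sballI[OF K(1,2,4) bh bg]) (auto simp: w'_def)
 have z0: "sball ?J \<theta> z0" by (rule sballI[OF K(1,2,4) bg bh]) (auto simp: z0_def)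
 have zz: "?z p q = of_real \<kappa> * z0 p q" if "p \<in> ?J" "q \<in> ?J" for p q using K(11)[OF that] by (simp add: z0_def)
 have tz: "tr ?J ?z x = of_real \<kappa> * tr ?J z0 x" for x
  unfolding tr_mult_left[symmetric] by (intro tr_cong) (simp_all add: zz)
 have mz: "ip ?J (mv ?J z0 (h k)) (g k) = of_real (\<sigma> k powr \<theta>)" if k: "k \<in> K" for k
 proof -
  have "(\<Sum>l\<in>K. (complex_of_real (\<sigma> l powr \<theta>) * ip ?J (h k) (h l)) * g l p) = (\<Sum>l\<in>K. if k = l then complex_of_real (\<sigma> l powr \<theta>) * g l p else 0)" for p
   using K(6)[OF k] by (intro sum.cong refl) auto
  hence "mv ?J z0 (h k) = (%p. of_real (\<sigma> k powr \<theta>) * g k p)" unfolding z0_def mv_dyads using k K(1) by simp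
  thus ?thesis using K(5)[OF k k] by (simp add: ip_mult_left)
 qed
 have "tr ?J z0 w' = (\<Sum>k\<in>K. of_real (\<sigma> k))"
  unfolding w'_def tr_dyads
 proof (intro sum.cong refl)
  fix k assume k: "k \<in> K"
  have "\<sigma> k powr (1-\<theta>) * \<sigma> k powr \<theta> = \<sigma> k" using K(2)[OF k] by (simp flip: powr_add)
  thus "of_real (\<sigma> k powr (1-\<theta>)) * ip ?J (mv ?J z0 (h k)) (g k) = complex_of_real (\<sigma> k)"
   unfolding mz[OF k] by (metis of_real_mult)
 qed
 hence t': "tr ?J ?z w' = of_real (\<kappa> * sum \<sigma> K)" unfolding tz by simp
 have ks: "\<kappa> * sum \<sigma> K = \<kappa>" using K(3,9) by (cases "K = {}") auto
 have a: "sb I (\<theta>/2) a 1" and b: "sb I (\<theta>/2) b 1" and w: "sb ?J (1-\<theta>) w 1" using m by (auto simp: maxi_def)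
 have "sball ?J (1-\<theta>) w" using th by (intro sb_1_sball[OF J w]) auto
 hence "cmod (tr ?J z0 w) \<le> 1" using th by (intro sball_pair[OF _ _ z0]) auto
 hence "Re (tr ?J z0 w) \<le> 1" using complex_Re_le_cmod order_trans by blast
 hence "\<kappa> * Re (tr ?J z0 w) \<le> \<kappa>" using K(7) by (rule mult_left_le)
 hence "phi I L \<delta> y a b w \<le> phi I L \<delta> y a b w'"
  unfolding phi_def t' ks using tz[of w] by simp
 hence "maxi I L \<theta> \<delta> y a b w'" using th
  by (intro maxi_replace[OF m a b] sball_sb w') auto
 moreover have "\<forall>p\<in>?J. \<forall>q\<in>?J. ?z p q = of_real \<kappa> * (\<Sum>k\<in>K. of_real (\<sigma> k powr \<theta>) * g k p * cnj (h k q))" using K(11) by blast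
 ultimately have "crit I L \<theta> \<delta> y a b w' K \<sigma> \<kappa> g h"
  unfolding crit_def using K(1-7) K(10) ks by (intro conjI) (auto simp: w'_def)
 thus ?thesis by blast
qed

lemma ip_prod: "ip (I \<times> L) \<xi> \<eta> = (\<Sum>l\<in>L. ip I (%i. \<xi> (i, l)) (%i. \<eta> (i, l)))"
 unfolding ip_def by (subst sum.swap) (simp add: sum.cartesian_product)

lemma tr_amp_left:
 assumes "finite L" "\<And>i j. i \<in> I ==> j \<in> I ==> a' i j = c * mm I s a i j"
 shows "tr (I \<times> L) (mm (I \<times> L) (amp a') x) w = c * tr (I \<times> L) (mm (I \<times> L) (amp s) (mm (I \<times> L) (amp a) x)) w"
proof -
 let ?J = "I \<times> L"
 have "tr ?J (mm ?J (amp a') x) w = tr ?J (%p q. c * mm ?J (mm ?J (amp s) (amp a)) x p q) w"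
 proof (intro tr_cong refl)
  fix p q assume pq: "p \<in> ?J" "q \<in> ?J"
  have "mm ?J (amp a') x p q = (\<Sum>r\<in>?J. (c * mm ?J (amp s) (amp a) p r) * x r q)"
   unfolding mm_def[of ?J "amp a'"] using pq
   by (intro sum.cong refl arg_cong2[where f = "(*)"]) (auto simp: mm_amp[OF assms(1)], auto simp: amp_def assms(2))
  thus "mm ?J (amp a') x p q = c * mm ?J (mm ?J (amp s) (amp a)) x p q"
   by (simp add: mm_def[of ?J _ x] sum_distrib_left mult_ac)
 qed
 thus ?thesis by (simp add: tr_mult_left mm_assoc)
qed

lemma stretch_form:
 assumes "finite I"
 shows "ip I (mv I (stretch (of_real (1 + t)) c) \<xi>) \<xi> = of_real (sq I \<xi> + t * (cmod (ip I \<xi> c))\<^sup>2)"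
proof -
 have "ip I (mv I (stretch (of_real (1 + t)) c) \<xi>) \<xi> = (\<Sum>i\<in>I. \<xi> i * cnj (\<xi> i) + (of_real t * ip I \<xi> c) * (c i * cnj (\<xi> i)))"
  unfolding ip_def[of I "mv I _ _"] using assms by (intro sum.cong refl) (simp add: mv_stretch algebra_simps)
 also have "... = ip I \<xi> \<xi> + of_real t * ip I \<xi> c * ip I c \<xi>"
  by (simp add: sum.distrib ip_def sum_distrib_left)
 also have "ip I c \<xi> = cnj (ip I \<xi> c)" by (rule ip_commute)
 finally show ?thesis unfolding ip_self by (simp add: mult.assoc flip: complex_norm_square)
qed

text \<open>The first order condition. Moving \<open>a\<close> to \<open>(1 + t c c\<^sup>*) a\<close>, normalised, cannot increase the value.\<close>

lemma crit_first_order_unit: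
 assumes I: "finite I" and L: "finite L" and th: "0 < \<theta>" "\<theta> < 1" and d: "0 < \<delta>"
  and cr: "crit I L \<theta> \<delta> y a b w K \<sigma> \<kappa> g h" and pf: "posf I \<theta> a Q \<alpha> v" and c: "sq I c = 1"
 shows "\<kappa> * (\<Sum>k\<in>K. \<sigma> k * (\<Sum>l\<in>L. (cmod (ip I (%i. g k (i, l)) c))\<^sup>2))
   \<le> (\<kappa> + \<delta> * Re (\<Sum>i\<in>I. a i i)) * (\<Sum>q\<in>Q. \<alpha> q * (cmod (ip I (v q) c))\<^sup>2)"
proof -
 let ?J = "I \<times> L"
 have J: "finite ?J" using I L by simp
 note C = critD[OF cr] and P = posfD[OF pf]
 define X where "X = \<kappa> * (\<Sum>k\<in>K. \<sigma> k * (\<Sum>l\<in>L. (cmod (ip I (%i. g k (i, l)) c))\<^sup>2))"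
 define m where "m = (\<Sum>q\<in>Q. \<alpha> q * (cmod (ip I (v q) c))\<^sup>2)"
 define lam where "lam = \<kappa> + \<delta> * Re (\<Sum>i\<in>I. a i i)"
 define N where "N = (%t. (1 + ((1 + t) powr (2/\<theta>) - 1) * m) powr (\<theta>/2))"
 have m0: "0 \<le> m" unfolding m_def using P(2) by (intro sum_nonneg mult_nonneg_nonneg) (auto simp: less_imp_le)
 have main: "X \<le> lam * ((N t - N 0) / t)" if t: "0 < t" for t
 proof -
  let ?S = "stretch (complex_of_real (1 + t)) c"
  have "1 \<le> (1 + t) powr (2/\<theta>)" using t th by (intro ge_one_powr_ge_zero) auto
  hence "1 \<le> 1 + ((1 + t) powr (2/\<theta>) - 1) * m" using m0 by simp
  hence N1: "1 \<le> N t" unfolding N_def using th by (intro ge_one_powr_ge_zero) auto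
  have sbt: "sb I (\<theta>/2) (mm I ?S a) (N t)"
   unfolding N_def m_def using th by (intro stretch_norm[OF I _ _ c t P]) auto
  define a' where "a' = (%i j. complex_of_real (1 / N t) * mm I ?S a i j)"
  have sa': "sb I (\<theta>/2) a' 1"
   using sb_mult[OF sbt, of "complex_of_real (1 / N t)"] N1 by (simp add: a'_def norm_divide)
  have "phi I L \<delta> y a' b w \<le> phi I L \<delta> y a b w"
   using C(1) sa' unfolding maxi_def by blast
  hence p: "Re (tr ?J (mm ?J (amp a') (mm ?J y (amp b))) w) + \<delta> * Re (\<Sum>i\<in>I. a' i i) \<le> lam"
   unfolding phi_def crit_value[OF cr I L] lam_def by simp
  have "tr ?J (mm ?J (amp a') (mm ?J y (amp b))) w
   = of_real (1 / N t) * tr ?J (mm ?J (amp ?S) (mm ?J (amp a) (mm ?J y (amp b)))) w"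
   by (rule tr_amp_left[OF L]) (simp add: a'_def)
  also have "tr ?J (mm ?J (amp ?S) (mm ?J (amp a) (mm ?J y (amp b)))) w = of_real (\<kappa> + t * X)"
  proof -
   have "ip ?J (mv ?J (amp ?S) (g k)) (g k) = of_real (1 + t * (\<Sum>l\<in>L. (cmod (ip I (%i. g k (i, l)) c))\<^sup>2))" if k: "k \<in> K" for k
   proof -
    have "ip ?J (mv ?J (amp ?S) (g k)) (g k) = (\<Sum>l\<in>L. ip I (mv I ?S (%i. g k (i, l))) (%i. g k (i, l)))"
     unfolding ip_prod using L by (intro sum.cong refl) (simp add: mv_amp)
    also have "... = of_real (sq ?J (g k) + t * (\<Sum>l\<in>L. (cmod (ip I (%i. g k (i, l)) c))\<^sup>2))"
     unfolding stretch_form[OF I] by (simp add: sq_prod sum.distrib sum_distrib_left)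
    finally show ?thesis using orthonormal_sq[of ?J "g k"] C(8)[OF k k] by simp
   qed
   hence "tr ?J (mm ?J (amp ?S) (mm ?J (amp a) (mm ?J y (amp b)))) w
    = (\<Sum>k\<in>K. of_real (\<kappa> * \<sigma> k) * of_real (1 + t * (\<Sum>l\<in>L. (cmod (ip I (%i. g k (i, l)) c))\<^sup>2)))"
    unfolding crit_form(1)[OF cr] by (intro sum.cong refl) simp
   also have "... = of_real (\<Sum>k\<in>K. \<kappa> * \<sigma> k + t * (\<kappa> * (\<sigma> k * (\<Sum>l\<in>L. (cmod (ip I (%i. g k (i, l)) c))\<^sup>2))))"
    by (simp only: of_real_mult[symmetric] of_real_sum[symmetric]) (simp add: algebra_simps)
   also have "(\<Sum>k\<in>K. \<kappa> * \<sigma> k + t * (\<kappa> * (\<sigma> k * (\<Sum>l\<in>L. (cmod (ip I (%i. g k (i, l)) c))\<^sup>2)))) = \<kappa> * sum \<sigma> K + t * X"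
    by (simp add: sum.distrib X_def sum_distrib_left)
   finally show ?thesis using C(5) by simp
  qed
  finally have t1: "Re (tr ?J (mm ?J (amp a') (mm ?J y (amp b))) w) = (\<kappa> + t * X) / N t" by simp
  have "Re (\<Sum>i\<in>I. a i i) / N t \<le> Re (\<Sum>i\<in>I. a' i i)"
  proof -
   have "mm I ?S a i i = (\<Sum>q\<in>Q. of_real (\<alpha> q powr (\<theta>/2)) * mv I ?S (v q) i * cnj (v q i))" if "i \<in> I" for i
   proof -
    have "mm I ?S a i i = (\<Sum>k\<in>I. \<Sum>q\<in>Q. of_real (\<alpha> q powr (\<theta>/2)) * (?S i k * v q k) * cnj (v q i))"
     unfolding mm_def using that by (intro sum.cong refl) (simp add: P(5) sum_distrib_left mult_ac)
    also have "... = (\<Sum>q\<in>Q. \<Sum>k\<in>I. of_real (\<alpha> q powr (\<theta>/2)) * (?S i k * v q k) * cnj (v q i))" by (rule sum.swap)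
    finally show ?thesis by (simp add: mv_def sum_distrib_left sum_distrib_right)
   qed
   hence "(\<Sum>i\<in>I. mm I ?S a i i) = (\<Sum>q\<in>Q. of_real (\<alpha> q powr (\<theta>/2)) * ip I (mv I ?S (v q)) (v q))"
    by (simp add: trace_dyads)
   also have "... = of_real (\<Sum>q\<in>Q. \<alpha> q powr (\<theta>/2) * (sq I (v q) + t * (cmod (ip I (v q) c))\<^sup>2))"
    unfolding stretch_form[OF I] by simp
   finally have e1: "Re (\<Sum>i\<in>I. mm I ?S a i i) = (\<Sum>q\<in>Q. \<alpha> q powr (\<theta>/2) * (sq I (v q) + t * (cmod (ip I (v q) c))\<^sup>2))" by simp
   have "(\<Sum>i\<in>I. a i i) = (\<Sum>q\<in>Q. of_real (\<alpha> q powr (\<theta>/2)) * ip I (v q) (v q))"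
    using P(5) by (simp flip: trace_dyads)
   hence "Re (\<Sum>i\<in>I. a i i) = (\<Sum>q\<in>Q. \<alpha> q powr (\<theta>/2) * sq I (v q))" by (simp add: ip_self)
   also have "... \<le> Re (\<Sum>i\<in>I. mm I ?S a i i)" unfolding e1 using t by (intro sum_mono mult_left_mono) auto
   finally have "Re (\<Sum>i\<in>I. a i i) / N t \<le> Re (\<Sum>i\<in>I. mm I ?S a i i) / N t" using N1 by (intro divide_right_mono) auto
   also have "... = Re (\<Sum>i\<in>I. a' i i)"
    unfolding a'_def sum_distrib_left[symmetric] by simp
   finally show ?thesis .
  qed
  hence "\<delta> * (Re (\<Sum>i\<in>I. a i i) / N t) \<le> \<delta> * Re (\<Sum>i\<in>I. a' i i)" using d by (intro mult_left_mono) auto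
  hence "(\<kappa> + t * X) / N t + \<delta> * (Re (\<Sum>i\<in>I. a i i) / N t) \<le> lam" using p t1 by linarith
  hence "(lam + t * X) / N t \<le> lam" unfolding lam_def by (simp add: add_divide_distrib)
  hence "lam + t * X \<le> lam * N t" using N1 by (simp add: divide_le_eq)
  moreover have "N 0 = 1" by (simp add: N_def)
  ultimately show ?thesis using t by (simp add: field_simps)
 qed
 have "(N has_real_derivative m) (at 0)"
  unfolding N_def using th by (auto intro!: derivative_eq_intros)
 hence "((%t. (N t - N 0) / t) \<longlongrightarrow> m) (at 0)" unfolding DERIV_def by simp
 hence "((%t. (N t - N 0) / t) \<longlongrightarrow> m) (at_right 0)" by (rule filterlim_mono[OF _ order_refl]) (simp add: at_le)
 hence "((%t. lam * ((N t - N 0) / t)) \<longlongrightarrow> lam * m) (at_right 0)" by (intro tendsto_intros)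
 moreover have "\<forall>\<^sub>F t in at_right 0. X \<le> lam * ((N t - N 0) / t)"
  using eventually_at_right_less[of "0::real"] by eventually_elim (rule main)
 ultimately have "X \<le> lam * m" by (rule tendsto_lowerbound) (rule trivial_limit_at_right_real)
 thus ?thesis by (simp add: X_def lam_def m_def)
qed

lemma crit_first_order:
 assumes I: "finite I" and L: "finite L" and th: "0 < \<theta>" "\<theta> < 1" and d: "0 < \<delta>"
  and cr: "crit I L \<theta> \<delta> y a b w K \<sigma> \<kappa> g h" and pf: "posf I \<theta> a Q \<alpha> v"
 shows "\<kappa> * (\<Sum>k\<in>K. \<sigma> k * (\<Sum>l\<in>L. (cmod (ip I (%i. g k (i, l)) c))\<^sup>2))
   \<le> (\<kappa> + \<delta> * Re (\<Sum>i\<in>I. a i i)) * (\<Sum>q\<in>Q. \<alpha> q * (cmod (ip I (v q) c))\<^sup>2)"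
proof (cases "sq I c = 0")
 case True
 have "ip I \<xi> c = 0" for \<xi> using ip_cs[of I \<xi> c] True by simp
 thus ?thesis by simp
next
 case False
 define r where "r = sqrt (sq I c)"
 have r: "r > 0" "r\<^sup>2 = sq I c" using False sq_nonneg[of I c] by (auto simp: r_def less_le)
 define c' where "c' = (%i. complex_of_real (1/r) * c i)"
 have "sq I c' = 1" unfolding c'_def sq_mult r(2)[symmetric] using r(1) by (simp add: norm_divide power_divide)
 have n: "cmod (cnj (complex_of_real (1/r))) = 1/r" using r(1) by (simp add: norm_divide)
 from crit_first_order_unit[OF I L th d cr pf \<open>sq I c' = 1\<close>]
 have "\<kappa> * (\<Sum>k\<in>K. \<sigma> k * (\<Sum>l\<in>L. (1/r)\<^sup>2 * (cmod (ip I (%i. g k (i, l)) c))\<^sup>2))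
   \<le> (\<kappa> + \<delta> * Re (\<Sum>i\<in>I. a i i)) * (\<Sum>q\<in>Q. \<alpha> q * ((1/r)\<^sup>2 * (cmod (ip I (v q) c))\<^sup>2))"
  unfolding c'_def ip_mult_right norm_mult power_mult_distrib n .
 also have "... = (1/r)\<^sup>2 * ((\<kappa> + \<delta> * Re (\<Sum>i\<in>I. a i i)) * (\<Sum>q\<in>Q. \<alpha> q * (cmod (ip I (v q) c))\<^sup>2))"
  by (simp add: sum_distrib_left mult_ac)
 also have "\<kappa> * (\<Sum>k\<in>K. \<sigma> k * (\<Sum>l\<in>L. (1/r)\<^sup>2 * (cmod (ip I (%i. g k (i, l)) c))\<^sup>2))
  = (1/r)\<^sup>2 * (\<kappa> * (\<Sum>k\<in>K. \<sigma> k * (\<Sum>l\<in>L. (cmod (ip I (%i. g k (i, l)) c))\<^sup>2)))"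
  by (simp add: sum_distrib_left mult_ac)
 finally show ?thesis using r by (simp only: mult_le_cancel_left_pos zero_less_power zero_less_divide_1_iff)
qed

text \<open>The linear term \<open>\<delta> Tr a\<close> forces \<open>a\<close> to be invertible: if \<open>a f = 0\<close>, then moving to \<open>a + t f f\<^sup>*\<close>
 costs only \<open>t\<^sup>2\<^sup>p\<close> in norm, while the first term of the functional does not change.\<close>

lemma crit_complete:
 assumes I: "finite I" and L: "finite L" and th: "0 < \<theta>" "\<theta> < 1" and d: "0 < \<delta>"
  and cr: "crit I L \<theta> \<delta> y a b w K \<sigma> \<kappa> g h" and pf: "posf I \<theta> a Q \<alpha> v" and i: "i \<in> I" and j: "j \<in> I"
 shows "(\<Sum>q\<in>Q. v q i * cnj (v q j)) = idm i j"
proof -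
 let ?J = "I \<times> L"
 have J: "finite ?J" using I L by simp
 note C = critD[OF cr] and P = posfD[OF pf]
 have nof: False if f1: "sq I f = 1" and fo: "\<And>q. q \<in> Q ==> ip I f (v q) = 0" for f
 proof -
  obtain q0 where q0: "q0 \<notin> Q" using ex_new_if_finite[OF infinite_UNIV_nat P(1)] by blast
  define lam where "lam = \<kappa> + \<delta> * Re (\<Sum>i\<in>I. a i i)"
  have "(\<Sum>i\<in>I. a i i) = (\<Sum>q\<in>Q. of_real (\<alpha> q powr (\<theta>/2)) * ip I (v q) (v q))"
   using P(5) by (simp flip: trace_dyads)
  hence "Re (\<Sum>i\<in>I. a i i) = (\<Sum>q\<in>Q. \<alpha> q powr (\<theta>/2) * sq I (v q))" by (simp add: ip_self)
  hence l0: "0 \<le> lam" unfolding lam_def using C(7) d by (auto intro!: add_nonneg_nonneg mult_nonneg_nonneg sum_nonneg)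
  define t where "t = min 1 (\<delta> / (2 * (lam + 1)))"
  have t: "0 < t" "t \<le> 1" "t \<le> \<delta> / (2 * (lam + 1))" using d l0 by (auto simp: t_def)
  define s where "s = 1 + t powr (2/\<theta>)"
  have s: "1 \<le> s" by (simp add: s_def)
  define N where "N = s powr (\<theta>/2)"
  have N1: "1 \<le> N" unfolding N_def using s th by (intro ge_one_powr_ge_zero) auto
  have "N \<le> s powr 1" unfolding N_def using s th by (intro powr_mono) auto
  also have "... = s" using s by simp
  also have "... \<le> 1 + t powr 2"
   unfolding s_def using powr_mono'[of 2 "2/\<theta>" t] t th by (simp add: le_divide_eq)
  finally have N2: "N \<le> 1 + t\<^sup>2" using t by simp
  define a' where "a' = (%i j. complex_of_real (1 / N) * (a i j + of_real t * (f i * cnj (f j))))"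
  define \<rho> where "\<rho> = (%q. (if q = q0 then t powr (2/\<theta>) else \<alpha> q) / s)"
  define v' where "v' = (%q. if q = q0 then f else v q)"
  have vf: "ip I (v q) f = 0" if "q \<in> Q" for q using fo[OF that] ip_commute[of I "v q" f] by simp
  have ov: "ip I (v' k) (v' l) = (if k = l then 1 else 0)" if "k \<in> insert q0 Q" "l \<in> insert q0 Q" for k l
   using that q0 fo vf f1 ip_self[of I f] by (auto simp: v'_def P(4))
  have fin: "finite (insert q0 Q)" using P(1) by simp
  have sa': "sball I (\<theta>/2) a'"
  proof (rule sballI[OF fin _ _ orthonormal_bessel[OF ov fin] orthonormal_bessel[OF ov fin]])
   show "0 < \<rho> q" if "q \<in> insert q0 Q" for q using that P(2) t s by (auto simp: \<rho>_def)
   have "sum \<rho> (insert q0 Q) = (t powr (2/\<theta>) + sum \<alpha> Q) / s"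
   proof -
    have "sum \<rho> Q = sum \<alpha> Q / s" unfolding \<rho>_def sum_divide_distrib using q0 by (intro sum.cong) auto
    thus ?thesis using P(1) q0 by (simp add: \<rho>_def add_divide_distrib)
   qed
   also have "... \<le> 1" using P(3) s by (simp add: divide_le_eq) (simp add: s_def)
   finally show "sum \<rho> (insert q0 Q) \<le> 1" .
   fix i j assume ij: "i \<in> I" "j \<in> I"
   have 1: "\<rho> q0 powr (\<theta>/2) = t / N" using t s th by (simp add: \<rho>_def N_def powr_divide powr_powr)
   have 2: "\<rho> q powr (\<theta>/2) = \<alpha> q powr (\<theta>/2) / N" if "q \<in> Q" for q
    using P(2)[OF that] s th that q0 by (auto simp: \<rho>_def N_def powr_divide)
   have "(\<Sum>q\<in>Q. of_real (\<rho> q powr (\<theta>/2)) * v' q i * cnj (v' q j)) = (\<Sum>q\<in>Q. of_real (1/N) * (of_real (\<alpha> q powr (\<theta>/2)) * v q i * cnj (v q j)))"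
    using 2 q0 by (intro sum.cong refl) (auto simp: v'_def)
   also have "... = of_real (1/N) * a i j" unfolding P(5)[OF ij] by (simp add: sum_distrib_left)
   finally show "a' i j = (\<Sum>q\<in>insert q0 Q. of_real (\<rho> q powr (\<theta>/2)) * v' q i * cnj (v' q j))"
    using P(1) q0 1 by (simp add: a'_def v'_def distrib_left add_divide_distrib)
  qed
  have "sb I (\<theta>/2) a' 1" using th by (intro sball_sb sa') auto
  hence "phi I L \<delta> y a' b w \<le> phi I L \<delta> y a b w" using C(1) unfolding maxi_def by blast
  hence p: "Re (tr ?J (mm ?J (amp a') (mm ?J y (amp b))) w) + \<delta> * Re (\<Sum>i\<in>I. a' i i) \<le> lam"
   unfolding phi_def crit_value[OF cr I L] lam_def by simp
  define F where "F = (%i j. f i * cnj (f j))"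
  let ?Y = "mm ?J y (amp b)"
  have gf: "ip I (%i. g k (i, l)) f = 0" if k: "k \<in> K" and l: "l \<in> L" for k l
  proof -
   have pos: "\<kappa> * \<sigma> k powr \<theta> \<noteq> 0" using C(6) C(3)[OF k] k by auto
   have "of_real (\<kappa> * \<sigma> k powr \<theta>) * ip I (%i. g k (i, l)) f = ip I (%i. of_real (\<kappa> * \<sigma> k powr \<theta>) * g k (i, l)) f"
    by (simp only: ip_mult_left)
   also have "... = ip I (mv I a (%j. mv ?J ?Y (h k) (j, l))) f"
   proof (intro ip_cong refl)
    fix i assume "i \<in> I"
    hence "of_real (\<kappa> * \<sigma> k powr \<theta>) * g k (i, l) = mv ?J (mm ?J (amp a) ?Y) (h k) (i, l)"
     using crit_form(2)[OF cr k, of "(i,l)"] l by simp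
    thus "of_real (\<kappa> * \<sigma> k powr \<theta>) * g k (i, l) = mv I a (%j. mv ?J ?Y (h k) (j, l)) i"
     unfolding mv_mm by (simp add: mv_amp[OF L l])
   qed
   also have "... = ip I (mv I (%i j. \<Sum>q\<in>Q. of_real (\<alpha> q powr (\<theta>/2)) * v q i * cnj (v q j)) (%j. mv ?J ?Y (h k) (j, l))) f"
    using P(5) by (intro ip_cong refl) (simp add: mv_def)
   also have "... = 0" unfolding mv_dyads ip_sum_left using vf by simp
   finally show ?thesis using pos by simp
  qed
  have "tr ?J (mm ?J (amp F) ?Y) w = 0"
  proof -
   have "ip ?J (mv ?J (amp F) (mv ?J ?Y (h k))) (g k) = 0" if k: "k \<in> K" for k
   proof -
    have "ip ?J (mv ?J (amp F) (mv ?J ?Y (h k))) (g k) = (\<Sum>l\<in>L. ip I (mv I F (%j. mv ?J ?Y (h k) (j, l))) (%i. g k (i, l)))"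
     unfolding ip_prod using L by (intro sum.cong refl) (simp add: mv_amp)
    also have "... = 0"
    proof (intro sum.neutral ballI)
     fix l assume l: "l \<in> L"
     have "mv I F \<xi> = (%i. ip I \<xi> f * f i)" for \<xi>
      by (simp add: mv_def F_def ip_def sum_distrib_left sum_distrib_right fun_eq_iff mult_ac)
     moreover have "ip I f (%i. g k (i, l)) = 0"
      using gf[OF k l] ip_commute[of I f "%i. g k (i, l)"] by simp
     ultimately show "ip I (mv I F (%j. mv ?J ?Y (h k) (j, l))) (%i. g k (i, l)) = 0"
      by (simp add: ip_mult_left)
    qed
    finally show ?thesis .
   qed
   thus ?thesis unfolding C(11) tr_dyads mv_mm by simp
  qed
  moreover have "tr ?J (mm ?J (amp a') ?Y) w = of_real (1/N) * (tr ?J (mm ?J (amp a) ?Y) w + of_real t * tr ?J (mm ?J (amp F) ?Y) w)"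
  proof -
   have am: "amp a' p q = complex_of_real (1/N) * (amp a p q + of_real t * amp F p q)" for p q
    by (simp add: amp_def a'_def F_def)
   have "mm ?J (amp a') ?Y = (%p q. complex_of_real (1/N) * (mm ?J (amp a) ?Y p q + of_real t * mm ?J (amp F) ?Y p q))"
   proof (intro ext)
    fix p q
    have "mm ?J (amp a') ?Y p q = (\<Sum>r\<in>?J. complex_of_real (1/N) * (amp a p r * ?Y r q + of_real t * (amp F p r * ?Y r q)))"
     unfolding mm_def[of ?J "amp a'"] am by (intro sum.cong refl) (simp only: algebra_simps)
    thus "mm ?J (amp a') ?Y p q = complex_of_real (1/N) * (mm ?J (amp a) ?Y p q + of_real t * mm ?J (amp F) ?Y p q)"
     unfolding mm_def[of ?J "amp a"] mm_def[of ?J "amp F"] by (simp only: sum_distrib_left[symmetric] sum.distrib)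
   qed
   thus ?thesis by (simp only: tr_mult_left tr_add_left)
  qed
  ultimately have t1: "Re (tr ?J (mm ?J (amp a') ?Y) w) = \<kappa> / N"
   unfolding crit_value[OF cr I L] by simp
  have "(\<Sum>i\<in>I. a' i i) = of_real (1/N) * ((\<Sum>i\<in>I. a i i) + of_real t * ip I f f)"
   unfolding a'_def sum_distrib_left[symmetric] sum.distrib by (simp add: ip_def)
  hence "Re (\<Sum>i\<in>I. a' i i) = (Re (\<Sum>i\<in>I. a i i) + t) / N" using f1 by (simp add: ip_self)
  hence "\<kappa> / N + \<delta> * ((Re (\<Sum>i\<in>I. a i i) + t) / N) \<le> lam" using p t1 by simp
  hence "(lam + \<delta> * t) / N \<le> lam" unfolding lam_def by (simp add: add_divide_distrib algebra_simps)
  hence "lam + \<delta> * t \<le> lam * N" using N1 by (simp add: divide_le_eq)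
  also have "... \<le> lam * (1 + t\<^sup>2)" using N2 l0 by (rule mult_left_mono)
  finally have "\<delta> * t \<le> (lam * t) * t" by (simp add: algebra_simps power2_eq_square)
  hence "\<delta> \<le> lam * t" using t by simp
  also have "... \<le> lam * (\<delta> / (2 * (lam + 1)))" using t l0 by (intro mult_left_mono) auto
  also have "... = \<delta> * (lam / (2 * (lam + 1)))" by simp
  also have "... < \<delta> * 1" using d l0 by (intro mult_strict_left_mono) (auto simp: divide_less_eq)
  finally show False by simp
 qed
 define f where "f = (%i. idm i j - (\<Sum>q\<in>Q. cnj (v q j) * v q i))"
 have "ip I f (v r) = 0" if r: "r \<in> Q" for r
 proof -
  have "ip I f (v r) = (\<Sum>i\<in>I. idm i j * cnj (v r i)) - ip I (%i. \<Sum>q\<in>Q. cnj (v q j) * v q i) (v r)"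
   unfolding f_def ip_def by (simp add: left_diff_distrib sum_subtractf)
  also have "(\<Sum>i\<in>I. idm i j * cnj (v r i)) = (\<Sum>i\<in>I. if i = j then cnj (v r i) else 0)"
   by (intro sum.cong refl) (simp add: idm_def)
  also have "... = cnj (v r j)" using I j by simp
  finally show ?thesis by (simp add: orthonormal_expand[OF P(1,4) r])
 qed
 have "sq I f = 0"
 proof (rule ccontr)
  assume "sq I f \<noteq> 0"
  then obtain r where r: "r > 0" "r\<^sup>2 = sq I f"
   using sq_nonneg[of I f] by (intro that[of "sqrt (sq I f)"]) (auto simp: less_le)
  have "sq I (%i. complex_of_real (1 / r) * f i) = 1"
   unfolding sq_mult r(2)[symmetric] using r(1) by (simp add: norm_divide power_divide)
  moreover have "ip I (%i. complex_of_real (1 / r) * f i) (v q) = 0" if "q \<in> Q" for q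
   unfolding ip_mult_left using \<open>\<And>r. r \<in> Q ==> ip I f (v r) = 0\<close>[OF that] by simp
  ultimately show False by (rule nof)
 qed
 hence "f i = 0" using I i unfolding sq_def by (simp add: sum_nonneg_eq_0_iff)
 thus ?thesis by (simp add: f_def mult.commute)
qed

section \<open>Elements of small norm in the interpolation space\<close>

lemma adj_dyads: "adj (%i j. \<Sum>k\<in>Q. c k * u k i * cnj (v k j)) = (%i j. \<Sum>k\<in>Q. cnj (c k) * v k i * cnj (u k j))"
 by (simp add: adj_def fun_eq_iff mult_ac)

lemma hs_adj: "hs J (adj x) = hs J x"
 unfolding hs_def adj_def by (subst sum.swap) simp

lemma mv_orthonormal:
 assumes "finite Q" "\<And>k l. k \<in> Q ==> l \<in> Q ==> ip I (v k) (v l) = (if k = l then 1 else 0)" "q \<in> Q"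
 shows "mv I (%i j. \<Sum>k\<in>Q. c k * u k i * cnj (v k j)) (v q) i = c q * u q i"
proof -
 have "(\<Sum>k\<in>Q. (c k * ip I (v q) (v k)) * u k i) = (\<Sum>k\<in>Q. if q = k then c k * u k i else 0)"
  using assms(2,3) by (intro sum.cong refl) auto
 thus ?thesis using assms(1,3) by (simp add: mv_dyads)
qed

text \<open>With \<open>D = a\<^sup>-\<^sup>p\<close> up to a unitary, the first order condition bounds the Hilbert-Schmidt norm of
 \<open>(A D \<otimes> 1) |z\<^sup>*|\<^sup>p\<^sup>/\<^sup>2\<close>.\<close>

lemma first_order_hs:
 assumes I: "finite I" and L: "finite L" and M: "finite M" "I \<subseteq> M" and lam: "0 \<le> lam"
  and fo: "\<And>c. \<kappa> * (\<Sum>k\<in>K. \<sigma> k * (\<Sum>l\<in>L. (cmod (ip I (%i. g k (i, l)) c))\<^sup>2)) \<le> lam * (\<Sum>q\<in>Q. \<alpha> q * (cmod (ip I (v q) c))\<^sup>2)"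
  and Q: "finite Q" "\<And>q. q \<in> Q ==> 0 < (\<alpha> :: nat => real) q"
  and o: "\<And>k l. k \<in> Q ==> l \<in> Q ==> ip I (v k) (v l) = (if k = l then 1 else 0)"
  and \<gamma>: "\<And>q. q \<in> Q ==> (cmod (\<gamma> q))\<^sup>2 = 1 / \<alpha> q" and A: "hs M A \<le> 1"
 defines "D \<equiv> (%i j. \<Sum>q\<in>Q. \<gamma> q * v q i * cnj (v q j))"
 shows "(\<Sum>k\<in>K. \<kappa> * \<sigma> k * sq (M \<times> L) (mv (M \<times> L) (amp A) (rs (I \<times> L) (mv (I \<times> L) (amp D) (g k))))) \<le> lam"
proof -
 define c where "c = (%r j. cnj (\<Sum>i\<in>I. A r i * D i j))"
 have e1: "mv (M \<times> L) (amp A) (rs (I \<times> L) (mv (I \<times> L) (amp D) (g k))) (r, l) = ip I (%i. g k (i, l)) (c r)"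
  if l: "l \<in> L" for k r l
 proof -
  have "mv (M \<times> L) (amp A) (rs (I \<times> L) (mv (I \<times> L) (amp D) (g k))) (r, l)
    = (\<Sum>i\<in>M. if i \<in> I then A r i * mv I D (%j. g k (j, l)) i else 0)"
   unfolding mv_amp[OF L l] mv_def[of M] using l
   by (intro sum.cong refl) (auto simp: rs_def mv_amp[OF L l])
  also have "... = (\<Sum>i\<in>I. A r i * mv I D (%j. g k (j, l)) i)"
   using M by (simp add: sum.inter_restrict[symmetric] Int_absorb1)
  also have "... = (\<Sum>i\<in>I. \<Sum>j\<in>I. A r i * D i j * g k (j, l))"
   by (simp add: mv_def sum_distrib_left mult.assoc)
  also have "... = (\<Sum>j\<in>I. \<Sum>i\<in>I. A r i * D i j * g k (j, l))" by (rule sum.swap)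
  finally show ?thesis by (simp add: ip_def c_def sum_distrib_left mult_ac)
 qed
 have e2: "\<alpha> q * (cmod (ip I (v q) (c r)))\<^sup>2 = (cmod (ip I (%i. cnj (A r i)) (v q)))\<^sup>2" if q: "q \<in> Q" for q r
 proof -
  have "ip I (v q) (c r) = (\<Sum>j\<in>I. \<Sum>i\<in>I. A r i * (D i j * v q j))"
   by (simp add: ip_def c_def sum_distrib_left mult_ac)
  also have "... = (\<Sum>i\<in>I. \<Sum>j\<in>I. A r i * (D i j * v q j))" by (rule sum.swap)
  also have "... = (\<Sum>i\<in>I. A r i * mv I D (v q) i)" by (simp add: mv_def sum_distrib_left)
  also have "... = (\<Sum>i\<in>I. A r i * (\<gamma> q * v q i))"
   unfolding D_def by (intro sum.cong refl) (simp only: mv_orthonormal[OF Q(1) o q])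
  also have "... = \<gamma> q * cnj (ip I (%i. cnj (A r i)) (v q))"
   by (simp add: ip_def sum_distrib_left mult_ac)
  finally have "(cmod (ip I (v q) (c r)))\<^sup>2 = (cmod (\<gamma> q))\<^sup>2 * (cmod (ip I (%i. cnj (A r i)) (v q)))\<^sup>2"
   by (simp add: norm_mult power_mult_distrib)
  thus ?thesis unfolding \<gamma>[OF q] using Q(2)[OF q] by simp
 qed
 have "(\<Sum>k\<in>K. \<kappa> * \<sigma> k * sq (M \<times> L) (mv (M \<times> L) (amp A) (rs (I \<times> L) (mv (I \<times> L) (amp D) (g k)))))
   = (\<Sum>k\<in>K. \<Sum>r\<in>M. \<kappa> * \<sigma> k * (\<Sum>l\<in>L. (cmod (ip I (%i. g k (i, l)) (c r)))\<^sup>2))"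
 proof (intro sum.cong refl)
  fix k
  have "sq (M \<times> L) (mv (M \<times> L) (amp A) (rs (I \<times> L) (mv (I \<times> L) (amp D) (g k))))
   = (\<Sum>l\<in>L. \<Sum>r\<in>M. (cmod (ip I (%i. g k (i, l)) (c r)))\<^sup>2)"
   unfolding sq_prod sq_def[of M] by (intro sum.cong refl) (simp only: e1)
  also have "... = (\<Sum>r\<in>M. \<Sum>l\<in>L. (cmod (ip I (%i. g k (i, l)) (c r)))\<^sup>2)" by (rule sum.swap)
  finally show "\<kappa> * \<sigma> k * sq (M \<times> L) (mv (M \<times> L) (amp A) (rs (I \<times> L) (mv (I \<times> L) (amp D) (g k))))
   = (\<Sum>r\<in>M. \<kappa> * \<sigma> k * (\<Sum>l\<in>L. (cmod (ip I (%i. g k (i, l)) (c r)))\<^sup>2))" by (simp add: sum_distrib_left)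
 qed
 also have "... = (\<Sum>r\<in>M. \<kappa> * (\<Sum>k\<in>K. \<sigma> k * (\<Sum>l\<in>L. (cmod (ip I (%i. g k (i, l)) (c r)))\<^sup>2)))"
  by (subst sum.swap) (simp add: sum_distrib_left mult.assoc)
 also have "... \<le> (\<Sum>r\<in>M. lam * (\<Sum>q\<in>Q. \<alpha> q * (cmod (ip I (v q) (c r)))\<^sup>2))" by (intro sum_mono fo)
 also have "... = lam * (\<Sum>r\<in>M. \<Sum>q\<in>Q. (cmod (ip I (%i. cnj (A r i)) (v q)))\<^sup>2)"
  using e2 by (simp add: sum_distrib_left[symmetric])
 also have "... \<le> lam * (\<Sum>r\<in>M. sq M (%i. A r i))"
 proof (intro mult_left_mono sum_mono lam)
  fix r
  have "(\<Sum>q\<in>Q. (cmod (ip I (%i. cnj (A r i)) (v q)))\<^sup>2) \<le> sq I (%i. cnj (A r i))"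
   using orthonormal_bessel[OF o Q(1)] by (simp add: bessel_def)
  also have "... = sq I (%i. A r i)" by (simp add: sq_def)
  also have "... \<le> sq M (%i. A r i)" by (rule sq_mono[OF M])
  finally show "(\<Sum>q\<in>Q. (cmod (ip I (%i. cnj (A r i)) (v q)))\<^sup>2) \<le> sq M (%i. A r i)" .
 qed
 also have "(\<Sum>r\<in>M. sq M (%i. A r i)) = hs M A" by (simp add: hs_def sq_def)
 also have "lam * hs M A \<le> lam" using A lam by (rule mult_left_le)
 finally show ?thesis .
qed

lemma two_prod_le: "c \<ge> 0 ==> 0 \<le> x ==> 0 \<le> y ==> c * (sqrt x * sqrt y) \<le> (c * x + c * y) / (2::real)"
proof -
 assume a: "c \<ge> 0" "0 \<le> x" "0 \<le> y"
 have "sqrt x * sqrt y \<le> (x + y) / 2" using a arith_geo_mean_sqrt[of x y] by (simp add: real_sqrt_mult)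
 hence "c * (sqrt x * sqrt y) \<le> c * ((x + y) / 2)" using a by (intro mult_left_mono) auto
 thus ?thesis by (simp add: algebra_simps add_divide_distrib)
qed

lemma tr_cycle4: "tr J (mm J A (mm J G B)) W = tr J (mm J B (mm J W A)) G"
proof -
 have "tr J (mm J A (mm J G B)) W = tr J A (mm J (mm J G B) W)" by (rule tr_mm_assoc)
 also have "... = tr J (mm J G (mm J B W)) A" by (subst tr_commute) (simp add: mm_assoc)
 also have "... = tr J G (mm J (mm J B W) A)" by (rule tr_mm_assoc)
 also have "... = tr J (mm J B (mm J W A)) G" by (subst tr_commute) (simp add: mm_assoc)
 finally show ?thesis .
qed

text \<open>The explicit analytic function. At a critical point put \<open>z = a y b\<close> and
 \<open>G(\<zeta>) = a\<^sup>-\<^sup>p\<^sup>\<zeta> u |z|\<^sup>p\<^sup>\<zeta> b\<^sup>-\<^sup>p\<^sup>\<zeta>\<close> (suitably normalised); then \<open>G(1/p) = y\<close>.\<close>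

lemma interpolation_upper:
 assumes I: "finite I" and L: "finite L" and th: "0 < \<theta>" "\<theta> < 1" and \<epsilon>: "0 < \<epsilon>"
  and bd: "\<And>a b. sball I (\<theta>/2) a ==> sball I (\<theta>/2) b ==>
   sb (I \<times> L) \<theta> (mm (I \<times> L) (amp a) (mm (I \<times> L) y (amp b))) C"
 obtains G where "\<And>p q. ebs (%z. G z p q)" "\<And>z. trunc (I \<times> L) (G z) = G z"
  "\<And>p q. p \<in> I \<times> L ==> q \<in> I \<times> L ==> G (of_real \<theta>) p q = y p q"
  "\<And>z. Re z = 0 ==> sb (I \<times> L) 0 (G z) (C + \<epsilon>)"
  "\<And>z M. Re z = 1 ==> finite M ==> I \<subseteq> M ==> s1b M L (G z) (C + \<epsilon>)"
proof -
 let ?J = "I \<times> L"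
 have J: "finite ?J" using I L by simp
 \<comment> \<open>The trace of a contraction on \<open>I\<close> is at most \<open>card I\<close>, so either linear term costs at most \<open>\<epsilon>\<close>.\<close>
 define \<delta> where "\<delta> = \<epsilon> / (real (card I) + 1)"
 have d: "0 < \<delta>" using \<epsilon> by (simp add: \<delta>_def)
 obtain a0 b0 w0 where m0: "maxi I L \<theta> \<delta> y a0 b0 w0" using maxi_exists[OF I L th, of \<delta> y] by blast
 obtain a w1 Qa \<alpha> v where m1: "maxi I L \<theta> \<delta> y a b0 w1" and pa: "posf I \<theta> a Qa \<alpha> v"
  using maxi_polar[OF I L th d m0] by blast
 obtain b' w2 Qb \<beta> u where m2: "maxi I L \<theta> \<delta> (adj y) b' (adj a) w2" and pb: "posf I \<theta> b' Qb \<beta> u"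
  using maxi_polar[OF I L th d maxi_adj[OF m1]] by blast
 define b where "b = adj b'"
 have m3: "maxi I L \<theta> \<delta> y a b (adj w2)" using maxi_adj[OF m2] by (simp add: b_def)
 obtain w K \<sigma> \<kappa> g h where cr: "crit I L \<theta> \<delta> y a b w K \<sigma> \<kappa> g h"
  using crit_exists[OF I L th m3] by blast
 have cr': "crit I L \<theta> \<delta> (adj y) b' (adj a) (adj w) K \<sigma> \<kappa> h g"
  using crit_adj[OF cr] by (simp add: b_def)
 note c = critD[OF cr] and Pa = posfD[OF pa] and Pb = posfD[OF pb]
 have sa: "sb I (\<theta>/2) a 1" and sbb: "sb I (\<theta>/2) b 1" and sw: "sb ?J (1-\<theta>) w 1" using c(1) by (auto simp: maxi_def)
 have kC: "\<kappa> \<le> C"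
 proof -
  have t0: "0 < \<theta>/2" using th by simp
  have "sball I (\<theta>/2) a" "sball I (\<theta>/2) b" using sb_1_sball[OF I sa t0] sb_1_sball[OF I sbb t0] by auto
  from bd[OF this] have "sb ?J \<theta> (mm ?J (amp a) (mm ?J y (amp b))) C" .
  moreover have "sball ?J (1-\<theta>) w" using th by (intro sb_1_sball[OF J sw]) auto
  ultimately have "cmod (tr ?J (mm ?J (amp a) (mm ?J y (amp b))) w) \<le> C" by (simp add: sb_def)
  thus ?thesis unfolding crit_value[OF cr I L] using c(7) by simp
 qed
 have trc: "0 \<le> Re (\<Sum>i\<in>I. x i i) \<and> \<kappa> + \<delta> * Re (\<Sum>i\<in>I. x i i) \<le> C + \<epsilon>" if pf: "posf I \<theta> x Q \<eta> e" and sx: "sb I (\<theta>/2) x 1" for x Q \<eta> e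
 proof -
  note P = posfD[OF pf]
  have "(\<Sum>i\<in>I. x i i) = (\<Sum>q\<in>Q. of_real (\<eta> q powr (\<theta>/2)) * ip I (e q) (e q))"
   using P(5) by (simp flip: trace_dyads)
  hence "Re (\<Sum>i\<in>I. x i i) = (\<Sum>q\<in>Q. \<eta> q powr (\<theta>/2) * sq I (e q))" by (simp add: ip_self)
  hence 0: "0 \<le> Re (\<Sum>i\<in>I. x i i)" by (simp add: sum_nonneg)
  have "Re (\<Sum>i\<in>I. x i i) \<le> (\<Sum>i\<in>I. cmod (x i i))"
   using complex_Re_le_cmod[of "\<Sum>i\<in>I. x i i"] norm_sum[of "%i. x i i" I] by linarith
  also have "... \<le> (\<Sum>i\<in>I. 1)" using sb_entry[OF sx I] by (intro sum_mono) auto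
  finally have "\<delta> * Re (\<Sum>i\<in>I. x i i) \<le> \<delta> * (real (card I) + 1)" using d by (intro mult_left_mono) auto
  also have "... = \<epsilon>" by (simp add: \<delta>_def)
  finally show ?thesis using 0 kC by simp
 qed
 have sb': "sb I (\<theta>/2) b' 1" using sb_adj[OF sbb] by (simp add: b_def)
 define la where "la = \<kappa> + \<delta> * Re (\<Sum>i\<in>I. a i i)"
 define lb where "lb = \<kappa> + \<delta> * Re (\<Sum>i\<in>I. b' i i)"
 have la: "0 \<le> la" "la \<le> C + \<epsilon>" using trc[OF pa sa] c(7) d by (auto simp: la_def)
 have lb: "0 \<le> lb" "lb \<le> C + \<epsilon>" using trc[OF pb sb'] c(7) d by (auto simp: lb_def)
 note foa = crit_first_order[OF I L th d cr pa, folded la_def]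
 note fob = crit_first_order[OF I L th d cr' pb, folded lb_def]
 define ca where "ca = (%z q. complex_of_real (\<alpha> q) powr (of_real 0 + of_real (-1/2) * z))"
 define cb where "cb = (%z q. complex_of_real (\<beta> q) powr (of_real 0 + of_real (-1/2) * z))"
 define A where "A = (%z i j. \<Sum>q\<in>Qa. ca z q * v q i * cnj (v q j))"
 define B where "B = (%z i j. \<Sum>q\<in>Qb. cb z q * u q i * cnj (u q j))"
 define cz where "cz = (%z k. of_real \<kappa> * complex_of_real (\<sigma> k) powr (of_real 0 + of_real 1 * z))"
 define Z where "Z = (%z p q. \<Sum>k\<in>K. cz z k * g k p * cnj (h k q))"
 define G where "G = (%z. trunc ?J (mm ?J (amp (A z)) (mm ?J (Z z) (amp (B z)))))"
 have na: "cmod (ca z q) = \<alpha> q powr (- Re z / 2)" if "q \<in> Qa" for z q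
  unfolding ca_def using norm_of_real_powr[OF Pa(2)[OF that]] by simp
 have nb: "cmod (cb z q) = \<beta> q powr (- Re z / 2)" if "q \<in> Qb" for z q
  unfolding cb_def using norm_of_real_powr[OF Pb(2)[OF that]] by simp
 have nz: "cmod (cz z k) = \<kappa> * \<sigma> k powr (Re z)" if "k \<in> K" for z k
  unfolding cz_def norm_mult using norm_of_real_powr[OF c(3)[OF that]] c(7) by simp
 have eA: "ebs (%z. A z i j)" for i j unfolding A_def ca_def by (intro ebs_sum ebs_mult ebs_const ebs_powr Pa(2))
 have eB: "ebs (%z. B z i j)" for i j unfolding B_def cb_def by (intro ebs_sum ebs_mult ebs_const ebs_powr Pb(2))
 have eZ: "ebs (%z. Z z p q)" for p q unfolding Z_def cz_def by (intro ebs_sum ebs_mult ebs_const ebs_powr c(3))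
 have eG: "ebs (%z. G z p q)" for p q
 proof (cases "p \<in> ?J \<and> q \<in> ?J")
  case True
  have "ebs (%z. mm ?J (amp (A z)) (mm ?J (Z z) (amp (B z))) p q)" by (intro ebs_mm ebs_amp eA eB eZ)
  thus ?thesis using True by (simp add: G_def trunc_def)
 next
  case False
  hence "(%z. G z p q) = (%z. 0)" by (auto simp: G_def trunc_def)
  thus ?thesis by (simp only: ebs_const)
 qed
 have tG: "trunc ?J (G z) = G z" for z by (auto simp: G_def trunc_def fun_eq_iff)
 have Gy: "G (of_real \<theta>) p q = y p q" if p: "p \<in> ?J" and q: "q \<in> ?J" for p q
 proof -
  have e: "complex_of_real t powr (of_real 0 + of_real (-1/2) * complex_of_real \<theta>) = of_real (t powr (-\<theta>/2))" if "0 < t" for t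
  proof -
   have "of_real 0 + of_real (-1/2) * complex_of_real \<theta> = complex_of_real (-\<theta>/2)" by simp
   thus ?thesis using of_real_powr[OF that, of "-\<theta>/2"] by simp
  qed
  have pp: "complex_of_real (t powr (-\<theta>/2)) * of_real (t powr (\<theta>/2)) = 1" if "0 < t" for t
  proof -
   have "t powr (-\<theta>/2) * t powr (\<theta>/2) = 1" using that by (simp flip: powr_add)
   thus ?thesis by (metis of_real_1 of_real_mult)
  qed
  have pp': "complex_of_real (t powr (\<theta>/2)) * of_real (t powr (-\<theta>/2)) = 1" if "0 < t" for t
   using pp[OF that] by (simp only: mult.commute)
  have Aa: "mm I (A (of_real \<theta>)) a i j = idm i j" if ij: "i \<in> I" "j \<in> I" for i j
  proof -
   have "mm I (A (of_real \<theta>)) a i j = mm I (A (of_real \<theta>)) (%i j. \<Sum>q\<in>Qa. of_real (\<alpha> q powr (\<theta>/2)) * v q i * cnj (v q j)) i j"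
    using Pa(5) ij by (intro mm_cong refl) auto
   also have "... = (\<Sum>q\<in>Qa. (ca (of_real \<theta>) q * of_real (\<alpha> q powr (\<theta>/2))) * v q i * cnj (v q j))"
    unfolding A_def by (rule fun_cong[OF fun_cong[OF mm_dyads[OF Pa(1,4)]]])
   also have "... = (\<Sum>q\<in>Qa. v q i * cnj (v q j))"
    by (intro sum.cong refl) (simp only: ca_def e[OF Pa(2)] pp[OF Pa(2)] mult_1)
   finally show ?thesis using crit_complete[OF I L th d cr pa ij] by simp
  qed
  have bB: "mm I b (B (of_real \<theta>)) i j = idm i j" if ij: "i \<in> I" "j \<in> I" for i j
  proof -
   have bf: "b i j = (\<Sum>q\<in>Qb. of_real (\<beta> q powr (\<theta>/2)) * u q i * cnj (u q j))" if "i \<in> I" "j \<in> I" for i j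
    using posfD(5)[OF posf_adj[OF pb] that] by (simp add: b_def)
   have "mm I b (B (of_real \<theta>)) i j = mm I (%i j. \<Sum>q\<in>Qb. of_real (\<beta> q powr (\<theta>/2)) * u q i * cnj (u q j)) (B (of_real \<theta>)) i j"
    using bf ij by (intro mm_cong refl) auto
   also have "... = (\<Sum>q\<in>Qb. (of_real (\<beta> q powr (\<theta>/2)) * cb (of_real \<theta>) q) * u q i * cnj (u q j))"
    unfolding B_def by (rule fun_cong[OF fun_cong[OF mm_dyads[OF Pb(1,4)]]])
   also have "... = (\<Sum>q\<in>Qb. u q i * cnj (u q j))"
    by (intro sum.cong refl) (simp only: cb_def e[OF Pb(2)] pp'[OF Pb(2)] mult_1)
   finally show ?thesis using crit_complete[OF I L th d cr' pb ij] by simp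
  qed
  have Zz: "Z (of_real \<theta>) r s = mm ?J (amp a) (mm ?J y (amp b)) r s" if "r \<in> ?J" "s \<in> ?J" for r s
  proof -
   have "of_real 0 + of_real 1 * complex_of_real \<theta> = complex_of_real \<theta>" by simp
   thus ?thesis unfolding c(10)[OF that] Z_def cz_def sum_distrib_left
    by (intro sum.cong refl) (simp only: of_real_powr[OF c(3)] mult.assoc)
  qed
  have ampAa: "mm ?J (amp (A (of_real \<theta>))) (amp a) r s = idm r s" if "r \<in> ?J" "s \<in> ?J" for r s
   unfolding mm_amp[OF L that] using that Aa by (auto simp: amp_def idm_def split: if_splits)
  have ampbB: "mm ?J (amp b) (amp (B (of_real \<theta>))) r s = idm r s" if "r \<in> ?J" "s \<in> ?J" for r s
   unfolding mm_amp[OF L that] using that bB by (auto simp: amp_def idm_def split: if_splits)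
  have "G (of_real \<theta>) p q = mm ?J (amp (A (of_real \<theta>))) (mm ?J (Z (of_real \<theta>)) (amp (B (of_real \<theta>)))) p q"
   using p q by (simp add: G_def trunc_def)
  also have "... = mm ?J (amp (A (of_real \<theta>))) (mm ?J (mm ?J (amp a) (mm ?J y (amp b))) (amp (B (of_real \<theta>)))) p q"
   by (intro mm_cong refl Zz p q)
  also have "... = mm ?J (mm ?J (amp (A (of_real \<theta>))) (amp a)) (mm ?J y (mm ?J (amp b) (amp (B (of_real \<theta>))))) p q"
   by (simp add: mm_assoc)
  also have "... = mm ?J idm (mm ?J y idm) p q"
   by (intro mm_cong refl ampAa ampbB p q)
  also have "... = mm ?J y idm p q" by (rule mm_idm[OF J p])
  also have "... = (\<Sum>r\<in>?J. if r = q then y p r else 0)"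
   unfolding mm_def by (intro sum.cong refl) (simp add: idm_def)
  also have "... = y p q" using J q by simp
  finally show ?thesis .
 qed
 have G0: "sb ?J 0 (G z) (C + \<epsilon>)" if z: "Re z = 0" for z
 proof -
  have "sball I 0 (A z)"
  proof (rule sball_coeffI[OF Pa(1-3) orthonormal_bessel[OF Pa(4,1)] orthonormal_bessel[OF Pa(4,1)]])
   show "cmod (ca z k) \<le> \<alpha> k powr 0" if "k \<in> Qa" for k using na[OF that] z Pa(2)[OF that] by simp
  show "A z i j = (\<Sum>q\<in>Qa. ca z q * v q i * cnj (v q j))" for i j by (simp add: A_def)
  qed
  hence cA: "contr ?J (amp (A z))" by (intro contr_amp L sball_0_contr)
  have "sball I 0 (B z)"
  proof (rule sball_coeffI[OF Pb(1-3) orthonormal_bessel[OF Pb(4,1)] orthonormal_bessel[OF Pb(4,1)]])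
   show "cmod (cb z k) \<le> \<beta> k powr 0" if "k \<in> Qb" for k using nb[OF that] z Pb(2)[OF that] by simp
  show "B z i j = (\<Sum>q\<in>Qb. cb z q * u q i * cnj (u q j))" for i j by (simp add: B_def)
  qed
  hence cB: "contr ?J (amp (B z))" by (intro contr_amp L sball_0_contr)
  define Z' where "Z' = (%p q. \<Sum>k\<in>K. (complex_of_real (\<sigma> k) powr (of_real 0 + of_real 1 * z)) * g k p * cnj (h k q))"
  have "sball ?J 0 Z'"
  proof (rule sball_coeffI[OF c(2-4) orthonormal_bessel[OF c(8,2)] orthonormal_bessel[OF c(9,2)]])
   show "cmod (complex_of_real (\<sigma> k) powr (of_real 0 + of_real 1 * z)) \<le> \<sigma> k powr 0" if "k \<in> K" for k
    using norm_of_real_powr[OF c(3)[OF that]] z by simp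
  show "Z' p q = (\<Sum>k\<in>K. (complex_of_real (\<sigma> k) powr (of_real 0 + of_real 1 * z)) * g k p * cnj (h k q))" for p q by (simp add: Z'_def)
  qed
  hence "sb ?J 0 (%p q. of_real \<kappa> * Z' p q) (cmod (of_real \<kappa>) * 1)" by (intro sb_mult sball_sb) auto
  moreover have "(%p q. of_real \<kappa> * Z' p q) = Z z"
   by (simp add: Z'_def Z_def cz_def sum_distrib_left mult.assoc fun_eq_iff)
  ultimately have "sb ?J 0 (Z z) (C + \<epsilon>)" using kC c(7) \<epsilon> by (auto elim: sb_mono_const)
  hence "sb ?J 0 (mm ?J (amp (A z)) (mm ?J (Z z) (amp (B z)))) (C + \<epsilon>)"
   by (intro sb_mm_left[OF cA] sb_mm_right[OF cB])
  thus ?thesis by (simp add: G_def sb_trunc_iff)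
 qed
 have G1: "s1b M L (G z) (C + \<epsilon>)" if z: "Re z = 1" and M: "finite M" "I \<subseteq> M" for z M
  unfolding s1b_def
 proof (intro allI impI)
  fix A' B' W assume A': "hs M A' \<le> 1" and B': "hs M B' \<le> 1" and W: "contr (M \<times> L) W"
  let ?N = "M \<times> L"
  define x where "x = (%k. rs ?J (mv ?J (amp (A z)) (g k)))"
  define x' where "x' = (%k. rs ?J (mv ?J (amp (adj (B z))) (h k)))"
  have ga: "(cmod (ca z q))\<^sup>2 = 1 / \<alpha> q" if "q \<in> Qa" for q
  proof -
   have "(cmod (ca z q))\<^sup>2 = \<alpha> q powr (-1)" unfolding na[OF that] z by (simp add: power2_eq_square flip: powr_add)
   thus ?thesis using Pa(2)[OF that] by (simp add: powr_minus_divide)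
  qed
  have gb: "(cmod (cnj (cb z q)))\<^sup>2 = 1 / \<beta> q" if "q \<in> Qb" for q
  proof -
   have "(cmod (cnj (cb z q)))\<^sup>2 = \<beta> q powr (-1)" unfolding complex_mod_cnj nb[OF that] z by (simp add: power2_eq_square flip: powr_add)
   thus ?thesis using Pb(2)[OF that] by (simp add: powr_minus_divide)
  qed
  have s1: "(\<Sum>k\<in>K. \<kappa> * \<sigma> k * sq ?N (mv ?N (amp A') (x k))) \<le> la"
   unfolding x_def A_def by (rule first_order_hs[OF I L M la(1) foa Pa(1,2,4) ga A'])
  have aB: "adj (B z) = (%i j. \<Sum>q\<in>Qb. cnj (cb z q) * u q i * cnj (u q j))"
   unfolding B_def adj_dyads ..
  have B'a: "hs M (adj B') \<le> 1" using B' by (simp add: hs_adj)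
  have s2: "(\<Sum>k\<in>K. \<kappa> * \<sigma> k * sq ?N (mv ?N (amp (adj B')) (x' k))) \<le> lb"
   unfolding x'_def aB by (rule first_order_hs[OF I L M lb(1) fob Pb(1,2,4) gb B'a])
  have Gx: "G z = (%p q. \<Sum>k\<in>K. cz z k * x k p * cnj (x' k q))"
  proof (intro ext)
   fix p q
   show "G z p q = (\<Sum>k\<in>K. cz z k * x k p * cnj (x' k q))"
   proof (cases "p \<in> ?J \<and> q \<in> ?J")
    case True
    have "mm ?J (amp (A z)) (mm ?J (Z z) (amp (B z))) p q = (\<Sum>r\<in>?J. \<Sum>s\<in>?J. \<Sum>k\<in>K. cz z k * (amp (A z) p r * g k r) * (cnj (h k s) * amp (B z) s q))"
     by (simp add: mm_def Z_def sum_distrib_left sum_distrib_right mult_ac)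
    also have "... = (\<Sum>r\<in>?J. \<Sum>k\<in>K. \<Sum>s\<in>?J. cz z k * (amp (A z) p r * g k r) * (cnj (h k s) * amp (B z) s q))"
     by (intro sum.cong refl sum.swap)
    also have "... = (\<Sum>k\<in>K. \<Sum>r\<in>?J. \<Sum>s\<in>?J. cz z k * (amp (A z) p r * g k r) * (cnj (h k s) * amp (B z) s q))"
     by (rule sum.swap)
    also have "... = (\<Sum>k\<in>K. cz z k * mv ?J (amp (A z)) (g k) p * cnj (mv ?J (adj (amp (B z))) (h k) q))"
     by (simp add: mv_def adj_def sum_distrib_left sum_distrib_right mult_ac)
    finally show ?thesis using True by (simp add: G_def trunc_def x_def x'_def rs_def adj_amp)
   qed (auto simp: G_def trunc_def x_def x'_def rs_def)
  qed
  have "cmod (tr ?N (mm ?N (amp A') (mm ?N (G z) (amp B'))) W)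
    = cmod (\<Sum>k\<in>K. cz z k * ip ?N (mv ?N W (mv ?N (amp A') (x k))) (mv ?N (amp (adj B')) (x' k)))"
   unfolding tr_cycle4 Gx tr_dyads mv_mm ip_mv[of ?N "amp B'"] adj_amp ..
  also have "... \<le> (\<Sum>k\<in>K. \<kappa> * \<sigma> k * (sqrt (sq ?N (mv ?N (amp A') (x k))) * sqrt (sq ?N (mv ?N (amp (adj B')) (x' k)))))"
  proof (rule order_trans[OF norm_sum sum_mono])
   fix k assume k: "k \<in> K"
   have "(cmod (ip ?N (mv ?N W (mv ?N (amp A') (x k))) (mv ?N (amp (adj B')) (x' k))))\<^sup>2
    \<le> sq ?N (mv ?N (amp A') (x k)) * sq ?N (mv ?N (amp (adj B')) (x' k))" by (rule contr_ip[OF W])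
   hence "cmod (ip ?N (mv ?N W (mv ?N (amp A') (x k))) (mv ?N (amp (adj B')) (x' k)))
    \<le> sqrt (sq ?N (mv ?N (amp A') (x k)) * sq ?N (mv ?N (amp (adj B')) (x' k)))" by (rule real_le_rsqrt)
   moreover have "cmod (cz z k) = \<kappa> * \<sigma> k" using nz[OF k] z c(3)[OF k] by simp
   ultimately show "cmod (cz z k * ip ?N (mv ?N W (mv ?N (amp A') (x k))) (mv ?N (amp (adj B')) (x' k)))
    \<le> \<kappa> * \<sigma> k * (sqrt (sq ?N (mv ?N (amp A') (x k))) * sqrt (sq ?N (mv ?N (amp (adj B')) (x' k))))"
    using c(7) c(3)[OF k] by (simp add: norm_mult real_sqrt_mult mult_left_mono)
  qed
  also have "... \<le> (\<Sum>k\<in>K. (\<kappa> * \<sigma> k * sq ?N (mv ?N (amp A') (x k)) + \<kappa> * \<sigma> k * sq ?N (mv ?N (amp (adj B')) (x' k))) / 2)"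
   using c(3,7) by (intro sum_mono two_prod_le) (auto simp: less_imp_le)
  also have "... = ((\<Sum>k\<in>K. \<kappa> * \<sigma> k * sq ?N (mv ?N (amp A') (x k))) + (\<Sum>k\<in>K. \<kappa> * \<sigma> k * sq ?N (mv ?N (amp (adj B')) (x' k)))) / 2"
   by (simp add: sum.distrib flip: sum_divide_distrib)
  also have "... \<le> C + \<epsilon>" using s1 s2 la(2) lb(2) by simp
  finally show "cmod (tr ?N (mm ?N (amp A') (mm ?N (G z) (amp B'))) W) \<le> C + \<epsilon>" .
 qed
 show thesis by (rule that[OF eG tG Gy G0 G1])
qed

section \<open>The operator norm, compact operators and Schatten classes\<close>

lemma zero_ell2_ball: "(%i. 0) \<in> {\<xi> \<in> ell2. ell2_norm \<xi> \<le> 1}"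
 by (simp add: ell2_norm_def)

lemma op_norm_le: assumes "sbf \<theta> x c" shows "op_norm x \<le> c"
 unfolding op_norm_def
proof (rule cSUP_least)
 show "{\<xi> \<in> ell2. ell2_norm \<xi> \<le> 1} \<noteq> ({} :: ('a => complex) set)" using zero_ell2_ball by (rule ne_empty)
 fix \<xi> :: "'a => complex" assume "\<xi> \<in> {\<xi> \<in> ell2. ell2_norm \<xi> \<le> 1}"
 hence "ell2_norm (mat_vec x \<xi>) \<le> c * ell2_norm \<xi>" "ell2_norm \<xi> \<le> 1" using mat_vec_bounded[OF assms] by auto
 thus "ell2_norm (mat_vec x \<xi>) \<le> c" using mult_left_le[of "ell2_norm \<xi>" c] sbf_nonneg[OF assms] by linarith
qed

lemma op_norm_ge:
 assumes x: "sbf \<theta> x c" and xi: "\<xi> \<in> ell2" "ell2_norm \<xi> \<le> 1"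
 shows "ell2_norm (mat_vec x \<xi>) \<le> op_norm x"
 unfolding op_norm_def
proof (rule cSUP_upper)
 show "bdd_above ((%\<xi>. ell2_norm (mat_vec x \<xi>)) ` {\<xi> \<in> ell2. ell2_norm \<xi> \<le> 1})"
 proof (rule bdd_aboveI2)
  fix \<xi> :: "'a => complex" assume "\<xi> \<in> {\<xi> \<in> ell2. ell2_norm \<xi> \<le> 1}"
  hence "ell2_norm (mat_vec x \<xi>) \<le> c * ell2_norm \<xi>" "ell2_norm \<xi> \<le> 1" using mat_vec_bounded[OF x] by auto
  thus "ell2_norm (mat_vec x \<xi>) \<le> c" using mult_left_le[of "ell2_norm \<xi>" c] sbf_nonneg[OF x] by linarith
 qed
qed (use xi in simp)

lemma op_norm_nonneg: assumes "sbf \<theta> x c" shows "0 \<le> op_norm x"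
 by (rule order_trans[OF ell2_norm_nonneg op_norm_ge[OF assms, of "%i. 0"]]) (use zero_ell2_ball in auto)

lemma sbf_0_formI:
 assumes "\<And>J \<xi> \<eta>. finite J ==> rs J \<xi> \<in> ub ==> rs J \<eta> \<in> ub ==> cmod (ip J (mat_vec x (rs J \<xi>)) \<eta>) \<le> c" "0 \<le> c"
 shows "sbf 0 x c"
 unfolding sbf_def
proof (intro allI impI)
 fix J :: "'a set" assume J: "finite J"
 show "sb J 0 x c"
 proof (rule sb_0_formI[OF _ assms(2)])
  fix \<xi> \<eta> assume "sq J \<xi> \<le> 1" "sq J \<eta> \<le> 1"
  from assms(1)[OF J rs_ub[OF J this(1)] rs_ub[OF J this(2)]]
  show "cmod (ip J (mv J x \<xi>) \<eta>) \<le> c" using J by (simp add: mat_vec_rs)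
 qed
qed

lemma form_le_norm:
 assumes "h \<in> ell2" "finite J" "rs J \<eta> \<in> ub" shows "cmod (ip J h \<eta>) \<le> ell2_norm h"
proof -
 have e: "rs J \<eta> \<in> ell2" "ell2_norm (rs J \<eta>) \<le> 1" using assms(3) by (auto simp: ub_iff)
 have "cmod (ip J h \<eta>) = cmod (ell2_inner h (rs J \<eta>))" by (simp add: ell2_inner_rs_right[OF assms(2)])
 also have "... \<le> ell2_norm h * ell2_norm (rs J \<eta>)" by (rule ell2_inner_cs[OF assms(1) e(1)])
 also have "... \<le> ell2_norm h" using e(2) by (intro mult_left_le) auto
 finally show ?thesis .
qed

lemma sbf_op_norm: assumes x: "sbf \<theta> x c" shows "sbf 0 x (op_norm x)"
proof (rule sbf_0_formI[OF _ op_norm_nonneg[OF x]])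
 fix J :: "'a set" and \<xi> \<eta> assume a: "finite J" "rs J \<xi> \<in> ub" "rs J \<eta> \<in> ub"
 have e: "rs J \<xi> \<in> ell2" "ell2_norm (rs J \<xi>) \<le> 1" using a(2) by (auto simp: ub_iff)
 have "cmod (ip J (mat_vec x (rs J \<xi>)) \<eta>) \<le> ell2_norm (mat_vec x (rs J \<xi>))"
  by (rule form_le_norm[OF mat_vec_bounded(1)[OF x e(1)] a(1,3)])
 also have "... \<le> op_norm x" by (rule op_norm_ge[OF x e])
 finally show "cmod (ip J (mat_vec x (rs J \<xi>)) \<eta>) \<le> op_norm x" .
qed

lemma bounded_ops_sbf: assumes "x \<in> bounded_ops A" shows "sbf 0 x (op_norm x)"
proof -
 obtain C where C: "\<And>\<xi>. \<xi> \<in> ell2 ==> mat_vec x \<xi> \<in> ell2" "\<And>\<xi>. \<xi> \<in> ell2 ==> ell2_norm (mat_vec x \<xi>) \<le> C * ell2_norm \<xi>"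
  using assms unfolding bounded_ops_def by blast
 have "sbf 0 x \<bar>C\<bar>"
 proof (rule sbf_0_formI)
  fix J :: "'a set" and \<xi> \<eta> assume a: "finite J" "rs J \<xi> \<in> ub" "rs J \<eta> \<in> ub"
  have e: "rs J \<xi> \<in> ell2" "ell2_norm (rs J \<xi>) \<le> 1" using a(2) by (auto simp: ub_iff)
  have "cmod (ip J (mat_vec x (rs J \<xi>)) \<eta>) \<le> ell2_norm (mat_vec x (rs J \<xi>))"
   by (rule form_le_norm[OF C(1)[OF e(1)] a(1,3)])
  also have "... \<le> C * ell2_norm (rs J \<xi>)" by (rule C(2)[OF e(1)])
  also have "... \<le> \<bar>C\<bar> * 1" using e(2) by (intro mult_mono) auto
  finally show "cmod (ip J (mat_vec x (rs J \<xi>)) \<eta>) \<le> \<bar>C\<bar>" by simp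
 qed simp
 thus ?thesis by (rule sbf_op_norm)
qed

lemma sbf_bounded_ops: assumes "sbf \<theta> x c" "supported_on A x" shows "x \<in> bounded_ops A"
 unfolding bounded_ops_def using assms(2) mat_vec_summable[OF assms(1)] mat_vec_bounded[OF assms(1)] by blast

subsection \<open>Singular decompositions\<close>

lemma singular_decompD:
 assumes "singular_decomp x s u v"
 shows "\<And>k. 0 \<le> s k" "\<And>k. u k \<in> ell2" "\<And>k. v k \<in> ell2"
  "\<And>k l. s k \<noteq> 0 ==> s l \<noteq> 0 ==> ell2_inner (u k) (u l) = (if k = l then 1 else 0)"
  "\<And>k l. s k \<noteq> 0 ==> s l \<noteq> 0 ==> ell2_inner (v k) (v l) = (if k = l then 1 else 0)"
  "\<And>i j. ((%k. complex_of_real (s k) * u k i * cnj (v k j)) has_sum x i j) UNIV"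
 using assms unfolding singular_decomp_def by blast+

lemma singular_decomp_bessel:
 assumes "singular_decomp x s u v" "finite F" "\<And>k. k \<in> F ==> s k \<noteq> 0" "finite J"
 shows "bessel J F u" "bessel J F v"
 by (rule orthonormal_ell2_bessel[OF assms(2) _ _ assms(4)];
   simp add: singular_decompD[OF assms(1)] assms(3))+

text \<open>Bounds for the tail of a singular decomposition whose coefficients satisfy \<open>s\<^sub>k \<le> \<kappa> \<rho>\<^sub>k\<^sup>\<theta>\<close> on every finite
 set of indices.\<close>

lemma singular_tail:
 assumes sd: "singular_decomp x s u v" and th: "0 \<le> \<theta>" "\<theta> \<le> 1" and k0: "0 \<le> \<kappa>"
  and r: "\<And>F. finite F ==> F \<subseteq> {k. N \<le> k \<and> s k \<noteq> 0} ==> \<exists>\<rho>. (\<forall>k\<in>F. 0 < \<rho> k \<and> s k \<le> \<kappa> * \<rho> k powr \<theta>) \<and> sum \<rho> F \<le> 1"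
 shows "sbf \<theta> (%i j. x i j - (\<Sum>k<N. complex_of_real (s k) * u k i * cnj (v k j))) \<kappa>"
 unfolding sbf_def sb_def
proof (intro allI impI)
 fix J :: "'a set" and w assume J: "finite J" and w: "sball J (1-\<theta>) w"
 note D = singular_decompD[OF sd]
 define S where "S = (%n i j. \<Sum>k<n. complex_of_real (s k) * u k i * cnj (v k j))"
 have lim: "(%n. S n i j) \<longlonglongrightarrow> x i j" for i j
  using has_sum_imp_sums[OF D(6)[of i j]] by (simp add: sums_def S_def)
 have b: "cmod (tr J (%i j. S n i j - S N i j) w) \<le> \<kappa>" if n: "n \<ge> N" for n
 proof -
  define F where "F = {k\<in>{N..<n}. s k \<noteq> 0}"
  have F: "finite F" "F \<subseteq> {k. N \<le> k \<and> s k \<noteq> 0}" by (auto simp: F_def)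
  obtain \<rho> where \<rho>: "\<And>k. k \<in> F ==> 0 < \<rho> k" "\<And>k. k \<in> F ==> s k \<le> \<kappa> * \<rho> k powr \<theta>" "sum \<rho> F \<le> 1"
   using r[OF F] by blast
  have bs: "bessel J F u" "bessel J F v" using singular_decomp_bessel[OF sd F(1) _ J] F(2) by auto
  have eq: "S n i j - S N i j = (\<Sum>k\<in>F. complex_of_real (s k) * u k i * cnj (v k j))" for i j
  proof -
   have "S n i j - S N i j = (\<Sum>k\<in>{N..<n}. complex_of_real (s k) * u k i * cnj (v k j))"
    unfolding S_def lessThan_atLeast0 by (rule sum_diff_nat_ivl) (use n in auto)
   also have "... = (\<Sum>k\<in>F. complex_of_real (s k) * u k i * cnj (v k j))"
    unfolding F_def by (intro sum.mono_neutral_right) auto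
   finally show ?thesis .
  qed
  show ?thesis
  proof (cases "\<kappa> = 0")
   case True
   have "k \<notin> F" for k using \<rho>(2)[of k] D(1)[of k] F(2) True by auto
   hence "F = {}" by blast
   thus ?thesis unfolding eq using True by (simp add: tr_def)
  next
   case False
   hence kp: "0 < \<kappa>" using k0 by simp
   have "sball J \<theta> (%i j. \<Sum>k\<in>F. complex_of_real (s k / \<kappa>) * u k i * cnj (v k j))"
   proof (rule sball_coeffI[OF F(1) \<rho>(1,3) bs])
    show "cmod (complex_of_real (s k / \<kappa>)) \<le> \<rho> k powr \<theta>" if "k \<in> F" for k
     using \<rho>(2)[OF that] kp D(1)[of k] by (simp add: norm_divide divide_le_eq mult.commute)
   qed auto
   hence "sb J \<theta> (%i j. of_real \<kappa> * (\<Sum>k\<in>F. complex_of_real (s k / \<kappa>) * u k i * cnj (v k j))) (cmod (of_real \<kappa>) * 1)"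
    using th by (intro sb_mult sball_sb)
   moreover have "(%i j. of_real \<kappa> * (\<Sum>k\<in>F. complex_of_real (s k / \<kappa>) * u k i * cnj (v k j))) = (%i j. S n i j - S N i j)"
    unfolding eq sum_distrib_left using False by (intro ext sum.cong refl) simp
   ultimately show ?thesis using w kp by (simp add: sb_def)
  qed
 qed
 have "(%n. tr J (%i j. S n i j - S N i j) w) \<longlonglongrightarrow> tr J (%i j. x i j - S N i j) w"
  unfolding tr_def by (intro tendsto_intros lim)
 from tendsto_norm[OF this]
 have "cmod (tr J (%i j. x i j - S N i j) w) \<le> \<kappa>"
  by (rule tendsto_upperbound) (auto simp: eventually_sequentially intro!: exI[of _ N] b)
 thus "cmod (tr J (%i j. x i j - (\<Sum>k<N. complex_of_real (s k) * u k i * cnj (v k j))) w) \<le> \<kappa>"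
  by (simp add: S_def)
qed

lemma sapp_sum: "(\<And>k. k \<in> K ==> sapp \<theta> (x k)) ==> sapp \<theta> (%i j. \<Sum>k\<in>K. x k i j)"
proof (induction K rule: infinite_finite_induct)
 case (insert k K) thus ?case by (simp add: sapp_add)
qed (auto intro: sapp_finite[of "{}"])

lemma singular_partial_sapp:
 assumes "singular_decomp x s u v" "0 \<le> \<theta>" "\<theta> \<le> 1"
 shows "sapp \<theta> (%i j. \<Sum>k<N. complex_of_real (s k) * u k i * cnj (v k j))"
proof -
 have "sapp \<theta> (%i j. complex_of_real (s k) * (u k i * cnj (v k j)))" for k
  by (intro sapp_mult sapp_rank_one singular_decompD(2,3)[OF assms(1)] assms)
 thus ?thesis by (intro sapp_sum) (simp add: mult.assoc)
qed

text \<open>From a singular decomposition one approximates by its partial sums; conversely \<open>compact_svd\<close> provides a decomposition.\<close>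

lemma compact_ops_iff: "x \<in> compact_ops A \<longleftrightarrow> supported_on A x \<and> sapp 0 x"
proof
 assume "x \<in> compact_ops A"
 then obtain s u v where A: "supported_on A x" and sd: "singular_decomp x s u v" and s: "s \<longlonglongrightarrow> 0"
  unfolding compact_ops_def by blast
 note D = singular_decompD[OF sd]
 have "sapp 0 x"
 proof (rule sapp_limit)
  fix \<epsilon> :: real assume e: "\<epsilon> > 0"
  obtain N where N: "\<And>k. k \<ge> N ==> norm (s k - 0) < \<epsilon>" using LIMSEQ_D[OF s e] by blast
  have "sbf 0 (%i j. x i j - (\<Sum>k<N. complex_of_real (s k) * u k i * cnj (v k j))) \<epsilon>"
  proof (rule singular_tail[OF sd])
   fix F assume F: "finite F" "F \<subseteq> {k. N \<le> k \<and> s k \<noteq> 0}"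
   have "(\<forall>k\<in>F. 0 < 1 / (real (card F) + 1) \<and> s k \<le> \<epsilon> * (1 / (real (card F) + 1)) powr 0) \<and> sum (%_. 1 / (real (card F) + 1)) F \<le> 1"
    using N F D(1) by (fastforce simp: less_imp_le)
   thus "\<exists>\<rho>. (\<forall>k\<in>F. 0 < \<rho> k \<and> s k \<le> \<epsilon> * \<rho> k powr 0) \<and> sum \<rho> F \<le> 1" by (rule exI[where x = "%_. 1 / (real (card F) + 1)"])
  qed (use e in auto)
  thus "\<exists>y. sapp 0 y \<and> sbf 0 (%i j. x i j - y i j) \<epsilon>"
   using singular_partial_sapp[OF sd, of 0 N] by (intro exI[of _ "%i j. \<Sum>k<N. complex_of_real (s k) * u k i * cnj (v k j)"]) simp
 qed
 thus "supported_on A x \<and> sapp 0 x" using A by simp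
next
 assume a: "supported_on A x \<and> sapp 0 x"
 obtain s u v where "singular_decomp x s u v" "s \<longlonglongrightarrow> 0" by (rule compact_svd[of x]) (use a in auto)
 thus "x \<in> compact_ops A" using a unfolding compact_ops_def by blast
qed

lemma singular_sum_le:
 assumes sd: "singular_decomp x s u v" and mv1: "\<And>k. mat_vec x (v k) = (%i. of_real (s k) * u k i)"
  and th: "0 < \<theta>" "\<theta> \<le> 1" and C: "sbf \<theta> x C" and F: "finite F"
 shows "(\<Sum>k\<in>F. s k powr (1/\<theta>)) \<le> C powr (1/\<theta>)"
proof -
 note D = singular_decompD[OF sd]
 have C0: "0 \<le> C" by (rule sbf_nonneg[OF C])
 define F' where "F' = {k\<in>F. s k \<noteq> 0}"
 have F': "finite F'" using F by (simp add: F'_def)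
 have sp: "0 < s k" if "k \<in> F'" for k using that D(1)[of k] by (auto simp: F'_def less_le)
 define S where "S = (\<Sum>k\<in>F'. s k powr (1/\<theta>))"
 have eq: "(\<Sum>k\<in>F. s k powr (1/\<theta>)) = S"
  unfolding S_def F'_def using F by (intro sum.mono_neutral_right) auto
 show ?thesis
 proof (cases "F' = {}")
  case True thus ?thesis unfolding eq S_def by simp
 next
  case False
  have spp: "0 < s k powr (1/\<theta>)" if "k \<in> F'" for k using sp[OF that] by simp
  have S: "0 < S" unfolding S_def using F' False spp by (rule sum_pos)
  define \<rho> where "\<rho> = (%k. s k powr (1/\<theta>) / S)"
  have r: "0 < \<rho> k" if "k \<in> F'" for k unfolding \<rho>_def using spp[OF that] S by simp
  have r1: "sum \<rho> F' = 1" unfolding \<rho>_def using S by (simp add: S_def flip: sum_divide_distrib)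
  have sk: "S powr \<theta> * \<rho> k powr \<theta> = s k" if "k \<in> F'" for k
   using sp[OF that] S th by (simp add: \<rho>_def powr_divide powr_powr)
  define w where "w = (%i j. \<Sum>k\<in>F'. complex_of_real (\<rho> k powr (1-\<theta>)) * v k i * cnj (u k j))"
  have b: "cmod (\<Sum>k\<in>F'. complex_of_real (\<rho> k powr (1-\<theta>)) * ip J (mv J x (v k)) (u k)) \<le> C" if J: "finite J" for J
  proof -
   have bs: "bessel J F' u" "bessel J F' v" using singular_decomp_bessel[OF sd F' _ J] by (auto simp: F'_def)
   have "sball J (1-\<theta>) w" by (rule sballI[OF F' r _ bs(2,1)]) (auto simp: r1 w_def)
   hence "cmod (tr J x w) \<le> C" using C J unfolding sbf_def sb_def by blast
   thus ?thesis unfolding w_def tr_dyads .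
  qed
  have "((%J. \<Sum>k\<in>F'. complex_of_real (\<rho> k powr (1-\<theta>)) * ip J (mv J x (v k)) (u k))
   \<longlongrightarrow> (\<Sum>k\<in>F'. complex_of_real (\<rho> k powr (1-\<theta>)) * ell2_inner (mat_vec x (v k)) (u k))) (finite_subsets_at_top UNIV)"
   by (intro tendsto_intros mat_vec_form_tendsto[OF C] D)
  from tendsto_norm[OF this]
  have "cmod (\<Sum>k\<in>F'. complex_of_real (\<rho> k powr (1-\<theta>)) * ell2_inner (mat_vec x (v k)) (u k)) \<le> C"
   by (rule tendsto_upperbound[OF _ _ finite_subsets_at_top_neq_bot]) (rule eventually_finite_subsets_at_top_weakI, rule b)
  also have "(\<Sum>k\<in>F'. complex_of_real (\<rho> k powr (1-\<theta>)) * ell2_inner (mat_vec x (v k)) (u k)) = (\<Sum>k\<in>F'. complex_of_real (S powr \<theta> * \<rho> k))"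
  proof (intro sum.cong refl)
   fix k assume k: "k \<in> F'"
   have "ell2_inner (mat_vec x (v k)) (u k) = of_real (s k)"
    unfolding mv1 ell2_inner_mult_left using D(4)[of k k] k by (simp add: F'_def)
   moreover have "\<rho> k powr (1-\<theta>) * s k = S powr \<theta> * \<rho> k"
   proof -
    have "\<rho> k powr (1-\<theta>) * s k = S powr \<theta> * (\<rho> k powr (1-\<theta>) * \<rho> k powr \<theta>)" by (simp add: sk[OF k, symmetric])
    also have "\<rho> k powr (1-\<theta>) * \<rho> k powr \<theta> = \<rho> k" using r[OF k] by (simp flip: powr_add)
    finally show ?thesis .
   qed
   ultimately show "complex_of_real (\<rho> k powr (1-\<theta>)) * ell2_inner (mat_vec x (v k)) (u k) = complex_of_real (S powr \<theta> * \<rho> k)"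
    by (simp only: of_real_mult[symmetric])
  qed
  also have "... = of_real (S powr \<theta>)" using r1 by (simp only: of_real_sum[symmetric] sum_distrib_left[symmetric] mult_1_right)
  finally have "S powr \<theta> \<le> C" by simp
  hence "(S powr \<theta>) powr (1/\<theta>) \<le> C powr (1/\<theta>)" using th by (intro powr_mono2) auto
  thus ?thesis unfolding eq using S th by (simp add: powr_powr)
 qed
qed

lemma sapp_decreasing: assumes "sapp \<theta> x" "\<theta>' \<le> \<theta>" shows "sapp \<theta>' x"
 unfolding sapp_def
proof (intro allI impI)
 fix \<epsilon> :: real assume "\<epsilon> > 0"
 then obtain J where "finite J" "sbf \<theta> (%i j. x i j - trunc J x i j) \<epsilon>" using assms(1) unfolding sapp_def by blast
 thus "\<exists>J. finite J \<and> sbf \<theta>' (%i j. x i j - trunc J x i j) \<epsilon>" using sbf_decreasing[OF _ assms(2)] by blast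
qed

text \<open>In one direction the tail of the singular values is small; in the other, testing \<open>x\<close> against
 \<open>\<Sum> \<rho>\<^sub>k\<^sup>1\<^sup>-\<^sup>\<theta> v\<^sub>k u\<^sub>k\<^sup>*\<close> bounds the sum of the powers of the singular values.\<close>

lemma schatten_iff:
 assumes p: "1 \<le> p" shows "x \<in> schatten p A \<longleftrightarrow> supported_on A x \<and> sapp (1/p) x"
proof
 assume "x \<in> schatten p A"
 then obtain s u v where A: "supported_on A x" and sd: "singular_decomp x s u v" and s: "(%k. s k powr p) summable_on UNIV"
  unfolding schatten_def by blast
 note D = singular_decompD[OF sd]
 have sm: "summable (%k. s k powr p)" using s by (rule summable_on_imp_summable)
 have "sapp (1/p) x"
 proof (rule sapp_limit)
  fix \<epsilon> :: real assume e: "\<epsilon> > 0"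
  hence "0 < \<epsilon> powr p" by simp
  then obtain N where N: "\<And>n. n \<ge> N ==> norm (\<Sum>i. s (i + n) powr p) < \<epsilon> powr p"
   using suminf_exist_split[OF _ sm] by blast
  have tail: "(\<Sum>k\<in>F. s k powr p) \<le> \<epsilon> powr p" if F: "finite F" "F \<subseteq> {k. N \<le> k \<and> s k \<noteq> 0}" for F
  proof -
   have "(\<Sum>k\<in>F. s k powr p) = (\<Sum>k\<in>(%k. k - N) ` F. s (k + N) powr p)"
    by (subst sum.reindex[OF inj_on_subset[OF _ F(2)]]) (use F(2) in \<open>auto simp: inj_on_def intro!: sum.cong\<close>)
   also have "... \<le> (\<Sum>i. s (i + N) powr p)"
    using F(1) summable_ignore_initial_segment[OF sm, of N] by (intro sum_le_suminf) auto
   also have "... \<le> \<epsilon> powr p" using N[of N] by simp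
   finally show ?thesis .
  qed
  have "sbf (1/p) (%i j. x i j - (\<Sum>k<N. complex_of_real (s k) * u k i * cnj (v k j))) \<epsilon>"
  proof (rule singular_tail[OF sd])
   fix F assume F: "finite F" "F \<subseteq> {k. N \<le> k \<and> s k \<noteq> 0}"
   have 1: "0 < s k powr p / \<epsilon> powr p" "s k \<le> \<epsilon> * (s k powr p / \<epsilon> powr p) powr (1/p)" if "k \<in> F" for k
   proof -
    have "0 < s k" using that F(2) D(1)[of k] by (auto simp: less_le)
    thus "0 < s k powr p / \<epsilon> powr p" "s k \<le> \<epsilon> * (s k powr p / \<epsilon> powr p) powr (1/p)"
     using e p by (simp_all add: powr_divide powr_powr)
   qed
   have 2: "sum (%k. s k powr p / \<epsilon> powr p) F \<le> 1"
    using tail[OF F] e by (simp add: divide_le_eq flip: sum_divide_distrib)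
   show "\<exists>\<rho>. (\<forall>k\<in>F. 0 < \<rho> k \<and> s k \<le> \<epsilon> * \<rho> k powr (1/p)) \<and> sum \<rho> F \<le> 1"
    by (intro exI[of _ "%k. s k powr p / \<epsilon> powr p"] conjI ballI 1 2)
  qed (use e p in auto)
  thus "\<exists>y. sapp (1/p) y \<and> sbf (1/p) (%i j. x i j - y i j) \<epsilon>"
   using singular_partial_sapp[OF sd, of "1/p" N] p
   by (intro exI[of _ "%i j. \<Sum>k<N. complex_of_real (s k) * u k i * cnj (v k j)"]) simp
 qed
 thus "supported_on A x \<and> sapp (1/p) x" using A by simp
next
 assume a: "supported_on A x \<and> sapp (1/p) x"
 have p0: "0 < p" using p by linarith
 have th: "0 < 1/p" "1/p \<le> 1" unfolding zero_less_divide_1_iff divide_le_eq_1_pos[OF p0] by (rule p0, rule p)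
 obtain C where C: "sbf (1/p) x C" by (rule sapp_sbf[OF conjunct2[OF a] th(2)]) (rule that)
 have a0: "sapp 0 x" using sapp_decreasing[OF conjunct2[OF a]] th(1) by simp
 obtain s u v where sd: "singular_decomp x s u v" "s \<longlonglongrightarrow> 0"
  "\<And>k. mat_vec x (v k) = (%i. of_real (s k) * u k i)"
  "\<And>k. mat_vec (adj x) (u k) = (%i. of_real (s k) * v k i)"
  by (rule compact_svd[OF a0]) (rule that)
 have "(%k. s k powr p) summable_on UNIV"
 proof (rule nonneg_bounded_partial_sums_imp_summable_on[where C = "C powr p"])
  have "(\<Sum>k\<in>F. s k powr p) \<le> C powr p" if "finite F" for F
   using singular_sum_le[OF sd(1,3) th C that] by simp
  thus "\<forall>\<^sub>F F in finite_subsets_at_top UNIV. (\<Sum>k\<in>F. s k powr p) \<le> C powr p"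
   by (rule eventually_finite_subsets_at_top_weakI)
 qed simp
 thus "x \<in> schatten p A" using a sd(1) unfolding schatten_def by blast
qed

section \<open>The matrix norms of the trace class\<close>

lemma contr_sball_0: assumes J: "finite J" and W: "contr J W" shows "sball J 0 W"
proof -
 obtain K :: "nat set" and s u v where K: "finite K" "\<And>k. k \<in> K ==> 0 < s k"
  "\<And>k l. k \<in> K ==> l \<in> K ==> ip J (u k) (u l) = (if k = l then 1 else 0)"
  "\<And>k l. k \<in> K ==> l \<in> K ==> ip J (v k) (v l) = (if k = l then 1 else 0)"
  "\<And>i j. i \<in> J ==> j \<in> J ==> W i j = (\<Sum>k\<in>K. of_real (s k) * u k i * cnj (v k j))"
  by (rule finite_svd[OF J, of W]) (rule that)
 have s1: "s k \<le> 1" if k: "k \<in> K" for k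
 proof -
  have "mv J W (v k) i = of_real (s k) * u k i" if "i \<in> J" for i
  proof -
   have "mv J W (v k) i = mv J (%i j. \<Sum>k\<in>K. of_real (s k) * u k i * cnj (v k j)) (v k) i"
    unfolding mv_def using K(5) that by (intro sum.cong refl) simp
   thus ?thesis by (simp only: mv_orthonormal[OF K(1,4) k])
  qed
  hence "sq J (mv J W (v k)) = (cmod (of_real (s k)))\<^sup>2 * sq J (u k)"
   unfolding sq_mult[symmetric] by (intro sq_cong) auto
  moreover have "sq J (u k) = 1" "sq J (v k) = 1" using orthonormal_sq[of J "u k"] orthonormal_sq[of J "v k"] K(3,4)[OF k k] by auto
  moreover have "sq J (mv J W (v k)) \<le> sq J (v k)" using W by (simp add: contr_def)
  ultimately have "(s k)\<^sup>2 \<le> 1" by simp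
  thus ?thesis using K(2)[OF k] by (simp add: power_le_one_iff abs_square_le_1)
 qed
 show ?thesis
 proof (rule sball_coeffI[OF K(1) _ _ orthonormal_bessel[OF K(3,1)] orthonormal_bessel[OF K(4,1)] _ K(5), where \<rho> = "%_. 1 / (real (card K) + 1)"])
  show "cmod (of_real (s k)) \<le> (1 / (real (card K) + 1)) powr 0" if "k \<in> K" for k
   using s1[OF that] K(2)[OF that] by simp
 qed (auto simp: divide_le_eq_1)
qed

lemma hs_contr: assumes "hs I A \<le> 1" shows "contr I A"
 unfolding contr_def
proof
 fix \<xi>
 have "sq I (mv I A \<xi>) \<le> (\<Sum>i\<in>I. (\<Sum>j\<in>I. (cmod (A i j))\<^sup>2) * sq I \<xi>)"
  unfolding sq_def mv_def by (intro sum_mono sum_norm_cs)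
 also have "... = hs I A * sq I \<xi>" by (simp add: hs_def sum_distrib_right)
 also have "... \<le> 1 * sq I \<xi>" using assms by (intro mult_right_mono) auto
 finally show "sq I (mv I A \<xi>) \<le> sq I \<xi>" by simp
qed

lemma sb1_s1b:
 assumes "finite M" "finite L" "sb (M \<times> L) 1 x c" shows "s1b M L x c"
 unfolding s1b_def
proof (intro allI impI)
 fix A B W assume a: "hs M A \<le> 1" "hs M B \<le> 1" "contr (M \<times> L) W"
 have "sb (M \<times> L) 1 (mm (M \<times> L) (amp A) (mm (M \<times> L) x (amp B))) c"
  by (intro sb_mm_left sb_mm_right contr_amp hs_contr assms a)
 moreover have "sball (M \<times> L) (1 - 1) W" using contr_sball_0[OF _ a(3)] assms by simp
 ultimately show "cmod (tr (M \<times> L) (mm (M \<times> L) (amp A) (mm (M \<times> L) x (amp B))) W) \<le> c" by (simp add: sb_def)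
qed

lemma sum_Times: "sum f (A \<times> B) = (\<Sum>a\<in>A. \<Sum>b\<in>B. f (a, b))"
 by (simp add: sum.cartesian_product)

lemma tr_amp_expand:
 assumes L: "finite L" and M: "finite M"
 shows "tr (M \<times> L) (mm (M \<times> L) (amp A) (mm (M \<times> L) x (amp B))) W
  = (\<Sum>r\<in>M. \<Sum>a\<in>M. \<Sum>s\<in>M. \<Sum>b\<in>M. A r a * B b s * (\<Sum>k\<in>L. \<Sum>l\<in>L. x (a, k) (b, l) * W (s, l) (r, k)))"
proof -
 have e1: "mm (M \<times> L) x (amp B) p (s, l) = (\<Sum>b\<in>M. x p (b, l) * B b s)" if "l \<in> L" for p s l
 proof -
  have "mm (M \<times> L) x (amp B) p (s, l) = (\<Sum>b\<in>M. \<Sum>l'\<in>L. if l' = l then x p (b, l) * B b s else 0)"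
   unfolding mm_def by (subst sum.cartesian_product, intro sum.cong refl) (auto simp: amp_def)
  thus ?thesis using that L by simp
 qed
 have e2: "mm (M \<times> L) (amp A) y (r, k) q = (\<Sum>a\<in>M. A r a * y (a, k) q)" if "k \<in> L" for y r k q
 proof -
  have "mm (M \<times> L) (amp A) y (r, k) q = (\<Sum>a\<in>M. \<Sum>k'\<in>L. if k' = k then A r a * y (a, k) q else 0)"
   unfolding mm_def by (subst sum.cartesian_product, intro sum.cong refl) (auto simp: amp_def)
  thus ?thesis using that L by simp
 qed
 have "tr (M \<times> L) (mm (M \<times> L) (amp A) (mm (M \<times> L) x (amp B))) W
  = (\<Sum>r\<in>M. \<Sum>k\<in>L. \<Sum>s\<in>M. \<Sum>l\<in>L. mm (M \<times> L) (amp A) (mm (M \<times> L) x (amp B)) (r, k) (s, l) * W (s, l) (r, k))"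
  unfolding tr_def sum_Times ..
 also have "... = (\<Sum>r\<in>M. \<Sum>k\<in>L. \<Sum>s\<in>M. \<Sum>l\<in>L. \<Sum>a\<in>M. \<Sum>b\<in>M. A r a * B b s * (x (a, k) (b, l) * W (s, l) (r, k)))"
  by (intro sum.cong refl) (simp add: e1 e2 sum_distrib_left sum_distrib_right mult_ac)
 also have "... = (\<Sum>r\<in>M. \<Sum>s\<in>M. \<Sum>k\<in>L. \<Sum>l\<in>L. \<Sum>a\<in>M. \<Sum>b\<in>M. A r a * B b s * (x (a, k) (b, l) * W (s, l) (r, k)))"
  by (intro sum.cong refl sum.swap)
 also have "... = (\<Sum>r\<in>M. \<Sum>s\<in>M. \<Sum>k\<in>L. \<Sum>a\<in>M. \<Sum>l\<in>L. \<Sum>b\<in>M. A r a * B b s * (x (a, k) (b, l) * W (s, l) (r, k)))"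
  by (intro sum.cong refl sum.swap)
 also have "... = (\<Sum>r\<in>M. \<Sum>s\<in>M. \<Sum>a\<in>M. \<Sum>k\<in>L. \<Sum>l\<in>L. \<Sum>b\<in>M. A r a * B b s * (x (a, k) (b, l) * W (s, l) (r, k)))"
  by (intro sum.cong refl sum.swap)
 also have "... = (\<Sum>r\<in>M. \<Sum>s\<in>M. \<Sum>a\<in>M. \<Sum>k\<in>L. \<Sum>b\<in>M. \<Sum>l\<in>L. A r a * B b s * (x (a, k) (b, l) * W (s, l) (r, k)))"
  by (intro sum.cong refl sum.swap)
 also have "... = (\<Sum>r\<in>M. \<Sum>s\<in>M. \<Sum>a\<in>M. \<Sum>b\<in>M. \<Sum>k\<in>L. \<Sum>l\<in>L. A r a * B b s * (x (a, k) (b, l) * W (s, l) (r, k)))"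
  by (intro sum.cong refl sum.swap)
 also have "... = (\<Sum>r\<in>M. \<Sum>a\<in>M. \<Sum>s\<in>M. \<Sum>b\<in>M. \<Sum>k\<in>L. \<Sum>l\<in>L. A r a * B b s * (x (a, k) (b, l) * W (s, l) (r, k)))"
  by (intro sum.cong refl sum.swap)
 finally show ?thesis by (simp only: sum_distrib_left)
qed

lemma contr_transpose: assumes "contr J w" shows "contr J (%i j. w j i)"
 unfolding contr_def
proof
 fix \<xi>
 have "mv J (%i j. w j i) \<xi> = (%i. cnj (mv J (adj w) (%j. cnj (\<xi> j)) i))"
  by (simp add: mv_def adj_def)
 hence "sq J (mv J (%i j. w j i) \<xi>) = sq J (mv J (adj w) (%j. cnj (\<xi> j)))" by (simp add: sq_def)
 also have "... \<le> sq J (%j. cnj (\<xi> j))" using contr_adj[OF assms] unfolding contr_def by blast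
 finally show "sq J (mv J (%i j. w j i) \<xi>) \<le> sq J \<xi>" by (simp add: sq_def)
qed

text \<open>Bounds for the norm of \<open>M\<^sub>n(S\<^sup>1)\<close> on arbitrary matrices. The first index set may exceed \<open>I\<close>: the test matrices of
 \<open>S1_matrix_norm\<close> have any size.\<close>

definition s1bf :: "nat set => (nat \<times> 'k) cmat => real => bool" where
 "s1bf I x c \<longleftrightarrow> (\<forall>M L. finite M \<longrightarrow> finite L \<longrightarrow> I \<subseteq> M \<longrightarrow> s1b M L x c)"

lemma sbf1_s1bf: "sbf 1 x c ==> s1bf I x c"
 unfolding s1bf_def sbf_def by (auto intro!: sb1_s1b)

text \<open>Rectangular partial sums of the pairing; the factors \<open>D\<^sub>k\<close> allow to pass to absolute values and to subsets.\<close>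

lemma S1_partial_bound:
 assumes x: "s1bf I x c" and Y: "sbf 0 Y 1" and M: "finite M" "I \<subseteq> M" and L: "finite L"
  and D: "\<And>k. cmod (D k) \<le> 1" and xi: "sq (M \<times> M) \<xi> \<le> 1" and eta: "sq (M \<times> M) \<eta> \<le> 1"
 shows "cmod (\<Sum>r\<in>M. \<Sum>a\<in>M. \<Sum>s\<in>M. \<Sum>b\<in>M. cnj (\<eta> (r, a)) * \<xi> (s, b) *
   (\<Sum>k\<in>L. \<Sum>l\<in>L. x (a, k) (b, l) * (D k * Y (r, k) (s, l)))) \<le> c"
proof -
 let ?J = "M \<times> L"
 have cY: "contr ?J Y" using Y M L by (intro sb_contr) (auto simp: sbf_def)
 have "contr ?J (%p q. D (snd p) * Y p q)"
  unfolding contr_def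
 proof
  fix \<zeta> :: "nat \<times> 'a => complex"
  have "mv ?J (%p q. D (snd p) * Y p q) \<zeta> = (%p. D (snd p) * mv ?J Y \<zeta> p)"
   by (simp add: mv_def sum_distrib_left mult.assoc)
  hence "sq ?J (mv ?J (%p q. D (snd p) * Y p q) \<zeta>) = (\<Sum>p\<in>?J. (cmod (D (snd p)))\<^sup>2 * (cmod (mv ?J Y \<zeta> p))\<^sup>2)"
   by (simp add: sq_def norm_mult power_mult_distrib)
  also have "... \<le> sq ?J (mv ?J Y \<zeta>)"
   unfolding sq_def by (intro sum_mono mult_left_le_one_le) (auto simp: D power_le_one)
  also have "... \<le> sq ?J \<zeta>" using cY by (simp add: contr_def)
  finally show "sq ?J (mv ?J (%p q. D (snd p) * Y p q) \<zeta>) \<le> sq ?J \<zeta>" .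
 qed
 hence W: "contr ?J (%q p. D (snd p) * Y p q)" by (rule contr_transpose)
 have hA: "hs M (%r a. cnj (\<eta> (r, a))) \<le> 1" using eta by (simp add: hs_def sq_def sum.cartesian_product case_prod_beta)
 have "hs M (adj (%s b. cnj (\<xi> (s, b)))) = sq (M \<times> M) \<xi>"
  unfolding hs_adj by (simp add: hs_def sq_def sum.cartesian_product case_prod_beta)
 hence hB: "hs M (%b s. \<xi> (s, b)) \<le> 1" using xi by (simp add: adj_def)
 have "s1b M L x c" using x M L by (simp add: s1bf_def)
 hence "cmod (tr ?J (mm ?J (amp (%r a. cnj (\<eta> (r, a)))) (mm ?J x (amp (%b s. \<xi> (s, b))))) (%q p. D (snd p) * Y p q)) \<le> c"
  using hA hB W unfolding s1b_def by blast
 thus ?thesis unfolding tr_amp_expand[OF L M(1)] by simp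
qed

lemma ell2_slice: assumes "\<xi> \<in> ell2" shows "(%l. \<xi> (b, l)) \<in> ell2"
proof (rule ell2_boundI(1))
 fix J :: "'b set" assume J: "finite J"
 have "sq J (%l. \<xi> (b, l)) = sq ((%l. (b, l)) ` J) \<xi>"
  unfolding sq_def by (subst sum.reindex) (auto simp: inj_on_def)
 also have "... \<le> (ell2_norm \<xi>)\<^sup>2" using J by (intro sq_le_ell2 assms) auto
 finally show "sq J (%l. \<xi> (b, l)) \<le> (ell2_norm \<xi>)\<^sup>2" .
qed simp

lemma S1_inner_tendsto:
 assumes x: "sbf \<theta> x C" and Y: "sbf \<theta>' Y C'"
 shows "((%L. \<Sum>l\<in>L. x (a, k) (b, l) * Y (r, k) (s, l)) \<longlongrightarrow> (\<Sum>\<^sub>\<infinity>l. x (a, k) (b, l) * Y (r, k) (s, l))) (finite_subsets_at_top UNIV)"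
 by (intro infsum_tendsto ell2_prod_summable ell2_slice sbf_row[OF x] sbf_row[OF Y])

lemma sum_subset_factor:
 assumes "finite L" "K \<subseteq> L" shows "(\<Sum>k\<in>L. (if k \<in> K then f k else 0)) = sum f K"
 using assms by (simp add: sum.inter_restrict[symmetric] Int_absorb1)

lemma S1_outer_summable:
 fixes x Y :: "(nat \<times> 'i) cmat" and r s :: nat
 assumes x: "sbf \<theta> x C" "s1bf I x c" "finite I" and Y: "sbf 0 Y 1"
 shows "(%k. \<Sum>\<^sub>\<infinity>l. x (a, k) (b, l) * Y (r, k) (s, l)) summable_on UNIV"
proof -
 define g where "g = (%k. \<Sum>\<^sub>\<infinity>l. x (a, k) (b, l) * Y (r, k) (s, l))"
 define M where "M = I \<union> {a, b, r, s}"
 have M: "finite M" "I \<subseteq> M" "a \<in> M" "b \<in> M" "r \<in> M" "s \<in> M" using x(3) by (auto simp: M_def)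
 have "(\<Sum>k\<in>K. cmod (g k)) \<le> c" if K: "finite K" for K
 proof -
  define d where "d = (%k. if k \<in> K then cnj (sgn (g k)) else 0)"
  have d1: "cmod (d k) \<le> 1" for k by (simp add: d_def norm_sgn)
  have b: "cmod (\<Sum>k\<in>K. cnj (sgn (g k)) * (\<Sum>l\<in>L. x (a, k) (b, l) * Y (r, k) (s, l))) \<le> c" if L: "finite L" "K \<subseteq> L" for L
  proof -
   let ?\<xi> = "%q. if q = (s, b) then (1::complex) else 0" and ?\<eta> = "%q. if q = (r, a) then (1::complex) else 0"
   have sq1: "sq (M \<times> M) (%q. if q = q0 then (1::complex) else 0) \<le> 1" for q0
   proof -
    have "sq (M \<times> M) (%q. if q = q0 then (1::complex) else 0) = (\<Sum>q\<in>M \<times> M. if q = q0 then 1 else 0)"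
     unfolding sq_def by (intro sum.cong refl) auto
    thus ?thesis using M by simp
   qed
   define T where "T = (%r a s b. \<Sum>k\<in>L. \<Sum>l\<in>L. x (a, k) (b, l) * (d k * Y (r, k) (s, l)))"
   have "cmod (\<Sum>r'\<in>M. \<Sum>a'\<in>M. \<Sum>s'\<in>M. \<Sum>b'\<in>M. cnj (?\<eta> (r', a')) * ?\<xi> (s', b') * T r' a' s' b') \<le> c"
    unfolding T_def by (rule S1_partial_bound[OF x(2) Y M(1,2) L(1) d1 sq1 sq1])
   also have "(\<Sum>r'\<in>M. \<Sum>a'\<in>M. \<Sum>s'\<in>M. \<Sum>b'\<in>M. cnj (?\<eta> (r', a')) * ?\<xi> (s', b') * T r' a' s' b')
    = (\<Sum>r'\<in>M. if r' = r then (\<Sum>a'\<in>M. if a' = a then (\<Sum>s'\<in>M. if s' = s then (\<Sum>b'\<in>M. if b' = b then T r a s b else 0) else 0) else 0) else 0)"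
    by (intro sum.cong refl) (auto intro!: sum.neutral sum.cong)
   also have "... = T r a s b" using M by simp
   also have "T r a s b = (\<Sum>k\<in>L. if k \<in> K then cnj (sgn (g k)) * (\<Sum>l\<in>L. x (a, k) (b, l) * Y (r, k) (s, l)) else 0)"
    unfolding T_def d_def by (intro sum.cong refl) (simp add: sum_distrib_left mult_ac)
   also have "... = (\<Sum>k\<in>K. cnj (sgn (g k)) * (\<Sum>l\<in>L. x (a, k) (b, l) * Y (r, k) (s, l)))"
    by (rule sum_subset_factor[OF L])
   finally show ?thesis .
  qed
  have "((%L. \<Sum>k\<in>K. cnj (sgn (g k)) * (\<Sum>l\<in>L. x (a, k) (b, l) * Y (r, k) (s, l))) \<longlongrightarrow> (\<Sum>k\<in>K. cnj (sgn (g k)) * g k)) (finite_subsets_at_top UNIV)"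
   unfolding g_def by (intro tendsto_intros S1_inner_tendsto[OF x(1) Y])
  from tendsto_norm[OF this] have "cmod (\<Sum>k\<in>K. cnj (sgn (g k)) * g k) \<le> c"
  proof (rule tendsto_upperbound)
   show "\<forall>\<^sub>F L in finite_subsets_at_top UNIV. cmod (\<Sum>k\<in>K. cnj (sgn (g k)) * (\<Sum>l\<in>L. x (a, k) (b, l) * Y (r, k) (s, l))) \<le> c"
    unfolding eventually_finite_subsets_at_top using K by (intro exI[of _ K]) (auto intro!: b)
  qed (rule finite_subsets_at_top_neq_bot)
  also have "(\<Sum>k\<in>K. cnj (sgn (g k)) * g k) = of_real (\<Sum>k\<in>K. cmod (g k))"
  proof -
   have "cnj (sgn z) * z = of_real (cmod z)" for z :: complex
    by (cases "z = 0") (simp_all add: sgn_div_norm scaleR_conv_of_real mult.commute[of "cnj z"] complex_norm_square[symmetric] power2_eq_square field_simps)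
   thus ?thesis by simp
  qed
  also have "cmod (of_real (\<Sum>k\<in>K. cmod (g k))) = (\<Sum>k\<in>K. cmod (g k))" unfolding norm_of_real by (simp add: sum_nonneg)
  finally show ?thesis .
 qed
 hence "(%k. norm (g k)) summable_on UNIV"
  by (intro nonneg_bounded_partial_sums_imp_summable_on[where C = c]) (auto intro!: eventually_finite_subsets_at_top_weakI)
 thus ?thesis unfolding g_def by (rule abs_summable_summable)
qed

text \<open>The unit vectors \<open>\<xi>\<close>, \<open>\<eta>\<close> testing the norm of the pairing are the Hilbert-Schmidt matrices \<open>A\<close>, \<open>B\<close> of \<open>s1b\<close>, and
 the test matrix \<open>Y\<close>, transposed, is its contraction.\<close>

lemma S1_pairing_sbf:
 assumes x: "sbf \<theta> x C" "s1bf I x c" "finite I" and Y: "sbf 0 Y 1" and c0: "0 \<le> c"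
 shows "sbf 0 (S1_pairing x Y) c"
 unfolding sbf_def
proof (intro allI impI)
 fix R :: "(nat \<times> nat) set" assume R: "finite R"
 define M where "M = I \<union> fst ` R \<union> snd ` R"
 have M: "finite M" "I \<subseteq> M" and RM: "R \<subseteq> M \<times> M" using x(3) R by (auto simp: M_def) (force simp: M_def)+
 have MM: "finite (M \<times> M)" using M by simp
 show "sb R 0 (S1_pairing x Y) c"
 proof (rule sb_0_formI[OF _ c0])
  fix \<xi>0 \<eta>0 :: "nat \<times> nat => complex" assume n: "sq R \<xi>0 \<le> 1" "sq R \<eta>0 \<le> 1"
  define \<xi> where "\<xi> = rs R \<xi>0" define \<eta> where "\<eta> = rs R \<eta>0"
  have nx: "sq (M \<times> M) \<xi> \<le> 1" "sq (M \<times> M) \<eta> \<le> 1"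
   using n RM by (simp_all add: \<xi>_def \<eta>_def sq_rs[OF MM] Int_absorb1)
  define T where "T = (%K L r a s b. \<Sum>k\<in>K. \<Sum>l\<in>L. x (a, k) (b, l) * Y (r, k) (s, l))"
  define T1 where "T1 = (%K r a s b. \<Sum>k\<in>K. \<Sum>\<^sub>\<infinity>l. x (a, k) (b, l) * Y (r, k) (s, l))"
  define Q where "Q = (%f. \<Sum>r\<in>M. \<Sum>a\<in>M. \<Sum>s\<in>M. \<Sum>b\<in>M. cnj (\<eta> (r, a)) * \<xi> (s, b) * (f r a s b :: complex))"
  have b1: "cmod (Q (T K L)) \<le> c" if L: "finite L" "K \<subseteq> L" for K L
  proof -
   have "T K L r a s b = (\<Sum>k\<in>L. \<Sum>l\<in>L. x (a, k) (b, l) * ((if k \<in> K then 1 else 0) * Y (r, k) (s, l)))" for r a s b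
   proof -
    have "(\<Sum>k\<in>L. \<Sum>l\<in>L. x (a, k) (b, l) * ((if k \<in> K then 1 else 0) * Y (r, k) (s, l)))
     = (\<Sum>k\<in>L. if k \<in> K then (\<Sum>l\<in>L. x (a, k) (b, l) * Y (r, k) (s, l)) else 0)"
     by (intro sum.cong refl) auto
    thus ?thesis unfolding T_def by (simp only: sum_subset_factor[OF L])
   qed
   thus ?thesis unfolding Q_def
    using S1_partial_bound[OF x(2) Y M L(1), of "%k. if k \<in> K then 1 else 0", OF _ nx] by simp
  qed
  have b2: "cmod (Q (T1 K)) \<le> c" if K: "finite K" for K
  proof (rule tendsto_upperbound)
   show "((%L. cmod (Q (T K L))) \<longlongrightarrow> cmod (Q (T1 K))) (finite_subsets_at_top UNIV)"
    unfolding Q_def T_def T1_def by (intro tendsto_intros S1_inner_tendsto[OF x(1) Y])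
   show "\<forall>\<^sub>F L in finite_subsets_at_top UNIV. cmod (Q (T K L)) \<le> c"
    unfolding eventually_finite_subsets_at_top using K by (intro exI[of _ K]) (auto intro!: b1)
  qed (rule finite_subsets_at_top_neq_bot)
  have "cmod (Q (%r a s b. S1_pairing x Y (r, a) (s, b))) \<le> c"
  proof (rule tendsto_upperbound)
   show "((%K. cmod (Q (T1 K))) \<longlongrightarrow> cmod (Q (%r a s b. S1_pairing x Y (r, a) (s, b)))) (finite_subsets_at_top UNIV)"
    unfolding Q_def T1_def S1_pairing_def prod.case
    by (intro tendsto_intros infsum_tendsto S1_outer_summable[OF x Y])
   show "\<forall>\<^sub>F K in finite_subsets_at_top UNIV. cmod (Q (T1 K)) \<le> c"
    by (intro eventually_finite_subsets_at_top_weakI b2)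
  qed (rule finite_subsets_at_top_neq_bot)
  also have "Q (%r a s b. S1_pairing x Y (r, a) (s, b)) = ip (M \<times> M) (mv (M \<times> M) (S1_pairing x Y) \<xi>) \<eta>"
   unfolding Q_def ip_def mv_def sum_Times sum_distrib_right by (simp add: mult_ac)
  also have "... = ip R (mv R (S1_pairing x Y) \<xi>0) \<eta>0"
  proof -
   have m: "mv (M \<times> M) (S1_pairing x Y) \<xi> = mv R (S1_pairing x Y) \<xi>0"
   proof
    fix q
    have "mv (M \<times> M) (S1_pairing x Y) \<xi> q = (\<Sum>q'\<in>M \<times> M. if q' \<in> R then S1_pairing x Y q q' * \<xi>0 q' else 0)"
     unfolding mv_def \<xi>_def rs_def by (intro sum.cong refl) auto
    thus "mv (M \<times> M) (S1_pairing x Y) \<xi> q = mv R (S1_pairing x Y) \<xi>0 q"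
     by (simp only: sum_subset_factor[OF MM RM] mv_def)
   qed
   have "ip (M \<times> M) h \<eta> = (\<Sum>q'\<in>M \<times> M. if q' \<in> R then h q' * cnj (\<eta>0 q') else 0)" for h
    unfolding ip_def \<eta>_def rs_def by (intro sum.cong refl) auto
   thus ?thesis unfolding m by (simp only: sum_subset_factor[OF MM RM] ip_def)
  qed
  finally show "cmod (ip R (mv R (S1_pairing x Y) \<xi>0) \<eta>0) \<le> c" .
 qed
qed

lemma S1_matrix_norm_le:
 assumes x: "sbf \<theta> x C" "s1bf I x c" "finite I" and c0: "0 \<le> c"
 shows "S1_matrix_norm A x \<le> c" "bdd_above {op_norm (S1_pairing x Y) | m Y. Y \<in> bounded_ops ({..<m} \<times> A) \<and> op_norm Y \<le> 1}"
proof -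
 have b: "op_norm (S1_pairing x Y) \<le> c" if "Y \<in> bounded_ops ({..<m} \<times> A)" "op_norm Y \<le> 1" for m :: nat and Y
  using op_norm_le[OF S1_pairing_sbf[OF x sbf_mono[OF bounded_ops_sbf[OF that(1)] that(2)] c0]] .
 show "bdd_above {op_norm (S1_pairing x Y) | m Y. Y \<in> bounded_ops ({..<m} \<times> A) \<and> op_norm Y \<le> 1}"
  by (rule bdd_aboveI[of _ c]) (use b in auto)
 have z: "sbf 0 (%p q. 0 :: complex) 0" by (simp add: sbf_def sb_def tr_def)
 have "(%p q. 0) \<in> bounded_ops ({..<0::nat} \<times> A)"
  by (rule sbf_bounded_ops[OF z]) (simp add: supported_on_def)
 moreover have "op_norm (%(p :: nat \<times> 'a) q. 0 :: complex) \<le> 1" by (rule order_trans[OF op_norm_le[OF z]]) simp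
 ultimately have "op_norm (S1_pairing x (%p q. 0)) \<in> {op_norm (S1_pairing x Y) | m Y. Y \<in> bounded_ops ({..<m} \<times> A) \<and> op_norm Y \<le> 1}"
  by blast
 thus "S1_matrix_norm A x \<le> c"
  unfolding S1_matrix_norm_def by (intro cSup_least ne_empty) (use b in auto)
qed

text \<open>Every contraction on the finite corner occurs, transposed, as a test matrix in the definition of the norm.\<close>

lemma S1_matrix_norm_ge:
 assumes x: "sbf 1 x C" and I: "finite I" "I \<subseteq> {..<n}" and L: "finite L" "L \<subseteq> A"
  and sx: "\<And>p q. x p q \<noteq> 0 ==> fst p \<in> I \<and> fst q \<in> I"
 shows "s1b I L x (S1_matrix_norm A x)"
 unfolding s1b_def
proof (intro allI impI)
 fix F B W assume FB: "hs I F \<le> 1" "hs I B \<le> 1" and W: "contr (I \<times> L) W"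
 let ?J = "I \<times> L"
 have J: "finite ?J" using I L by simp
 define Y where "Y = trunc ?J (%p q. W q p)"
 have "sb ?J 0 (%p q. W q p) 1" by (rule contr_sb[OF contr_transpose[OF W]])
 have Y1: "sbf 0 Y 1" unfolding sbf_def
 proof (intro allI impI)
  fix R :: "(nat \<times> 'a) set" assume R: "finite R"
  show "sb R 0 Y 1"
  proof (rule sb_0_formI)
   fix \<xi> \<eta> :: "nat \<times> 'a => complex" assume n: "sq R \<xi> \<le> 1" "sq R \<eta> \<le> 1"
   have m: "mv R Y \<xi> p = (if p \<in> ?J then mv ?J (%p q. W q p) (rs R \<xi>) p else 0)" for p
   proof -
    have "mv R Y \<xi> p = (\<Sum>q\<in>R \<union> ?J. if q \<in> R then Y p q * \<xi> q else 0)"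
     using R J by (simp only: sum_subset_factor[OF _ Un_upper1] finite_Un mv_def)
    also have "... = (\<Sum>q\<in>R \<union> ?J. if q \<in> ?J then (if p \<in> ?J then W q p * rs R \<xi> q else 0) else 0)"
     by (intro sum.cong refl) (auto simp: Y_def trunc_def rs_def)
    also have "... = (\<Sum>q\<in>?J. if p \<in> ?J then W q p * rs R \<xi> q else 0)"
     using R J by (intro sum_subset_factor) auto
    finally show ?thesis by (simp add: mv_def)
   qed
   have "ip R (mv R Y \<xi>) \<eta> = ip ?J (mv ?J (%p q. W q p) (rs R \<xi>)) (rs R \<eta>)"
   proof -
    have "ip R (mv R Y \<xi>) \<eta> = (\<Sum>p\<in>R \<union> ?J. if p \<in> R then mv R Y \<xi> p * cnj (\<eta> p) else 0)"
     using R J by (simp only: sum_subset_factor[OF _ Un_upper1] finite_Un ip_def)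
    also have "... = (\<Sum>p\<in>R \<union> ?J. if p \<in> ?J then mv ?J (%p q. W q p) (rs R \<xi>) p * cnj (rs R \<eta> p) else 0)"
     unfolding m by (intro sum.cong refl) (auto simp: rs_def)
    also have "... = (\<Sum>p\<in>?J. mv ?J (%p q. W q p) (rs R \<xi>) p * cnj (rs R \<eta> p))"
     using R J by (intro sum_subset_factor) auto
    finally show ?thesis by (simp add: ip_def)
   qed
   hence "(cmod (ip R (mv R Y \<xi>) \<eta>))\<^sup>2 \<le> sq ?J (rs R \<xi>) * sq ?J (rs R \<eta>)"
    using contr_ip[OF contr_transpose[OF W]] by simp
   also have "... \<le> 1 * 1"
   proof (intro mult_mono)
    show "sq ?J (rs R \<xi>) \<le> 1" "sq ?J (rs R \<eta>) \<le> 1"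
     unfolding sq_rs[OF J] using n sq_mono[OF R, of "?J \<inter> R"] by (meson Int_lower2 order_trans)+
   qed auto
   finally show "cmod (ip R (mv R Y \<xi>) \<eta>) \<le> 1" by (simp add: power_le_one_iff)
  qed simp
 qed
 have Yb: "Y \<in> bounded_ops ({..<n} \<times> A)"
  by (rule sbf_bounded_ops[OF Y1]) (use I L in \<open>auto simp: supported_on_def Y_def trunc_def split: if_splits\<close>)
 have xs: "s1bf I x C" by (rule sbf1_s1bf[OF x])
 have C0: "0 \<le> C" by (rule sbf_nonneg[OF x])
 let ?P = "S1_pairing x Y"
 have Ps: "sbf 0 ?P C" by (rule S1_pairing_sbf[OF x xs I(1) Y1 C0])
 have le: "op_norm ?P \<le> S1_matrix_norm A x"
  unfolding S1_matrix_norm_def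
  by (rule cSup_upper[OF _ S1_matrix_norm_le(2)[OF x xs I(1) C0]]) (use Yb op_norm_le[OF Y1] in blast)
 have Pv: "?P (r, a) (s, b) = (\<Sum>k\<in>L. \<Sum>l\<in>L. x (a, k) (b, l) * W (s, l) (r, k))" if "r \<in> I" "s \<in> I" for r a s b
 proof -
  have 1: "(\<Sum>\<^sub>\<infinity>l. x (a, k) (b, l) * Y (r, k) (s, l)) = (if k \<in> L then (\<Sum>l\<in>L. x (a, k) (b, l) * W (s, l) (r, k)) else 0)" for k
  proof (cases "k \<in> L")
   case True
   have "(\<Sum>\<^sub>\<infinity>l. x (a, k) (b, l) * Y (r, k) (s, l)) = (\<Sum>l\<in>L. x (a, k) (b, l) * W (s, l) (r, k))"
    by (rule infsumI, rule has_sum_finite_neutralI[where B = L]) (use L that True in \<open>auto simp: Y_def trunc_def intro!: sum.cong\<close>)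
   thus ?thesis using True by simp
  qed (simp add: Y_def trunc_def)
  have "(\<Sum>\<^sub>\<infinity>k. if k \<in> L then (\<Sum>l\<in>L. x (a, k) (b, l) * W (s, l) (r, k)) else 0) = (\<Sum>k\<in>L. \<Sum>l\<in>L. x (a, k) (b, l) * W (s, l) (r, k))"
   by (rule infsumI, rule has_sum_finite_neutralI[where B = L]) (use L in auto)
  thus ?thesis unfolding S1_pairing_def prod.case 1 .
 qed
 define \<xi> where "\<xi> = (%q::nat \<times> nat. B (snd q) (fst q))"
 define \<eta> where "\<eta> = (%q::nat \<times> nat. cnj (F (fst q) (snd q)))"
 have "sq (I \<times> I) \<eta> = hs I F" by (simp add: \<eta>_def sq_def hs_def sum.cartesian_product case_prod_beta)
 hence e1: "sq (I \<times> I) \<eta> \<le> 1" using FB by simp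
 have "sq (I \<times> I) \<xi> = hs I (%s b. B b s)" by (simp add: \<xi>_def sq_def hs_def sum.cartesian_product case_prod_beta)
 also have "... = hs I B" unfolding hs_def by (rule sum.swap)
 finally have x1: "sq (I \<times> I) \<xi> \<le> 1" using FB by simp
 have "tr ?J (mm ?J (amp F) (mm ?J x (amp B))) W
  = (\<Sum>r\<in>I. \<Sum>a\<in>I. \<Sum>s\<in>I. \<Sum>b\<in>I. F r a * B b s * ?P (r, a) (s, b))"
  unfolding tr_amp_expand[OF L(1) I(1)] using Pv by (intro sum.cong refl) simp
 also have "... = ip (I \<times> I) (mv (I \<times> I) ?P \<xi>) \<eta>"
  unfolding ip_def mv_def sum_Times sum_distrib_right by (simp add: mult_ac \<xi>_def \<eta>_def)
 finally have "cmod (tr ?J (mm ?J (amp F) (mm ?J x (amp B))) W) \<le> op_norm ?P"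
  using sb_ip_le[OF _ x1 e1, of 0 ?P "op_norm ?P"] sbf_op_norm[OF Ps] I(1) by (simp add: sbf_def)
 thus "cmod (tr ?J (mm ?J (amp F) (mm ?J x (amp B))) W) \<le> S1_matrix_norm A x" using le by simp
qed

section \<open>Series of analytic matrix functions\<close>

text \<open>A Bessel representation of a test matrix restricts to the common corner.\<close>

lemma sb_sbf_trunc:
 assumes J: "finite J" and x: "sb J \<theta> x c" shows "sbf \<theta> (trunc J x) c"
 unfolding sbf_def sb_def
proof (intro allI impI)
 fix M :: "'a set" and w assume M: "finite M" "sball M (1 - \<theta>) w"
 obtain K \<rho> e f where "dyadic M (1 - \<theta>) w K \<rho> e f" using M(2) unfolding sball_def by blast
 note D = dyadicD[OF this]
 have bs: "bessel J K (%k. rs M (g k))" if "bessel M K g" for g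
  unfolding bessel_iff_synthesis
 proof
  fix c
  have "(%i. \<Sum>k\<in>K. c k * rs M (g k) i) = rs M (%i. \<Sum>k\<in>K. c k * g k i)" by (auto simp: rs_def fun_eq_iff)
  hence "sq J (%i. \<Sum>k\<in>K. c k * rs M (g k) i) = sq (J \<inter> M) (%i. \<Sum>k\<in>K. c k * g k i)" using J by (simp add: sq_rs)
  also have "... \<le> sq M (%i. \<Sum>k\<in>K. c k * g k i)" using M by (intro sq_mono) auto
  also have "... \<le> (\<Sum>k\<in>K. (cmod (c k))\<^sup>2)" using that by (simp add: bessel_synthesis)
  finally show "sq J (%i. \<Sum>k\<in>K. c k * rs M (g k) i) \<le> (\<Sum>k\<in>K. (cmod (c k))\<^sup>2)" .
 qed
 have w: "sball J (1 - \<theta>) (trunc M w)"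
  by (rule sballI[OF D(1-3) bs[OF D(4)] bs[OF D(5)]]) (auto simp: trunc_def rs_def D(6))
 have "tr M (trunc J x) w = (\<Sum>i\<in>M. if i \<in> J then (\<Sum>j\<in>M. if j \<in> J then x i j * w j i else 0) else 0)"
  unfolding tr_def trunc_def by (intro sum.cong refl) (auto intro!: sum.cong)
 also have "... = (\<Sum>i\<in>J. if i \<in> M then (\<Sum>j\<in>J. if j \<in> M then x i j * w j i else 0) else 0)"
  using M J by (simp add: sum.inter_restrict[symmetric] Int_commute)
 also have "... = tr J x (trunc M w)"
  unfolding tr_def trunc_def by (intro sum.cong refl) (auto intro!: sum.cong)
 finally show "cmod (tr M (trunc J x) w) \<le> c" using x w by (simp add: sb_def)
qed

lemma sbf_zero: "0 \<le> c ==> sbf \<theta> (%i j. 0) c" by (simp add: sbf_def sb_def tr_def)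

lemma sbf_summable:
 assumes "\<And>m. sbf \<theta> (x m) (B m)" "summable B" shows "summable (%m. x m p q)"
 by (rule summable_comparison_test'[OF assms(2), of 0]) (rule sbf_entry[OF assms(1)])

lemma sbf_suminf:
 assumes x: "\<And>m. sbf \<theta> (x m) (B m)" and B: "summable B"
 shows "sbf \<theta> (%p q. \<Sum>m. x m p q) (suminf B)"
 unfolding sbf_def sb_def
proof (intro allI impI)
 fix J :: "'a set" and w assume J: "finite J" "sball J (1 - \<theta>) w"
 have "(%m. tr J (x m) w) sums tr J (%p q. \<Sum>m. x m p q) w"
  unfolding tr_def by (intro sums_sum sums_mult2 summable_sums sbf_summable[OF x B])
 moreover have "cmod (tr J (x m) w) \<le> B m" for m using x[of m] J unfolding sbf_def sb_def by blast
 ultimately show "cmod (tr J (%p q. \<Sum>m. x m p q) w) \<le> suminf B"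
  using norm_suminf_le[of "%m. tr J (x m) w" B] B by (simp add: sums_iff)
qed

lemma sbf_suminf_tail:
 assumes x: "\<And>m. sbf \<theta> (x m) (B m)" and B: "summable B"
 shows "sbf \<theta> (%p q. (\<Sum>m. x m p q) - (\<Sum>m<N. x m p q)) (\<Sum>m. B (m + N))"
proof -
 have "sbf \<theta> (%p q. \<Sum>m. x (m + N) p q) (\<Sum>m. B (m + N))"
  by (rule sbf_suminf) (use x B in \<open>auto simp: summable_iff_shift\<close>)
 moreover have "(\<Sum>m. x (m + N) p q) = (\<Sum>m. x m p q) - (\<Sum>m<N. x m p q)" for p q
  using suminf_minus_initial_segment[OF sbf_summable[OF x B], where k = N] by simp
 ultimately show ?thesis by simp
qed

lemma sapp_suminf:
 assumes x: "\<And>m. sbf \<theta> (x m) (B m)" "\<And>m. sapp \<theta> (x m)" and B: "summable B"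
 shows "sapp \<theta> (%p q. \<Sum>m. x m p q)"
proof (rule sapp_limit)
 fix \<epsilon> :: real assume e: "\<epsilon> > 0"
 obtain N where N: "norm (\<Sum>m. B (m + N)) < \<epsilon>" using suminf_exist_split[OF e B] by blast
 have "sbf \<theta> (%p q. (\<Sum>m. x m p q) - (\<Sum>m<N. x m p q)) \<epsilon>"
  by (rule sbf_mono[OF sbf_suminf_tail[OF x(1) B]]) (use N in simp)
 moreover have "sapp \<theta> (%p q. \<Sum>m<N. x m p q)" by (intro sapp_sum x)
 ultimately show "\<exists>y. sapp \<theta> y \<and> sbf \<theta> (%p q. (\<Sum>m. x m p q) - y p q) \<epsilon>"
  by (intro exI[of _ "%p q. \<Sum>m<N. x m p q"] conjI)
qed

text \<open>Continuity of the individual entries and a summable majorant give continuity in norm.\<close>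

lemma series_continuous:
 fixes H :: "nat => complex => 'i cmat"
 assumes th: "\<theta> \<le> 1" and b: "\<And>m w. w \<in> S ==> sbf \<theta> (H m w) (B m)" and s: "summable B"
  and J: "\<And>m. finite (J m)" and sup: "\<And>m w p q. H m w p q \<noteq> 0 ==> p \<in> J m \<and> q \<in> J m"
  and c: "\<And>m p q. ((%w. H m w p q) \<longlongrightarrow> H m z p q) (at z within S)" and z: "z \<in> S" and e: "0 < \<epsilon>"
 shows "\<forall>\<^sub>F w in at z within S. sbf \<theta> (%p q. (\<Sum>m. H m w p q) - (\<Sum>m. H m z p q)) \<epsilon>"
proof -
 obtain N where N: "norm (\<Sum>m. B (m + N)) < \<epsilon>/4" using suminf_exist_split[OF _ s, of "\<epsilon>/4"] e by auto
 have tail: "sbf \<theta> (%p q. (\<Sum>m. H m w p q) - (\<Sum>m<N. H m w p q)) (\<epsilon>/4)" if "w \<in> S" for w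
  by (rule sbf_mono[OF sbf_suminf_tail[OF b[OF that] s]]) (use N in simp)
 have one: "\<forall>\<^sub>F w in at z within S. sbf \<theta> (%p q. H m w p q - H m z p q) \<delta>" if d: "0 < \<delta>" for m \<delta>
 proof -
  have "((%w. \<Sum>p\<in>J m. \<Sum>q\<in>J m. cmod (H m w p q - H m z p q)) \<longlongrightarrow>
   (\<Sum>p\<in>J m. \<Sum>q\<in>J m. cmod (H m z p q - H m z p q))) (at z within S)"
   by (intro tendsto_intros c)
  hence "\<forall>\<^sub>F w in at z within S. (\<Sum>p\<in>J m. \<Sum>q\<in>J m. cmod (H m w p q - H m z p q)) < \<delta>"
   by (rule order_tendstoD) (use d in simp)
  thus ?thesis
  proof eventually_elim
   case (elim w)
   have t: "trunc (J m) (%p q. H m w p q - H m z p q) = (%p q. H m w p q - H m z p q)"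
   proof (intro ext)
    fix p q
    show "trunc (J m) (%p q. H m w p q - H m z p q) p q = H m w p q - H m z p q"
     using sup[of m w p q] sup[of m z p q]
     by (cases "H m w p q = 0"; cases "H m z p q = 0") (auto simp: trunc_def)
   qed
   show ?case using sbf_mono[OF sbf_trunc_finite[OF J[of m] th, where x = "%p q. H m w p q - H m z p q"]] elim
    unfolding t by simp
  qed
 qed
 have fin: "\<forall>\<^sub>F w in at z within S. sbf \<theta> (%p q. (\<Sum>m<n. H m w p q) - (\<Sum>m<n. H m z p q)) \<delta>" if "0 < \<delta>" for n \<delta>
  using that
 proof (induction n arbitrary: \<delta>)
  case 0 thus ?case by (simp add: sbf_zero)
 next
  case (Suc n)
  have h: "0 < \<delta>/2" using Suc.prems by simp
  from Suc.IH[OF h] one[OF h, of n] show ?case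
  proof eventually_elim
   case (elim w)
   from sbf_add[OF this] show ?case by (simp add: algebra_simps)
  qed
 qed
 have h: "0 < \<epsilon>/2" using e by simp
 have "\<forall>\<^sub>F w in at z within S. w \<in> S" by (simp add: eventually_at_filter)
 with fin[OF h, of N] show ?thesis
 proof eventually_elim
  case (elim w)
  from sbf_add[OF sbf_diff[OF tail[OF elim(2)] tail[OF z]] elim(1)] show ?case by (simp add: algebra_simps)
 qed
qed

lemma op_norm_tendsto_0:
 assumes "\<And>\<epsilon>. 0 < \<epsilon> ==> \<forall>\<^sub>F w in A. sbf 0 (X w) \<epsilon>" shows "((%w. op_norm (X w)) \<longlongrightarrow> 0) A"
proof (rule tendstoI)
 fix \<epsilon> :: real assume "0 < \<epsilon>"
 hence h: "0 < \<epsilon>/2" "\<epsilon>/2 < \<epsilon>" by auto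
 from assms[OF h(1)] show "\<forall>\<^sub>F w in A. dist (op_norm (X w)) 0 < \<epsilon>"
 proof eventually_elim
  case (elim w)
  show ?case using op_norm_le[OF elim] op_norm_nonneg[OF elim] h by (simp add: dist_real_def)
 qed
qed

lemma S1_matrix_norm_nonneg:
 assumes "sbf 1 x C" "\<And>p q. x p q \<noteq> 0 ==> fst p < n \<and> fst q < n" shows "0 \<le> S1_matrix_norm A x"
proof -
 have "s1b {..<n} {} x (S1_matrix_norm A x)" by (rule S1_matrix_norm_ge[OF assms(1), where n = n]) (use assms(2) in auto)
 from this[unfolded s1b_def, rule_format, of "%i j. 0" "%i j. 0" "%p q. 0"]
 show ?thesis by (simp add: hs_def contr_def sq_def tr_def)
qed

text \<open>Cauchy's estimate for the scalar functions \<open>u \<mapsto> Tr (F(u) v)\<close>, uniformly in the test matrix \<open>v\<close>.\<close>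

lemma difference_quotient_sbf:
 assumes e: "\<And>p q. ebs (%z. F z p q)" and b: "\<And>z. z \<in> strip ==> sbf 0 (F z) B"
  and r: "0 < \<rho>" "ball z (2 * \<rho>) \<subseteq> strip" and w: "w \<in> ball z \<rho>"
 shows "sbf 0 (%p q. if w = z then deriv (%u. F u p q) z else (F w p q - F z p q) / (w - z)) (B / \<rho>)"
 unfolding sbf_def sb_def
proof (intro allI impI)
 fix K :: "'a set" and v assume K: "finite K" "sball K (1 - 0) v"
 define g where "g = (%u. tr K (F u) v)"
 have hol: "(%u. F u p q) holomorphic_on UNIV" for p q using e by (simp add: ebs_def)
 have gh: "g holomorphic_on UNIV" unfolding g_def tr_def by (intro holomorphic_intros hol)
 have gB: "cmod (g u) \<le> B" if "u \<in> ball z (2 * \<rho>)" for u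
  using b[of u] that r(2) K unfolding g_def sbf_def sb_def by blast
 have dB: "cmod (deriv g u) \<le> B / \<rho>" if u: "u \<in> ball z \<rho>" for u
 proof -
  have "cmod ((deriv ^^ 1) g u) \<le> fact 1 * B / \<rho> ^ 1"
  proof (rule Cauchy_inequality[OF _ _ r(1)])
   show "g holomorphic_on ball u \<rho>" by (rule holomorphic_on_subset[OF gh]) simp
   show "continuous_on (cball u \<rho>) g" by (rule holomorphic_on_imp_continuous_on[OF holomorphic_on_subset[OF gh]]) simp
   fix x assume "cmod (u - x) = \<rho>"
   hence "x \<in> ball z (2 * \<rho>)" using u dist_triangle[of z x u] by (simp add: dist_norm)
   thus "cmod (g x) \<le> B" by (rule gB)
  qed
  thus ?thesis by simp
 qed
 show "cmod (tr K (%p q. if w = z then deriv (%u. F u p q) z else (F w p q - F z p q) / (w - z)) v) \<le> B / \<rho>"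
 proof (cases "w = z")
  case True
  have "((%u. \<Sum>i\<in>K. \<Sum>j\<in>K. F u i j * v j i) has_field_derivative (\<Sum>i\<in>K. \<Sum>j\<in>K. deriv (%u. F u i j) z * v j i)) (at z)"
   by (intro DERIV_sum DERIV_cmult_right holomorphic_derivI[OF hol]) auto
  hence "deriv g z = tr K (%p q. deriv (%u. F u p q) z) v" unfolding g_def tr_def by (rule DERIV_imp_deriv)
  thus ?thesis using True dB[of z] r by simp
 next
  case False
  have "cmod (g w - g z) \<le> (B / \<rho>) * cmod (w - z)"
  proof (rule field_differentiable_bound[OF convex_ball _ dB w])
   fix u
   show "(g has_field_derivative deriv g u) (at u within ball z \<rho>)" by (rule holomorphic_derivI[OF gh]) auto
  qed (use r in auto)
  moreover have "tr K (%p q. if w = z then deriv (%u. F u p q) z else (F w p q - F z p q) / (w - z)) v = (g w - g z) / (w - z)"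
   using False by (simp add: g_def tr_def left_diff_distrib diff_divide_distrib sum_subtractf sum_divide_distrib)
  ultimately show ?thesis using False by (simp add: norm_divide divide_le_eq)
 qed
qed

text \<open>Continuity and differentiability in norm hold for each summand since its entries are finitely many scalar functions.
 The difference quotients have a summable majorant, so that \<open>series_continuous\<close> gives the derivative, too.\<close>

lemma interp_series:
 fixes F :: "nat => complex => (nat \<times> 'k) cmat"
 assumes e: "\<And>m p q. ebs (%z. F m z p q)"
  and J: "\<And>m. finite (J m)" "\<And>m. J m \<subseteq> {..<n} \<times> UNIV"
  and sup: "\<And>m z p q. F m z p q \<noteq> 0 ==> p \<in> J m \<and> q \<in> J m"
  and B: "\<And>m z. z \<in> strip ==> sbf 0 (F m z) (B m)" "summable B"
  and D: "\<And>m z. Re z = 1 ==> sbf 1 (F m z) (D m)" "summable D"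
 shows "(%z p q. \<Sum>m. F m z p q) \<in> interp_functions UNIV n"
proof -
 define S where "S = (%z p q. \<Sum>m. F m z p q)"
 have supS: "supported_on ({..<n} \<times> UNIV) (%p q. \<Sum>m. X m p q)" if "\<And>m p q. X m p q \<noteq> 0 ==> p \<in> J m \<and> q \<in> J m" for X :: "nat => (nat \<times> 'k) cmat"
 proof -
  have "X m p q = 0" if "\<not> (p \<in> {..<n} \<times> UNIV \<and> q \<in> {..<n} \<times> UNIV)" for m p q
   using \<open>\<And>m p q. X m p q \<noteq> 0 ==> p \<in> J m \<and> q \<in> J m\<close>[of m p q] J(2)[of m] that by blast
  hence "(\<Sum>m. X m p q) = 0" if "\<not> (p \<in> {..<n} \<times> UNIV \<and> q \<in> {..<n} \<times> UNIV)" for p q using that by simp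
  thus ?thesis unfolding supported_on_def by blast
 qed
 have cpt: "(%p q. \<Sum>m. X m p q) \<in> compact_ops ({..<n} \<times> UNIV)"
  if "\<And>m p q. X m p q \<noteq> 0 ==> p \<in> J m \<and> q \<in> J m" "\<And>m. sbf 0 (X m) (b m)" "summable b" for X :: "nat => (nat \<times> 'k) cmat" and b
  unfolding compact_ops_iff using supS[OF that(1)] sapp_suminf[OF that(2) sapp_finite[OF J(1) that(1)] that(3)] by simp
 have sumF: "summable (%m. F m z p q)" if "z \<in> strip" for z p q by (rule sbf_summable[OF B(1)[OF that] B(2)])
 have Sb: "sbf 0 (S z) (suminf B)" if "z \<in> strip" for z unfolding S_def by (rule sbf_suminf[OF B(1)[OF that] B(2)])
 have S1b: "sbf 1 (S z) (suminf D)" if "Re z = 1" for z unfolding S_def by (rule sbf_suminf[OF D(1)[OF that] D(2)])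
 have cF: "((%w. F m w p q) \<longlongrightarrow> F m z p q) (at z within T)" for m p q z T
 proof -
  have "isCont (%w. F m w p q) z" using e[of m p q] unfolding ebs_def
   by (meson holomorphic_on_imp_continuous_on continuous_on_eq_continuous_at open_UNIV UNIV_I)
  thus ?thesis unfolding isCont_def by (rule tendsto_within_subset) simp
 qed
 have d: "(X :: (nat \<times> 'k) cmat) - Y = (%p q. X p q - Y p q)" for X Y by (simp add: fun_eq_iff)
 have 3: "((%w. op_norm (S w - S z)) \<longlongrightarrow> 0) (at z within strip)" if z: "z \<in> strip" for z
  unfolding d S_def
  by (intro op_norm_tendsto_0 series_continuous[OF _ B(1) B(2) J(1) sup cF z]) auto
 have 4: "\<exists>E\<in>compact_ops ({..<n} \<times> UNIV). ((%w. op_norm (%i j. (S w i j - S z i j) / (w - z) - E i j)) \<longlongrightarrow> 0) (at z)"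
  if "z \<in> interior strip" for z
 proof -
  obtain r where r: "0 < r" "ball z r \<subseteq> strip" using \<open>z \<in> interior strip\<close> by (auto simp: mem_interior)
  define \<rho> where "\<rho> = r / 2"
  have \<rho>: "0 < \<rho>" "ball z (2 * \<rho>) \<subseteq> strip" using r by (auto simp: \<rho>_def)
  have br: "ball z \<rho> \<subseteq> strip" using \<rho> by (auto intro: subset_ball)
  have zs: "z \<in> strip" using br \<rho> by auto
  define H where "H = (%m w p q. if w = z then deriv (%u. F m u p q) z else (F m w p q - F m z p q) / (w - z))"
  have Hb: "sbf 0 (H m w) (B m / \<rho>)" if "w \<in> ball z \<rho>" for m w
   unfolding H_def by (rule difference_quotient_sbf[OF e B(1) \<rho> that])
  have Bs: "summable (%m. B m / \<rho>)" using B(2) by (rule summable_divide)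
  have Hs: "p \<in> J m \<and> q \<in> J m" if "H m w p q \<noteq> 0" for m w p q
  proof (rule ccontr)
   assume n: "\<not> (p \<in> J m \<and> q \<in> J m)"
   hence "(%u. F m u p q) = (%u. 0)" using sup[of m _ p q] by (auto simp: fun_eq_iff)
   thus False using that by (auto simp: H_def fun_eq_iff split: if_splits)
  qed
  have Hc: "((%w. H m w p q) \<longlongrightarrow> H m z p q) (at z within ball z \<rho>)" for m p q
  proof -
   have "((%u. F m u p q) has_field_derivative deriv (%u. F m u p q) z) (at z within ball z \<rho>)"
    by (rule holomorphic_derivI[of _ UNIV]) (use e[of m p q] in \<open>auto simp: ebs_def\<close>)
   hence "((%w. (F m w p q - F m z p q) / (w - z)) \<longlongrightarrow> H m z p q) (at z within ball z \<rho>)"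
    by (simp add: has_field_derivative_iff H_def)
   thus ?thesis by (rule Lim_transform_eventually) (simp add: eventually_at_filter H_def)
  qed
  define E where "E = (%p q. \<Sum>m. H m z p q)"
  have zb: "z \<in> ball z \<rho>" using \<rho> by simp
  have "E \<in> compact_ops ({..<n} \<times> UNIV)" unfolding E_def by (rule cpt[OF Hs Hb[OF zb] Bs])
  moreover have "((%w. op_norm (%i j. (S w i j - S z i j) / (w - z) - E i j)) \<longlongrightarrow> 0) (at z)"
  proof (rule op_norm_tendsto_0)
   fix \<epsilon> :: real assume "0 < \<epsilon>"
   hence "\<forall>\<^sub>F w in at z within ball z \<rho>. sbf 0 (%p q. (\<Sum>m. H m w p q) - (\<Sum>m. H m z p q)) \<epsilon>"
    by (intro series_continuous[OF _ Hb Bs J(1) Hs Hc zb]) auto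
   moreover have "\<forall>\<^sub>F w in at z within ball z \<rho>. w \<in> ball z \<rho> \<and> w \<noteq> z" by (simp add: eventually_at_filter)
   ultimately have "\<forall>\<^sub>F w in at z within ball z \<rho>. sbf 0 (%i j. (S w i j - S z i j) / (w - z) - E i j) \<epsilon>"
   proof eventually_elim
    case (elim w)
    hence ws: "w \<in> strip" using br by blast
    have "(S w i j - S z i j) / (w - z) = (\<Sum>m. H m w i j)" for i j
     using elim(2) suminf_divide[OF summable_diff[OF sumF[OF ws] sumF[OF zs]]] suminf_diff[OF sumF[OF ws] sumF[OF zs]]
     by (simp add: S_def H_def)
    thus ?case using elim(1) by (simp add: E_def)
   qed
   thus "\<forall>\<^sub>F w in at z. sbf 0 (%i j. (S w i j - S z i j) / (w - z) - E i j) \<epsilon>"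
    using at_within_open[OF zb open_ball] by simp
  qed
  ultimately show ?thesis by blast
 qed
 have 7: "((%s. S1_matrix_norm UNIV (S (Complex 1 s) - S (Complex 1 t))) \<longlongrightarrow> 0) (at t)" for t
 proof (rule tendstoI)
  fix \<epsilon> :: real assume "0 < \<epsilon>"
  hence h: "0 < \<epsilon>/2" "\<epsilon>/2 < \<epsilon>" by auto
  let ?T = "{z. Re z = 1}"
  have "\<forall>\<^sub>F w in at (Complex 1 t) within ?T. sbf 1 (%p q. (\<Sum>m. F m w p q) - (\<Sum>m. F m (Complex 1 t) p q)) (\<epsilon>/2)"
   by (rule series_continuous[OF _ _ D(2) J(1) sup cF _ h(1)]) (use D(1) in auto)
  moreover have "filterlim (Complex 1) (at (Complex 1 t) within ?T) (at t)"
   unfolding filterlim_at by (auto intro!: tendsto_intros simp: eventually_at_filter)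
  ultimately have "\<forall>\<^sub>F s in at t. sbf 1 (%p q. S (Complex 1 s) p q - S (Complex 1 t) p q) (\<epsilon>/2)"
   unfolding S_def by (rule eventually_compose_filterlim)
  thus "\<forall>\<^sub>F s in at t. dist (S1_matrix_norm UNIV (S (Complex 1 s) - S (Complex 1 t))) 0 < \<epsilon>"
  proof eventually_elim
   case (elim s)
   have s0: "supported_on ({..<n} \<times> UNIV) (S z)" for z unfolding S_def by (rule supS[OF sup])
   have s: "fst p < n \<and> fst q < n" if "S z p q \<noteq> 0" for z p q
    using s0[of z] that unfolding supported_on_def by (cases p, cases q) auto
   have "0 \<le> S1_matrix_norm UNIV (%p q. S (Complex 1 s) p q - S (Complex 1 t) p q)"
   proof (rule S1_matrix_norm_nonneg[OF elim])
    fix p q assume "S (Complex 1 s) p q - S (Complex 1 t) p q \<noteq> 0"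
    hence "S (Complex 1 s) p q \<noteq> 0 \<or> S (Complex 1 t) p q \<noteq> 0" by auto
    thus "fst p < n \<and> fst q < n" using s by blast
   qed
   moreover have "S1_matrix_norm UNIV (%p q. S (Complex 1 s) p q - S (Complex 1 t) p q) \<le> \<epsilon>/2"
    by (rule S1_matrix_norm_le(1)[OF elim sbf1_s1bf[OF elim] finite.emptyI]) (use h in simp)
   ultimately show ?case unfolding d using h by (simp add: dist_real_def)
  qed
 qed
 have 5: "S (Complex 1 t) \<in> schatten 1 ({..<n} \<times> UNIV)" for t
 proof -
  have "sapp 1 (S (Complex 1 t))" unfolding S_def
   by (rule sapp_suminf[OF D(1) sapp_finite[OF J(1) sup] D(2)]) auto
  moreover have "supported_on ({..<n} \<times> UNIV) (S (Complex 1 t))" unfolding S_def by (rule supS[OF sup])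
  ultimately show ?thesis by (simp add: schatten_iff)
 qed
 have D0: "0 \<le> suminf D" using sbf_nonneg[OF S1b[of 1]] by simp
 have 6: "S1_matrix_norm UNIV (S (Complex 1 t)) \<le> suminf D" for t
  by (rule S1_matrix_norm_le(1)[OF S1b sbf1_s1bf[OF S1b] finite.emptyI D0]) auto
 have 1: "S z \<in> compact_ops ({..<n} \<times> UNIV)" if "z \<in> strip" for z
  unfolding S_def by (rule cpt[OF sup B(1)[OF that] B(2)])
 have 2: "op_norm (S z) \<le> suminf B" if "z \<in> strip" for z by (rule op_norm_le[OF Sb[OF that]])
 have "S \<in> interp_functions UNIV n"
  unfolding interp_functions_def using 1 2 3 4 5 6 7 by blast
 thus ?thesis by (simp add: S_def)
qed

section \<open>The norm of the interpolation space\<close>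

lemma amp_form: "tr J (mm J (amp A) (mm J x (amp B))) W = tr J x (mm J (amp B) (mm J W (amp A)))"
 by (rule trans[OF tr_cycle4 tr_commute])

lemma s1bf_add:
 assumes "s1bf I x c" "s1bf I y d" shows "s1bf I (%p q. x p q + y p q) (c + d)"
 unfolding s1bf_def s1b_def amp_form tr_add_left
proof (intro allI impI)
 fix M and L :: "'a set" and A B W assume a: "finite M" "finite L" "I \<subseteq> M" "hs M A \<le> 1" "hs M B \<le> 1" "contr (M \<times> L) W"
 let ?W = "mm (M \<times> L) (amp B) (mm (M \<times> L) W (amp A))"
 have "cmod (tr (M \<times> L) x ?W) \<le> c" using assms(1) a unfolding s1bf_def s1b_def amp_form by simp
 moreover have "cmod (tr (M \<times> L) y ?W) \<le> d" using assms(2) a unfolding s1bf_def s1b_def amp_form by simp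
 ultimately show "cmod (tr (M \<times> L) x ?W + tr (M \<times> L) y ?W) \<le> c + d" by (rule norm_triangle_mono)
qed

text \<open>A contraction on the larger corner restricts to one on the corner that carries \<open>x\<close>.\<close>

lemma s1b_extend:
 assumes M: "finite M" and L: "finite L" "finite L'" and b: "s1b M L x c"
  and x: "\<And>p q. x p q \<noteq> 0 ==> snd p \<in> L \<and> snd q \<in> L"
 shows "s1b M L' x c"
 unfolding s1b_def
proof (intro allI impI)
 fix A B W assume h: "hs M A \<le> 1" "hs M B \<le> 1" and W: "contr (M \<times> L') W"
 have f: "finite (M \<times> L)" "finite (M \<times> L')" using M L by auto
 let ?W = "trunc (M \<times> L') W"
 have "sbf 0 ?W 1" by (rule sb_sbf_trunc[OF f(2) contr_sb[OF W]])
 hence cW: "contr (M \<times> L) ?W" using f by (intro sb_contr[where \<theta> = 0]) (simp add: sbf_def)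
 have "(\<Sum>k\<in>L'. \<Sum>l\<in>L'. x (a, k) (b, l) * W (s, l) (r, k)) = (\<Sum>k\<in>L. \<Sum>l\<in>L. x (a, k) (b, l) * ?W (s, l) (r, k))"
  if rs: "r \<in> M" "s \<in> M" for a b r s
 proof -
  have "(\<Sum>k\<in>L'. \<Sum>l\<in>L'. x (a, k) (b, l) * W (s, l) (r, k))
   = (\<Sum>k\<in>L'. if k \<in> L then (\<Sum>l\<in>L'. if l \<in> L then x (a, k) (b, l) * W (s, l) (r, k) else 0) else 0)"
  proof (intro sum.cong refl)
   fix k assume "k \<in> L'"
   have z: "x (a, k) (b, l) = 0" if "k \<notin> L \<or> l \<notin> L" for l using x[of "(a, k)" "(b, l)"] that by auto
   show "(\<Sum>l\<in>L'. x (a, k) (b, l) * W (s, l) (r, k)) =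
    (if k \<in> L then (\<Sum>l\<in>L'. if l \<in> L then x (a, k) (b, l) * W (s, l) (r, k) else 0) else 0)"
    by (auto simp: z intro!: sum.cong sum.neutral)
  qed
  also have "... = (\<Sum>k\<in>L. if k \<in> L' then (\<Sum>l\<in>L. if l \<in> L' then x (a, k) (b, l) * W (s, l) (r, k) else 0) else 0)"
   using L by (simp add: sum.inter_restrict[symmetric] Int_commute)
  also have "... = (\<Sum>k\<in>L. \<Sum>l\<in>L. x (a, k) (b, l) * ?W (s, l) (r, k))"
   using rs by (intro sum.cong refl) (auto simp: trunc_def intro!: sum.cong)
  finally show ?thesis .
 qed
 hence "tr (M \<times> L') (mm (M \<times> L') (amp A) (mm (M \<times> L') x (amp B))) W
  = tr (M \<times> L) (mm (M \<times> L) (amp A) (mm (M \<times> L) x (amp B))) ?W"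
  unfolding tr_amp_expand[OF L(1) M] tr_amp_expand[OF L(2) M] by (intro sum.cong refl) simp
 thus "cmod (tr (M \<times> L') (mm (M \<times> L') (amp A) (mm (M \<times> L') x (amp B))) W) \<le> c"
  using b h cW unfolding s1b_def by simp
qed

text \<open>Pisier's expression for the norm of \<open>M\<^sub>n(S\<^sup>p)\<close>, \<open>\<theta> = 1/p\<close>: the supremum of
 \<open>\<parallel>(a \<otimes> 1) y (b \<otimes> 1)\<parallel>\<^sub>p\<close> over the unit ball of \<open>S\<^sup>2\<^sup>p\<^sub>n\<close>.\<close>

definition mbound :: "nat => real => (nat \<times> 'k) cmat => real => bool" where
 "mbound n \<theta> y C \<longleftrightarrow> (\<forall>L a b. finite L \<longrightarrow> sball {..<n} (\<theta>/2) a \<longrightarrow> sball {..<n} (\<theta>/2) b \<longrightarrow>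
   sb ({..<n} \<times> L) \<theta> (mm ({..<n} \<times> L) (amp a) (mm ({..<n} \<times> L) y (amp b))) C)"

lemma sbf_mbound: assumes "sbf \<theta> y C" "0 \<le> \<theta>" shows "mbound n \<theta> y C"
 unfolding mbound_def
proof (intro allI impI)
 fix L :: "'a set" and a b assume L: "finite L" and ab: "sball {..<n} (\<theta>/2) a" "sball {..<n} (\<theta>/2) b"
 have "contr ({..<n} \<times> L) (amp a)" "contr ({..<n} \<times> L) (amp b)"
  using assms(2) by (intro contr_amp[OF L] sball_contr[OF ab(1)] sball_contr[OF ab(2)]; simp)+
 thus "sb ({..<n} \<times> L) \<theta> (mm ({..<n} \<times> L) (amp a) (mm ({..<n} \<times> L) y (amp b))) C"
  using assms(1) L by (intro sb_mm_left sb_mm_right) (auto simp: sbf_def)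
qed

text \<open>Replace the exponent \<open>\<theta>\<close> by \<open>z\<close> in the normal form.\<close>

lemma finite_family:
 assumes J: "finite J" and th: "0 < \<theta>" and x: "sb J \<theta> x c" "trunc J x = x"
 shows "\<exists>Z. (\<forall>p q. ebs (%z. Z z p q)) \<and> (\<forall>z. trunc J (Z z) = Z z) \<and> Z (of_real \<theta>) = x \<and> (\<forall>z\<in>strip. sbf (Re z) (Z z) c)"
proof -
 obtain \<kappa> x' where k: "0 \<le> \<kappa>" "\<kappa> \<le> c" "sball J \<theta> x'" "\<And>i j. i \<in> J ==> j \<in> J ==> x i j = of_real \<kappa> * x' i j"
  by (rule sb_sball[OF J x(1) th]) (rule that)
 obtain X where X: "\<And>i j. i \<in> J ==> j \<in> J ==> X (complex_of_real \<theta>) i j = x' i j"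
  "\<And>z. sball J (Re z) (X z)" "\<And>i j. ebs (%z. X z i j)" by (rule sball_family[OF k(3)]) (rule that)
 define Z where "Z = (%z. trunc J (%i j. of_real \<kappa> * X z i j))"
 have "ebs (%z. Z z p q)" for p q
 proof (cases "p \<in> J \<and> q \<in> J")
  case True
  have "ebs (%z. of_real \<kappa> * X z p q)" by (intro ebs_mult ebs_const X)
  thus ?thesis using True by (simp add: Z_def trunc_def)
 next
  case False
  hence "(%z. Z z p q) = (%z. 0)" by (auto simp: Z_def trunc_def)
  thus ?thesis by (simp only: ebs_const)
 qed
 moreover have "trunc J (Z z) = Z z" for z by (auto simp: Z_def trunc_def fun_eq_iff)
 moreover have "Z (of_real \<theta>) = x"
 proof -
  have "Z (of_real \<theta>) = trunc J x" using X(1) k(4) by (auto simp: Z_def trunc_def fun_eq_iff)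
  thus ?thesis using x(2) by simp
 qed
 moreover have "sbf (Re z) (Z z) c" if "z \<in> strip" for z
 proof -
  have "sb J (Re z) (%i j. of_real \<kappa> * X z i j) (cmod (of_real \<kappa>) * 1)"
   by (intro sb_mult sball_sb X) (use that in \<open>auto simp: strip_def\<close>)
  hence "sb J (Re z) (%i j. of_real \<kappa> * X z i j) c" by (rule sb_mono_const) (use k in simp)
  thus ?thesis unfolding Z_def by (rule sb_sbf_trunc[OF J])
 qed
 ultimately show ?thesis by blast
qed

lemma ebs_finite_bound:
 assumes J: "finite J" and e: "\<And>p q. ebs (%z. G z p q)" and t: "\<And>z. trunc J (G z) = G z"
 shows "\<exists>c. \<forall>z\<in>strip. \<forall>\<theta>\<le>1. sbf \<theta> (G z) c"
proof -
 have "\<forall>r. \<exists>B. \<forall>z\<in>strip. cmod (G z (fst r) (snd r)) \<le> B" using e by (simp add: ebs_def)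
 from choice[OF this] obtain B where B0: "\<forall>r. \<forall>z\<in>strip. cmod (G z (fst r) (snd r)) \<le> B r" by (elim exE) (rule that)
 have B: "cmod (G z p q) \<le> B (p, q)" if "z \<in> strip" for z p q using spec[OF B0, of "(p, q)"] that by simp
 have "sbf \<theta> (G z) (\<Sum>p\<in>J. \<Sum>q\<in>J. B (p, q))" if z: "z \<in> strip" and t1: "\<theta> \<le> 1" for z \<theta>
 proof -
  have "(\<Sum>p\<in>J. \<Sum>q\<in>J. cmod (G z p q)) \<le> (\<Sum>p\<in>J. \<Sum>q\<in>J. B (p, q))" by (intro sum_mono B z)
  thus ?thesis using sbf_mono[OF sbf_trunc_finite[OF J t1, where x = "G z"]] unfolding t by simp
 qed
 thus ?thesis by blast
qed

text \<open>Elements of small norm: the finite result for a large corner, corrected by a telescoping series of analytic families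
 of small norm.\<close>

lemma interpolation_function:
 fixes y :: "(nat \<times> 'k) cmat"
 assumes th: "0 < \<theta>" "\<theta> < 1" and y: "sapp \<theta> y" "supported_on ({..<n} \<times> UNIV) y" and bd: "mbound n \<theta> y C" and \<epsilon>: "0 < \<epsilon>"
 shows "\<exists>F\<in>interp_functions UNIV n. F (of_real \<theta>) = y \<and>
  (\<forall>t. op_norm (F (Complex 0 t)) \<le> C + \<epsilon>) \<and> (\<forall>t. S1_matrix_norm UNIV (F (Complex 1 t)) \<le> C + \<epsilon>)"
proof -
 let ?I = "{..<n}"
 \<comment> \<open>The telescoping series has total norm \<open>\<Sum> 2 \<eta> / 2\<^sup>m = 4 \<eta>\<close>; the other \<open>\<epsilon>/2\<close> is spent on the corner.\<close>
 define \<eta> where "\<eta> = \<epsilon> / 8"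
 have \<eta>: "0 < \<eta>" using \<epsilon> by (simp add: \<eta>_def)
 have "\<forall>m. \<exists>L. finite L \<and> sbf \<theta> (%p q. y p q - trunc (?I \<times> L) y p q) (\<eta> / 2 ^ m)"
 proof
  fix m
  have "0 < \<eta> / 2 ^ m / 2" using \<eta> by simp
  then obtain J where J: "finite J" "sbf \<theta> (%p q. y p q - trunc J y p q) (\<eta> / 2 ^ m / 2)"
   using y(1) unfolding sapp_def by blast
  have "sbf \<theta> (%p q. y p q - trunc (J \<union> ?I \<times> snd ` J) y p q) (2 * (\<eta> / 2 ^ m / 2))"
   by (rule sapp_superset[OF J(2)]) simp
  moreover have "trunc (J \<union> ?I \<times> snd ` J) y = trunc (?I \<times> snd ` J) y"
   using y(2) unfolding supported_on_def trunc_def fun_eq_iff by (force simp: mem_Times_iff image_iff)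
  ultimately show "\<exists>L. finite L \<and> sbf \<theta> (%p q. y p q - trunc (?I \<times> L) y p q) (\<eta> / 2 ^ m)"
   using J(1) by (intro exI[of _ "snd ` J"]) simp
 qed
 from choice[OF this]
 obtain L where L0: "\<forall>m. finite (L m) \<and> sbf \<theta> (%p q. y p q - trunc (?I \<times> L m) y p q) (\<eta> / 2 ^ m)" by (elim exE) (rule that)
 have L: "finite (L m)" "sbf \<theta> (%p q. y p q - trunc (?I \<times> L m) y p q) (\<eta> / 2 ^ m)" for m
  using spec[OF L0, of m] by blast+
 define Y where "Y = (%m. trunc (?I \<times> L m) y)"
 define K where "K = (%m. ?I \<times> (L m \<union> L (Suc m)))"
 have K: "finite (K m)" for m using L(1) by (simp add: K_def)
 define b where "b = (%m. 2 * \<eta> * (1/2) ^ m)"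
 have bs: "b sums (4 * \<eta>)" unfolding b_def using sums_mult[OF geometric_sums[of "1/2 :: real"], of "2 * \<eta>"] by simp
 have "\<forall>m. \<exists>Z. (\<forall>p q. ebs (%z. Z z p q)) \<and> (\<forall>z. trunc (K m) (Z z) = Z z) \<and> Z (of_real \<theta>) = (%p q. Y (Suc m) p q - Y m p q)
  \<and> (\<forall>z\<in>strip. sbf (Re z) (Z z) (b m))"
 proof (rule allI, rule finite_family[OF K th(1)])
  fix m
  have "sbf \<theta> (%p q. (y p q - Y m p q) - (y p q - Y (Suc m) p q)) (\<eta> / 2 ^ m + \<eta> / 2 ^ Suc m)"
   unfolding Y_def by (intro sbf_diff L)
  hence "sbf \<theta> (%p q. Y (Suc m) p q - Y m p q) (\<eta> / 2 ^ m + \<eta> / 2 ^ Suc m)" by simp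
  hence "sbf \<theta> (%p q. Y (Suc m) p q - Y m p q) (b m)"
   by (rule sbf_mono) (use \<eta> in \<open>simp add: b_def power_one_over field_simps\<close>)
  thus "sb (K m) \<theta> (%p q. Y (Suc m) p q - Y m p q) (b m)" using K by (simp add: sbf_def)
  show "trunc (K m) (%p q. Y (Suc m) p q - Y m p q) = (%p q. Y (Suc m) p q - Y m p q)"
   unfolding Y_def K_def trunc_def fun_eq_iff by auto
 qed
 from choice[OF this] obtain Z where Z0: "\<forall>m. (\<forall>p q. ebs (%z. Z m z p q)) \<and> (\<forall>z. trunc (K m) (Z m z) = Z m z)
  \<and> Z m (of_real \<theta>) = (%p q. Y (Suc m) p q - Y m p q) \<and> (\<forall>z\<in>strip. sbf (Re z) (Z m z) (b m))" by (elim exE) (rule that)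
 have Z: "\<And>p q. ebs (%z. Z m z p q)" "\<And>z. trunc (K m) (Z m z) = Z m z"
  "Z m (of_real \<theta>) = (%p q. Y (Suc m) p q - Y m p q)" "\<And>z. z \<in> strip ==> sbf (Re z) (Z m z) (b m)" for m
  using spec[OF Z0, of m] by blast+
 have e2: "0 < \<epsilon>/2" using \<epsilon> by simp
 obtain G where G: "\<And>p q. ebs (%z. G z p q)" "\<And>z. trunc (?I \<times> L 0) (G z) = G z"
  "\<And>p q. p \<in> ?I \<times> L 0 ==> q \<in> ?I \<times> L 0 ==> G (of_real \<theta>) p q = y p q"
  "\<And>z. Re z = 0 ==> sb (?I \<times> L 0) 0 (G z) (C + \<epsilon>/2)"
  "\<And>z M. Re z = 1 ==> finite M ==> ?I \<subseteq> M ==> s1b M (L 0) (G z) (C + \<epsilon>/2)"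
  by (rule interpolation_upper[OF finite_lessThan[of n] L(1)[of 0] th e2, where y = y and C = C])
    (use bd L(1) in \<open>auto simp: mbound_def\<close>)
 have J0: "finite (?I \<times> L 0)" using L(1) by simp
 obtain c where c: "\<And>z \<theta>. z \<in> strip ==> \<theta> \<le> 1 ==> sbf \<theta> (G z) c" using ebs_finite_bound[OF J0 G(1,2)] by blast
 define F where "F = case_nat G Z"
 define J where "J = case_nat (?I \<times> L 0) K"
 define B where "B = case_nat c b"
 have Bs: "summable B" using bs by (subst summable_Suc_iff[symmetric]) (simp add: B_def sums_iff)
 define S where "S = (%z p q. \<Sum>m. F m z p q)"
 have S: "S \<in> interp_functions UNIV n" unfolding S_def
 proof (rule interp_series)
  show "ebs (%z. F m z p q)" for m p q using G(1) Z(1) by (cases m) (simp_all add: F_def)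
  show "finite (J m)" for m using J0 K by (cases m) (simp_all add: J_def)
  show "J m \<subseteq> {..<n} \<times> UNIV" for m by (cases m) (auto simp: J_def K_def)
  show "p \<in> J m \<and> q \<in> J m" if "F m z p q \<noteq> 0" for m z p q
  proof -
   have "trunc (J m) (F m z) = F m z" using G(2) Z(2) by (cases m) (simp_all add: F_def J_def)
   from fun_cong[OF fun_cong[OF this], of p q] show ?thesis using that by (auto simp: trunc_def split: if_splits)
  qed
  show "sbf 0 (F m z) (B m)" if "z \<in> strip" for m z
   using c[OF that] sbf_decreasing[OF Z(4)[OF that], of 0] that by (cases m) (simp_all add: F_def B_def strip_def)
  show "sbf 1 (F m z) (B m)" if "Re z = 1" for m z
   using c[of z 1] Z(4)[of z] that by (cases m) (simp_all add: F_def B_def strip_def)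
 qed (rule Bs)+
 have split: "S z p q = G z p q + (\<Sum>k. Z k z p q)" if z: "z \<in> strip" for z p q
 proof -
  have "(%k. F (Suc k) z p q) sums (\<Sum>k. Z k z p q)"
   using sbf_summable[OF Z(4)[OF z], where p = p and q = q] bs by (simp add: F_def summable_sums sums_iff)
  from sums_unique[OF sums_Suc[OF this]] show ?thesis by (simp add: S_def F_def add.commute)
 qed
 have tail: "sbf (Re z) (%p q. \<Sum>k. Z k z p q) (4 * \<eta>)" if z: "z \<in> strip" for z
  using sbf_suminf[OF Z(4)[OF z] sums_summable[OF bs]] unfolding sums_unique[OF bs, symmetric] .
 have "S (of_real \<theta>) = y"
 proof (intro ext)
  fix p q
  have g: "G (of_real \<theta>) = Y 0"
  proof -
   have "G (of_real \<theta>) = trunc (?I \<times> L 0) (G (of_real \<theta>))" using G(2) by simp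
   also have "... = Y 0" unfolding Y_def trunc_def using G(3) by (intro ext) auto
   finally show ?thesis .
  qed
  have "(%m. Y m p q - y p q) \<longlonglongrightarrow> 0"
  proof (rule Lim_null_comparison)
   show "\<forall>\<^sub>F m in sequentially. norm (Y m p q - y p q) \<le> \<eta> * (1/2) ^ m"
    using sbf_entry[OF L(2)] by (intro always_eventually allI) (simp add: Y_def norm_minus_commute power_one_over field_simps)
   show "(%m. \<eta> * (1/2) ^ m) \<longlonglongrightarrow> 0" by (intro tendsto_mult_right_zero LIMSEQ_realpow_zero) auto
  qed
  hence "(%m. Y m p q) \<longlonglongrightarrow> y p q" by (rule LIM_zero_cancel)
  note e = sums_unique[OF telescope_sums[OF this], symmetric]
  show "S (of_real \<theta>) p q = y p q" unfolding split[OF of_real_in_strip[OF less_imp_le[OF th(1)] less_imp_le[OF th(2)]]] Z(3) g e by simp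
 qed
 moreover have "op_norm (S z) \<le> C + \<epsilon>" if "Re z = 0" for z
 proof -
  have z: "z \<in> strip" using that by (simp add: strip_def)
  have "sbf 0 (G z) (C + \<epsilon>/2)" using sb_sbf_trunc[OF J0 G(4)[OF that]] unfolding G(2) .
  from sbf_add[OF this tail[OF z, unfolded that]] have "sbf 0 (S z) (C + \<epsilon>/2 + 4 * \<eta>)"
   unfolding split[OF z, symmetric] .
  from op_norm_le[OF this] show ?thesis by (simp add: \<eta>_def)
 qed
 moreover have "S1_matrix_norm UNIV (S z) \<le> C + \<epsilon>" if "Re z = 1" for z
 proof -
  have z: "z \<in> strip" using that by (simp add: strip_def)
  have "s1b M L' (G z) (C + \<epsilon>/2)" if M: "finite M" "finite L'" "?I \<subseteq> M" for M L'
  proof (rule s1b_extend[OF M(1) L(1)[of 0] M(2) G(5)[OF \<open>Re z = 1\<close> M(1,3)]])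
   fix p q assume "G z p q \<noteq> 0"
   hence "trunc (?I \<times> L 0) (G z) p q \<noteq> 0" unfolding G(2) .
   thus "snd p \<in> L 0 \<and> snd q \<in> L 0" by (auto simp: trunc_def split: if_splits)
  qed
  hence "s1bf ?I (G z) (C + \<epsilon>/2)" by (simp add: s1bf_def)
  from s1bf_add[OF this sbf1_s1bf[OF tail[OF z, unfolded that]]] have s: "s1bf ?I (S z) (C + \<epsilon>/2 + 4 * \<eta>)"
   unfolding split[OF z, symmetric] .
  have s1: "sbf 1 (S z) (c + 4 * \<eta>)" using sbf_add[OF c[OF z order_refl] tail[OF z, unfolded that]] unfolding split[OF z, symmetric] .
  have "0 \<le> C + \<epsilon>/2 + 4 * \<eta>"
   using sb_nonneg[OF G(4)[of 0]] \<eta> by simp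
  from S1_matrix_norm_le(1)[OF s1 s finite_lessThan this, of UNIV] show ?thesis by (simp add: \<eta>_def)
 qed
 ultimately show ?thesis by (intro bexI[OF _ S] conjI allI) simp_all
qed

text \<open>Conversely the three lines theorem bounds every element of the unit ball.\<close>

lemma interpolation_function_mbound:
 assumes th: "0 < \<theta>" "\<theta> < 1" and F: "F \<in> interp_functions UNIV n"
  and c: "max (SUP t. op_norm (F (Complex 0 t))) (SUP t. S1_matrix_norm UNIV (F (Complex 1 t))) \<le> c"
 shows "mbound n \<theta> (F (of_real \<theta>)) c"
proof -
 have F1: "F z \<in> compact_ops ({..<n} \<times> UNIV)" if "z \<in> strip" for z using F that unfolding interp_functions_def by blast
 obtain C where F2: "\<And>z. z \<in> strip ==> op_norm (F z) \<le> C" using F unfolding interp_functions_def by blast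
 have F3: "((%w. op_norm (F w - F z)) \<longlongrightarrow> 0) (at z within strip)" if "z \<in> strip" for z
  using F that unfolding interp_functions_def by blast
 have F4: "\<exists>D\<in>compact_ops ({..<n} \<times> UNIV). ((%w. op_norm (%i j. (F w i j - F z i j) / (w - z) - D i j)) \<longlongrightarrow> 0) (at z)"
  if "z \<in> interior strip" for z using F that unfolding interp_functions_def by blast
 have F5: "F (Complex 1 t) \<in> schatten 1 ({..<n} \<times> UNIV)" for t using F unfolding interp_functions_def by blast
 obtain C' where F6: "\<And>t. S1_matrix_norm UNIV (F (Complex 1 t)) \<le> C'" using F unfolding interp_functions_def by blast
 have sb: "\<exists>c. sbf 0 x c" if "x \<in> compact_ops A" for x :: "(nat \<times> 'a) cmat" and A
 proof -
  have "sapp 0 x" using that by (simp add: compact_ops_iff)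
  then obtain c where "sbf 0 x c" by (rule sapp_sbf[OF _ zero_le_one]) (rule that)
  thus ?thesis by blast
 qed
 have entry: "cmod (x p q) \<le> op_norm x" if "sbf 0 x c" for x :: "(nat \<times> 'a) cmat" and c p q
  using sbf_entry[OF sbf_op_norm[OF that]] .
 have d: "(X :: (nat \<times> 'a) cmat) - Y = (%p q. X p q - Y p q)" for X Y by (simp add: fun_eq_iff)
 have sok: "sok (%z. F z p q)" for p q
  unfolding sok_def
 proof (intro conjI)
  show "continuous_on strip (%z. F z p q)"
   unfolding continuous_on_def
  proof
   fix z assume z: "z \<in> strip"
   have "((%w. F w p q - F z p q) \<longlongrightarrow> 0) (at z within strip)"
   proof (rule Lim_null_comparison[OF _ F3[OF z]])
    have "cmod (F w p q - F z p q) \<le> op_norm (F w - F z)" if "w \<in> strip" for w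
    proof -
     obtain c1 c2 where "sbf 0 (F w) c1" "sbf 0 (F z) c2" using sb[OF F1[OF \<open>w \<in> strip\<close>]] sb[OF F1[OF z]] by auto
     from entry[OF sbf_diff[OF this], of p q] show ?thesis by (simp add: d)
    qed
    thus "\<forall>\<^sub>F w in at z within strip. norm (F w p q - F z p q) \<le> op_norm (F w - F z)" by (simp add: eventually_at_filter)
   qed
   thus "((%z. F z p q) \<longlongrightarrow> F z p q) (at z within strip)" by (rule LIM_zero_cancel)
  qed
  show "(%z. F z p q) holomorphic_on interior strip"
   unfolding holomorphic_on_open[OF open_interior]
  proof
   fix z assume z: "z \<in> interior strip"
   obtain D where D: "D \<in> compact_ops ({..<n} \<times> UNIV)" "((%w. op_norm (%i j. (F w i j - F z i j) / (w - z) - D i j)) \<longlongrightarrow> 0) (at z)"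
    using F4[OF z] by blast
   have zs: "z \<in> strip" using z interior_subset by blast
   have "((%w. (F w p q - F z p q) / (w - z) - D p q) \<longlongrightarrow> 0) (at z)"
   proof (rule Lim_null_comparison[OF _ D(2)])
    have "cmod ((F w p q - F z p q) / (w - z) - D p q) \<le> op_norm (%i j. (F w i j - F z i j) / (w - z) - D i j)" if "w \<in> interior strip" for w
    proof -
     have ws: "w \<in> strip" using that interior_subset by blast
     obtain c1 c2 c3 where s: "sbf 0 (F w) c1" "sbf 0 (F z) c2" "sbf 0 D c3"
      using sb[OF F1[OF ws]] sb[OF F1[OF zs]] sb[OF D(1)] by auto
     from sbf_diff[OF sbf_mult[OF sbf_diff[OF s(1,2)], of "1 / (w - z)"] s(3)]
     have "sbf 0 (%i j. (F w i j - F z i j) / (w - z) - D i j) (cmod (1 / (w - z)) * (c1 + c2) + c3)" by simp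
     from entry[OF this, of p q] show ?thesis .
    qed
    moreover have "\<forall>\<^sub>F w in at z. w \<in> interior strip" using eventually_at_in_open'[OF open_interior z] .
    ultimately show "\<forall>\<^sub>F w in at z. norm ((F w p q - F z p q) / (w - z) - D p q) \<le> op_norm (%i j. (F w i j - F z i j) / (w - z) - D i j)"
     by (auto elim: eventually_mono)
   qed
   hence "((%w. (F w p q - F z p q) / (w - z)) \<longlongrightarrow> D p q) (at z)" by (rule LIM_zero_cancel)
   thus "\<exists>f'. ((%z. F z p q) has_field_derivative f') (at z)" unfolding has_field_derivative_iff by blast
  qed
  have "cmod (F z p q) \<le> C" if z: "z \<in> strip" for z
  proof -
   obtain c1 where "sbf 0 (F z) c1" using sb[OF F1[OF z]] by blast
   from entry[OF this, of p q] F2[OF z] show ?thesis by linarith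
  qed
  thus "\<exists>B. \<forall>z\<in>strip. cmod (F z p q) \<le> B" by blast
 qed
 have b0: "sbf 0 (F z) c" if "Re z = 0" for z
 proof -
  have z: "z \<in> strip" "z = Complex 0 (Im z)" using that by (simp_all add: strip_def complex_eq_iff)
  obtain c1 where s: "sbf 0 (F z) c1" using sb[OF F1[OF z(1)]] by blast
  have "op_norm (F (Complex 0 (Im z))) \<le> (SUP t. op_norm (F (Complex 0 t)))"
   by (rule cSUP_upper) (auto intro!: bdd_aboveI2[of _ _ C] F2 simp: strip_def)
  hence "op_norm (F z) \<le> c" using c z(2) by simp
  thus ?thesis using sbf_op_norm[OF s] by (rule sbf_mono[rotated])
 qed
 have b1: "s1b {..<n} L (F z) c" if "Re z = 1" "finite L" for z L
 proof -
  have z: "z \<in> strip" "z = Complex 1 (Im z)" using that by (simp_all add: strip_def complex_eq_iff)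
  have sc: "F z \<in> schatten 1 ({..<n} \<times> UNIV)" using F5[of "Im z"] z(2) by simp
  have "sapp 1 (F z)" using sc by (simp add: schatten_iff)
  then obtain c1 where s: "sbf 1 (F z) c1" by (rule sapp_sbf[OF _ order_refl]) (rule that)
  have "s1b {..<n} L (F z) (S1_matrix_norm UNIV (F z))"
  proof (rule S1_matrix_norm_ge[OF s _ order_refl])
   fix p q assume "F z p q \<noteq> 0"
   thus "fst p \<in> {..<n} \<and> fst q \<in> {..<n}" using sc unfolding schatten_def supported_on_def by (cases p, cases q) auto
  qed (use that in auto)
  moreover have "S1_matrix_norm UNIV (F (Complex 1 (Im z))) \<le> (SUP t. S1_matrix_norm UNIV (F (Complex 1 t)))"
   by (rule cSUP_upper[OF UNIV_I]) (rule bdd_aboveI2[OF F6])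
  hence "S1_matrix_norm UNIV (F z) \<le> c" using c z(2) by simp
  ultimately show ?thesis unfolding s1b_def by (meson order_trans)
 qed
 show ?thesis
  unfolding mbound_def
 proof (intro allI impI)
  fix L :: "'a set" and a b assume L: "finite L" and ab: "sball {..<n} (\<theta>/2) a" "sball {..<n} (\<theta>/2) b"
  show "sb ({..<n} \<times> L) \<theta> (mm ({..<n} \<times> L) (amp a) (mm ({..<n} \<times> L) (F (of_real \<theta>)) (amp b))) c"
   by (rule interpolation_lower[OF finite_lessThan L th sok _ b1[OF _ L] ab]) (use b0 L in \<open>auto simp: sbf_def\<close>)
 qed
qed

lemma Sp_value_nonneg:
 assumes F: "F \<in> interp_functions UNIV n"
 shows "0 \<le> max (SUP t. op_norm (F (Complex 0 t))) (SUP t. S1_matrix_norm UNIV (F (Complex 1 t)))"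
proof -
 have "mbound n (1/2) (F (of_real (1/2))) (max (SUP t. op_norm (F (Complex 0 t))) (SUP t. S1_matrix_norm UNIV (F (Complex 1 t))))"
  by (rule interpolation_function_mbound[OF _ _ F order_refl]) auto
 hence "sb ({..<n} \<times> {}) (1/2) (mm ({..<n} \<times> {}) (amp (%i j. 0)) (mm ({..<n} \<times> {}) (F (of_real (1/2))) (amp (%i j. 0))))
  (max (SUP t. op_norm (F (Complex 0 t))) (SUP t. S1_matrix_norm UNIV (F (Complex 1 t))))"
  unfolding mbound_def using sball_0 by blast
 thus ?thesis by (rule sb_nonneg)
qed

lemma Sp_matrix_norm_le:
 fixes y :: "(nat \<times> 'k) cmat"
 assumes p: "1 < p" and y: "y \<in> schatten p ({..<n} \<times> UNIV)" and bd: "mbound n (1/p) y C"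
 shows "Sp_matrix_norm p UNIV n y \<le> C"
proof (rule field_le_epsilon)
 fix \<epsilon> :: real assume e: "0 < \<epsilon>"
 have th: "0 < 1/p" "1/p < 1" using p by simp_all
 obtain F where F: "F \<in> interp_functions UNIV n" "F (of_real (1/p)) = y"
  "\<And>t. op_norm (F (Complex 0 t)) \<le> C + \<epsilon>" "\<And>t. S1_matrix_norm UNIV (F (Complex 1 t)) \<le> C + \<epsilon>"
  using interpolation_function[OF th _ _ bd e] y p by (auto simp: schatten_iff)
 have "Sp_matrix_norm p UNIV n y \<le> max (SUP t. op_norm (F (Complex 0 t))) (SUP t. S1_matrix_norm UNIV (F (Complex 1 t)))"
  unfolding Sp_matrix_norm_def
  by (rule cInf_lower) (use F(1,2) in \<open>auto intro!: bdd_belowI[of _ 0] Sp_value_nonneg\<close>)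
 also have "... \<le> C + \<epsilon>" by (intro max.boundedI cSUP_least F) auto
 finally show "Sp_matrix_norm p UNIV n y \<le> C + \<epsilon>" .
qed

lemma Sp_matrix_norm_mbound:
 fixes y :: "(nat \<times> 'k) cmat"
 assumes p: "1 < p" and y: "y \<in> schatten p ({..<n} \<times> UNIV)" and c: "Sp_matrix_norm p UNIV n y < c"
 shows "mbound n (1/p) y c"
proof -
 have th: "0 < 1/p" "1/p < 1" using p by simp_all
 let ?V = "{max (SUP t. op_norm (F (Complex 0 t))) (SUP t. S1_matrix_norm UNIV (F (Complex 1 t))) | F.
     F \<in> interp_functions UNIV n \<and> F (complex_of_real (1 / p)) = y}"
 have sa: "sapp (1/p) y" "supported_on ({..<n} \<times> UNIV) y" using y p by (simp_all add: schatten_iff)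
 obtain C where "sbf (1/p) y C" by (rule sapp_sbf[OF sa(1) less_imp_le[OF th(2)]])
 hence "mbound n (1/p) y C" by (rule sbf_mbound) (use th in simp)
 from interpolation_function[OF th sa this zero_less_one]
 obtain F where "F \<in> interp_functions UNIV n" "F (of_real (1/p)) = y" by blast
 hence "?V \<noteq> {}" by blast
 have "Inf ?V < c" using c by (simp add: Sp_matrix_norm_def)
 from cInf_lessD[OF \<open>?V \<noteq> {}\<close> this] obtain F where F: "F \<in> interp_functions UNIV n" "F (complex_of_real (1 / p)) = y"
  "max (SUP t. op_norm (F (Complex 0 t))) (SUP t. S1_matrix_norm UNIV (F (Complex 1 t))) \<le> c"
  by (auto simp: less_imp_le)
 show ?thesis using interpolation_function_mbound[OF th F(1,3)] F(2) by simp
qed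

section \<open>Triangular Schur multipliers are completely bounded\<close>

text \<open>The Schur multiplier with symbol \<open>\<alpha> + \<beta> + \<gamma>\<close> above, \<open>\<alpha> + \<gamma>\<close> on and \<open>\<gamma>\<close> below the diagonal. It is built from two
 truncations, whose norms are controlled together.\<close>

definition gmul :: "complex => complex => complex => ('i => nat) => 'i cmat => 'i cmat" where
 "gmul \<alpha> \<beta> \<gamma> \<phi> x = (%p q. \<alpha> * trunc_rel (\<le>) \<phi> x p q + \<beta> * trunc_rel (<) \<phi> x p q + \<gamma> * x p q)"

definition gmul_bound :: "complex => complex => complex => real => real" where
 "gmul_bound \<alpha> \<beta> \<gamma> C = cmod \<alpha> * C + cmod \<beta> * C + cmod \<gamma>"

lemma gmul_sb:
 assumes "tri_bound J \<phi> \<theta> C" "sb J \<theta> x c" shows "sb J \<theta> (gmul \<alpha> \<beta> \<gamma> \<phi> x) (gmul_bound \<alpha> \<beta> \<gamma> C * c)"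
proof -
 have "sb J \<theta> (gmul \<alpha> \<beta> \<gamma> \<phi> x) (cmod \<alpha> * (C * c) + cmod \<beta> * (C * c) + cmod \<gamma> * c)"
  unfolding gmul_def by (intro sb_add sb_mult tri_boundD[OF assms(1) _ assms(2)] assms(2)) auto
 thus ?thesis by (simp add: gmul_bound_def algebra_simps)
qed

lemma gmul_diff: "gmul \<alpha> \<beta> \<gamma> \<phi> (%p q. x p q - y p q) = (%p q. gmul \<alpha> \<beta> \<gamma> \<phi> x p q - gmul \<alpha> \<beta> \<gamma> \<phi> y p q)"
 by (auto simp: gmul_def trunc_rel_def fun_eq_iff algebra_simps)

lemma gmul_trunc: "gmul \<alpha> \<beta> \<gamma> \<phi> (trunc J x) = trunc J (gmul \<alpha> \<beta> \<gamma> \<phi> x)"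
 by (auto simp: gmul_def trunc_rel_def trunc_def fun_eq_iff)

text \<open>The multiplier commutes with truncation to corners, so it preserves norm limits of finite matrices.\<close>

lemma gmul_schatten:
 assumes C: "\<And>J. finite J ==> tri_bound J \<phi> (1/p) C" "0 \<le> C" and p: "1 < p" and x: "x \<in> schatten p A"
 shows "gmul \<alpha> \<beta> \<gamma> \<phi> x \<in> schatten p A"
proof -
 define D where "D = gmul_bound \<alpha> \<beta> \<gamma> C"
 have D: "0 \<le> D" using C(2) by (simp add: D_def gmul_bound_def)
 have x': "supported_on A x" "sapp (1/p) x" using x p by (simp_all add: schatten_iff)
 have "sapp (1/p) (gmul \<alpha> \<beta> \<gamma> \<phi> x)" unfolding sapp_def
 proof (intro allI impI)
  fix \<epsilon> :: real assume e: "0 < \<epsilon>"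
  hence "0 < \<epsilon> / (D + 1)" using D by simp
  then obtain J where J: "finite J" "sbf (1/p) (%p q. x p q - trunc J x p q) (\<epsilon> / (D + 1))"
   using x'(2) unfolding sapp_def by blast
  have "sbf (1/p) (gmul \<alpha> \<beta> \<gamma> \<phi> (%p q. x p q - trunc J x p q)) (D * (\<epsilon> / (D + 1)))"
   using J(2) gmul_sb[OF C(1)] unfolding sbf_def D_def by blast
  hence "sbf (1/p) (%p q. gmul \<alpha> \<beta> \<gamma> \<phi> x p q - trunc J (gmul \<alpha> \<beta> \<gamma> \<phi> x) p q) (D * (\<epsilon> / (D + 1)))"
   unfolding gmul_diff gmul_trunc .
  hence "sbf (1/p) (%p q. gmul \<alpha> \<beta> \<gamma> \<phi> x p q - trunc J (gmul \<alpha> \<beta> \<gamma> \<phi> x) p q) \<epsilon>"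
   by (rule sbf_mono) (use D e in \<open>simp add: field_simps\<close>)
  thus "\<exists>J. finite J \<and> sbf (1/p) (%i j. gmul \<alpha> \<beta> \<gamma> \<phi> x i j - trunc J (gmul \<alpha> \<beta> \<gamma> \<phi> x) i j) \<epsilon>"
   using J(1) by blast
 qed
 moreover have "supported_on A (gmul \<alpha> \<beta> \<gamma> \<phi> x)"
  unfolding supported_on_def
 proof (intro allI impI)
  fix i j assume "gmul \<alpha> \<beta> \<gamma> \<phi> x i j \<noteq> 0"
  hence "x i j \<noteq> 0" by (intro notI) (simp add: gmul_def trunc_rel_def cong: if_cong)
  thus "i \<in> A \<and> j \<in> A" using x'(1) unfolding supported_on_def by blast
 qed
 ultimately show ?thesis using p by (simp add: schatten_iff)
qed

text \<open>Multiplication by \<open>a \<otimes> 1\<close> does not see the second coordinate, so it commutes with the truncation graded by it.\<close>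

lemma trunc_rel_amp_left: "trunc_rel R snd (mm J (amp a) y) = mm J (amp a) (trunc_rel R snd y)"
 unfolding trunc_rel_def mm_def fun_eq_iff by (auto simp: amp_def intro!: sum.cong sum.neutral)

lemma trunc_rel_amp_right: "trunc_rel R snd (mm J y (amp a)) = mm J (trunc_rel R snd y) (amp a)"
 unfolding trunc_rel_def mm_def fun_eq_iff by (auto simp: amp_def intro!: sum.cong sum.neutral)

lemma gmul_amp:
 "gmul \<alpha> \<beta> \<gamma> snd (mm J (amp a) (mm J x (amp b))) = mm J (amp a) (mm J (gmul \<alpha> \<beta> \<gamma> snd x) (amp b))"
proof -
 have "mm J (amp a) (mm J (gmul \<alpha> \<beta> \<gamma> snd x) (amp b)) = (%p q. \<alpha> * mm J (amp a) (mm J (trunc_rel (\<le>) snd x) (amp b)) p q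
  + \<beta> * mm J (amp a) (mm J (trunc_rel (<) snd x) (amp b)) p q + \<gamma> * mm J (amp a) (mm J x (amp b)) p q)"
  unfolding gmul_def mm_def by (simp add: algebra_simps sum.distrib sum_distrib_left)
 thus ?thesis by (simp add: gmul_def trunc_rel_amp_left trunc_rel_amp_right)
qed

lemma gmul_mbound:
 assumes C: "\<And>J :: (nat \<times> nat) set. finite J ==> tri_bound J snd \<theta> C" and b: "mbound n \<theta> x c"
 shows "mbound n \<theta> (gmul \<alpha> \<beta> \<gamma> snd x) (gmul_bound \<alpha> \<beta> \<gamma> C * c)"
 unfolding mbound_def gmul_amp[symmetric]
 using b unfolding mbound_def by (auto intro!: gmul_sb C finite_cartesian_product)

lemma amplify_gmul: "amplify (gmul \<alpha> \<beta> \<gamma> id) X = gmul \<alpha> \<beta> \<gamma> snd X"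
 by (auto simp: amplify_def gmul_def block_def trunc_rel_def fun_eq_iff)

lemma tri_bound_exists:
 assumes "0 < \<theta>" "\<theta> < 1"
 obtains C where "0 \<le> C" "\<And>(J :: 'i set) \<phi>. finite J ==> tri_bound J \<phi> \<theta> C"
proof -
 from triangular_truncation_bounded[OF assms] obtain C where C: "\<forall>(J :: 'i set) \<phi>. finite J \<longrightarrow> tri_bound J \<phi> \<theta> C" by (elim exE)
 have "tri_bound J \<phi> \<theta> \<bar>C\<bar>" if "finite J" for J :: "'i set" and \<phi>
  unfolding tri_bound_def
 proof (intro ballI allI impI)
  fix R x c assume R: "R \<in> {(\<le>), (<) :: nat => nat => bool}" and x: "sb J \<theta> x c"
  have "tri_bound J \<phi> \<theta> C" using C that by simp
  from tri_boundD[OF this R x] show "sb J \<theta> (trunc_rel R \<phi> x) (\<bar>C\<bar> * c)"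
   by (rule sb_mono_const) (intro mult_right_mono sb_nonneg[OF x] abs_ge_self)
 qed
 thus thesis by (intro that[of "\<bar>C\<bar>"]) auto
qed

lemma gmul_completely_bounded:
 assumes p: "1 < p" shows "completely_bounded p (gmul \<alpha> \<beta> \<gamma> (id :: nat => nat))"
proof -
 have th: "0 < 1/p" "1/p < 1" using p by simp_all
 obtain C where C: "0 \<le> C" "\<And>(J :: nat set) \<phi>. finite J ==> tri_bound J \<phi> (1/p) C" by (rule tri_bound_exists[OF th]) (rule that)
 obtain C' where C': "0 \<le> C'" "\<And>(J :: (nat \<times> nat) set) \<phi>. finite J ==> tri_bound J \<phi> (1/p) C'" by (rule tri_bound_exists[OF th]) (rule that)
 let ?T = "gmul \<alpha> \<beta> \<gamma> (id :: nat => nat)"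
 have "linear_on_schatten p UNIV ?T"
  unfolding linear_on_schatten_def
 proof (intro conjI ballI allI)
  fix x y :: "nat cmat" and c assume x: "x \<in> schatten p UNIV"
  show "?T x \<in> schatten p UNIV" by (rule gmul_schatten[OF C(2,1) p x])
  show "?T (%i j. x i j + y i j) = (%i j. ?T x i j + ?T y i j)"
   "?T (%i j. c * x i j) = (%i j. c * ?T x i j)"
   by (auto simp: gmul_def trunc_rel_def fun_eq_iff algebra_simps)
 qed
 moreover have "cb_norm p ?T \<le> ennreal (gmul_bound \<alpha> \<beta> \<gamma> C' * 2)"
  unfolding cb_norm_def
 proof (intro SUP_least)
  fix n and x :: "(nat \<times> nat) cmat" assume "x \<in> {x \<in> schatten p ({..<n} \<times> UNIV). Sp_matrix_norm p UNIV n x \<le> 1}"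
  hence x: "x \<in> schatten p ({..<n} \<times> UNIV)" "Sp_matrix_norm p UNIV n x < 2" by auto
  have "Sp_matrix_norm p UNIV n (gmul \<alpha> \<beta> \<gamma> snd x) \<le> gmul_bound \<alpha> \<beta> \<gamma> C' * 2"
   by (rule Sp_matrix_norm_le[OF p gmul_schatten[OF C'(2,1) p x(1)] gmul_mbound[OF C'(2) Sp_matrix_norm_mbound[OF p x]]])
  thus "ennreal (Sp_matrix_norm p UNIV n (amplify ?T x)) \<le> ennreal (gmul_bound \<alpha> \<beta> \<gamma> C' * 2)"
   unfolding amplify_gmul by (rule ennreal_leI)
 qed
 hence "cb_norm p ?T < \<infinity>" using le_less_trans ennreal_less_top by (metis infinity_ennreal_def)
 ultimately show ?thesis by (simp add: completely_bounded_def)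
qed

lemma triangular_truncation_gmul: "triangular_truncation = gmul 1 0 0 id"
 by (auto simp: triangular_truncation_def gmul_def trunc_rel_def fun_eq_iff)

lemma discrete_Hilbert_transform_gmul: "discrete_Hilbert_transform = gmul (-\<i>) (-\<i>) \<i> id"
 by (auto simp: discrete_Hilbert_transform_def gmul_def trunc_rel_def fun_eq_iff)

section \<open>Distance to the decomposable maps\<close>

definition unit :: "'i => 'i => 'i cmat" where
 "unit i j = (%k l. if k = i \<and> l = j then 1 else 0)"

text \<open>\<open>y\<close> as a \<open>1 \<times> 1\<close> matrix over \<open>S\<^sup>p\<close>\<close>

definition corner :: "'i cmat => (nat \<times> 'i) cmat" where
 "corner y = (%(a, i) (b, j). if a = 0 \<and> b = 0 then y i j else 0)"

lemma delta_ell2: "(%k. if k = i then 1 else 0) \<in> ell2" "ell2_norm (%k. if k = i then 1 else 0) = 1"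
proof -
 have e: "(%k. if k = i then 1 else 0 :: complex) \<in> ell2" "(ell2_norm (%k. if k = i then 1 else 0 :: complex))\<^sup>2 = sq {i} (%k. if k = i then 1 else 0)"
  by (rule ell2_finite_support[of "{i}"]; simp)+
 show "(%k. if k = i then 1 else 0 :: complex) \<in> ell2" by (rule e)
 show "ell2_norm (%k. if k = i then 1 else 0 :: complex) = 1"
  using e(2) ell2_norm_nonneg[of "%k. if k = i then 1 else 0 :: complex"] by (simp add: sq_def power2_eq_1_iff)
qed

lemma unit_rank_one: "unit i j = (%k l. (if k = i then 1 else 0) * cnj (if l = j then 1 else 0))"
 by (auto simp: unit_def fun_eq_iff)

lemma sbf_unit: "0 \<le> \<theta> ==> \<theta> \<le> 1 ==> sbf \<theta> (unit i j) 1"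
 using sbf_rank_one[OF delta_ell2(1)[of i] delta_ell2(1)[of j], of \<theta>] unfolding unit_rank_one delta_ell2(2) by simp

lemma unit_schatten: "1 \<le> p ==> i \<in> A ==> j \<in> A ==> unit i j \<in> schatten p A"
 unfolding schatten_iff by (auto simp: supported_on_def unit_def intro!: sapp_finite[of "{i, j}"] split: if_splits)

lemma sbf_corner:
 assumes "sbf \<theta> y c" shows "sbf \<theta> (corner y) c"
 unfolding sbf_def sb_def
proof (intro allI impI)
 fix J :: "(nat \<times> 'a) set" and w assume J: "finite J" and w: "sball J (1-\<theta>) w"
 define J' where "J' = {i. (0, i) \<in> J}"
 have im: "(%i. (0, i)) ` J' \<subseteq> J" by (auto simp: J'_def)
 have J': "finite J'" by (rule finite_subset[of _ "snd ` J"]) (use J in \<open>force simp: J'_def\<close>)+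
 obtain K \<rho> e f where "dyadic J (1 - \<theta>) w K \<rho> e f" using w unfolding sball_def by blast
 note D = dyadicD[OF this]
 have bs: "bessel J' K (%k i. g k (0, i))" if "bessel J K g" for g
  unfolding bessel_iff_synthesis
 proof
  fix c
  have "sq J' (%i. \<Sum>k\<in>K. c k * g k (0, i)) = sq ((%i. (0, i)) ` J') (%p. \<Sum>k\<in>K. c k * g k p)"
   unfolding sq_def by (subst sum.reindex) (auto simp: inj_on_def)
  also have "... \<le> sq J (%p. \<Sum>k\<in>K. c k * g k p)" by (rule sq_mono[OF J im])
  also have "... \<le> (\<Sum>k\<in>K. (cmod (c k))\<^sup>2)" using that by (simp add: bessel_synthesis)
  finally show "sq J' (%i. \<Sum>k\<in>K. c k * g k (0, i)) \<le> (\<Sum>k\<in>K. (cmod (c k))\<^sup>2)" .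
 qed
 have w': "sball J' (1-\<theta>) (%i j. w (0, i) (0, j))"
  by (rule sballI[OF D(1-3) bs[OF D(4)] bs[OF D(5)]]) (use D(6) in \<open>auto simp: J'_def\<close>)
 have s: "(\<Sum>p\<in>J. f p) = (\<Sum>i\<in>J'. f (0, i))" if "\<And>p. fst p \<noteq> 0 ==> f p = 0" for f :: "nat \<times> 'a => complex"
 proof -
  have "(\<Sum>p\<in>J. f p) = (\<Sum>p\<in>(%i. (0, i)) ` J'. f p)"
  proof (rule sum.mono_neutral_right[OF J im], rule ballI, rule that)
   fix p assume "p \<in> J - (%i. (0, i)) ` J'"
   thus "fst p \<noteq> 0" by (cases p) (auto simp: J'_def)
  qed
  thus ?thesis by (simp add: sum.reindex inj_on_def)
 qed
 have "tr J (corner y) w = tr J' y (%i j. w (0, i) (0, j))"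
  unfolding tr_def by (subst s, simp add: corner_def case_prod_beta, intro sum.cong refl, subst s) (simp_all add: corner_def case_prod_beta)
 thus "cmod (tr J (corner y) w) \<le> c" using assms J' w' unfolding sbf_def sb_def by simp
qed

lemma corner_schatten:
 assumes p: "1 \<le> p" and y: "y \<in> schatten p UNIV" shows "corner y \<in> schatten p ({..<1} \<times> UNIV)"
proof -
 have y': "sapp (1/p) y" using y p by (simp add: schatten_iff)
 have "sapp (1/p) (corner y)" unfolding sapp_def
 proof (intro allI impI)
  fix \<epsilon> :: real assume "0 < \<epsilon>"
  then obtain J where J: "finite J" "sbf (1/p) (%i j. y i j - trunc J y i j) \<epsilon>" using y' unfolding sapp_def by blast
  have "corner (%i j. y i j - trunc J y i j) = (%p q. corner y p q - trunc ({0} \<times> J) (corner y) p q)"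
   by (auto simp: corner_def trunc_def fun_eq_iff)
  thus "\<exists>J. finite J \<and> sbf (1/p) (%i j. corner y i j - trunc J (corner y) i j) \<epsilon>"
   using sbf_corner[OF J(2)] J(1) by (intro exI[of _ "{0} \<times> J"]) simp
 qed
 moreover have "supported_on ({..<1} \<times> UNIV) (corner y)" by (auto simp: supported_on_def corner_def split: if_splits)
 ultimately show ?thesis using p by (simp add: schatten_iff)
qed

lemma mbound_corner_entry:
 fixes Y :: "(nat \<times> 'k) cmat"
 assumes th: "0 < \<theta>" "\<theta> < 1" and Y: "mbound 1 \<theta> Y c" shows "cmod (Y (0, i) (0, j)) \<le> c"
proof -
 let ?J = "{..<1::nat} \<times> {i, j}" and ?u = "%a b. (if a = 0 then 1 else 0) * cnj (if b = (0::nat) then 1 else 0)"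
 have u: "sball {..<1::nat} (\<theta>/2) ?u" by (rule sball_rank_one) (simp_all add: sq_def)
 have fJ: "finite ?J" by simp
 have s: "sb ?J \<theta> (mm ?J (amp ?u) (mm ?J Y (amp ?u))) c" by (rule Y[unfolded mbound_def, rule_format, OF _ u u]) simp
 have a: "amp ?u p q = idm p q" if "p \<in> ?J" "q \<in> ?J" for p q using that by (auto simp: amp_def idm_def)
 have m: "(0, i) \<in> ?J" "(0, j) \<in> ?J" by auto
 have r: "mm ?J x (amp ?u) p q = x p q" if q: "q \<in> ?J" for x p q
 proof -
  have "mm ?J x (amp ?u) p q = (\<Sum>r\<in>?J. if r = q then x p r else 0)"
   unfolding mm_def by (intro sum.cong refl) (simp add: a[OF _ q] idm_def)
  thus ?thesis using q by simp
 qed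
 have "mm ?J (amp ?u) (mm ?J Y (amp ?u)) (0, i) (0, j) = mm ?J idm (mm ?J Y (amp ?u)) (0, i) (0, j)"
  by (intro mm_cong refl a m)
 also have "... = mm ?J Y (amp ?u) (0, i) (0, j)" by (rule mm_idm[OF fJ m(1)])
 also have "... = Y (0, i) (0, j)" by (rule r[OF m(2)])
 finally show ?thesis using sb_entry[OF s fJ m] by simp
qed

text \<open>The completely bounded norm controls the diagonal coefficients of a map.\<close>

lemma cb_norm_entry:
 fixes S :: "'i cmat => 'i cmat"
 assumes p: "1 < p" and S: "linear_on_schatten p UNIV S" and e: "cb_norm p S < ennreal \<epsilon>"
 shows "cmod (S (unit i j) i j) \<le> \<epsilon>"
proof -
 have th: "0 < 1/p" "1/p < 1" using p by simp_all
 let ?E = "unit (0::nat, i) (0, j)"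
 have E: "?E \<in> schatten p ({..<1} \<times> UNIV)" by (rule unit_schatten) (use p in auto)
 have E1: "Sp_matrix_norm p UNIV 1 ?E \<le> 1" by (rule Sp_matrix_norm_le[OF p E sbf_mbound[OF sbf_unit]]) (use th in auto)
 have S0: "S (%i j. 0) = (%i j. 0)"
 proof -
  have "unit i j \<in> schatten p UNIV" by (rule unit_schatten) (use p in auto)
  hence "S (%k l. 0 * unit i j k l) = (%k l. 0 * S (unit i j) k l)" using S unfolding linear_on_schatten_def by blast
  thus ?thesis by simp
 qed
 have b: "block ?E a b = (if a = 0 \<and> b = 0 then unit i j else (%i j. 0))" for a b
  by (auto simp: block_def unit_def fun_eq_iff)
 have amp: "amplify S ?E = corner (S (unit i j))"
  by (intro ext) (simp add: amplify_def corner_def b S0 case_prod_beta)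
 have "S (unit i j) \<in> schatten p UNIV" using S unit_schatten[of p i UNIV j] p unfolding linear_on_schatten_def by simp
 hence Y: "corner (S (unit i j)) \<in> schatten p ({..<1} \<times> UNIV)" by (rule corner_schatten[rotated]) (use p in simp)
 have "ennreal (Sp_matrix_norm p UNIV 1 (amplify S ?E)) \<le> cb_norm p S"
  unfolding cb_norm_def by (rule SUP_upper2[of 1], simp, rule SUP_upper) (use E E1 in simp)
 hence "ennreal (Sp_matrix_norm p UNIV 1 (corner (S (unit i j)))) < ennreal \<epsilon>" unfolding amp using e by (rule le_less_trans)
 hence "Sp_matrix_norm p UNIV 1 (corner (S (unit i j))) < \<epsilon>"
  by (meson ennreal_leI leD leI)
 from mbound_corner_entry[OF th Sp_matrix_norm_mbound[OF p Y this], of i j] show ?thesis by (simp add: corner_def)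
qed

subsection \<open>Positivity\<close>

lemma positive_op_form:
 assumes "positive_op Y" "finite J" shows "0 \<le> Re (\<Sum>p\<in>J. \<Sum>q\<in>J. cnj (c p) * c q * Y p q)"
proof -
 have "ell2_inner (mat_vec Y (rs J c)) (rs J c) \<in> \<real>\<^sub>\<ge>\<^sub>0" using assms rs_ell2[OF assms(2)] unfolding positive_op_def by blast
 moreover have "ell2_inner (mat_vec Y (rs J c)) (rs J c) = (\<Sum>p\<in>J. \<Sum>q\<in>J. cnj (c p) * c q * Y p q)"
  unfolding mat_vec_rs[OF assms(2)] ell2_inner_rs_right[OF assms(2)]
  by (simp add: ip_def mv_def sum_distrib_left sum_distrib_right mult_ac)
 ultimately show ?thesis by (simp add: complex_nonneg_Reals_iff)
qed

lemma positive_op_rank_one: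
 assumes J: "finite J" "\<And>p. p \<notin> J ==> \<omega> p = 0" shows "positive_op (%p q. \<omega> p * cnj (\<omega> q))"
 unfolding positive_op_def
proof
 fix \<xi> :: "'a => complex"
 define s where "s = (\<Sum>q\<in>J. cnj (\<omega> q) * \<xi> q)"
 have "mat_vec (%p q. \<omega> p * cnj (\<omega> q)) \<xi> = (%p. \<omega> p * s)"
  unfolding mat_vec_def
 proof
  fix p
  have "((%q. \<omega> p * cnj (\<omega> q) * \<xi> q) has_sum (\<Sum>q\<in>J. \<omega> p * cnj (\<omega> q) * \<xi> q)) UNIV"
   by (rule has_sum_finite_neutralI[OF J(1)]) (use J in auto)
  from infsumI[OF this] show "(\<Sum>\<^sub>\<infinity>q. \<omega> p * cnj (\<omega> q) * \<xi> q) = \<omega> p * s"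
   by (simp add: s_def sum_distrib_left mult.assoc)
 qed
 moreover have "ell2_inner (%p. \<omega> p * s) \<xi> = s * cnj s"
 proof -
  have "((%q. \<omega> q * s * cnj (\<xi> q)) has_sum (\<Sum>q\<in>J. \<omega> q * s * cnj (\<xi> q))) UNIV"
   by (rule has_sum_finite_neutralI[OF J(1)]) (use J in auto)
  from infsumI[OF this] show ?thesis
   unfolding ell2_inner_def by (simp add: s_def[THEN arg_cong[where f = cnj]] sum_distrib_left mult_ac)
 qed
 ultimately show "ell2_inner (mat_vec (%p q. \<omega> p * cnj (\<omega> q)) \<xi>) \<xi> \<in> \<real>\<^sub>\<ge>\<^sub>0"
  by (simp add: complex_mult_cnj complex_nonneg_Reals_iff)
qed

lemma positive_op_diag:
 assumes "\<And>p. 0 \<le> d p" shows "positive_op (%p q. if p = q then complex_of_real (d p) else 0)"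
 unfolding positive_op_def
proof
 fix \<xi> :: "'a => complex"
 have "mat_vec (%p q. if p = q then complex_of_real (d p) else 0) \<xi> p = of_real (d p) * \<xi> p" for p
 proof -
  have "((%q. (if p = q then complex_of_real (d p) else 0) * \<xi> q) has_sum (\<Sum>q\<in>{p}. (if p = q then complex_of_real (d p) else 0) * \<xi> q)) UNIV"
   by (rule has_sum_finite_neutralI[where B = "{p}"]) auto
  from infsumI[OF this] show ?thesis by (simp add: mat_vec_def)
 qed
 hence "ell2_inner (mat_vec (%p q. if p = q then complex_of_real (d p) else 0) \<xi>) \<xi> = (\<Sum>\<^sub>\<infinity>p. complex_of_real (d p * (cmod (\<xi> p))\<^sup>2))"
  unfolding ell2_inner_def by (intro infsum_cong) (simp only: of_real_mult complex_norm_square mult.assoc)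
 also have "... \<ge> 0"
 proof (cases "(%p. complex_of_real (d p * (cmod (\<xi> p))\<^sup>2)) summable_on UNIV")
  case True
  thus ?thesis by (rule infsum_nonneg_complex) (use assms in \<open>auto simp: less_eq_complex_def\<close>)
 next
  case False
  thus ?thesis unfolding infsum_not_exists[OF False] by simp
 qed
 finally show "ell2_inner (mat_vec (%p q. if p = q then complex_of_real (d p) else 0) \<xi>) \<xi> \<in> \<real>\<^sub>\<ge>\<^sub>0"
  by (simp add: complex_nonneg_Reals_iff less_eq_complex_def)
qed

lemma diag_sapp:
 assumes th: "0 \<le> \<theta>" "\<theta> \<le> 1" and c: "\<And>k. 0 \<le> c k" "summable c"
 shows "sapp \<theta> (%p q. \<Sum>k. complex_of_real (c k) * unit (\<kappa> k) (\<kappa> k) p q)"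
proof (rule sapp_suminf[OF _ _ c(2)])
 show "sbf \<theta> (%p q. complex_of_real (c k) * unit (\<kappa> k) (\<kappa> k) p q) (c k)" for k
  using sbf_mult[OF sbf_unit[OF th], of "complex_of_real (c k)" "\<kappa> k" "\<kappa> k"] c(1) by simp
 show "sapp \<theta> (%p q. complex_of_real (c k) * unit (\<kappa> k) (\<kappa> k) p q)" for k
  by (rule sapp_finite[of "{\<kappa> k}"]) (auto simp: unit_def split: if_splits)
qed

lemma diag_eq:
 assumes c: "\<And>k. 0 \<le> c k" "summable c"
 shows "(%p q. \<Sum>k. complex_of_real (c k) * unit (\<kappa> k) (\<kappa> k) p q)
  = (%p q. if p = q then complex_of_real (\<Sum>k. c k * (if \<kappa> k = p then 1 else 0)) else 0)"
proof (intro ext)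
 fix p q
 have "summable (%k. c k * (if \<kappa> k = p then 1 else 0))"
  by (rule summable_comparison_test'[OF c(2), of 0]) (use c(1) in auto)
 hence "(\<Sum>k. complex_of_real (c k * (if \<kappa> k = p then 1 else 0))) = of_real (\<Sum>k. c k * (if \<kappa> k = p then 1 else 0))"
  by (rule suminf_of_real[symmetric])
 moreover have "(%k. complex_of_real (c k) * unit (\<kappa> k) (\<kappa> k) p p) = (%k. complex_of_real (c k * (if \<kappa> k = p then 1 else 0)))"
  by (auto simp: unit_def)
 ultimately have "(\<Sum>k. complex_of_real (c k) * unit (\<kappa> k) (\<kappa> k) p p) = of_real (\<Sum>k. c k * (if \<kappa> k = p then 1 else 0))"
  by (simp only:)
 moreover have "unit (\<kappa> k) (\<kappa> k) p q = 0" if "p \<noteq> q" for k using that by (auto simp: unit_def)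
 ultimately show "(\<Sum>k. complex_of_real (c k) * unit (\<kappa> k) (\<kappa> k) p q)
  = (if p = q then complex_of_real (\<Sum>k. c k * (if \<kappa> k = p then 1 else 0)) else 0)"
  by (cases "p = q") simp_all
qed

text \<open>A diagonal matrix with nonnegative entries in one diagonal corner is positive.\<close>

lemma two_by_two_diag_positive:
 fixes v0 v1 :: "nat cmat => nat cmat" and e :: nat
 assumes p: "1 < p" and cp: "completely_positive p ({..<2} \<times> UNIV) (two_by_two_map v0 T T' v1)"
  and e: "e < 2" and c: "\<And>k. 0 \<le> c k" "summable c"
 shows "0 \<le> Re ((if e = 0 then v0 else v1) (%p q. \<Sum>k. complex_of_real (c k) * unit (\<kappa> k) (\<kappa> k) p q) i i)"
proof -
 define X where "X = (%p q. \<Sum>k. complex_of_real (c k) * unit (0::nat, (e, \<kappa> k)) (0, (e, \<kappa> k)) p q)"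
 have X1: "X = (%p q. if p = q then complex_of_real (\<Sum>k. c k * (if (0::nat, (e, \<kappa> k)) = p then 1 else 0)) else 0)"
  unfolding X_def by (rule diag_eq[OF c, where \<kappa> = "%k. (0, (e, \<kappa> k))"])
 have s0: "summable (%k. c k * (if P k then 1 else 0))" for P
  by (rule summable_comparison_test'[OF c(2), of 0]) (use c(1) in auto)
 have "positive_op X" unfolding X1 by (intro positive_op_diag suminf_nonneg s0) (use c in auto)
 moreover have "X \<in> schatten p ({..<1} \<times> ({..<2} \<times> UNIV))"
 proof -
  have "supported_on ({..<1} \<times> ({..<2} \<times> UNIV)) X" unfolding supported_on_def
  proof (intro allI impI)
   fix r s assume "X r s \<noteq> 0"
   have "\<exists>k. unit (0::nat, (e, \<kappa> k)) (0, (e, \<kappa> k)) r s \<noteq> 0"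
   proof (rule ccontr)
    assume "\<nexists>k. unit (0::nat, (e, \<kappa> k)) (0, (e, \<kappa> k)) r s \<noteq> 0"
    thus False using \<open>X r s \<noteq> 0\<close> by (simp add: X_def)
   qed
   thus "r \<in> {..<1} \<times> ({..<2} \<times> UNIV) \<and> s \<in> {..<1} \<times> ({..<2} \<times> UNIV)" using e by (auto simp: unit_def split: if_splits)
  qed
  moreover have "sapp (1/p) X" unfolding X_def using p by (intro diag_sapp c) auto
  ultimately show ?thesis using p by (simp add: schatten_iff)
 qed
 ultimately have "positive_op (amplify (two_by_two_map v0 T T' v1) X)" using cp unfolding completely_positive_def by blast
 from positive_op_form[OF this, of "{(0, (e, i))}" "%_. 1"]
 have "0 \<le> Re (two_by_two_map v0 T T' v1 (block X 0 0) (e, i) (e, i))" by (simp add: amplify_def)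
 moreover have "block (block X 0 0) e e = (%p q. \<Sum>k. complex_of_real (c k) * unit (\<kappa> k) (\<kappa> k) p q)"
  by (simp add: block_def X_def unit_def)
 ultimately show ?thesis using e by (cases "e = 0") (auto simp: two_by_two_map_def less_2_cases_iff)
qed

text \<open>Positive maps have bounded diagonal coefficients: otherwise a summable combination of diagonal units would be
 mapped to a matrix with unbounded entries.\<close>

lemma two_by_two_diag_bounded:
 fixes v0 v1 :: "nat cmat => nat cmat" and e :: nat
 assumes p: "1 < p" and cp: "completely_positive p ({..<2} \<times> UNIV) (two_by_two_map v0 T T' v1)"
  and e: "e < 2" and lin: "linear_on_schatten p UNIV (if e = 0 then v0 else v1)"
 shows "\<exists>M. \<forall>i. Re ((if e = 0 then v0 else v1) (unit i i) i i) \<le> M"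
proof (rule ccontr)
 define v where "v = (if e = 0 then v0 else v1)"
 assume "\<nexists>M. \<forall>i. Re ((if e = 0 then v0 else v1) (unit i i) i i) \<le> M"
 hence "\<forall>k. \<exists>i. (4::real) ^ k < Re (v (unit i i) i i)" unfolding v_def not_le[symmetric] by blast
 from choice[OF this] obtain \<kappa> where \<kappa>: "\<forall>k. (4::real) ^ k < Re (v (unit (\<kappa> k) (\<kappa> k)) (\<kappa> k) (\<kappa> k))" by (elim exE) (rule that)
 define D where "D = (%c p q. \<Sum>k. complex_of_real (c k) * unit (\<kappa> k) (\<kappa> k) p q)"
 define c where "c = (%k. (1/2::real) ^ k)"
 have c: "0 \<le> c k" "summable c" for k by (auto simp: c_def intro: summable_geometric)
 have th: "0 \<le> 1/p" "1/p \<le> 1" using p by auto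
 have DS: "D d \<in> schatten p UNIV" if "\<And>k. 0 \<le> d k" "summable d" for d
  using diag_sapp[OF th that, of \<kappa>] p by (simp add: schatten_iff D_def supported_on_def)
 have lin': "v (%i j. x i j + y i j) = (%i j. v x i j + v y i j)" "v (%i j. a * x i j) = (%i j. a * v x i j)" "v x \<in> schatten p UNIV"
  if "x \<in> schatten p UNIV" "y \<in> schatten p UNIV" for x y a
  using lin that unfolding linear_on_schatten_def v_def[symmetric] by blast+
 have pos: "0 \<le> Re (v (D d) i i)" if "\<And>k. 0 \<le> d k" "summable d" for d i
  unfolding v_def D_def by (rule two_by_two_diag_positive[OF p cp e that])
 have "sapp (1/p) (v (D c))" using lin'(3)[OF DS[OF c] DS[OF c]] p by (simp add: schatten_iff)
 then obtain C where C: "sbf (1/p) (v (D c)) C" by (rule sapp_sbf[OF _ th(2)])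
 have "2 ^ k \<le> C" for k
 proof -
  define d where "d = (%l. if l = k then 0 else c l)"
  have d: "0 \<le> d l" "summable d" for l
  proof -
   show "0 \<le> d l" using c(1) by (simp add: d_def)
   show "summable d" by (rule summable_comparison_test'[OF c(2), of 0]) (use c(1) in \<open>auto simp: d_def\<close>)
  qed
  let ?E = "unit (\<kappa> k) (\<kappa> k)"
  have E: "?E \<in> schatten p UNIV" by (rule unit_schatten) (use p in auto)
  have cE: "(%i j. complex_of_real (c k) * ?E i j) \<in> schatten p UNIV"
   using E p by (auto simp: schatten_iff supported_on_def intro: sapp_mult)
  have "D c = (%i j. D d i j + complex_of_real (c k) * ?E i j)"
  proof (intro ext)
   fix i j
   have sm: "summable (%l. complex_of_real (d l) * unit (\<kappa> l) (\<kappa> l) i j)"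
    by (rule summable_comparison_test'[OF d(2), of 0]) (use d(1) in \<open>auto simp: unit_def\<close>)
   have "(%l. complex_of_real (d l) * unit (\<kappa> l) (\<kappa> l) i j + (if l = k then complex_of_real (c k) * ?E i j else 0))
    sums (D d i j + complex_of_real (c k) * ?E i j)"
    unfolding D_def by (intro sums_add summable_sums sm sums_single)
   moreover have "complex_of_real (d l) * unit (\<kappa> l) (\<kappa> l) i j + (if l = k then complex_of_real (c k) * ?E i j else 0)
    = complex_of_real (c l) * unit (\<kappa> l) (\<kappa> l) i j" for l by (simp add: d_def)
   ultimately show "D c i j = D d i j + complex_of_real (c k) * ?E i j" by (simp add: D_def sums_iff)
  qed
  hence "v (D c) = (%i j. v (D d) i j + complex_of_real (c k) * v ?E i j)"
   using lin'(1)[OF DS[OF d] cE] lin'(2)[OF E E] by simp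
  hence "Re (v (D c) (\<kappa> k) (\<kappa> k)) = Re (v (D d) (\<kappa> k) (\<kappa> k)) + c k * Re (v ?E (\<kappa> k) (\<kappa> k))" by simp
  hence "c k * Re (v ?E (\<kappa> k) (\<kappa> k)) \<le> Re (v (D c) (\<kappa> k) (\<kappa> k))" using pos[OF d, of "\<kappa> k"] by simp
  also have "... \<le> cmod (v (D c) (\<kappa> k) (\<kappa> k))" by (rule complex_Re_le_cmod)
  also have "... \<le> C" by (rule sbf_entry[OF C])
  finally have "c k * Re (v ?E (\<kappa> k) (\<kappa> k)) \<le> C" .
  moreover have "2 ^ k \<le> c k * Re (v ?E (\<kappa> k) (\<kappa> k))"
  proof -
   have "(2::real) ^ k = c k * 4 ^ k" by (simp add: c_def flip: power_mult_distrib)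
   also have "... \<le> c k * Re (v ?E (\<kappa> k) (\<kappa> k))" using spec[OF \<kappa>, of k] c(1)[of k] by (intro mult_left_mono) auto
   finally show ?thesis .
  qed
  ultimately show ?thesis by simp
 qed
 moreover obtain k where "C < 2 ^ k" using real_arch_pow[of 2 C] by auto
 ultimately show False by (meson not_le)
qed

text \<open>Testing complete positivity on the positive rank one matrix of \<open>e\<^sub>0\<^sub>,\<^sub>0, ..., e\<^sub>0\<^sub>,\<^sub>N\<^sub>-\<^sub>1, e\<^sub>1\<^sub>,\<^sub>j\<close> shows that the diagonal
 coefficients of \<open>R\<close> are dominated by those of the two completing maps.\<close>

lemma decomposable_diagonal_bound:
 fixes v0 R v1 :: "nat cmat => nat cmat"
 assumes p: "1 < p" and cp: "completely_positive p ({..<2} \<times> UNIV) (two_by_two_map v0 R (circ R) v1)"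
  and M: "0 < M" "\<And>j. Re (v1 (unit j j) j j) \<le> M"
 shows "(cmod (\<Sum>q<N. of_real (x q) * R (unit q j) q j))\<^sup>2 \<le> M * (\<Sum>q<N. \<Sum>q'<N. x q * x q' * Re (v0 (unit q q') q q'))"
proof -
 let ?\<Phi> = "two_by_two_map v0 R (circ R) v1"
 \<comment> \<open>The vector \<open>w\<close> is \<open>\<Sum> e\<^sub>q \<otimes> e\<^bsub>P q\<^esub>\<close>; hence the blocks of \<open>w w\<^sup>*\<close> are matrix units.\<close>
 define P where "P = (%q. if q < N then (0::nat, q) else (1, j))"
 define w where "w = (%r::nat \<times> nat \<times> nat. if fst r \<le> N \<and> snd r = P (fst r) then 1 else (0::complex))"
 define J where "J = (%q. (q, P q)) ` {..N}"
 have J: "finite J" "\<And>r. r \<notin> J ==> w r = 0" by (force simp: J_def w_def)+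
 define X where "X = (%r s. w r * cnj (w s))"
 have "positive_op X" unfolding X_def by (rule positive_op_rank_one[OF J])
 moreover have "X \<in> schatten p ({..<Suc N} \<times> ({..<2} \<times> UNIV))"
 proof -
  have "supported_on ({..<Suc N} \<times> ({..<2} \<times> UNIV)) X"
   by (auto simp: supported_on_def X_def w_def P_def split: if_splits)
  moreover have "sapp (1/p) X" by (rule sapp_finite[OF J(1)]) (use J(2) in \<open>auto simp: X_def\<close>)
  ultimately show ?thesis using p by (simp add: schatten_iff)
 qed
 moreover have "1 \<le> Suc N" by simp
 ultimately have Y: "positive_op (amplify ?\<Phi> X)" using cp unfolding completely_positive_def by blast
 have bX: "block X q q' = unit (P q) (P q')" if "q \<le> N" "q' \<le> N" for q q'
  using that by (auto simp: block_def X_def w_def unit_def fun_eq_iff)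
 define K where "K = (%q q'. ?\<Phi> (unit (P q) (P q')) (P q) (P q'))"
 have bu: "block (unit (a, i) (b, k)) a b = unit i k" for a b :: nat and i k :: nat
  by (auto simp: block_def unit_def fun_eq_iff)
 have au: "adj (unit i k) = unit k i" for i k :: nat by (auto simp: adj_def unit_def fun_eq_iff)
 have K: "K q q' = v0 (unit q q') q q'" "K q N = R (unit q j) q j" "K N q' = cnj (R (unit q' j) q' j)" "K N N = v1 (unit j j) j j"
  if "q < N" "q' < N" for q q'
  using that by (simp_all add: K_def P_def two_by_two_map_def bu circ_def au) (simp add: adj_def)
 have form: "0 \<le> Re (\<Sum>q\<le>N. \<Sum>q'\<le>N. cnj (d q) * d q' * K q q')" for d
 proof -
  have inj: "inj_on (%q. (q, P q)) {..N}" by (auto simp: inj_on_def)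
  have "0 \<le> Re (\<Sum>r\<in>J. \<Sum>s\<in>J. cnj (d (fst r)) * d (fst s) * amplify ?\<Phi> X r s)"
   by (rule positive_op_form[OF Y J(1)])
  also have "(\<Sum>r\<in>J. \<Sum>s\<in>J. cnj (d (fst r)) * d (fst s) * amplify ?\<Phi> X r s)
   = (\<Sum>q\<le>N. \<Sum>q'\<le>N. cnj (d q) * d q' * amplify ?\<Phi> X (q, P q) (q', P q'))"
   unfolding J_def sum.reindex[OF inj] by simp
  also have "... = (\<Sum>q\<le>N. \<Sum>q'\<le>N. cnj (d q) * d q' * K q q')"
   by (intro sum.cong refl) (auto simp: amplify_def bX K_def case_prod_beta)
  finally show ?thesis .
 qed
 define s where "s = (\<Sum>q<N. of_real (x q) * R (unit q j) q j)"
 define Q where "Q = (\<Sum>q<N. \<Sum>q'<N. x q * x q' * Re (v0 (unit q q') q q'))"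
 define B where "B = Re (v1 (unit j j) j j)"
 \<comment> \<open>The minimiser over \<open>y\<close> of the bound \<open>Q + 2 Re (y s) + M |y|\<^sup>2\<close> for the quadratic form.\<close>
 define y where "y = - of_real (1 / M) * cnj s"
 define d where "d = (%q. if q < N then complex_of_real (x q) else y)"
 have KN: "K N N = v1 (unit j j) j j" by (simp add: K_def P_def two_by_two_map_def bu)
 have "(\<Sum>q\<le>N. \<Sum>q'\<le>N. cnj (d q) * d q' * K q q')
  = (\<Sum>q<N. (\<Sum>q'<N. of_real (x q) * of_real (x q') * v0 (unit q q') q q') + of_real (x q) * y * R (unit q j) q j)
   + ((\<Sum>q'<N. cnj y * of_real (x q') * cnj (R (unit q' j) q' j)) + cnj y * y * v1 (unit j j) j j)"
  unfolding lessThan_Suc_atMost[symmetric] sum.lessThan_Suc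
  by (intro arg_cong2[where f = "(+)"] sum.cong refl) (simp_all add: d_def K KN)
 also have "... = (\<Sum>q<N. \<Sum>q'<N. of_real (x q * x q') * v0 (unit q q') q q') + y * s + cnj y * cnj s + cnj y * y * v1 (unit j j) j j"
  by (simp add: s_def sum.distrib sum_distrib_left mult_ac)
 finally have "0 \<le> Re ((\<Sum>q<N. \<Sum>q'<N. of_real (x q * x q') * v0 (unit q q') q q') + y * s + cnj y * cnj s + cnj y * y * v1 (unit j j) j j)"
  using form[of d] by simp
 also have "... = Q + 2 * Re (y * s) + Re (cnj y * y * v1 (unit j j) j j)"
 proof -
  have e: "Re (cnj y * cnj s) = Re (y * s)" by simp
  have q: "Re (\<Sum>q<N. \<Sum>q'<N. of_real (x q * x q') * v0 (unit q q') q q') = Q"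
   unfolding Q_def Re_sum by (intro sum.cong refl) simp
  show ?thesis unfolding plus_complex.sel q e by linarith
 qed
 also have "y * s = - of_real ((cmod s)\<^sup>2 / M)"
 proof -
  have "y * s = - (of_real (1 / M) * (s * cnj s))" by (simp add: y_def mult_ac)
  thus ?thesis unfolding complex_norm_square[symmetric] by simp
 qed
 also have "cnj y * y = of_real ((cmod s)\<^sup>2 / M\<^sup>2)"
 proof -
  have "cnj y * y = of_real (1 / M) * of_real (1 / M) * (s * cnj s)" by (simp add: y_def mult_ac)
  thus ?thesis unfolding complex_norm_square[symmetric] by (simp add: power2_eq_square)
 qed
 finally have "0 \<le> Q - 2 * ((cmod s)\<^sup>2 / M) + (cmod s)\<^sup>2 / M\<^sup>2 * B" by (simp add: B_def)
 also have "(cmod s)\<^sup>2 / M\<^sup>2 * B \<le> (cmod s)\<^sup>2 / M\<^sup>2 * M" using M(2) by (intro mult_left_mono) (auto simp: B_def)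
 also have "(cmod s)\<^sup>2 / M\<^sup>2 * M = (cmod s)\<^sup>2 / M" using M(1) by (simp add: power2_eq_square)
 finally have "(cmod s)\<^sup>2 / M \<le> Q" by simp
 thus ?thesis using M(1) by (simp add: s_def Q_def divide_le_eq mult.commute)
qed

text \<open>Mazur's argument: averages over far apart index sets which nearly minimise the quadratic form are close to each
 other, but an index \<open>j\<close> between the two sets separates them by \<open>\<gamma>\<^sub>1 - \<gamma>\<^sub>2\<close>.\<close>

lemma order_property_bound:
 fixes a :: "nat => nat => real" and r :: "nat => nat => complex"
 assumes cs: "\<And>N x j. (cmod (\<Sum>q<N. of_real (x q) * r q j))\<^sup>2 \<le> M * (\<Sum>q<N. \<Sum>q'<N. x q * x q' * a q q')"
  and M: "0 < M" and A: "\<And>i. a i i \<le> M'"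
  and r1: "\<And>i j. i < j ==> cmod (r i j - \<gamma>\<^sub>1) \<le> \<epsilon>" and r2: "\<And>i j. j < i ==> cmod (r i j - \<gamma>\<^sub>2) \<le> \<epsilon>"
 shows "cmod (\<gamma>\<^sub>1 - \<gamma>\<^sub>2) \<le> 2 * \<epsilon>"
proof -
 define Q where "Q = (%N x. \<Sum>q<N. \<Sum>q'<N. x q * x q' * a q q')"
 define W where "W = (%n N x. (\<forall>q::nat. 0 \<le> x q) \<and> (\<forall>q. x q \<noteq> (0::real) \<longrightarrow> n \<le> q \<and> q < N) \<and> (\<Sum>q<N. x q) = 1)"
 have ext: "(\<Sum>q<N'. f q) = (\<Sum>q<N. f q)" if "N \<le> N'" "\<And>q. N \<le> q ==> f q = 0" for N N' :: nat and f :: "nat => 'b::comm_monoid_add"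
  by (rule sum.mono_neutral_right) (use that in auto)
 have W0: "x q = 0" if "W n N x" "q < n \<or> N \<le> q" for n N x q
 proof (rule ccontr)
  assume "x q \<noteq> 0"
  hence "n \<le> q \<and> q < N" using that(1) unfolding W_def by blast
  thus False using that(2) by auto
 qed
 have Wm: "W m N' x" if "W n N x" "m \<le> n" "N \<le> N'" for n N m N' x
 proof -
  have "(\<Sum>q<N'. x q) = (\<Sum>q<N. x q)" by (rule ext[OF that(3)]) (use W0[OF that(1)] in auto)
  thus ?thesis using that unfolding W_def by force
 qed
 have Qm: "Q N' x = Q N x" if "W n N x" "N \<le> N'" for n N N' x
 proof -
  have z: "x q = 0" if "N \<le> q" for q using W0[OF \<open>W n N x\<close>] that by auto
  have "Q N' x = (\<Sum>q<N'. \<Sum>q'<N. x q * x q' * a q q')" unfolding Q_def by (intro sum.cong refl ext[OF that(2)]) (simp add: z)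
  also have "... = Q N x" unfolding Q_def by (rule ext[OF that(2)]) (simp add: z)
  finally show ?thesis .
 qed
 define V where "V = (%n. {Q N x | N x. W n N x})"
 have Q0: "0 \<le> Q N x" for N x
 proof -
  have "0 \<le> M * Q N x" unfolding Q_def by (rule order_trans[OF zero_le_power2 cs])
  thus ?thesis using M by (simp add: zero_le_mult_iff)
 qed
 have bb: "bdd_below (V n)" for n by (rule bdd_belowI[of _ 0]) (use Q0 in \<open>auto simp: V_def\<close>)
 have Vn: "\<exists>v\<in>V n. v \<le> M'" for n
 proof (intro bexI)
  let ?x = "%q. if q = n then 1 else (0::real)"
  show "Q (Suc n) ?x \<in> V n" unfolding V_def W_def by (intro CollectI exI[of _ "Suc n"] exI[of _ ?x]) simp
  have "Q (Suc n) ?x = (\<Sum>q<Suc n. if q = n then (\<Sum>q'<Suc n. if q' = n then a n n else 0) else 0)"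
   unfolding Q_def by (intro sum.cong refl) (auto intro!: sum.cong)
  thus "Q (Suc n) ?x \<le> M'" using A[of n] by simp
 qed
 define d where "d = (%n. Inf (V n))"
 have dM: "d n \<le> M'" for n
 proof -
  obtain v where "v \<in> V n" "v \<le> M'" using Vn by blast
  thus ?thesis unfolding d_def using cInf_lower[OF _ bb] by force
 qed
 have dQ: "d n \<le> Q N x" if "W n N x" for n N x unfolding d_def by (rule cInf_lower[OF _ bb]) (use that in \<open>auto simp: V_def\<close>)
 have near: "\<exists>N x. W n N x \<and> Q N x < d n + \<delta>" if "0 < \<delta>" for n \<delta>
 proof -
  have "V n \<noteq> {}" using Vn[of n] by blast
  from cInf_lessD[OF this, of "d n + \<delta>"] that show ?thesis unfolding d_def by (auto simp: V_def)
 qed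
 have bd: "bdd_above (range d)" by (rule bdd_aboveI2[OF dM])
 have main: "cmod (\<gamma>\<^sub>1 - \<gamma>\<^sub>2) \<le> 2 * \<epsilon> + sqrt (6 * \<delta> * M)" if \<delta>: "0 < \<delta>" for \<delta>
 proof -
  have "Sup (range d) - \<delta> < Sup (range d)" using \<delta> by simp
  from less_cSupD[OF _ this] obtain n where n: "Sup (range d) - \<delta> < d n" by auto
  have dn: "d m \<le> d n + \<delta>" for m using cSup_upper[OF rangeI bd, of m] n by simp
  obtain N u where u: "W n N u" "Q N u < d n + \<delta>" using near[OF \<delta>] by blast
  define j where "j = max N n"
  obtain N' u' where u': "W (Suc j) N' u'" "Q N' u' < d (Suc j) + \<delta>" using near[OF \<delta>] by blast
  define L where "L = max N N'"
  have uL: "W n L u" "W n L u'" "W (Suc j) L u'"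
   using Wm[OF u(1), of n L] Wm[OF u'(1), of n L] Wm[OF u'(1), of "Suc j" L] by (auto simp: L_def j_def)
  have QL: "Q L u < d n + \<delta>" "Q L u' < d n + 2 * \<delta>"
   using Qm[OF u(1), of L] Qm[OF u'(1), of L] u(2) u'(2) dn[of "Suc j"] by (auto simp: L_def)
  have "W n L (%q. (u q + u' q) / 2)"
   unfolding W_def
  proof (intro conjI allI impI)
   show "0 \<le> (u q + u' q) / 2" for q using uL unfolding W_def by simp
   show "(\<Sum>q<L. (u q + u' q) / 2) = 1" using uL unfolding W_def by (simp add: sum.distrib flip: sum_divide_distrib)
   fix q assume "(u q + u' q) / 2 \<noteq> 0"
   hence "u q \<noteq> 0 \<or> u' q \<noteq> 0" by auto
   thus "n \<le> q" "q < L" using uL unfolding W_def by blast+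
  qed
  hence mid: "d n \<le> Q L (%q. (u q + u' q) / 2)" by (rule dQ)
  \<comment> \<open>The parallelogram law: \<open>u\<close>, \<open>u'\<close> and their midpoint all nearly attain the infimum.\<close>
  have alg: "2 * (x * y * c) + 2 * (x' * y' * c) - 4 * ((x + x') / 2 * ((y + y') / 2) * c) = (x - x') * (y - y') * c" for x y x' y' c :: real
  proof -
   have "4 * ((x + x') / 2 * ((y + y') / 2) * c) = (x + x') * (y + y') * c" by simp
   thus ?thesis by (simp only:) (simp add: algebra_simps)
  qed
  have "Q L (%q. u q - u' q) = 2 * Q L u + 2 * Q L u' - 4 * Q L (%q. (u q + u' q) / 2)"
  proof -
   have "2 * Q L u + 2 * Q L u' - 4 * Q L (%q. (u q + u' q) / 2) = (\<Sum>q<L. \<Sum>q'<L.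
    2 * (u q * u q' * a q q') + 2 * (u' q * u' q' * a q q') - 4 * ((u q + u' q) / 2 * ((u q' + u' q') / 2) * a q q'))"
    by (simp only: Q_def sum_distrib_left sum.distrib sum_subtractf)
   also have "... = Q L (%q. u q - u' q)" unfolding Q_def by (simp only: alg)
   finally show ?thesis by simp
  qed
  hence "Q L (%q. u q - u' q) \<le> 6 * \<delta>" using QL mid by linarith
  hence "M * Q L (%q. u q - u' q) \<le> M * (6 * \<delta>)" using M by (intro mult_left_mono) auto
  hence "(cmod (\<Sum>q<L. of_real (u q - u' q) * r q j))\<^sup>2 \<le> 6 * \<delta> * M"
   using cs[where N = L and x = "%q. u q - u' q" and j = j] by (simp add: Q_def mult_ac)
  hence 1: "cmod (\<Sum>q<L. of_real (u q - u' q) * r q j) \<le> sqrt (6 * \<delta> * M)" by (rule real_le_rsqrt)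
  have avg: "cmod ((\<Sum>q<L. of_real (x q) * r q j) - \<gamma>) \<le> \<epsilon>" if x: "W m L x" and c: "\<And>q. x q \<noteq> 0 ==> cmod (r q j - \<gamma>) \<le> \<epsilon>" for x m \<gamma>
  proof -
   have x1: "(\<Sum>q<L. x q) = 1" "\<And>q. 0 \<le> x q" using x unfolding W_def by auto
   have "(\<Sum>q<L. of_real (x q) * (r q j - \<gamma>)) = (\<Sum>q<L. of_real (x q) * r q j) - of_real (\<Sum>q<L. x q) * \<gamma>"
    by (simp add: right_diff_distrib sum_subtractf sum_distrib_right)
   hence "cmod ((\<Sum>q<L. of_real (x q) * r q j) - \<gamma>) = cmod (\<Sum>q<L. of_real (x q) * (r q j - \<gamma>))" using x1 by simp
   also have "... \<le> (\<Sum>q<L. x q * \<epsilon>)"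
   proof (rule order_trans[OF norm_sum sum_mono])
    fix q
    show "cmod (of_real (x q) * (r q j - \<gamma>)) \<le> x q * \<epsilon>"
     using c[of q] x1(2)[of q] by (cases "x q = 0") (simp_all add: norm_mult mult_left_mono)
   qed
   also have "... = \<epsilon>" using x1 by (simp flip: sum_distrib_right)
   finally show ?thesis .
  qed
  have 2: "cmod ((\<Sum>q<L. of_real (u q) * r q j) - \<gamma>\<^sub>1) \<le> \<epsilon>"
  proof (rule avg[OF uL(1) r1])
   show "q < j" if "u q \<noteq> 0" for q using u(1) that unfolding W_def j_def by force
  qed
  have 3: "cmod ((\<Sum>q<L. of_real (u' q) * r q j) - \<gamma>\<^sub>2) \<le> \<epsilon>"
  proof (rule avg[OF uL(3) r2])
   show "j < q" if "u' q \<noteq> 0" for q using u'(1) that unfolding W_def by force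
  qed
  define s1 where "s1 = (\<Sum>q<L. of_real (u q) * r q j)" define s2 where "s2 = (\<Sum>q<L. of_real (u' q) * r q j)"
  have "(\<Sum>q<L. of_real (u q - u' q) * r q j) = s1 - s2"
   by (simp add: s1_def s2_def left_diff_distrib sum_subtractf)
  hence 1: "cmod (s1 - s2) \<le> sqrt (6 * \<delta> * M)" using 1 by simp
  have e: "\<gamma>\<^sub>1 - \<gamma>\<^sub>2 = (s1 - s2) - (s1 - \<gamma>\<^sub>1) + (s2 - \<gamma>\<^sub>2)" by simp
  have "cmod (\<gamma>\<^sub>1 - \<gamma>\<^sub>2) \<le> cmod (s1 - s2) + cmod (s1 - \<gamma>\<^sub>1) + cmod (s2 - \<gamma>\<^sub>2)"
   unfolding e using norm_triangle_ineq[of "(s1 - s2) - (s1 - \<gamma>\<^sub>1)" "s2 - \<gamma>\<^sub>2"] norm_triangle_ineq4[of "s1 - s2" "s1 - \<gamma>\<^sub>1"] by linarith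
  thus ?thesis using 1 2[folded s1_def] 3[folded s2_def] by simp
 qed
 show ?thesis
 proof (rule field_le_epsilon)
  fix e :: real assume e: "0 < e"
  have "cmod (\<gamma>\<^sub>1 - \<gamma>\<^sub>2) \<le> 2 * \<epsilon> + sqrt (6 * (e\<^sup>2 / (6 * M)) * M)" by (rule main) (use e M in simp)
  also have "6 * (e\<^sup>2 / (6 * M)) * M = e\<^sup>2" using M by simp
  finally show "cmod (\<gamma>\<^sub>1 - \<gamma>\<^sub>2) \<le> 2 * \<epsilon> + e" using e by simp
 qed
qed

text \<open>A decomposable map within \<open>|\<alpha> + \<beta>| / 3\<close> would have coefficients near \<open>\<alpha> + \<beta> + \<gamma>\<close> above and near \<open>\<gamma>\<close> below the
 diagonal.\<close>

lemma gmul_strongly_non_decomposable: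
 assumes p: "1 < p" and ne: "\<alpha> + \<beta> \<noteq> 0" shows "CB_strongly_non_decomposable p (gmul \<alpha> \<beta> \<gamma> (id :: nat => nat))"
proof -
 let ?T = "gmul \<alpha> \<beta> \<gamma> (id :: nat => nat)"
 have cb: "completely_bounded p ?T" by (rule gmul_completely_bounded[OF p])
 have "\<not> in_cb_closure_of_Dec p ?T"
 proof
  assume cl: "in_cb_closure_of_Dec p ?T"
  define \<epsilon> where "\<epsilon> = cmod (\<alpha> + \<beta>) / 3"
  have \<epsilon>: "0 < \<epsilon>" using ne by (simp add: \<epsilon>_def)
  obtain R where R: "decomposable p R" "cb_norm p (%x. ?T x - R x) < ennreal \<epsilon>"
   using cl \<epsilon> unfolding in_cb_closure_of_Dec_def by blast
  obtain v0 v1 where v: "linear_on_schatten p UNIV R" "linear_on_schatten p UNIV v0" "linear_on_schatten p UNIV v1"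
   "completely_positive p ({..<2} \<times> UNIV) (two_by_two_map v0 R (circ R) v1)"
   using R(1) unfolding decomposable_def by blast
  have linT: "linear_on_schatten p UNIV ?T" using cb by (simp add: completely_bounded_def)
  have d: "(X :: nat cmat) - Y = (%p q. X p q - Y p q)" for X Y by (simp add: fun_eq_iff)
  have linS: "linear_on_schatten p UNIV (%x. ?T x - R x)"
   unfolding linear_on_schatten_def
  proof (intro conjI ballI allI)
   fix x y :: "nat cmat" and c assume x: "x \<in> schatten p UNIV"
   have T: "?T x \<in> schatten p UNIV" "?T (%i j. c * x i j) = (%i j. c * ?T x i j)" using linT x unfolding linear_on_schatten_def by blast+
   have R: "R x \<in> schatten p UNIV" "R (%i j. c * x i j) = (%i j. c * R x i j)" using v(1) x unfolding linear_on_schatten_def by blast+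
   show "?T x - R x \<in> schatten p UNIV" unfolding d using T(1) R(1) p by (auto simp: schatten_iff supported_on_def intro: sapp_diff)
   show "?T (%i j. c * x i j) - R (%i j. c * x i j) = (%i j. c * (?T x - R x) i j)" unfolding T R by (simp add: fun_eq_iff right_diff_distrib)
   assume y: "y \<in> schatten p UNIV"
   have "?T (%i j. x i j + y i j) = (%i j. ?T x i j + ?T y i j)" using linT x y unfolding linear_on_schatten_def by blast
   moreover have "R (%i j. x i j + y i j) = (%i j. R x i j + R y i j)" using v(1) x y unfolding linear_on_schatten_def by blast
   ultimately show "?T (%i j. x i j + y i j) - R (%i j. x i j + y i j) = (%i j. (?T x - R x) i j + (?T y - R y) i j)" by (simp add: fun_eq_iff)
  qed
  have ent: "cmod (R (unit i j) i j - ?T (unit i j) i j) \<le> \<epsilon>" for i j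
   using cb_norm_entry[OF p linS R(2), of i j] by (simp add: norm_minus_commute)
  obtain M0 where M0: "\<And>i. Re (v0 (unit i i) i i) \<le> M0" using two_by_two_diag_bounded[OF p v(4), of 0] v(2) by (simp; blast)
  obtain M1 where M1: "\<And>i. Re (v1 (unit i i) i i) \<le> M1" using two_by_two_diag_bounded[OF p v(4), of 1] v(3) by (simp; blast)
  have M: "0 < max M1 1" "Re (v1 (unit i i) i i) \<le> max M1 1" for i using M1[of i] by auto
  have "cmod ((\<alpha> + \<beta> + \<gamma>) - \<gamma>) \<le> 2 * \<epsilon>"
  proof (rule order_property_bound[OF decomposable_diagonal_bound[OF p v(4) M] M(1) M0])
   show "cmod (R (unit i j) i j - (\<alpha> + \<beta> + \<gamma>)) \<le> \<epsilon>" if "i < j" for i j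
    using ent[of i j] that by (simp add: gmul_def trunc_rel_def unit_def)
   show "cmod (R (unit i j) i j - \<gamma>) \<le> \<epsilon>" if "j < i" for i j
    using ent[of i j] that by (simp add: gmul_def trunc_rel_def unit_def)
  qed
  hence "3 * \<epsilon> \<le> 2 * \<epsilon>" by (simp add: \<epsilon>_def)
  thus False using \<epsilon> by simp
 qed
 thus ?thesis using cb by (simp add: CB_strongly_non_decomposable_def)
qed

theorem corollary7p22:
 fixes p :: real
 assumes "1 < p"
 shows "CB_strongly_non_decomposable p triangular_truncation
  \<and> CB_strongly_non_decomposable p discrete_Hilbert_transform"
 unfolding triangular_truncation_gmul discrete_Hilbert_transform_gmul
 by (intro conjI gmul_strongly_non_decomposable assms) (simp_all add: complex_eq_iff)

end
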